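(* Let $n\ge 4$ and set $$\epsilon_n=\begin{cases}\dfrac1n, & n\ge 11,\\[2mm] \dfrac{n^2(n-1)}{2(3n-2)(2n^2-4n+1)}, & 4\le n\le 10.\end{cases}$$ Then for every $a\in[\frac n4-\epsilon_n,\frac n4]$ the curvature cones $\overline{\Omega(a)}$ and $\Omega(a)$ are both invariant under the Hamilton ODE $\frac{d}{dt}R=Q(R)$, and thus both define Ricci flow invariant curvature conditions.
   Context: Algebraic curvature operators. $S_B^2(\mathfrak{so}(n))$ is the vector space of self-adjoint endomorphisms of $\Lambda^2\mathbb{R}^n\cong\mathfrak{so}(n)$ (with $e_i\wedge e_j$, $i<j$, orthonormal) satisfying the first Bianchi identity; equivalently, of tensors $R_{ijkl}$ with the symmetries of a Riemann curvature tensor, via $R(e_i\wedge e_j)=\frac12\sum_{k,l}R_{ijkl}\,e_k\wedge e_l$. The sign convention is that sectional curvatures are $R_{ijij}$, $\mathrm{Ric}_{ik}=\sum_j R_{ijkj}$, $\mathrm{scal}=\mathrm{tr}\,\mathrm{Ric}$. Norms: $\|R\|^2=\frac14\sum_{i,j,k,l}R_{ijkl}^2$, $|\mathrm{Ric}|^2=\sum_{i,j}\mathrm{Ric}_{ij}^2$. Cones. For $a\in[0,n/4]$, $$\Omega(a)=\Big\{R\in S_B^2(\mathfrak{so}(n)) : \Big(\frac{n-2}{4}+a\Big)\|R\|^2\le\frac14|\mathrm{Ric}(R)|^2,\ \mathrm{scal}(R)>0\Big\},\qquad \overline{\Omega(a)}=\Omega(a)\cup\{0\}.$$ Equivalently,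 with $R=R_I+R_{\mathrm{Ric}_0}+W$ the orthogonal decomposition into scalar, traceless Ricci and Weyl parts, $\Omega(a)$ is given by $a\|R_{\mathrm{Ric}_0}\|^2+\frac{n-2+4a}{4}\|W\|^2\le\frac{n-4a}{4}\|R_I\|^2$ and $\mathrm{scal}(R)>0$. These sets are $O(n)$-invariant. Hamilton ODE. $Q(R)=R^2+R^\sharp$, where $(R^2)_{ijkl}=\frac12\sum_{p,q}R_{ijpq}R_{klpq}$ and $(R^\sharp)_{ijkl}=\sum_{p,q}\big(R_{ipkq}R_{jplq}-R_{iplq}R_{jpkq}\big)$. A set $C\subset S_B^2(\mathfrak{so}(n))$ is invariant under the ODE $\frac{d}{dt}R=Q(R)$ if solutions starting in $C$ at $t=0$ stay in $C$ for all $t\ge0$ for which they exist. Ricci flow invariance. An $O(n)$-invariant set $C\subset S_B^2(\mathfrak{so}(n))$ defines a Ricci flow invariant curvature condition if, for every solution $g(t)$, $t\in[0,T)$, of the Ricci flow $\frac{\partial g}{\partial t}=-2\,\mathrm{Ric}(g)$ on a compact $n$-manifold such that the curvature operator of $g(0)$ at each point lies in $C$ (after identifying the tangent space isometrically with $\mathbb{R}^n$), the curvature operator of $g(t)$ at each point lies in $C$ for all $t\in[0,T)$. *)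

theory Defs
  imports "HOL-Analysis.Analysis"
begin

section \<open>Algebraic curvature operators\<close>

text \<open>
  A covariant 4-tensor on \<open>\<real>\<^sup>n\<close>, \<open>n = CARD('n)\<close>, is given by its components \<open>R $ i $ j $ k $ l\<close> in
  the standard basis. A curvature operator is represented by its tensor, the two being related by
  \<open>R(e\<^sub>i \<and> e\<^sub>j) = 1/2 \<Sum>k l. R $ i $ j $ k $ l e\<^sub>k \<and> e\<^sub>l\<close>; sectional curvatures are
  \<open>R $ i $ j $ i $ j\<close>.
\<close>

type_synonym 'n tensor4 = "real ^ 'n ^ 'n ^ 'n ^ 'n"

text \<open>The space \<open>S\<^sub>B\<^sup>2(so(n))\<close>.\<close>

definition curvature_tensors :: "('n::finite) tensor4 set" where
  "curvature_tensors = {R. \<forall>i j k l.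
      R $ i $ j $ k $ l = - R $ j $ i $ k $ l \<and>
      R $ i $ j $ k $ l = - R $ i $ j $ l $ k \<and>
      R $ i $ j $ k $ l = R $ k $ l $ i $ j \<and>
      R $ i $ j $ k $ l + R $ j $ k $ i $ l + R $ k $ i $ j $ l = 0}"

definition ric :: "('n::finite) tensor4 \<Rightarrow> real ^ 'n ^ 'n" where
  "ric R = (\<chi> i k. \<Sum>j\<in>UNIV. R $ i $ j $ k $ j)"

definition scal :: "('n::finite) tensor4 \<Rightarrow> real" where
  "scal R = trace (ric R)"

text \<open>The factor \<open>1/4\<close> makes this the norm of an endomorphism of \<open>\<Lambda>\<^sup>2 \<real>\<^sup>n\<close> with respect to
  the orthonormal basis \<open>e\<^sub>i \<and> e\<^sub>j\<close>, \<open>i < j\<close>; it is not the square of the library's \<^const>\<open>norm\<close>.\<close>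

definition curv_norm_sq :: "('n::finite) tensor4 \<Rightarrow> real" where
  "curv_norm_sq R = 1/4 * (\<Sum>i\<in>UNIV. \<Sum>j\<in>UNIV. \<Sum>k\<in>UNIV. \<Sum>l\<in>UNIV. (R $ i $ j $ k $ l)\<^sup>2)"

definition ric_norm_sq :: "('n::finite) tensor4 \<Rightarrow> real" where
  "ric_norm_sq R = (\<Sum>i\<in>UNIV. \<Sum>j\<in>UNIV. (ric R $ i $ j)\<^sup>2)"

definition Omega :: "real \<Rightarrow> ('n::finite) tensor4 set" where
  "Omega a = {R \<in> curvature_tensors.
      ((real CARD('n) - 2) / 4 + a) * curv_norm_sq R \<le> 1/4 * ric_norm_sq R \<and> scal R > 0}"

definition Omega_bar :: "real \<Rightarrow> ('n::finite) tensor4 set" where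
  "Omega_bar a = Omega a \<union> {0}"

definition epsilon :: "nat \<Rightarrow> real" where
  "epsilon n = (if n \<ge> 11 then 1 / real n
     else (real n)\<^sup>2 * (real n - 1) / (2 * (3 * real n - 2) * (2 * (real n)\<^sup>2 - 4 * real n + 1)))"


section \<open>The Hamilton ODE\<close>

definition curv_square :: "('n::finite) tensor4 \<Rightarrow> 'n tensor4" where
  "curv_square R = (\<chi> i j k l. 1/2 * (\<Sum>p\<in>UNIV. \<Sum>q\<in>UNIV. R $ i $ j $ p $ q * R $ k $ l $ p $ q))"

definition curv_sharp :: "('n::finite) tensor4 \<Rightarrow> 'n tensor4" where
  "curv_sharp R = (\<chi> i j k l. \<Sum>p\<in>UNIV. \<Sum>q\<in>UNIV.
      R $ i $ p $ k $ q * R $ j $ p $ l $ q - R $ i $ p $ l $ q * R $ j $ p $ k $ q)"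

definition Q :: "('n::finite) tensor4 \<Rightarrow> 'n tensor4" where
  "Q R = curv_square R + curv_sharp R"

text \<open>The interval \<open>I\<close> of existence may be bounded or not, and closed or half-open at its right end.
  The ODE is one on the vector space of curvature tensors, so solutions take values there.\<close>

definition hamilton_ode_invariant :: "('n::finite) tensor4 set \<Rightarrow> bool" where
  "hamilton_ode_invariant C \<longleftrightarrow>
     (\<forall>(R :: real \<Rightarrow> 'n tensor4) I.
        is_interval I \<and> 0 \<in> I \<and> I \<subseteq> {0..} \<and>
        (\<forall>t\<in>I. R t \<in> curvature_tensors) \<and>
        (\<forall>t\<in>I. (R has_vector_derivative Q (R t)) (at t within I)) \<and>
        R 0 \<in> C
        \<longrightarrow> (\<forall>t\<in>I. R t \<in> C))"


section \<open>Smooth manifolds and Riemannian metrics\<close>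

text \<open>
  \<open>C\<^sup>k\<close> maps, by existence and continuity of iterated directional derivatives. The derivatives are
  taken within \<open>S\<close>, so that sets such as \<open>{0..<T} \<times> V\<close> with \<open>V\<close> open are covered, where the
  derivative in time at \<open>0\<close> is one-sided. This is meant for sets \<open>S\<close> on which derivatives within
  \<open>S\<close> are unique, as is the case for open sets and for \<open>{0..<T} \<times> V\<close>.
\<close>

primrec C_k_on :: "nat \<Rightarrow> 'a::euclidean_space set \<Rightarrow> ('a \<Rightarrow> 'b::real_normed_vector) \<Rightarrow> bool" where
  "C_k_on 0 S f \<longleftrightarrow> continuous_on S f"
| "C_k_on (Suc k) S f \<longleftrightarrow> f differentiable_on S \<and>
     (\<forall>v. C_k_on k S (\<lambda>x. frechet_derivative f (at x within S) v))"

definition smooth_on :: "'a::euclidean_space set \<Rightarrow> ('a \<Rightarrow> 'b::real_normed_vector) \<Rightarrow> bool" where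
  "smooth_on S f \<longleftrightarrow> (\<forall>k. C_k_on k S f)"

text \<open>A chart is a pair of its domain and its coordinate map; the values of the map outside the
  domain are irrelevant.\<close>

type_synonym ('m, 'n) chart = "'m set \<times> ('m \<Rightarrow> real ^ 'n)"

definition chart_image :: "('m, 'n::finite) chart \<Rightarrow> (real ^ 'n) set" where
  "chart_image c = snd c ` fst c"

definition transition :: "('m, 'n::finite) chart \<Rightarrow> ('m, 'n) chart \<Rightarrow> real ^ 'n \<Rightarrow> real ^ 'n" where
  "transition c d = snd d \<circ> inv_into (fst c) (snd c)"

definition smooth_manifold :: "'m topology \<Rightarrow> ('m, 'n::finite) chart set \<Rightarrow> bool" where
  "smooth_manifold M \<A> \<longleftrightarrow>
     Hausdorff_space M \<and> second_countable M \<and>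
     topspace M = (\<Union>c\<in>\<A>. fst c) \<and>
     (\<forall>c\<in>\<A>. openin M (fst c) \<and> open (chart_image c) \<and>
        homeomorphic_map (subtopology M (fst c)) (top_of_set (chart_image c)) (snd c)) \<and>
     (\<forall>c\<in>\<A>. \<forall>d\<in>\<A>. smooth_on (snd c ` (fst c \<inter> fst d)) (transition c d))"

text \<open>A Riemannian metric on a manifold with atlas \<open>\<A>\<close> is given by its coordinate matrices
  \<open>g c x\<close>, for charts \<open>c\<close> of the atlas and coordinates \<open>x\<close> in the image of \<open>c\<close>, subject to the
  transformation law of a covariant 2-tensor.\<close>

type_synonym ('m, 'n) metric = "('m, 'n) chart \<Rightarrow> real ^ 'n \<Rightarrow> real ^ 'n ^ 'n"

definition riemannian_metric ::
    "('m, 'n::finite) chart set \<Rightarrow> ('m, 'n) metric \<Rightarrow> bool" where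
  "riemannian_metric \<A> g \<longleftrightarrow>
     (\<forall>c\<in>\<A>. smooth_on (chart_image c) (g c)) \<and>
     (\<forall>c\<in>\<A>. \<forall>x\<in>chart_image c.
        transpose (g c x) = g c x \<and> (\<forall>v. v \<noteq> 0 \<longrightarrow> v \<bullet> (g c x *v v) > 0)) \<and>
     (\<forall>c\<in>\<A>. \<forall>d\<in>\<A>. \<forall>p \<in> fst c \<inter> fst d.
        let J = matrix (frechet_derivative (transition c d) (at (snd c p)))
        in g c (snd c p) = transpose J ** g d (snd d p) ** J)"


section \<open>Curvature in local coordinates\<close>

text \<open>In this section \<open>h\<close> is a field of coordinate matrices of a metric on an open subset of
  \<open>\<real>\<^sup>n\<close>.\<close>

definition partial :: "'n::finite \<Rightarrow> (real ^ 'n \<Rightarrow> real) \<Rightarrow> real ^ 'n \<Rightarrow> real" where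
  "partial i f x = frechet_derivative f (at x) (axis i 1)"

text \<open>\<open>christoffel h k i j\<close> is \<open>\<Gamma>\<^sup>k\<^sub>i\<^sub>j\<close>.\<close>

definition christoffel ::
    "(real ^ 'n::finite \<Rightarrow> real ^ 'n ^ 'n) \<Rightarrow> 'n \<Rightarrow> 'n \<Rightarrow> 'n \<Rightarrow> real ^ 'n \<Rightarrow> real" where
  "christoffel h k i j x = 1/2 * (\<Sum>l\<in>UNIV. matrix_inv (h x) $ k $ l *
      (partial i (\<lambda>y. h y $ j $ l) x + partial j (\<lambda>y. h y $ i $ l) x
        - partial l (\<lambda>y. h y $ i $ j) x))"

text \<open>\<open>riemann_up h i j k l\<close> is the \<open>l\<close>-th component of
  \<open>\<nabla>\<^sub>i \<nabla>\<^sub>j \<partial>\<^sub>k - \<nabla>\<^sub>j \<nabla>\<^sub>i \<partial>\<^sub>k\<close>.\<close>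

definition riemann_up ::
    "(real ^ 'n::finite \<Rightarrow> real ^ 'n ^ 'n) \<Rightarrow> 'n \<Rightarrow> 'n \<Rightarrow> 'n \<Rightarrow> 'n \<Rightarrow> real ^ 'n \<Rightarrow> real" where
  "riemann_up h i j k l x =
     partial i (christoffel h l j k) x - partial j (christoffel h l i k) x
     + (\<Sum>m\<in>UNIV. christoffel h m j k x * christoffel h l i m x
                 - christoffel h m i k x * christoffel h l j m x)"

text \<open>The lowered tensor has components \<open>R\<^sub>i\<^sub>j\<^sub>k\<^sub>l = g(R(\<partial>\<^sub>i,\<partial>\<^sub>j)\<partial>\<^sub>l, \<partial>\<^sub>k)\<close>; the order of the
  last two indices makes \<open>R\<^sub>i\<^sub>j\<^sub>i\<^sub>j\<close> the sectional curvature in an orthonormal frame.\<close>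

definition riemann :: "(real ^ 'n::finite \<Rightarrow> real ^ 'n ^ 'n) \<Rightarrow> real ^ 'n \<Rightarrow> 'n tensor4" where
  "riemann h x = (\<chi> i j k l. \<Sum>m\<in>UNIV. h x $ k $ m * riemann_up h i j l m x)"

definition ricci :: "(real ^ 'n::finite \<Rightarrow> real ^ 'n ^ 'n) \<Rightarrow> real ^ 'n \<Rightarrow> real ^ 'n ^ 'n" where
  "ricci h x = (\<chi> i k. \<Sum>j\<in>UNIV. \<Sum>l\<in>UNIV. matrix_inv (h x) $ j $ l * riemann h x $ i $ j $ k $ l)"

text \<open>Components of a tensor in the frame formed by the columns of \<open>E\<close>.\<close>

definition frame_components :: "real ^ 'n ^ 'n \<Rightarrow> ('n::finite) tensor4 \<Rightarrow> 'n tensor4" where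
  "frame_components E R = (\<chi> i j k l. \<Sum>p\<in>UNIV. \<Sum>q\<in>UNIV. \<Sum>r\<in>UNIV. \<Sum>s\<in>UNIV.
      E $ p $ i * E $ q $ j * E $ r $ k * E $ s $ l * R $ p $ q $ r $ s)"

definition O_invariant :: "('n::finite) tensor4 set \<Rightarrow> bool" where
  "O_invariant C \<longleftrightarrow> (\<forall>E. orthogonal_matrix E \<longrightarrow> (\<forall>R\<in>C. frame_components E R \<in> C))"

definition orthonormal_frame :: "real ^ 'n ^ 'n \<Rightarrow> real ^ 'n ^ 'n::finite \<Rightarrow> bool" where
  "orthonormal_frame G E \<longleftrightarrow> transpose E ** G ** E = mat 1"

text \<open>An isometric identification of the tangent space at \<open>p\<close> with \<open>\<real>\<^sup>n\<close> is an orthonormal frame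
  at \<open>p\<close>. For sets \<open>C\<close> invariant under \<open>O(n)\<close> it is immaterial whether all frames or some frame is
  required.\<close>

definition curvature_in ::
    "('m, 'n::finite) chart set \<Rightarrow> ('m, 'n) metric \<Rightarrow> 'n tensor4 set \<Rightarrow> bool" where
  "curvature_in \<A> g C \<longleftrightarrow>
     (\<forall>c\<in>\<A>. \<forall>x\<in>chart_image c. \<forall>E. orthonormal_frame (g c x) E \<longrightarrow>
        frame_components E (riemann (g c) x) \<in> C)"


section \<open>Ricci flow\<close>

text \<open>A smooth solution on \<open>[0,T)\<close> with \<open>T\<close> finite; a solution on \<open>[0,\<infinity>)\<close> is one that restricts to
  a solution on \<open>[0,T)\<close> for each \<open>T > 0\<close>.\<close>

definition ricci_flow ::
    "('m, 'n::finite) chart set \<Rightarrow> real \<Rightarrow> (real \<Rightarrow> ('m, 'n) metric) \<Rightarrow> bool" where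
  "ricci_flow \<A> T g \<longleftrightarrow>
     (\<forall>t\<in>{0..<T}. riemannian_metric \<A> (g t)) \<and>
     (\<forall>c\<in>\<A>. smooth_on ({0..<T} \<times> chart_image c) (\<lambda>(t, x). g t c x)) \<and>
     (\<forall>t\<in>{0..<T}. \<forall>c\<in>\<A>. \<forall>x\<in>chart_image c.
        ((\<lambda>s. g s c x) has_vector_derivative (- 2) *\<^sub>R ricci (g t c) x) (at t within {0..<T}))"

text \<open>The type argument is the type of points of the manifolds considered; being invariant as a
  curvature condition means that this holds for every type \<open>'m\<close>.\<close>

definition ricci_flow_invariant :: "'m itself \<Rightarrow> ('n::finite) tensor4 set \<Rightarrow> bool" where
  "ricci_flow_invariant TYPE('m) C \<longleftrightarrow>
     C \<subseteq> curvature_tensors \<and> O_invariant C \<and>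
     (\<forall>(M :: 'm topology) (\<A> :: ('m, 'n) chart set) T g.
        smooth_manifold M \<A> \<and> compact_space M \<and> T > 0 \<and> ricci_flow \<A> T g \<and>
        curvature_in \<A> (g 0) C
        \<longrightarrow> (\<forall>t\<in>{0..<T}. curvature_in \<A> (g t) C))"

end

theory Submission
  imports Defs
begin

text \<open>
  Put \<open>\<kappa> = (n - 2) / 4 + a\<close>. On curvature tensors the form \<open>P(R) = (|Ric R|\<^sup>2 - 4 \<kappa> |R|\<^sup>2) / 4\<close> has
  Lorentzian signature, its positive direction being the scalar part, so that \<open>Omega_bar a\<close> is the
  half \<open>scal \<ge> 0\<close> of the cone \<open>P \<ge> 0\<close>. Three facts give the theorem.

  (1) If \<open>P(R) = 0\<close> and \<open>scal R > 0\<close>, then \<open>P(R, Q R) \<ge> 0\<close>. In terms of the traceless Ricci part \<open>h\<close>,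
  the Weyl part \<open>W\<close> and the scalar curvature, \<open>P(R, Q R)\<close> is a cubic polynomial whose only terms without
  a sign are \<open>tr h\<^sup>3\<close>, \<open>W(h, h)\<close> and \<open>W \<bullet> Q W\<close>. Sharp bounds for \<open>tr h\<^sup>3\<close> and \<open>W(h, h)\<close> and a
  cruder one for \<open>W \<bullet> Q W\<close> reduce the claim to an inequality in \<open>|h|\<close> and \<open>|W|\<close>, which holds
  for \<open>a \<ge> n/4 - epsilon n\<close>.

  (2) Under the Ricci flow, Uhlenbeck's identity \<open>\<partial>\<^sub>t Rm = \<Delta> Rm + 2 Q(Rm)\<close> holds modulo the action of \<open>Ric\<close>.
  At the centre of normal coordinates of \<open>g(t\<^sub>0)\<close> it is an identity between ordinary derivatives of
  coefficients, whence the operator \<open>\<Delta>\<close> need not be defined.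

  (3) A first contact argument for \<open>R + \<eta> I\<close>, where \<open>I\<close> is the curvature tensor of the unit sphere and
  \<open>\<eta> = \<epsilon> exp(L t)\<close>: at the first zero of \<open>P(R + \<eta> I)\<close> the gradient term has a sign by the reversed
  Cauchy-Schwarz inequality for \<open>P\<close>, and (1) makes the time derivative positive. The ODE is the case of a
  spatially constant \<open>R\<close>, and \<open>a = n/4\<close> is the limit of smaller \<open>a\<close>.
\<close>

text \<open>The contact argument needs strict growth, which the boundary inequality does not give;
  the round tensor I supplies it. Since P(I, X) = \<beta> scal X with \<beta> = (n/4 - a)/2, the
  perturbed form P(R + \<eta> I) is a combination of P(R) and scal R with coefficients that depend
  on time only. The geometry therefore enters through two real functions on an interval times a
  compact space, and a single argument covers the manifold and the ODE. The factor \<beta> vanishes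
  at a = n/4, which is what forces the limit there. Scalar curvature has to be controlled on its
  own: P \<ge> 0 is a double cone, and for \<open>Omega a\<close> strict positivity must survive.
  Both follow because the spatial minimum of scal cannot decrease, scal (Q R) being |Ric|^2. The
  size of \<open>epsilon n\<close> is used in (1) alone; elsewhere only 0 < \<open>epsilon n\<close>
  < n/4 matters. Both scalars are written with the inverse metric instead of an orthonormal frame:
  this makes them smooth in any chart without a smooth choice of frames, and their derivatives at a
  normal centre reproduce the covariant ones.\<close>

section \<open>Smooth maps on sets with unique derivatives\<close>

text \<open>A condition under which derivatives within \<open>S\<close> are unique; it covers open sets and \<open>{0..<T} \<times> V\<close>.\<close>

definition udom :: "'a::euclidean_space set \<Rightarrow> bool" where
  "udom S \<longleftrightarrow> (\<forall>x\<in>S. \<forall>i\<in>Basis. \<forall>e>0. \<exists>d. 0 < \<bar>d\<bar> \<and> \<bar>d\<bar> < e \<and> x + d *\<^sub>R i \<in> S)"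

text \<open>Derivatives are taken within S, as in \<open>C_k_on\<close>, so that the iterated
  derivatives of a flow at time 0 are one-sided in time.\<close>

definition dird :: "'a::euclidean_space set \<Rightarrow> 'a \<Rightarrow> ('a \<Rightarrow> 'b::real_normed_vector) \<Rightarrow> 'a \<Rightarrow> 'b" where
  "dird S v f = (\<lambda>x. frechet_derivative f (at x within S) v)"

lemma dird_eqI:
  assumes "udom S" "x \<in> S" "(f has_derivative f') (at x within S)"
  shows "dird S v f x = f' v"
proof -
  have "(f has_derivative frechet_derivative f (at x within S)) (at x within S)"
    using assms(3) frechet_derivative_works differentiable_def by blast
  from frechet_derivative_unique_within[OF this assms(3)] assms(1,2)
  show ?thesis by (auto simp: udom_def dird_def)
qed

lemma udom_open: "open S \<Longrightarrow> udom S"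
  unfolding udom_def
proof (intro ballI allI impI)
  fix x i :: 'a and e :: real assume S: "open S" "x \<in> S" "i \<in> Basis" "e > 0"
  then obtain r where r: "r > 0" "ball x r \<subseteq> S" by (meson open_contains_ball)
  let ?d = "min (e/2) (r/2)"
  have "x + ?d *\<^sub>R i \<in> ball x r" using r S by (auto simp: dist_norm min_def)
  then show "\<exists>d. 0 < \<bar>d\<bar> \<and> \<bar>d\<bar> < e \<and> x + d *\<^sub>R i \<in> S"
    using r S by (intro exI[of _ ?d]) auto
qed

lemma udom_Times: "udom A \<Longrightarrow> udom B \<Longrightarrow> udom (A \<times> B)"
  unfolding udom_def Basis_prod_def by (fastforce simp: mem_Times_iff)

lemma udom_Ico: "udom {0..<T::real}"
  unfolding udom_def
proof (intro ballI allI impI)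
  fix x i e :: real assume S: "x \<in> {0..<T}" "i \<in> Basis" "e > 0"
  let ?d = "min (e/2) ((T - x)/2)"
  show "\<exists>d. 0 < \<bar>d\<bar> \<and> \<bar>d\<bar> < e \<and> x + d *\<^sub>R i \<in> {0..<T}"
    using S by (intro exI[of _ ?d]) (auto simp: min_def field_simps)
qed

lemma has_derivative_dird:
  assumes "f differentiable_on S" "x \<in> S"
  shows "(f has_derivative (\<lambda>v. dird S v f x)) (at x within S)"
  using assms by (simp add: dird_def differentiable_on_def frechet_derivative_works)

lemma has_derivative_dird_open:
  assumes "f differentiable_on S" "x \<in> S" "open S"
  shows "(f has_derivative (\<lambda>v. dird S v f x)) (at x)"
  using has_derivative_dird[OF assms(1,2)] unfolding at_within_open[OF assms(2,3)] .

lemma dird_cong: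
  assumes "\<And>x. x \<in> S \<Longrightarrow> f x = g x" "x \<in> S"
  shows "dird S v f x = dird S v g x"
proof -
  have "(f has_derivative f') (at x within S) = (g has_derivative f') (at x within S)" for f'
    using assms by (metis has_derivative_transform)
  then show ?thesis by (simp add: dird_def frechet_derivative_def)
qed

lemma C_k_on_Suc: "C_k_on (Suc k) S f \<longleftrightarrow> f differentiable_on S \<and> (\<forall>v. C_k_on k S (dird S v f))"
  by (simp add: dird_def)

declare C_k_on.simps(2)[simp del]

lemma C_k_on_cong:
  assumes "\<And>x. x \<in> S \<Longrightarrow> f x = g x"
  shows "C_k_on k S f \<longleftrightarrow> C_k_on k S g"
  using assms
proof (induction k arbitrary: f g)
  case 0 then show ?case by (simp cong: continuous_on_cong)
next
  case (Suc k)
  have "f differentiable_on S \<longleftrightarrow> g differentiable_on S"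
    using Suc.prems unfolding differentiable_on_def differentiable_def
    by (metis has_derivative_transform)
  moreover have "C_k_on k S (dird S v f) = C_k_on k S (dird S v g)" for v
    by (intro Suc.IH dird_cong) (use Suc.prems in auto)
  ultimately show ?case by (simp add: C_k_on_Suc)
qed

lemma smooth_on_cong:
  "(\<And>x. x \<in> S \<Longrightarrow> f x = g x) \<Longrightarrow> smooth_on S f \<longleftrightarrow> smooth_on S g"
  unfolding smooth_on_def using C_k_on_cong by blast

lemma C_k_on_SucD: "C_k_on (Suc k) S f \<Longrightarrow> C_k_on k S f"
proof (induction k arbitrary: f)
  case 0 then show ?case by (simp add: C_k_on_Suc differentiable_imp_continuous_on)
next
  case (Suc k) then show ?case by (subst C_k_on_Suc) (meson C_k_on_Suc)
qed

lemma smooth_on_dird: "smooth_on S f \<Longrightarrow> smooth_on S (dird S v f)"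
  unfolding smooth_on_def by (meson C_k_on_Suc)

lemma smooth_on_imp_differentiable_on: "smooth_on S f \<Longrightarrow> f differentiable_on S"
  unfolding smooth_on_def by (meson C_k_on_Suc)

lemma smooth_on_imp_continuous_on: "smooth_on S f \<Longrightarrow> continuous_on S f"
  unfolding smooth_on_def by (meson C_k_on.simps(1))

lemma C_k_on_const: "udom S \<Longrightarrow> C_k_on k S (\<lambda>x. c)"
proof (induction k arbitrary: c)
  case (Suc k)
  have "C_k_on k S (dird S v (\<lambda>x. c))" for v
    by (subst C_k_on_cong[where g="\<lambda>x. 0"])
      (auto intro!: Suc.IH Suc.prems dird_eqI[OF \<open>udom S\<close>, where f'="\<lambda>x. 0"])
  then show ?case by (simp add: C_k_on_Suc)
qed simp

lemma C_k_on_linear: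
  assumes "udom S" "bounded_linear f" shows "C_k_on k S f"
proof (cases k)
  case (Suc m)
  have "C_k_on m S (dird S v f)" for v
    by (subst C_k_on_cong[where g="\<lambda>x. f v"])
      (auto intro!: C_k_on_const assms dird_eqI bounded_linear_imp_has_derivative)
  then show ?thesis using Suc assms
    by (auto simp: C_k_on_Suc intro!: bounded_linear_imp_differentiable_on)
qed (use assms in \<open>simp add: linear_continuous_on\<close>)

lemma C_k_on_add:
  assumes "udom S"
  shows "C_k_on k S f \<Longrightarrow> C_k_on k S g \<Longrightarrow> C_k_on k S (\<lambda>x. f x + g x)"
proof (induction k arbitrary: f g)
  case (Suc k)
  note fg = Suc.prems[unfolded C_k_on_Suc]
  have "C_k_on k S (dird S v (\<lambda>x. f x + g x))" for v
    by (subst C_k_on_cong[where g="\<lambda>x. dird S v f x + dird S v g x"])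
      (use fg in \<open>auto intro!: Suc.IH dird_eqI assms derivative_eq_intros has_derivative_dird\<close>)
  then show ?case using fg by (simp add: C_k_on_Suc differentiable_on_add)
qed (simp add: continuous_on_add)

text \<open>By the Leibniz rule a derivative of \<open>B (f x) (g x)\<close> is a sum of two terms
  of the same form with one factor differentiated, so the induction runs over all f and g. Products,
  matrix products and contractions are instances.\<close>

lemma C_k_on_bilinear:
  assumes "udom S" "bounded_bilinear B"
  shows "C_k_on k S f \<Longrightarrow> C_k_on k S g \<Longrightarrow> C_k_on k S (\<lambda>x. B (f x) (g x))"
proof (induction k arbitrary: f g)
  case 0 then show ?case by (simp add: bounded_bilinear.continuous_on[OF assms(2)])
next
  case (Suc k)
  note fg = Suc.prems[unfolded C_k_on_Suc]
  have d: "((\<lambda>x. B (f x) (g x)) has_derivative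
      (\<lambda>v. B (f x) (dird S v g x) + B (dird S v f x) (g x))) (at x within S)" if "x \<in> S" for x
    by (rule bounded_bilinear.FDERIV[OF assms(2)]; rule has_derivative_dird) (use fg that in auto)
  have "C_k_on k S (dird S v (\<lambda>x. B (f x) (g x)))" for v
  proof -
    have "C_k_on k S (\<lambda>x. B (f x) (dird S v g x))" "C_k_on k S (\<lambda>x. B (dird S v f x) (g x))"
      using C_k_on_SucD[OF Suc.prems(1)] C_k_on_SucD[OF Suc.prems(2)] fg by (simp_all add: Suc.IH)
    from C_k_on_add[OF assms(1) this] show ?thesis
      by (subst C_k_on_cong[where g="\<lambda>x. B (f x) (dird S v g x) + B (dird S v f x) (g x)"])
        (auto intro!: dird_eqI[OF assms(1) _ d])
  qed
  then show ?case using d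
    by (auto simp add: C_k_on_Suc differentiable_on_def differentiable_def)
qed

lemma C_k_on_sum:
  assumes "udom S"
  shows "(\<And>i. i \<in> I \<Longrightarrow> C_k_on k S (f i)) \<Longrightarrow> C_k_on k S (\<lambda>x. \<Sum>i\<in>I. f i x)"
  by (induction I rule: infinite_finite_induct) (auto intro: C_k_on_add C_k_on_const assms)

text \<open>The chain rule gives a derivative of f in the moving direction
  \<open>dird S v \<phi> x\<close>. Expanding this direction over the basis leaves derivatives of f
  in fixed directions, to which the induction hypothesis applies.\<close>

lemma C_k_on_compose:
  fixes f :: "'b::euclidean_space \<Rightarrow> 'c::real_normed_vector" and \<phi> :: "'a::euclidean_space \<Rightarrow> 'b"
  assumes "udom S" "udom T" "\<phi> ` S \<subseteq> T"
  shows "C_k_on k S \<phi> \<Longrightarrow> C_k_on k T f \<Longrightarrow> C_k_on k S (\<lambda>x. f (\<phi> x))"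
proof (induction k arbitrary: f)
  case 0 then show ?case using assms by (auto intro: continuous_on_compose2)
next
  case (Suc k)
  note fg = Suc.prems[unfolded C_k_on_Suc]
  have d: "((\<lambda>x. f (\<phi> x)) has_derivative
      (\<lambda>v. \<Sum>b\<in>Basis. (dird S v \<phi> x \<bullet> b) *\<^sub>R dird T b f (\<phi> x))) (at x within S)" if "x \<in> S" for x
  proof -
    let ?f' = "\<lambda>v. dird T v f (\<phi> x)"
    have f': "(f has_derivative ?f') (at (\<phi> x) within T)"
      using that assms fg by (auto intro: has_derivative_dird)
    have "((\<lambda>x. f (\<phi> x)) has_derivative (\<lambda>v. ?f' (dird S v \<phi> x))) (at x within S)"
      by (rule has_derivative_in_compose[OF has_derivative_dird[OF conjunct1[OF fg(1)] that]
         has_derivative_subset[OF f' assms(3)]])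
    moreover have *: "?f' w = (\<Sum>b\<in>Basis. (w \<bullet> b) *\<^sub>R ?f' b)" for w
    proof -
      have l: "linear ?f'" by (rule has_derivative_linear[OF f'])
      have "?f' (\<Sum>b\<in>Basis. (w \<bullet> b) *\<^sub>R b) = (\<Sum>b\<in>Basis. ?f' ((w \<bullet> b) *\<^sub>R b))"
        by (rule linear_sum[OF l])
      also have "\<dots> = (\<Sum>b\<in>Basis. (w \<bullet> b) *\<^sub>R ?f' b)"
        by (intro sum.cong refl linear_scale[OF l])
      finally show ?thesis by (simp only: euclidean_representation)
    qed
    moreover have "(\<lambda>v. ?f' (dird S v \<phi> x)) = (\<lambda>v. \<Sum>b\<in>Basis. (dird S v \<phi> x \<bullet> b) *\<^sub>R ?f' b)"
      by (rule ext) (rule *)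
    ultimately show ?thesis by metis
  qed
  have c: "C_k_on k S (\<lambda>x. dird T b f (\<phi> x))" for b
    using Suc.IH[OF C_k_on_SucD[OF Suc.prems(1)]] fg by blast
  have e: "C_k_on k S (\<lambda>x. dird S v \<phi> x \<bullet> b)" for v b
    using C_k_on_bilinear[OF assms(1) bounded_bilinear_inner _ C_k_on_const[OF assms(1)]] fg by blast
  have "C_k_on k S (dird S v (\<lambda>x. f (\<phi> x)))" for v
    by (subst C_k_on_cong[where g="\<lambda>x. \<Sum>b\<in>Basis. (dird S v \<phi> x \<bullet> b) *\<^sub>R dird T b f (\<phi> x)"])
      (rule dird_eqI[OF assms(1) _ d], assumption+,
       intro C_k_on_sum assms(1) C_k_on_bilinear[OF assms(1) bounded_bilinear_scaleR] c e)
  then show ?case using d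
    by (auto simp add: C_k_on_Suc differentiable_on_def differentiable_def)
qed

lemma C_k_on_inverse:
  fixes f :: "'a::euclidean_space \<Rightarrow> real"
  assumes "udom S" "\<And>x. x \<in> S \<Longrightarrow> f x \<noteq> 0"
  shows "C_k_on k S f \<Longrightarrow> C_k_on k S (\<lambda>x. inverse (f x))"
proof (induction k)
  case 0 then show ?case using assms by (auto intro!: continuous_on_inverse)
next
  case (Suc k)
  note fg = Suc.prems[unfolded C_k_on_Suc]
  have d: "((\<lambda>x. inverse (f x)) has_derivative
      (\<lambda>v. - (inverse (f x) * dird S v f x * inverse (f x)))) (at x within S)" if "x \<in> S" for x
    by (rule Deriv.has_derivative_inverse[where f=f, OF assms(2)[OF that]], rule has_derivative_dird[OF _ that])
        (use fg in simp)
  have m: "C_k_on k S (\<lambda>x. u x * w x)" if "C_k_on k S u" "C_k_on k S w" for u w :: "'a \<Rightarrow> real"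
    using C_k_on_bilinear[OF assms(1) bounded_bilinear_mult that] .
  have "C_k_on k S (\<lambda>x. (-1) * (inverse (f x) * dird S v f x * inverse (f x)))" for v
    using fg Suc.IH[OF C_k_on_SucD[OF Suc.prems]] by (intro m C_k_on_const[OF assms(1)]) auto
  then have "C_k_on k S (dird S v (\<lambda>x. inverse (f x)))" for v
    by (subst C_k_on_cong[where g="\<lambda>x. (-1) * (inverse (f x) * dird S v f x * inverse (f x))"])
      (auto simp: dird_eqI[OF assms(1) _ d])
  then show ?case using d
    by (auto simp add: C_k_on_Suc differentiable_on_def differentiable_def)
qed

text \<open>Permits passing from \<open>{0..<T}\<close> times a chart to the open slab without time
  0, on which derivatives commute.\<close>

lemma C_k_on_subset:
  assumes "udom S'" "S' \<subseteq> S"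
  shows "C_k_on k S f \<Longrightarrow> C_k_on k S' f"
proof (induction k arbitrary: f)
  case 0 then show ?case using assms(2) by (auto intro: continuous_on_subset)
next
  case (Suc k)
  note f = Suc.prems[unfolded C_k_on_Suc]
  have d: "(f has_derivative (\<lambda>v. dird S v f x)) (at x within S')" if "x \<in> S'" for x
    by (rule has_derivative_subset[OF has_derivative_dird assms(2)]) (use that assms(2) f in auto)
  have "C_k_on k S' (dird S' v f)" for v
    by (subst C_k_on_cong[where g="dird S v f"])
      (use f Suc.IH in \<open>auto simp: dird_eqI[OF assms(1) _ d]\<close>)
  then show ?case using d
    by (auto simp add: C_k_on_Suc differentiable_on_def differentiable_def)
qed

section \<open>Closure properties of smooth maps and rules of differentiation\<close>

context
  fixes S :: "'a::euclidean_space set" assumes S: "udom S"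
begin

lemma smooth_on_const: "smooth_on S (\<lambda>x. c)"
  using C_k_on_const[OF S] by (auto simp: smooth_on_def)

lemma smooth_on_linear: "bounded_linear f \<Longrightarrow> smooth_on S f"
  using C_k_on_linear[OF S] by (auto simp: smooth_on_def)

lemma smooth_on_bilinear:
  "bounded_bilinear B \<Longrightarrow> smooth_on S f \<Longrightarrow> smooth_on S g \<Longrightarrow> smooth_on S (\<lambda>x. B (f x) (g x))"
  by (simp add: smooth_on_def C_k_on_bilinear[OF S])

lemma smooth_on_linear_compose:
  assumes "bounded_linear L" "smooth_on S f" shows "smooth_on S (\<lambda>x. L (f x))"
proof -
  \<comment> \<open>Writing L y as 1 times L y makes composition with a linear map an instance of
    the bilinear rule, one factor being constant.\<close>
  have b: "bounded_bilinear (\<lambda>(r::real) y. r *\<^sub>R L y)"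
    by (rule bounded_bilinear.comp[OF bounded_bilinear_scaleR bounded_linear_ident assms(1)])
  show ?thesis using smooth_on_bilinear[OF b smooth_on_const[of 1] assms(2)] by simp
qed

lemma smooth_on_add: "smooth_on S f \<Longrightarrow> smooth_on S g \<Longrightarrow> smooth_on S (\<lambda>x. f x + g x)"
  by (simp add: smooth_on_def C_k_on_add[OF S])

lemma smooth_on_minus: "smooth_on S f \<Longrightarrow> smooth_on S (\<lambda>x. - f x)"
  using smooth_on_linear_compose[OF bounded_linear_minus[OF bounded_linear_ident]] .

lemma smooth_on_diff: "smooth_on S f \<Longrightarrow> smooth_on S g \<Longrightarrow> smooth_on S (\<lambda>x. f x - g x)"
  using smooth_on_add[OF _ smooth_on_minus, of f g] by simp

lemma smooth_on_mult:
  fixes f g :: "'a \<Rightarrow> 'b::real_normed_algebra"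
  shows "smooth_on S f \<Longrightarrow> smooth_on S g \<Longrightarrow> smooth_on S (\<lambda>x. f x * g x)"
  by (rule smooth_on_bilinear[OF bounded_bilinear_mult])

lemma smooth_on_scaleR:
  "smooth_on S f \<Longrightarrow> smooth_on S g \<Longrightarrow> smooth_on S (\<lambda>x. f x *\<^sub>R g x)"
  by (rule smooth_on_bilinear[OF bounded_bilinear_scaleR])

lemma smooth_on_inner:
  "smooth_on S f \<Longrightarrow> smooth_on S g \<Longrightarrow> smooth_on S (\<lambda>x. f x \<bullet> g x)"
  by (rule smooth_on_bilinear[OF bounded_bilinear_inner])

lemma smooth_on_sum:
  "(\<And>i. i \<in> I \<Longrightarrow> smooth_on S (f i)) \<Longrightarrow> smooth_on S (\<lambda>x. \<Sum>i\<in>I. f i x)"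
  by (simp add: smooth_on_def C_k_on_sum[OF S])

lemma smooth_on_prod:
  fixes f :: "'i \<Rightarrow> 'a \<Rightarrow> real"
  shows "(\<And>i. i \<in> I \<Longrightarrow> smooth_on S (f i)) \<Longrightarrow> smooth_on S (\<lambda>x. \<Prod>i\<in>I. f i x)"
  by (induction I rule: infinite_finite_induct) (simp_all add: smooth_on_mult smooth_on_const)

lemma smooth_on_divide:
  fixes f :: "'a \<Rightarrow> real"
  shows "smooth_on S f \<Longrightarrow> smooth_on S g \<Longrightarrow> (\<And>x. x \<in> S \<Longrightarrow> g x \<noteq> 0) \<Longrightarrow> smooth_on S (\<lambda>x. f x / g x)"
  unfolding divide_inverse
  by (rule smooth_on_mult) (simp_all add: smooth_on_def C_k_on_inverse[OF S])

lemma smooth_on_vec_nth: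
  fixes f :: "'a \<Rightarrow> 'b::real_normed_vector ^ 'n"
  shows "smooth_on S f \<Longrightarrow> smooth_on S (\<lambda>x. f x $ i)"
  by (rule smooth_on_linear_compose[OF bounded_linear_vec_nth])

lemma norm_axis': "norm (axis i x) = norm x" for x :: "'b::real_normed_vector"
proof -
  have "(norm (axis i x $ j))\<^sup>2 = (if j = i then (norm x)\<^sup>2 else 0)" for j
    by (simp add: axis_def)
  then show ?thesis by (simp add: norm_vec_def L2_set_def)
qed

lemma smooth_on_vec:
  fixes f :: "'a \<Rightarrow> 'b::real_normed_vector ^ 'n"
  assumes "\<And>i. smooth_on S (\<lambda>x. f x $ i)" shows "smooth_on S f"
proof -
  have b: "bounded_linear (axis i :: 'b \<Rightarrow> 'b ^ 'n)" for i
    by (rule bounded_linear_intro[where K=1]) (simp_all add: vec_eq_iff norm_axis', simp_all add: axis_def)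
  have "smooth_on S (\<lambda>x. \<Sum>i\<in>UNIV. axis i (f x $ i))"
    by (intro smooth_on_sum smooth_on_linear_compose[OF b] assms)
  moreover have "(\<Sum>i\<in>UNIV. axis i (f x $ i)) = f x" for x
    by (simp add: vec_eq_iff axis_def)
  ultimately show ?thesis by simp
qed

lemma dird_linear_dir:
  assumes "f differentiable_on S" "x \<in> S"
  shows "linear (\<lambda>v. dird S v f x)"
  using has_derivative_dird[OF assms] by (rule has_derivative_linear)

lemma dird_const: "x \<in> S \<Longrightarrow> dird S v (\<lambda>x. c) x = 0"
  by (rule dird_eqI[OF S]) auto

lemma dird_linear:
  assumes "bounded_linear f" "x \<in> S" shows "dird S v f x = f v"
  using assms by (intro dird_eqI[OF S]) (auto intro: bounded_linear_imp_has_derivative)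

lemma dird_linear_compose:
  assumes "bounded_linear L" "f differentiable_on S" "x \<in> S"
  shows "dird S v (\<lambda>x. L (f x)) x = L (dird S v f x)"
  by (rule dird_eqI[OF S assms(3)], rule bounded_linear.has_derivative[OF assms(1)],
      rule has_derivative_dird[OF assms(2,3)])

lemma dird_add:
  assumes "f differentiable_on S" "g differentiable_on S" "x \<in> S"
  shows "dird S v (\<lambda>x. f x + g x) x = dird S v f x + dird S v g x"
  by (rule dird_eqI[OF S assms(3)]) (intro has_derivative_add has_derivative_dird assms)

lemma dird_diff:
  assumes "f differentiable_on S" "g differentiable_on S" "x \<in> S"
  shows "dird S v (\<lambda>x. f x - g x) x = dird S v f x - dird S v g x"
  by (rule dird_eqI[OF S assms(3)]) (intro has_derivative_diff has_derivative_dird assms)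

lemma dird_bilinear:
  assumes "bounded_bilinear B" "f differentiable_on S" "g differentiable_on S" "x \<in> S"
  shows "dird S v (\<lambda>x. B (f x) (g x)) x = B (f x) (dird S v g x) + B (dird S v f x) (g x)"
  by (rule dird_eqI[OF S assms(4)], rule bounded_bilinear.FDERIV[OF assms(1)])
    (intro has_derivative_dird assms)+

lemma dird_sum:
  assumes "\<And>i. i \<in> I \<Longrightarrow> f i differentiable_on S" "x \<in> S"
  shows "dird S v (\<lambda>x. \<Sum>i\<in>I. f i x) x = (\<Sum>i\<in>I. dird S v (f i) x)"
  by (rule dird_eqI[OF S assms(2)]) (intro has_derivative_sum has_derivative_dird assms)

lemma dird_vec_nth:
  fixes f :: "'a \<Rightarrow> 'b::real_normed_vector ^ 'n"
  assumes "f differentiable_on S" "x \<in> S"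
  shows "dird S v (\<lambda>x. f x $ i) x = dird S v f x $ i"
  by (rule dird_linear_compose[OF bounded_linear_vec_nth assms])

end

lemma smooth_on_subset: "smooth_on S f \<Longrightarrow> udom S' \<Longrightarrow> S' \<subseteq> S \<Longrightarrow> smooth_on S' f"
  unfolding smooth_on_def using C_k_on_subset by blast

lemma smooth_on_compose:
  fixes f :: "'b::euclidean_space \<Rightarrow> 'c::real_normed_vector" and \<phi> :: "'a::euclidean_space \<Rightarrow> 'b"
  assumes "smooth_on T f" "smooth_on S \<phi>" "udom S" "udom T" "\<phi> ` S \<subseteq> T"
  shows "smooth_on S (\<lambda>x. f (\<phi> x))"
  using assms(1,2) by (simp add: smooth_on_def C_k_on_compose[OF assms(3-5)])

lemma dird_compose:
  fixes f :: "'b::euclidean_space \<Rightarrow> 'c::real_normed_vector" and \<phi> :: "'a::euclidean_space \<Rightarrow> 'b"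
  assumes "udom S" "f differentiable_on T" "\<phi> differentiable_on S" "\<phi> ` S \<subseteq> T" "x \<in> S"
  shows "dird S v (\<lambda>x. f (\<phi> x)) x = dird T (dird S v \<phi> x) f (\<phi> x)"
proof (rule dird_eqI[OF assms(1,5)])
  have f': "(f has_derivative (\<lambda>v. dird T v f (\<phi> x))) (at (\<phi> x) within T)"
    using assms by (auto intro: has_derivative_dird)
  show "((\<lambda>x. f (\<phi> x)) has_derivative (\<lambda>v. dird T (dird S v \<phi> x) f (\<phi> x))) (at x within S)"
    by (rule has_derivative_in_compose[OF has_derivative_dird[OF assms(3,5)]
         has_derivative_subset[OF f' assms(4)]])
qed

section \<open>Restriction to lines and symmetry of mixed second derivatives\<close>

lemma dird_line:
  fixes f :: "'a::euclidean_space \<Rightarrow> 'b::real_normed_vector"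
  assumes "f differentiable_on W" "open W" "x + s *\<^sub>R u \<in> W"
  shows "((\<lambda>s. f (x + s *\<^sub>R u)) has_vector_derivative dird W u f (x + s *\<^sub>R u)) (at s)"
proof -
  have l: "linear (\<lambda>v. dird W v f (x + s *\<^sub>R u))"
    by (rule dird_linear_dir[OF udom_open[OF assms(2)] assms(1,3)])
  have "((\<lambda>s. x + s *\<^sub>R u) has_derivative (\<lambda>r. r *\<^sub>R u)) (at s)"
    by (auto intro!: derivative_eq_intros)
  from has_derivative_compose[OF this has_derivative_dird_open[OF assms(1,3,2)]]
  show ?thesis unfolding has_vector_derivative_def linear_scale[OF l] .
qed

text \<open>Being symmetric in \<open>u\<close> and \<open>v\<close>, the second difference also equals \<open>h\<^sup>2\<close> times the other mixed
  derivative, which gives their equality in the limit.\<close>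

lemma second_difference_mvt:
  fixes f :: "'a::euclidean_space \<Rightarrow> real"
  assumes W: "open W" and f: "f differentiable_on W" "dird W u f differentiable_on W"
    and h: "h > 0" and sub: "\<And>s t. 0 \<le> s \<Longrightarrow> s \<le> h \<Longrightarrow> 0 \<le> t \<Longrightarrow> t \<le> h \<Longrightarrow> x + s *\<^sub>R u + t *\<^sub>R v \<in> W"
  obtains s t where "0 < s" "s < h" "0 < t" "t < h"
    "f (x + h *\<^sub>R u + h *\<^sub>R v) - f (x + h *\<^sub>R u) - f (x + h *\<^sub>R v) + f x
      = h\<^sup>2 * dird W v (dird W u f) (x + s *\<^sub>R u + t *\<^sub>R v)"
proof -
  have "\<exists>s>0. s < h \<and> (f (x + h *\<^sub>R v + h *\<^sub>R u) - f (x + h *\<^sub>R u)) - (f (x + h *\<^sub>R v + 0 *\<^sub>R u) - f (x + 0 *\<^sub>R u))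
     = (h - 0) * (dird W u f (x + h *\<^sub>R v + s *\<^sub>R u) - dird W u f (x + s *\<^sub>R u))"
  proof (rule MVT2[OF h])
    fix s assume s: "0 \<le> s" "s \<le> h"
    have "x + h *\<^sub>R v + s *\<^sub>R u \<in> W" "x + s *\<^sub>R u \<in> W"
      using sub[OF s, of h] sub[OF s, of 0] h by (simp_all add: algebra_simps)
    from this[THEN dird_line[OF f(1) W]]
    show "DERIV (\<lambda>s. f (x + h *\<^sub>R v + s *\<^sub>R u) - f (x + s *\<^sub>R u)) s :>
        dird W u f (x + h *\<^sub>R v + s *\<^sub>R u) - dird W u f (x + s *\<^sub>R u)"
      by (auto simp: has_real_derivative_iff_has_vector_derivative intro: has_vector_derivative_diff)
  qed
  then obtain s where s: "0 < s" "s < h" and e1: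
    "f (x + h *\<^sub>R u + h *\<^sub>R v) - f (x + h *\<^sub>R u) - f (x + h *\<^sub>R v) + f x
     = h * (dird W u f (x + h *\<^sub>R v + s *\<^sub>R u) - dird W u f (x + s *\<^sub>R u))"
    by (auto simp: algebra_simps)
  have "\<exists>t>0. t < h \<and> dird W u f ((x + s *\<^sub>R u) + h *\<^sub>R v) - dird W u f ((x + s *\<^sub>R u) + 0 *\<^sub>R v)
     = (h - 0) * dird W v (dird W u f) ((x + s *\<^sub>R u) + t *\<^sub>R v)"
  proof (rule MVT2[OF h])
    fix t assume t: "0 \<le> t" "t \<le> h"
    have "(x + s *\<^sub>R u) + t *\<^sub>R v \<in> W" using sub[of s t] t s by simp
    from this[THEN dird_line[OF f(2) W]]
    show "DERIV (\<lambda>t. dird W u f ((x + s *\<^sub>R u) + t *\<^sub>R v)) t :> dird W v (dird W u f) ((x + s *\<^sub>R u) + t *\<^sub>R v)"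
      by (simp add: has_real_derivative_iff_has_vector_derivative)
  qed
  then obtain t where "0 < t" "t < h" and e2:
    "dird W u f (x + h *\<^sub>R v + s *\<^sub>R u) - dird W u f (x + s *\<^sub>R u)
     = h * dird W v (dird W u f) (x + s *\<^sub>R u + t *\<^sub>R v)"
    by (auto simp: algebra_simps)
  then show ?thesis using that[of s t] s e1 by (simp add: power2_eq_square)
qed

lemma dird_commute_real:
  fixes f :: "'a::euclidean_space \<Rightarrow> real"
  assumes W: "open W" and f: "smooth_on W f" and x: "x \<in> W"
  shows "dird W u (dird W v f) x = dird W v (dird W u f) x"
proof (rule ccontr)
  let ?g1 = "dird W u (dird W v f)" and ?g2 = "dird W v (dird W u f)"
  assume "?g1 x \<noteq> ?g2 x"
  define e where "e = \<bar>?g1 x - ?g2 x\<bar> / 2"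
  have e: "e > 0" using \<open>?g1 x \<noteq> ?g2 x\<close> by (simp add: e_def)
  have c: "continuous_on W ?g1" "continuous_on W ?g2"
    by (intro smooth_on_imp_continuous_on smooth_on_dird f)+
  have d: "f differentiable_on W" "dird W u f differentiable_on W" "dird W v f differentiable_on W"
    by (intro smooth_on_imp_differentiable_on smooth_on_dird f)+
  obtain d1 where d1: "d1 > 0" "ball x d1 \<subseteq> W" using W x by (meson open_contains_ball)
  have "isCont ?g1 x" "isCont ?g2 x" using c W x by (simp_all add: continuous_on_eq_continuous_at)
  then obtain d2 d3 where d23: "d2 > 0" "d3 > 0"
    "\<And>y. dist y x < d2 \<Longrightarrow> dist (?g1 y) (?g1 x) < e" "\<And>y. dist y x < d3 \<Longrightarrow> dist (?g2 y) (?g2 x) < e"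
    using e unfolding continuous_at_eps_delta by (metis dist_norm)
  define d where "d = min d1 (min d2 d3)"
  have "d > 0" using d1 d23 by (simp add: d_def)
  \<comment> \<open>With this side length the whole parallelogram spanned by h u and h v stays in
    the ball of radius d; the summand 1 covers u = v = 0.\<close>
  define h where "h = d / (norm u + norm v + 1)"
  have np: "norm u + norm v + 1 > 0" by (smt (verit) norm_ge_zero)
  then have h: "h > 0" using \<open>d > 0\<close> by (simp add: h_def)
  have hd: "h * (norm u + norm v) < d"
    using np \<open>d > 0\<close> by (simp add: h_def field_simps)
  have near: "dist (x + s *\<^sub>R u + t *\<^sub>R v) x < d" if "0 \<le> s" "s \<le> h" "0 \<le> t" "t \<le> h" for s t
  proof -
    have "dist (x + s *\<^sub>R u + t *\<^sub>R v) x = norm (s *\<^sub>R u + t *\<^sub>R v)" by (simp add: dist_norm)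
    also have "\<dots> \<le> s * norm u + t * norm v"
      using norm_triangle_ineq[of "s *\<^sub>R u" "t *\<^sub>R v"] that by simp
    also have "\<dots> \<le> h * norm u + h * norm v" using that by (intro add_mono mult_right_mono) auto
    finally show ?thesis using hd by (simp add: algebra_simps)
  qed
  have sub: "x + s *\<^sub>R u + t *\<^sub>R v \<in> W" if "0 \<le> s" "s \<le> h" "0 \<le> t" "t \<le> h" for s t
  proof -
    have "x + s *\<^sub>R u + t *\<^sub>R v \<in> ball x d1"
      using near[OF that] by (simp add: d_def dist_commute)
    then show ?thesis using d1(2) by blast
  qed
  obtain s t where st: "0 < s" "s < h" "0 < t" "t < h"
    "f (x + h *\<^sub>R u + h *\<^sub>R v) - f (x + h *\<^sub>R u) - f (x + h *\<^sub>R v) + f x = h\<^sup>2 * ?g2 (x + s *\<^sub>R u + t *\<^sub>R v)"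
    by (rule second_difference_mvt[OF W d(1,2) h, of x v]) (use sub in auto)
  have sub': "x + s *\<^sub>R v + t *\<^sub>R u \<in> W" if "0 \<le> s" "s \<le> h" "0 \<le> t" "t \<le> h" for s t
    using sub[of t s] that by (simp add: algebra_simps)
  obtain s' t' where st': "0 < s'" "s' < h" "0 < t'" "t' < h"
    "f (x + h *\<^sub>R v + h *\<^sub>R u) - f (x + h *\<^sub>R v) - f (x + h *\<^sub>R u) + f x = h\<^sup>2 * ?g1 (x + s' *\<^sub>R v + t' *\<^sub>R u)"
    by (rule second_difference_mvt[OF W d(1,3) h, of x u]) (use sub' in auto)
  have eq: "?g2 (x + s *\<^sub>R u + t *\<^sub>R v) = ?g1 (x + t' *\<^sub>R u + s' *\<^sub>R v)"
  proof -
    have "h\<^sup>2 * ?g2 (x + s *\<^sub>R u + t *\<^sub>R v) = h\<^sup>2 * ?g1 (x + s' *\<^sub>R v + t' *\<^sub>R u)"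
    proof -
      have "x + h *\<^sub>R v + h *\<^sub>R u = x + h *\<^sub>R u + h *\<^sub>R v" by (simp add: algebra_simps)
      from st(5) st'(5)[unfolded this] show ?thesis by linarith
    qed
    moreover have "x + s' *\<^sub>R v + t' *\<^sub>R u = x + t' *\<^sub>R u + s' *\<^sub>R v" by (simp add: add.assoc add.commute)
    ultimately show ?thesis using h by simp
  qed
  have "\<bar>?g2 (x + s *\<^sub>R u + t *\<^sub>R v) - ?g2 x\<bar> < e"
    using d23(4)[of "x + s *\<^sub>R u + t *\<^sub>R v"] near[of s t] st by (simp add: d_def dist_real_def)
  moreover have "\<bar>?g1 (x + t' *\<^sub>R u + s' *\<^sub>R v) - ?g1 x\<bar> < e"
    using d23(3)[of "x + t' *\<^sub>R u + s' *\<^sub>R v"] near[of t' s'] st' by (simp add: d_def dist_real_def)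
  ultimately show False unfolding eq e_def by (simp add: abs_if split: if_splits)
qed

lemma dird_commute:
  fixes f :: "'a::euclidean_space \<Rightarrow> 'b::euclidean_space"
  assumes W: "open W" and f: "smooth_on W f" and x: "x \<in> W"
  shows "dird W u (dird W v f) x = dird W v (dird W u f) x"
proof (rule euclidean_eqI)
  fix b :: 'b assume "b \<in> Basis"
  note U = udom_open[OF W]
  have b: "bounded_linear (\<lambda>y. y \<bullet> b)" by (rule bounded_linear_inner_left)
  have e: "dird W u (dird W v f) x \<bullet> b = dird W u (dird W v (\<lambda>x. f x \<bullet> b)) x" for u v
  proof -
    have "dird W u (dird W v (\<lambda>x. f x \<bullet> b)) x = dird W u (\<lambda>x. dird W v f x \<bullet> b) x"
      by (rule dird_cong[OF dird_linear_compose[OF U b] x])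
        (use smooth_on_imp_differentiable_on[OF f] in auto)
    also have "\<dots> = dird W u (dird W v f) x \<bullet> b"
      by (rule dird_linear_compose[OF U b smooth_on_imp_differentiable_on[OF smooth_on_dird[OF f]] x])
    finally show ?thesis ..
  qed
  have "smooth_on W (\<lambda>x. f x \<bullet> b)" by (rule smooth_on_linear_compose[OF U b f])
  from dird_commute_real[OF W this x] show "dird W u (dird W v f) x \<bullet> b = dird W v (dird W u f) x \<bullet> b"
    unfolding e .
qed

section \<open>Levi-Civita connection and curvature in matrix form\<close>

lemma bounded_bilinear_matrix_mult:
  "bounded_bilinear ((**) :: real^'n^'m \<Rightarrow> real^'p^'n \<Rightarrow> real^'p^'m)"
  unfolding bilinear_conv_bounded_bilinear[symmetric] bilinear_def
  by (auto intro!: linearI simp: vec_eq_iff matrix_matrix_mult_def algebra_simps sum.distrib sum_distrib_left)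

lemma bounded_linear_transpose: "bounded_linear (transpose :: real^'n^'m \<Rightarrow> real^'m^'n)"
  unfolding linear_conv_bounded_linear[symmetric]
  by (auto intro!: linearI simp: vec_eq_iff transpose_def)

lemma mat_add_rdistrib: "(B + C) ** A = B ** A + C ** (A :: 'a::comm_ring_1^'n^'m)"
  by (simp add: vec_eq_iff matrix_matrix_mult_def algebra_simps sum.distrib)

lemma mat_diff_rdistrib: "(B - C) ** A = B ** A - C ** (A :: 'a::comm_ring_1^'n^'m)"
  by (simp add: vec_eq_iff matrix_matrix_mult_def algebra_simps sum_subtractf)

lemma mat_diff_ldistrib: "A ** (B - C) = A ** B - A ** (C :: 'a::comm_ring_1^'n^'m)"
  by (simp add: vec_eq_iff matrix_matrix_mult_def algebra_simps sum_subtractf)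

lemma mat_scaleR: "(r *\<^sub>R A) ** B = r *\<^sub>R (A ** B)" "A ** (r *\<^sub>R B) = r *\<^sub>R (A ** (B :: real^'n^'m))"
  by (simp_all add: vec_eq_iff matrix_matrix_mult_def sum_distrib_left mult_ac)

lemma mat_minus: "(- A) ** B = - (A ** B)" "A ** (- B) = - (A ** (B :: real^'n^'m))"
  by (simp_all add: vec_eq_iff matrix_matrix_mult_def sum_negf)

lemma mat_zero: "0 ** A = 0" "A ** 0 = (0 :: real^'n^'m)"
  by (simp_all add: vec_eq_iff matrix_matrix_mult_def)

lemma mat_sum: "(\<Sum>i\<in>I. f i) ** A = (\<Sum>i\<in>I. f i ** A)" "A ** (\<Sum>i\<in>I. f i) = (\<Sum>i\<in>I. A ** (f i :: real^'n^'m))"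
  by (induction I rule: infinite_finite_induct) (simp_all add: mat_zero mat_add_rdistrib matrix_add_ldistrib)

lemma transpose_add: "transpose (A + B) = transpose A + transpose (B :: real^'n^'m)"
  and transpose_diff: "transpose (A - B) = transpose A - transpose (B :: real^'n^'m)"
  and transpose_zero: "transpose (0 :: real^'n^'m) = 0"
  and transpose_uminus: "transpose (- A) = - transpose (A :: real^'n^'m)"
  by (simp_all add: vec_eq_iff transpose_def)

lemma transpose_sum: "transpose (\<Sum>i\<in>I. f i) = (\<Sum>i\<in>I. transpose (f i :: real^'n^'m))"
  by (induction I rule: infinite_finite_induct) (simp_all add: transpose_zero transpose_add)

lemmas mat_ring = matrix_add_ldistrib mat_add_rdistrib mat_diff_rdistrib mat_diff_ldistrib mat_scaleR
  mat_minus mat_zero transpose_add transpose_diff transpose_zero transpose_uminus matrix_transpose_mul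
  transpose_scalar matrix_mul_assoc

lemma matrix_inv_works:
  fixes A :: "real^'n^'n"
  assumes "invertible A" shows "A ** matrix_inv A = mat 1" "matrix_inv A ** A = mat 1"
  using someI_ex[OF assms[unfolded invertible_def]] unfolding matrix_inv_def by auto

lemma matrix_inv_eqI:
  fixes A :: "real^'n^'n"
  assumes "A ** B = mat 1" shows "matrix_inv A = B"
proof -
  have i: "invertible A" using assms by (metis invertible_def matrix_left_right_inverse)
  have "matrix_inv A = matrix_inv A ** (A ** B)" by (simp add: assms)
  then show ?thesis by (simp add: matrix_mul_assoc matrix_inv_works(2)[OF i])
qed

text \<open>Cramer's rule makes the entries of the inverse quotients of polynomials in the entries
  of A, from which the smoothness of the inverse metric is read off.\<close>

lemma matrix_inv_cramer:
  fixes A :: "real^'n^'n"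
  assumes "invertible A"
  shows "matrix_inv A $ k $ j = det (\<chi> r c. if c = k then (if r = j then 1 else 0) else A $ r $ c) / det A"
proof -
  have "A *v (matrix_inv A *v axis j 1) = axis j 1"
    by (simp add: matrix_vector_mul_assoc matrix_inv_works[OF assms])
  then have "matrix_inv A *v axis j 1 = (\<chi> k. det (\<chi> r c. if c = k then (axis j 1 :: real^'n) $ r else A $ r $ c) / det A)"
    using cramer[of A] assms invertible_det_nz by blast
  moreover have "(matrix_inv A *v axis j 1) $ k = matrix_inv A $ k $ j"
    by (simp add: matrix_vector_mult_def axis_def if_distrib cong: if_cong)
  ultimately show ?thesis by (simp add: axis_def eq_commute cong: if_cong)
qed

lemma smooth_on_det:
  fixes h :: "'a::euclidean_space \<Rightarrow> real^'n^'n"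
  assumes "udom S" "\<And>i j. smooth_on S (\<lambda>x. h x $ i $ j)"
  shows "smooth_on S (\<lambda>x. det (h x))"
  unfolding det_def
  by (intro smooth_on_sum smooth_on_mult smooth_on_const smooth_on_prod assms)

lemma smooth_on_matrix_inv:
  fixes h :: "'a::euclidean_space \<Rightarrow> real^'n^'n"
  assumes S: "udom S" and h: "smooth_on S h" and i: "\<And>x. x \<in> S \<Longrightarrow> invertible (h x)"
  shows "smooth_on S (\<lambda>x. matrix_inv (h x))"
proof (intro smooth_on_vec S)
  fix k j
  have hc: "smooth_on S (\<lambda>x. h x $ i $ j)" for i j
    by (intro smooth_on_vec_nth S h)
  have "smooth_on S (\<lambda>x. det (\<chi> r c. if c = k then (if r = j then 1 else 0) else h x $ r $ c) / det (h x))"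
  proof (intro smooth_on_divide smooth_on_det S)
    show "smooth_on S (\<lambda>x. (\<chi> r c. if c = k then (if r = j then 1 else 0) else h x $ r $ c) $ i $ l)" for i l
      by (cases "l = k") (simp_all add: hc smooth_on_const[OF S])
  qed (use hc i invertible_det_nz in auto)
  then show "smooth_on S (\<lambda>x. matrix_inv (h x) $ k $ j)"
    by (subst smooth_on_cong[where g="\<lambda>x. det (\<chi> r c. if c = k then (if r = j then 1 else 0) else h x $ r $ c) / det (h x)"])
      (auto simp: matrix_inv_cramer i)
qed

text \<open>\<open>d i\<close> is the \<open>i\<close>-th coordinate direction, which on \<open>I \<times> V\<close> is a spatial one. The matrix
  \<open>G i\<close> has the entries \<open>\<Gamma>\<^sup>a\<^sub>i\<^sub>b\<close>, so that the curvature becomes \<open>\<partial>\<^sub>i G\<^sub>j - \<partial>\<^sub>j G\<^sub>i + [G\<^sub>i, G\<^sub>j]\<close>.\<close>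

definition christoffel_matrix :: "'a::euclidean_space set \<Rightarrow> ('n \<Rightarrow> 'a) \<Rightarrow> ('a \<Rightarrow> real^'n^'n) \<Rightarrow> 'n \<Rightarrow> 'a \<Rightarrow> real^'n^'n" where
  "christoffel_matrix S d h = (\<lambda>i z. matrix_inv (h z) ** (\<chi> a b. (dird S (d i) h z $ b $ a + dird S (d b) h z $ i $ a
      - dird S (d a) h z $ i $ b) / 2))"

definition curvature_matrix :: "'a::euclidean_space set \<Rightarrow> ('n \<Rightarrow> 'a) \<Rightarrow> ('n \<Rightarrow> 'a \<Rightarrow> real^'n^'n) \<Rightarrow> 'n \<Rightarrow> 'n \<Rightarrow> 'a \<Rightarrow>
    real^'n^'n" where
  "curvature_matrix S d G = (\<lambda>i j z. dird S (d i) (G j) z - dird S (d j) (G i) z + G i z ** G j z - G j z ** G i z)"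

lemma smooth_on_matmul:
  fixes f :: "'a::euclidean_space \<Rightarrow> real^'n^'m" and g :: "'a \<Rightarrow> real^'p^'n"
  shows "udom S \<Longrightarrow> smooth_on S f \<Longrightarrow> smooth_on S g \<Longrightarrow> smooth_on S (\<lambda>x. f x ** g x)"
  by (rule smooth_on_bilinear[OF _ bounded_bilinear_matrix_mult])

lemma smooth_on_transpose:
  fixes f :: "'a::euclidean_space \<Rightarrow> real^'n^'m"
  shows "udom S \<Longrightarrow> smooth_on S f \<Longrightarrow> smooth_on S (\<lambda>x. transpose (f x))"
  by (rule smooth_on_linear_compose[OF _ bounded_linear_transpose])

lemma dird_matmul:
  fixes f :: "'a::euclidean_space \<Rightarrow> real^'n^'m" and g :: "'a \<Rightarrow> real^'p^'n"
  assumes "udom S" "smooth_on S f" "smooth_on S g" "x \<in> S"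
  shows "dird S v (\<lambda>x. f x ** g x) x = f x ** dird S v g x + dird S v f x ** g x"
  by (rule dird_bilinear[OF assms(1) bounded_bilinear_matrix_mult])
    (use assms in \<open>auto intro: smooth_on_imp_differentiable_on\<close>)

lemma dird_transpose:
  fixes f :: "'a::euclidean_space \<Rightarrow> real^'n^'m"
  assumes "udom S" "smooth_on S f" "x \<in> S"
  shows "dird S v (\<lambda>x. transpose (f x)) x = transpose (dird S v f x)"
  by (rule dird_linear_compose[OF assms(1) bounded_linear_transpose])
    (use assms in \<open>auto intro: smooth_on_imp_differentiable_on\<close>)

lemma smooth_on_christoffel_matrix:
  fixes h :: "'a::euclidean_space \<Rightarrow> real^'n^'n"
  assumes S: "udom S" and h: "smooth_on S h" and i: "\<And>x. x \<in> S \<Longrightarrow> invertible (h x)"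
  shows "smooth_on S (christoffel_matrix S d h i)"
proof -
  have hc: "smooth_on S (\<lambda>x. dird S v h x $ i $ j)" for i j v
    by (intro smooth_on_vec_nth S smooth_on_dird h)
  have "smooth_on S (\<lambda>z. (\<chi> a b. (dird S (d i) h z $ b $ a + dird S (d b) h z $ i $ a
      - dird S (d a) h z $ i $ b) / 2) :: real^'n^'n)"
    by (intro smooth_on_vec S, unfold vec_lambda_beta)
      (intro S hc smooth_on_divide smooth_on_add smooth_on_diff smooth_on_const, simp)
  then show ?thesis unfolding christoffel_matrix_def
    by (intro smooth_on_matmul S smooth_on_matrix_inv h i)
qed

lemma smooth_on_curvature_matrix:
  assumes S: "udom S" and h: "\<And>i. smooth_on S (G i)"
  shows "smooth_on S (curvature_matrix S d G i j)"
  unfolding curvature_matrix_def by (intro S smooth_on_diff smooth_on_add smooth_on_matmul smooth_on_dird h)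

lemma transpose_nth: "transpose A $ i $ j = A $ j $ i"
  by (simp add: transpose_def)

lemma symmetric_dird:
  fixes h :: "'a::euclidean_space \<Rightarrow> real^'n^'n"
  assumes S: "udom S" and h: "smooth_on S h" and s: "\<And>x. x \<in> S \<Longrightarrow> transpose (h x) = h x" and x: "x \<in> S"
  shows "dird S v h x $ a $ b = dird S v h x $ b $ a"
proof -
  have "dird S v h x = dird S v (\<lambda>x. transpose (h x)) x"
    by (rule dird_cong[OF _ x]) (simp add: s)
  then show ?thesis using dird_transpose[OF S h x] by (metis transpose_nth)
qed

lemma christoffel_matrix_symmetric:
  assumes S: "udom S" and h: "smooth_on S h" and s: "\<And>x. x \<in> S \<Longrightarrow> transpose (h x) = h x" and x: "x \<in> S"
  shows "christoffel_matrix S d h i x $ a $ b = christoffel_matrix S d h b x $ a $ i"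
proof -
  have "dird S (d i) h x $ b $ c + dird S (d b) h x $ i $ c - dird S (d c) h x $ i $ b
      = dird S (d b) h x $ i $ c + dird S (d i) h x $ b $ c - dird S (d c) h x $ b $ i" for c
    using symmetric_dird[OF S h s x, of "d c"] by simp
  then show ?thesis by (simp add: christoffel_matrix_def matrix_matrix_mult_def add.commute)
qed

text \<open>Multiplication by h leaves the symbols of the first kind. Their sum of three derivatives
  consists of one term symmetric in a and b and of a difference antisymmetric in them, which cancels
  against the transpose.\<close>

lemma christoffel_matrix_compatible:
  fixes h :: "'a::euclidean_space \<Rightarrow> real^'n^'n"
  assumes S: "udom S" and h: "smooth_on S h" and s: "\<And>x. x \<in> S \<Longrightarrow> transpose (h x) = h x"
    and i: "\<And>x. x \<in> S \<Longrightarrow> invertible (h x)" and x: "x \<in> S"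
  shows "dird S (d i) h x = transpose (christoffel_matrix S d h i x) ** h x + h x ** christoffel_matrix S d h i x"
proof -
  have K: "h x ** christoffel_matrix S d h i x = (\<chi> a b. (dird S (d i) h x $ b $ a + dird S (d b) h x $ i $ a
      - dird S (d a) h x $ i $ b) / 2)" (is "_ = ?K")
    by (simp add: christoffel_matrix_def matrix_mul_assoc matrix_inv_works[OF i[OF x]])
  have "transpose (christoffel_matrix S d h i x) ** h x = transpose ?K"
    unfolding K[symmetric] by (simp add: matrix_transpose_mul s x)
  then show ?thesis unfolding K
    using symmetric_dird[OF S h s x] by (simp only:) (simp add: vec_eq_iff transpose_nth field_simps)
qed

text \<open>The lowered difference K of two such connections is antisymmetric in a, b and symmetric
  in i, b; applying the two symmetries alternately returns K with the opposite sign. This replaces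
  index computations both in the transformation law and at the centre of normal coordinates.\<close>

lemma levi_civita_unique:
  fixes h :: "real^'n^'n"
  assumes s: "transpose h = h" and i: "invertible h"
    and G: "\<And>i a b. G i $ a $ b = G b $ a $ i" and H: "\<And>i a b. H i $ a $ b = H b $ a $ i"
    and e: "\<And>i. transpose (G i) ** h + h ** G i = transpose (H i) ** h + h ** H i"
  shows "G i = H i"
proof -
  define K where "K i = h ** (G i - H i)" for i
  have 1: "K i $ a $ b = - K i $ b $ a" for i a b
  proof -
    have "transpose (K i) + K i = 0"
      using e[of i] by (simp add: K_def mat_ring s algebra_simps)
    then have "(transpose (K i) + K i) $ a $ b = 0" by simp
    then show ?thesis by (simp add: transpose_nth)
  qed
  have 2: "K i $ a $ b = K b $ a $ i" for i a b
    by (simp add: K_def matrix_matrix_mult_def G[of i] H[of i])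
  have "K i $ a $ b = 0" for a b
    using 1[of i a b] 2[of i a b] 1[of b a i] 2[of b i a] 1[of a b i] 2[of a b i] 1[of a i b] 2[of i b a] by linarith
  then have "K i = 0" by (simp add: vec_eq_iff)
  then have "matrix_inv h ** K i = 0" by (simp add: mat_zero)
  then show ?thesis by (simp add: K_def matrix_mul_assoc matrix_inv_works[OF i])
qed

lemma frechet_eq_dird:
  "open V \<Longrightarrow> x \<in> V \<Longrightarrow> frechet_derivative f (at x) v = dird V v f x"
  unfolding dird_def by (metis at_within_open)

text \<open>The link between \<open>partial\<close>, which differentiates at a frozen time, and the
  spatial directions of a space-time slab.\<close>

lemma dird_slice:
  fixes f :: "real \<times> (real^'n) \<Rightarrow> real"
  assumes "f differentiable_on I \<times> V" "open V" "(t, x) \<in> I \<times> V"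
  shows "partial i (\<lambda>y. f (t, y)) x = dird (I \<times> V) (0, axis i 1) f (t, x)"
proof -
  have x: "x \<in> V" using assms by simp
  have 1: "((\<lambda>y. (t, y)) has_derivative (\<lambda>v. (0, v))) (at x within V)"
    by (auto intro!: derivative_eq_intros)
  have 2: "(f has_derivative (\<lambda>v. dird (I \<times> V) v f (t, x))) (at (t, x) within (\<lambda>y. (t, y)) ` V)"
    by (rule has_derivative_subset[OF has_derivative_dird[OF assms(1,3)]]) (use assms in auto)
  have "((\<lambda>y. f (t, y)) has_derivative (\<lambda>v. dird (I \<times> V) (0, v) f (t, x))) (at x within V)"
    by (rule has_derivative_in_compose[OF 1 2])
  from dird_eqI[OF udom_open[OF assms(2)] x this]
  show ?thesis unfolding partial_def frechet_eq_dird[OF assms(2) x] .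
qed

lemma partial_cong:
  assumes "open V" "x \<in> V" "\<And>y. y \<in> V \<Longrightarrow> f y = g y"
  shows "partial i f x = partial i g x"
  unfolding partial_def frechet_eq_dird[OF assms(1,2)] by (rule dird_cong[OF assms(3,2)])

abbreviation sp :: "'n::finite \<Rightarrow> real \<times> (real^'n)" where "sp i \<equiv> (0, axis i 1)"

section \<open>Coordinate curvature on a slab of times and points\<close>

context
  fixes I :: "real set" and V :: "(real^'n::finite) set" and h :: "real \<times> (real^'n) \<Rightarrow> real^'n^'n"
  assumes I: "udom I" and V: "open V" and h: "smooth_on (I \<times> V) h"
    and s: "\<And>z. z \<in> I \<times> V \<Longrightarrow> transpose (h z) = h z"
    and inv: "\<And>z. z \<in> I \<times> V \<Longrightarrow> invertible (h z)"
begin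

lemma udom_slab: "udom (I \<times> V)" by (intro udom_Times I udom_open V)

lemma partial_slab:
  assumes "(t, x) \<in> I \<times> V" "smooth_on (I \<times> V) f"
  shows "partial i (\<lambda>y. f (t, y) $ a $ b) x = dird (I \<times> V) (sp i) f (t, x) $ a $ b"
proof -
  note U = udom_slab
  have d: "f differentiable_on I \<times> V" "(\<lambda>z. f z $ a) differentiable_on I \<times> V"
    "(\<lambda>z. f z $ a $ b) differentiable_on I \<times> V"
    using assms(2) by (auto intro!: smooth_on_imp_differentiable_on smooth_on_vec_nth U)
  show ?thesis
    by (subst dird_slice[OF d(3) V assms(1)])
      (simp add: dird_vec_nth[OF U d(2) assms(1)] dird_vec_nth[OF U d(1) assms(1)])
qed

lemma christoffel_slab:
  assumes z: "(t, x) \<in> I \<times> V"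
  shows "christoffel (\<lambda>y. h (t, y)) a i b x = christoffel_matrix (I \<times> V) sp h i (t, x) $ a $ b"
proof -
  note p = partial_slab[OF z h]
  show ?thesis
    unfolding christoffel_def p
    using symmetric_dird[OF udom_slab h s z]
    by (simp add: christoffel_matrix_def matrix_matrix_mult_def sum_distrib_left)
qed

lemma riemann_slab:
  assumes z: "(t, x) \<in> I \<times> V"
  shows "riemann (\<lambda>y. h (t, y)) x $ i $ j = h (t, x) ** curvature_matrix (I \<times> V) sp
      (christoffel_matrix (I \<times> V) sp h) i j (t, x)"
proof -
  have x: "x \<in> V" and zy: "\<And>y. y \<in> V \<Longrightarrow> (t, y) \<in> I \<times> V" using z by auto
  have "partial i (christoffel (\<lambda>y. h (t, y)) a j b) x
      = dird (I \<times> V) (sp i) (christoffel_matrix (I \<times> V) sp h j) (t, x) $ a $ b" for i j a b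
    by (subst partial_cong[OF V x christoffel_slab[OF zy]], assumption)
      (rule partial_slab[OF z smooth_on_christoffel_matrix[OF udom_slab h inv]])
  then have "riemann_up (\<lambda>y. h (t, y)) i j k l x = curvature_matrix (I \<times> V) sp (christoffel_matrix (I \<times> V) sp h) i
      j (t, x) $ l $ k" for k l
    by (simp add: riemann_up_def curvature_matrix_def christoffel_slab[OF z] matrix_matrix_mult_def sum_subtractf
        algebra_simps)
  then show ?thesis
    by (simp add: vec_eq_iff riemann_def matrix_matrix_mult_def)
qed

text \<open>Antisymmetry in the first pair is built into the formula, the Bianchi identity comes
  from the symmetry of the Christoffel symbols, and antisymmetry in the last pair from commuting
  second derivatives of h. The last point is why the time interval is open here.\<close>

lemma riemann_symmetries:
  assumes z: "(t, x) \<in> I \<times> V" and oI: "open I"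
  shows "riemann (\<lambda>y. h (t, y)) x \<in> curvature_tensors"
proof -
  let ?S = "I \<times> V" and ?z = "(t, x)"
  let ?G = "christoffel_matrix ?S sp h"
  let ?F = "\<lambda>i j. curvature_matrix ?S sp ?G i j ?z"
  note U = udom_slab and W = open_Times[OF oI V]
  have sG: "smooth_on ?S (?G i)" for i by (rule smooth_on_christoffel_matrix[OF U h inv])
  define R where "R = riemann (\<lambda>y. h (t, y)) x"
  have R: "R $ i $ j = h ?z ** ?F i j" for i j unfolding R_def by (rule riemann_slab[OF z])
  have 1: "?F i j = - ?F j i" for i j by (simp add: curvature_matrix_def)
  have dsym: "dird ?S (sp i) (?G j) ?z $ a $ b = dird ?S (sp i) (?G b) ?z $ a $ j" for i j a b
  proof -
    have d: "?G i differentiable_on ?S" "(\<lambda>z. ?G i z $ a) differentiable_on ?S" for i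
      by (auto intro!: smooth_on_imp_differentiable_on smooth_on_vec_nth U sG)
    have "dird ?S (sp i) (\<lambda>z. ?G j z $ a $ b) ?z = dird ?S (sp i) (\<lambda>z. ?G b z $ a $ j) ?z"
      by (rule dird_cong[OF _ z]) (rule christoffel_matrix_symmetric[OF U h s])
    then show ?thesis
      by (simp add: dird_vec_nth[OF U d(2) z] dird_vec_nth[OF U d(1) z])
  qed
  have GGsym: "(?G i ?z ** ?G j ?z) $ a $ b = (?G i ?z ** ?G b ?z) $ a $ j" for i j a b
    by (simp add: matrix_matrix_mult_def christoffel_matrix_symmetric[OF U h s z, of sp j])
  have F2: "?F i j $ a $ b + ?F j b $ a $ i + ?F b i $ a $ j = 0" for i j a b
    using dsym[of i j a b] dsym[of j b a i] dsym[of b i a j] GGsym[of i j a b] GGsym[of j b a i] GGsym[of b i a j]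
    by (simp add: curvature_matrix_def)
  have 2: "R $ i $ j $ k $ l + R $ j $ l $ k $ i + R $ l $ i $ k $ j = 0" for i j k l
  proof -
    have "R $ i $ j $ k $ l + R $ j $ l $ k $ i + R $ l $ i $ k $ j
      = (\<Sum>a\<in>UNIV. h ?z $ k $ a * (?F i j $ a $ l + ?F j l $ a $ i + ?F l i $ a $ j))"
      by (simp add: R matrix_matrix_mult_def sum.distrib algebra_simps)
    then show ?thesis by (simp add: F2)
  qed
  have compat: "dird ?S (sp i) h y = transpose (?G i y) ** h y + h y ** ?G i y" if "y \<in> ?S" for i y
    by (rule christoffel_matrix_compatible[OF U h s inv that])
  have dd: "dird ?S (sp j) (dird ?S (sp i) h) ?z
      = transpose (?G i ?z) ** dird ?S (sp j) h ?z + transpose (dird ?S (sp j) (?G i) ?z) ** h ?z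
       + (h ?z ** dird ?S (sp j) (?G i) ?z + dird ?S (sp j) h ?z ** ?G i ?z)" for i j
    apply (subst dird_cong[OF compat z], assumption)
    apply (subst dird_add[OF U _ _ z])
    apply (intro smooth_on_imp_differentiable_on smooth_on_matmul smooth_on_transpose U sG h)+
    apply (simp only: dird_matmul[OF U smooth_on_transpose[OF U sG] h z] dird_matmul[OF U h sG z]
        dird_transpose[OF U sG z])
    done
  \<comment> \<open>Both orders of differentiating h twice are expanded by metric compatibility;
    their difference is \<open>R $ i $ j\<close> plus its transpose.\<close>
  have 3: "transpose (R $ i $ j) = - R $ i $ j" for i j
  proof -
    have "dird ?S (sp j) (dird ?S (sp i) h) ?z = dird ?S (sp i) (dird ?S (sp j) h) ?z"
      by (rule dird_commute[OF W h z])
    then show ?thesis unfolding dd unfolding compat[OF z]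
      by (simp add: R curvature_matrix_def mat_ring s[OF z] algebra_simps)
  qed
  have a1: "R $ i $ j $ k $ l = - R $ j $ i $ k $ l" for i j k l
    using 1[of i j] by (simp add: R mat_ring)
  have a2: "R $ i $ j $ k $ l = - R $ i $ j $ l $ k" for i j k l
  proof -
    have "transpose (R $ i $ j) $ k $ l = (- R $ i $ j) $ k $ l" by (simp only: 3)
    then show ?thesis by (simp add: transpose_nth)
  qed
  have b: "R $ i $ j $ k $ l + R $ j $ k $ i $ l + R $ k $ i $ j $ l = 0"  for i j k l
    using 2[of i j l k] a2[of i j l k] a2[of j k l i] a2[of k i l j] by linarith
  have p: "R $ i $ j $ k $ l = R $ k $ l $ i $ j" for i j k l
    using b[of i j k l] b[of j k l i] b[of k l i j] b[of l i j k]
      a1[of i j k l] a2[of i j k l] a1[of k l i j] a2[of k l i j] a1[of j k i l] a2[of j k i l]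
      a1[of k i j l] a2[of k i j l] a1[of l j k i] a2[of l j k i] a1[of k l j i] a2[of k l j i]
      a1[of j k l i] a2[of j k l i] a1[of l i k j] a2[of l i k j] a1[of i k l j] a2[of i k l j]
      a1[of i l k j] a2[of i l k j] a1[of j l i k] a2[of j l i k] a1[of i j l k] a2[of i j l k]
      a1[of l i j k] a2[of l i j k] a1[of i k j l] a2[of i k j l] a1[of l j i k] a2[of l j i k] by linarith
  show ?thesis unfolding R_def[symmetric] curvature_tensors_def using a1 a2 p b by blast
qed

end

section \<open>Change of coordinates\<close>

text \<open>\<open>d\<close> and \<open>d'\<close> need not span their spaces: in the applications
  they are the spatial directions of slabs and \<psi> preserves time. \<open>Jsym\<close> expresses
  that J consists of first derivatives of a map.\<close>

context
  fixes S :: "'a::euclidean_space set" and T :: "'b::euclidean_space set"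
    and d :: "'n::finite \<Rightarrow> 'a" and d' :: "'n \<Rightarrow> 'b" and h :: "'b \<Rightarrow> real^'n^'n" and h' :: "'a \<Rightarrow> real^'n^'n"
    and \<psi> :: "'a \<Rightarrow> 'b" and J :: "'a \<Rightarrow> real^'n^'n"
  assumes S: "open S" and T: "open T" and h: "smooth_on T h"
    and s: "\<And>z. z \<in> T \<Longrightarrow> transpose (h z) = h z" and inv: "\<And>z. z \<in> T \<Longrightarrow> invertible (h z)"
    and \<psi>: "smooth_on S \<psi>" "\<psi> ` S \<subseteq> T" and J: "smooth_on S J"
    and d\<psi>: "\<And>i z. z \<in> S \<Longrightarrow> dird S (d i) \<psi> z = (\<Sum>a\<in>UNIV. J z $ a $ i *\<^sub>R d' a)"
    and Jsym: "\<And>i j a z. z \<in> S \<Longrightarrow> dird S (d i) J z $ a $ j = dird S (d j) J z $ a $ i"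
    and Jinv: "\<And>z. z \<in> S \<Longrightarrow> invertible (J z)"
    and h': "\<And>z. z \<in> S \<Longrightarrow> h' z = transpose (J z) ** h (\<psi> z) ** J z"
begin

text \<open>The pullback of the connection form: only the form index is contracted with J, the two
  matrix indices still refer to the target.\<close>

abbreviation "Gh i z \<equiv> (\<Sum>a\<in>UNIV. J z $ a $ i *\<^sub>R christoffel_matrix T d' h a (\<psi> z))"

lemma dird_pull:
  fixes f :: "'b \<Rightarrow> 'c::real_normed_vector"
  assumes "smooth_on T f" "z \<in> S"
  shows "dird S (d i) (\<lambda>z. f (\<psi> z)) z = (\<Sum>a\<in>UNIV. J z $ a $ i *\<^sub>R dird T (d' a) f (\<psi> z))"
proof -
  have f: "f differentiable_on T" using assms smooth_on_imp_differentiable_on by blast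
  have p: "\<psi> z \<in> T" using assms \<psi> by auto
  note l = dird_linear_dir[OF udom_open[OF T] f p]
  have "dird S (d i) (\<lambda>z. f (\<psi> z)) z = dird T (dird S (d i) \<psi> z) f (\<psi> z)"
    by (rule dird_compose[OF udom_open[OF S] f smooth_on_imp_differentiable_on[OF \<psi>(1)] \<psi>(2) assms(2)])
  also have "\<dots> = (\<Sum>a\<in>UNIV. dird T (J z $ a $ i *\<^sub>R d' a) f (\<psi> z))"
    unfolding d\<psi>[OF assms(2)] by (rule linear_sum[OF l])
  also have "\<dots> = (\<Sum>a\<in>UNIV. J z $ a $ i *\<^sub>R dird T (d' a) f (\<psi> z))"
    by (intro sum.cong refl linear_scale[OF l])
  finally show ?thesis .
qed

lemma smooth_pull: "smooth_on T f \<Longrightarrow> smooth_on S (\<lambda>z. f (\<psi> z))"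
  by (rule smooth_on_compose[OF _ \<psi>(1) udom_open[OF S] udom_open[OF T] \<psi>(2)])

lemma smooth_h': "smooth_on S h'"
proof -
  have "smooth_on S (\<lambda>z. transpose (J z) ** h (\<psi> z) ** J z)"
    by (intro smooth_on_matmul smooth_on_transpose smooth_pull h J udom_open S)
  then show ?thesis using smooth_on_cong[of S h', OF h'] by blast
qed

lemma h'_sym: "z \<in> S \<Longrightarrow> transpose (h' z) = h' z"
  using s[of "\<psi> z"] \<psi>(2) by (auto simp: h' matrix_transpose_mul matrix_mul_assoc)

lemma h'_inv: "z \<in> S \<Longrightarrow> invertible (h' z)"
  using inv[of "\<psi> z"] \<psi>(2) by (auto simp: h' intro!: invertible_mult Jinv transpose_invertible)

lemma smooth_Gh: "smooth_on S (Gh i)"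
  by (intro smooth_on_sum smooth_on_scaleR smooth_on_vec_nth smooth_pull smooth_on_christoffel_matrix h inv J udom_open S T)

text \<open>The gauge transformation law, multiplied by J so that no inverse appears. By
  \<open>levi_civita_unique\<close> it is enough that the connection it predicts is symmetric and
  compatible with h'.\<close>

lemma christoffel_matrix_pull:
  assumes z: "z \<in> S"
  shows "J z ** christoffel_matrix S d h' i z = Gh i z ** J z + dird S (d i) J z"
proof -
  have p: "\<psi> z \<in> T" using z \<psi> by auto
  note US = udom_open[OF S] and UT = udom_open[OF T]
  define Ji where "Ji = matrix_inv (J z)"
  have Ji: "J z ** Ji = mat 1" "Ji ** J z = mat 1" unfolding Ji_def by (rule matrix_inv_works[OF Jinv[OF z]])+
  have Jl: "J z ** (Ji ** A) = A" for A :: "real^'n^'n" by (simp add: matrix_mul_assoc Ji)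
  have Jr: "(A ** transpose Ji) ** transpose (J z) = A" for A :: "real^'n^'n"
    by (simp add: matrix_mul_assoc[symmetric] matrix_transpose_mul[symmetric] Ji)
  have Jr': "transpose (J z) ** (transpose Ji ** A) = A" for A :: "real^'n^'n"
    by (simp add: matrix_mul_assoc matrix_transpose_mul[symmetric] Ji)
  \<comment> \<open>The predicted connection; what follows checks its symmetry and its compatibility
    with h'.\<close>
  define G where "G i = Ji ** (Gh i z ** J z + dird S (d i) J z)" for i
  have "christoffel_matrix S d h' i z = G i" for i
  proof (rule levi_civita_unique[OF h'_sym[OF z] h'_inv[OF z]])
    show "christoffel_matrix S d h' i z $ a $ b = christoffel_matrix S d h' b z $ a $ i" for i a b
      by (rule christoffel_matrix_symmetric[OF US smooth_h' h'_sym z])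
    show "G i $ a $ b = G b $ a $ i" for i a b
    proof -
      have "(Gh i z ** J z) $ c $ b = (Gh b z ** J z) $ c $ i" for c
      proof -
        have "(Gh i z ** J z) $ c $ b = (\<Sum>k\<in>UNIV. \<Sum>a\<in>UNIV. J z $ a $ i * christoffel_matrix T d' h a (\<psi> z) $ c $ k
            * J z $ k $ b)"
          by (simp add: matrix_matrix_mult_def sum_distrib_right)
        also have "\<dots> = (\<Sum>k\<in>UNIV. \<Sum>a\<in>UNIV. J z $ k $ i * christoffel_matrix T d' h k (\<psi> z) $ c $ a * J z $ a $ b)"
          by (rule sum.swap)
        also have "\<dots> = (\<Sum>k\<in>UNIV. \<Sum>a\<in>UNIV. J z $ k $ i * christoffel_matrix T d' h a (\<psi> z) $ c $ k * J z $ a $ b)"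
          by (intro sum.cong refl) (simp add: christoffel_matrix_symmetric[OF UT h s p])
        also have "\<dots> = (Gh b z ** J z) $ c $ i"
          by (simp add: matrix_matrix_mult_def sum_distrib_right sum_distrib_left mult_ac)
        finally show ?thesis .
      qed
      then show ?thesis using Jsym[OF z] by (simp add: G_def matrix_matrix_mult_def)
    qed
    show "transpose (christoffel_matrix S d h' i z) ** h' z + h' z ** christoffel_matrix S d h' i z = transpose
        (G i) ** h' z + h' z ** G i" for i
    proof -
      have "transpose (christoffel_matrix S d h' i z) ** h' z + h' z ** christoffel_matrix S d h' i z = dird S (d i) h' z"
        by (rule christoffel_matrix_compatible[OF US smooth_h' h'_sym h'_inv z, symmetric])
      also have "\<dots> = dird S (d i) (\<lambda>z. transpose (J z) ** h (\<psi> z) ** J z) z"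
        by (rule dird_cong[OF h' z])
      also have "\<dots> = transpose (J z) ** h (\<psi> z) ** dird S (d i) J z
          + (transpose (J z) ** dird S (d i) (\<lambda>z. h (\<psi> z)) z + transpose (dird S (d i) J z) ** h (\<psi> z)) ** J z"
        by (subst dird_matmul[OF US smooth_on_matmul[OF US smooth_on_transpose[OF US J] smooth_pull[OF h]] J z])
          (simp only: dird_matmul[OF US smooth_on_transpose[OF US J] smooth_pull[OF h] z] dird_transpose[OF US J z])
      also have "dird S (d i) (\<lambda>z. h (\<psi> z)) z = transpose (Gh i z) ** h (\<psi> z) + h (\<psi> z) ** Gh i z"
        using christoffel_matrix_compatible[OF UT h s inv p, where d=d']
        by (simp add: dird_pull[OF h z] transpose_sum mat_sum mat_ring sum.distrib scaleR_add_right)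
      finally have "transpose (christoffel_matrix S d h' i z) ** h' z + h' z ** christoffel_matrix S d h' i z
        = transpose (J z) ** h (\<psi> z) ** (dird S (d i) J z + Gh i z ** J z)
          + transpose (dird S (d i) J z + Gh i z ** J z) ** h (\<psi> z) ** J z"
        by (simp add: mat_ring algebra_simps)
      also have "transpose (J z) ** h (\<psi> z) ** (dird S (d i) J z + Gh i z ** J z) = h' z ** G i"
        unfolding G_def h'[OF z] by (simp add: matrix_mul_assoc[symmetric] Jl add.commute)
      also have "transpose (dird S (d i) J z + Gh i z ** J z) ** h (\<psi> z) ** J z = transpose (G i) ** h' z"
        unfolding G_def h'[OF z] by (simp add: matrix_transpose_mul matrix_mul_assoc Jr add.commute)
      finally show ?thesis by (simp add: add.commute)
    qed
  qed
  then show ?thesis unfolding G_def using Jl by simp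
qed

text \<open>The transformation law is differentiated and antisymmetrised in i and j. The second
  derivatives of J drop out because they commute, and the first derivatives are removed by the law
  itself.\<close>

lemma curvature_matrix_pull:
  assumes z: "z \<in> S"
  shows "J z ** curvature_matrix S d (christoffel_matrix S d h') i j z
    = (\<Sum>a\<in>UNIV. \<Sum>b\<in>UNIV. (J z $ a $ i * J z $ b $ j) *\<^sub>R curvature_matrix T d' (christoffel_matrix T d' h) a b (\<psi> z)) ** J z"
proof -
  have p: "\<psi> z \<in> T" using z \<psi> by auto
  note US = udom_open[OF S] and UT = udom_open[OF T]
  let ?G = "christoffel_matrix S d h'" and ?D = "\<lambda>i f. dird S (d i) f z"
  have sG: "smooth_on S (?G i)" for i by (rule smooth_on_christoffel_matrix[OF US smooth_h' h'_inv])
  have sH: "smooth_on T (christoffel_matrix T d' h a)" for a by (rule smooth_on_christoffel_matrix[OF UT h inv])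
  note sGh = smooth_Gh
  have e: "?D i (\<lambda>z. J z ** ?G j z) = ?D i (\<lambda>z. Gh j z ** J z + dird S (d j) J z)" for i j
    by (rule dird_cong[OF christoffel_matrix_pull z])
  have e1: "J z ** ?D i (?G j) + ?D i J ** ?G j z
      = Gh j z ** ?D i J + ?D i (Gh j) ** J z + ?D i (dird S (d j) J)" for i j
    using e[of i j] unfolding dird_matmul[OF US J sG z]
    by (subst (asm) dird_add[OF US smooth_on_imp_differentiable_on smooth_on_imp_differentiable_on z])
      (auto intro!: smooth_on_matmul[OF US] sGh J smooth_on_dird simp only: dird_matmul[OF US sGh J z])
  have c: "?D i (dird S (d j) J) = ?D j (dird S (d i) J)"
    by (rule dird_commute[OF S J z])
  have DJ: "?D i J = J z ** ?G i z - Gh i z ** J z" for i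
    using christoffel_matrix_pull[OF z, of i] by simp
  \<comment> \<open>The inserted products of dJ with G cancel. The grouping exhibits the left sides
    of \<open>e1\<close> and the combination \<open>J G - dJ\<close>, which is \<open>Gh J\<close>
    by the transformation law.\<close>
  have "J z ** curvature_matrix S d ?G i j z = (J z ** ?D i (?G j) + ?D i J ** ?G j z) -
      (J z ** ?D j (?G i) + ?D j J ** ?G i z)
      + (J z ** ?G i z - ?D i J) ** ?G j z - (J z ** ?G j z - ?D j J) ** ?G i z"
    by (simp add: curvature_matrix_def mat_ring algebra_simps)
  also have "\<dots> = Gh j z ** ?D i J + ?D i (Gh j) ** J z - Gh i z ** ?D j J - ?D j (Gh i) ** J z
     + Gh i z ** (J z ** ?G j z) - Gh j z ** (J z ** ?G i z)"
    unfolding e1 c by (simp add: DJ mat_ring algebra_simps)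
  also have "\<dots> = (?D i (Gh j) - ?D j (Gh i) + Gh i z ** Gh j z - Gh j z ** Gh i z) ** J z"
    unfolding christoffel_matrix_pull[OF z] by (simp add: mat_ring algebra_simps)
  also have "?D i (Gh j) - ?D j (Gh i) + Gh i z ** Gh j z - Gh j z ** Gh i z
     = (\<Sum>a\<in>UNIV. \<Sum>b\<in>UNIV. (J z $ a $ i * J z $ b $ j) *\<^sub>R curvature_matrix T d' (christoffel_matrix T d' h) a b (\<psi> z))"
  proof -
    let ?H = "\<lambda>a. christoffel_matrix T d' h a (\<psi> z)"
    \<comment> \<open>The part in which J is differentiated is symmetric in i and j by
      \<open>Jsym\<close> and disappears on antisymmetrising; the other part yields the pulled back
      derivatives.\<close>
    have D: "?D i (Gh j) = (\<Sum>a\<in>UNIV. ?D i J $ a $ j *\<^sub>R ?H a)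
       + (\<Sum>a\<in>UNIV. \<Sum>b\<in>UNIV. (J z $ a $ i * J z $ b $ j) *\<^sub>R dird T (d' a) (christoffel_matrix T d' h b) (\<psi> z))" for i j
    proof -
      have sJ: "smooth_on S (\<lambda>z. J z $ a $ j)" "smooth_on S (\<lambda>z. J z $ a)" for a j
        by (intro smooth_on_vec_nth US J)+
      have Jn: "?D i (\<lambda>z. J z $ a $ j) = ?D i J $ a $ j" for a
        using dird_vec_nth[OF US smooth_on_imp_differentiable_on[OF sJ(2)] z]
          dird_vec_nth[OF US smooth_on_imp_differentiable_on[OF J] z] by simp
      have "?D i (Gh j) = (\<Sum>b\<in>UNIV. ?D i (\<lambda>z. J z $ b $ j *\<^sub>R christoffel_matrix T d' h b (\<psi> z)))"
        by (rule dird_sum[OF US _ z])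
          (intro smooth_on_imp_differentiable_on smooth_on_scaleR US sJ smooth_pull sH)
      also have "\<dots> = (\<Sum>b\<in>UNIV. J z $ b $ j *\<^sub>R (\<Sum>a\<in>UNIV. J z $ a $ i *\<^sub>R dird T (d' a) (christoffel_matrix T d' h b) (\<psi> z))
           + ?D i J $ b $ j *\<^sub>R ?H b)"
        by (intro sum.cong refl, subst dird_bilinear[OF US bounded_bilinear_scaleR _ _ z])
          (auto intro!: smooth_on_imp_differentiable_on smooth_on_scaleR US sJ smooth_pull sH
            simp: Jn dird_pull[OF sH z])
      also have "\<dots> = (\<Sum>b\<in>UNIV. \<Sum>a\<in>UNIV. (J z $ a $ i * J z $ b $ j) *\<^sub>R dird T (d' a) (christoffel_matrix T d' h b) (\<psi> z))
          + (\<Sum>a\<in>UNIV. ?D i J $ a $ j *\<^sub>R ?H a)"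
        by (simp add: sum.distrib scaleR_sum_right mult.commute)
      finally show ?thesis by (subst sum.swap) simp
    qed
    have P: "Gh i z ** Gh j z = (\<Sum>a\<in>UNIV. \<Sum>b\<in>UNIV. (J z $ a $ i * J z $ b $ j) *\<^sub>R (?H a ** ?H b))" for i j
      by (simp add: mat_sum mat_ring scaleR_sum_right, subst sum.swap, simp add: mult.commute)
    have sw: "(\<Sum>a\<in>UNIV. \<Sum>b\<in>UNIV. (J z $ a $ j * J z $ b $ i) *\<^sub>R f a b)
      = (\<Sum>a\<in>UNIV. \<Sum>b\<in>UNIV. (J z $ a $ i * J z $ b $ j) *\<^sub>R f b a)" for f :: "'n \<Rightarrow> 'n \<Rightarrow> real^'n^'n"
      by (subst sum.swap) (simp add: mult.commute)
    have js: "(\<Sum>a\<in>UNIV. ?D j J $ a $ i *\<^sub>R ?H a) = (\<Sum>a\<in>UNIV. ?D i J $ a $ j *\<^sub>R ?H a)"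
      by (simp add: Jsym[OF z, of j])
    show ?thesis unfolding D P js sw[of "\<lambda>a b. dird T (d' a) (christoffel_matrix T d' h b) (\<psi> z)"]
        sw[of "\<lambda>a b. ?H a ** ?H b"]
      by (simp add: curvature_matrix_def scaleR_diff_right scaleR_add_right sum.distrib sum_subtractf)
  qed
  finally show ?thesis .
qed

end

section \<open>Pullback of the curvature under coordinate changes in space\<close>

lemma frame_components_nth:
  "frame_components E R $ i $ j = (\<Sum>p\<in>UNIV. \<Sum>q\<in>UNIV. (E $ p $ i * E $ q $ j) *\<^sub>R (transpose E ** R $ p $ q ** E))"
proof -
  have "(\<Sum>r\<in>UNIV. \<Sum>s\<in>UNIV. E $ p $ i * E $ q $ j * E $ r $ k * E $ s $ l * R $ p $ q $ r $ s)
     = E $ p $ i * E $ q $ j * (transpose E ** R $ p $ q ** E) $ k $ l" for p q k l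
    by (subst sum.swap) (simp add: matrix_matrix_mult_def transpose_def sum_distrib_left sum_distrib_right mult_ac)
  then show ?thesis by (simp add: vec_eq_iff frame_components_def)
qed

text \<open>The spatial map \<phi> is extended to space-time by the identity in time, so J does not
  depend on time. It serves transition maps at a fixed time as well as normal coordinates for a
  whole flow.\<close>

locale chart_map =
  fixes I :: "real set" and U V :: "(real^'n::finite) set" and \<phi> :: "real^'n \<Rightarrow> real^'n"
    and J :: "real \<times> (real^'n) \<Rightarrow> real^'n^'n" and \<psi> :: "real \<times> (real^'n) \<Rightarrow> real \<times> (real^'n)"
  assumes I: "open I" and U: "open U" and V: "open V" and \<phi>: "smooth_on U \<phi>" "\<phi> ` U \<subseteq> V"
    and J_def: "J = (\<lambda>z. \<chi> a i. dird U (axis i 1) \<phi> (snd z) $ a)"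
    and \<psi>_def: "\<psi> = (\<lambda>z. (fst z, \<phi> (snd z)))"
begin

lemma open_slabs: "open (I \<times> U)" "open (I \<times> V)"
  by (rule open_Times[OF I U], rule open_Times[OF I V])

lemmas udom_slabs = open_slabs[THEN udom_open]

lemma J_matrix: "z \<in> I \<times> U \<Longrightarrow> J z = matrix (frechet_derivative \<phi> (at (snd z)))"
  by (auto simp: J_def matrix_def vec_eq_iff frechet_eq_dird[OF U])

lemma smooth_snd: "smooth_on U f \<Longrightarrow> smooth_on (I \<times> U) (\<lambda>z. f (snd z))"
  for f :: "real^'n \<Rightarrow> 'c::real_normed_vector"
  by (rule smooth_on_compose[OF _ smooth_on_linear[OF udom_slabs(1) bounded_linear_snd] udom_slabs(1) udom_open[OF U]]) auto

lemma dird_snd: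
  fixes f :: "real^'n \<Rightarrow> 'c::real_normed_vector"
  assumes "smooth_on U f" "z \<in> I \<times> U"
  shows "dird (I \<times> U) (sp i) (\<lambda>z. f (snd z)) z = dird U (axis i 1) f (snd z)"
  using dird_compose[OF udom_slabs(1) smooth_on_imp_differentiable_on[OF assms(1)]
      smooth_on_imp_differentiable_on[OF smooth_on_linear[OF udom_slabs(1) bounded_linear_snd]] _ assms(2)]
    dird_linear[OF udom_slabs(1) bounded_linear_snd assms(2)] by auto

lemma inclusions: "bounded_linear (\<lambda>x::real^'n. (0::real, x))" "bounded_linear (\<lambda>x::real. (x, 0::real^'n))"
  by (auto intro!: bounded_linear_Pair bounded_linear_zero bounded_linear_ident)

lemma \<psi>_split: "\<psi> = (\<lambda>z. (\<lambda>x. (x, 0)) (fst z) + (\<lambda>x. (0, x)) (\<phi> (snd z)))"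
  by (auto simp: \<psi>_def)

lemma smooth_fst_part: "smooth_on (I \<times> U) (\<lambda>z. (\<lambda>x. (x, 0::real^'n)) (fst z))"
  by (intro smooth_on_linear[OF udom_slabs(1)] bounded_linear_compose[OF inclusions(2) bounded_linear_fst])

lemma smooth_snd_part: "smooth_on (I \<times> U) (\<lambda>z. (\<lambda>x. (0::real, x)) (\<phi> (snd z)))"
  by (rule smooth_on_linear_compose[OF udom_slabs(1) inclusions(1) smooth_snd[OF \<phi>(1)]])

lemma smooth_\<psi>: "smooth_on (I \<times> U) \<psi>"
  unfolding \<psi>_split by (rule smooth_on_add[OF udom_slabs(1) smooth_fst_part smooth_snd_part])

lemma \<psi>_image: "\<psi> ` (I \<times> U) \<subseteq> I \<times> V" using \<phi>(2) by (auto simp: \<psi>_def)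

lemma smooth_J: "smooth_on (I \<times> U) J"
proof (intro smooth_on_vec udom_slabs(1))
  fix a i
  have "smooth_on (I \<times> U) (\<lambda>z. dird U (axis i 1) \<phi> (snd z) $ a)"
    by (rule smooth_snd, intro smooth_on_vec_nth udom_open U smooth_on_dird \<phi>)
  then show "smooth_on (I \<times> U) (\<lambda>z. J z $ a $ i)" by (simp add: J_def)
qed

lemma dird_\<psi>:
  assumes z: "z \<in> I \<times> U"
  shows "dird (I \<times> U) (sp i) \<psi> z = (\<Sum>a\<in>UNIV. J z $ a $ i *\<^sub>R sp a)"
proof -
  have "dird (I \<times> U) (sp i) \<psi> z = (0, dird U (axis i 1) \<phi> (snd z))"
    unfolding \<psi>_split
    apply (subst dird_add[OF udom_slabs(1) smooth_on_imp_differentiable_on[OF smooth_fst_part]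
        smooth_on_imp_differentiable_on[OF smooth_snd_part] z])
    apply (subst dird_linear[OF udom_slabs(1) bounded_linear_compose[OF inclusions(2) bounded_linear_fst] z])
    apply (subst dird_linear_compose[OF udom_slabs(1) inclusions(1)
        smooth_on_imp_differentiable_on[OF smooth_snd[OF \<phi>(1)]] z])
    by (simp add: dird_snd[OF \<phi>(1) z])
  also have "\<dots> = (\<Sum>a\<in>UNIV. J z $ a $ i *\<^sub>R sp a)"
  proof -
    have "(\<Sum>a\<in>UNIV. J z $ a $ i *\<^sub>R axis a 1) = dird U (axis i 1) \<phi> (snd z)"
      by (simp add: vec_eq_iff J_def axis_def if_distrib cong: if_cong)
    then show ?thesis by (simp add: prod_eq_iff fst_sum snd_sum)
  qed
  finally show ?thesis .
qed

lemma dird_J: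
  assumes z: "z \<in> I \<times> U"
  shows "dird (I \<times> U) (sp i) J z $ a $ j = dird U (axis i 1) (dird U (axis j 1) \<phi>) (snd z) $ a"
proof -
  have sJa: "smooth_on (I \<times> U) (\<lambda>z. J z $ a)" by (intro smooth_on_vec_nth udom_slabs smooth_J)
  have "dird (I \<times> U) (sp i) J z $ a $ j = dird (I \<times> U) (sp i) (\<lambda>z. J z $ a $ j) z"
    using dird_vec_nth[OF udom_slabs(1) smooth_on_imp_differentiable_on[OF sJa] z]
      dird_vec_nth[OF udom_slabs(1) smooth_on_imp_differentiable_on[OF smooth_J] z] by simp
  also have "\<dots> = dird (I \<times> U) (sp i) (\<lambda>z. dird U (axis j 1) \<phi> (snd z) $ a) z" by (simp add: J_def)
  also have "\<dots> = dird U (axis i 1) (\<lambda>y. dird U (axis j 1) \<phi> y $ a) (snd z)"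
    by (rule dird_snd[OF _ z], intro smooth_on_vec_nth udom_open U smooth_on_dird \<phi>)
  also have "\<dots> = dird U (axis i 1) (dird U (axis j 1) \<phi>) (snd z) $ a"
    using z by (intro dird_vec_nth udom_open U smooth_on_imp_differentiable_on smooth_on_dird \<phi>) auto
  finally show ?thesis .
qed

lemma J_symmetric:
  assumes z: "z \<in> I \<times> U"
  shows "dird (I \<times> U) (sp i) J z $ a $ j = dird (I \<times> U) (sp j) J z $ a $ i"
proof -
  have "snd z \<in> U" using z by auto
  then show ?thesis unfolding dird_J[OF z] using dird_commute[OF U \<phi>(1)] by simp
qed

end

lemma riemann_pullback:
  fixes h h' :: "real^'n \<Rightarrow> real^'n^'n" and \<phi> :: "real^'n \<Rightarrow> real^'n"
  assumes U: "open U" and V: "open V" and h: "smooth_on V h"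
    and s: "\<And>z. z \<in> V \<Longrightarrow> transpose (h z) = h z" and inv: "\<And>z. z \<in> V \<Longrightarrow> invertible (h z)"
    and \<phi>: "smooth_on U \<phi>" "\<phi> ` U \<subseteq> V"
    and Jinv: "\<And>y. y \<in> U \<Longrightarrow> invertible (matrix (frechet_derivative \<phi> (at y)))"
    and h': "\<And>y. y \<in> U \<Longrightarrow> h' y = transpose (matrix (frechet_derivative \<phi> (at y))) ** h (\<phi> y)
         ** matrix (frechet_derivative \<phi> (at y))"
    and y: "y \<in> U"
  shows "riemann h' y = frame_components (matrix (frechet_derivative \<phi> (at y))) (riemann h (\<phi> y))"
proof -
  \<comment> \<open>A dummy time interval on which the metrics are constant; everything is evaluated
    at its interior point 1/2.\<close>
  define I where "I = {0<..<1::real}"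
  define J :: "real \<times> (real^'n) \<Rightarrow> real^'n^'n" where "J = (\<lambda>z. \<chi> a i. dird U (axis i 1) \<phi> (snd z) $ a)"
  define \<psi> :: "real \<times> (real^'n) \<Rightarrow> real \<times> (real^'n)" where "\<psi> = (\<lambda>z. (fst z, \<phi> (snd z)))"
  have oI: "open I" "udom I" by (auto simp: I_def intro: udom_open)
  interpret chart_map I U V \<phi> J \<psi> by standard (use oI U V \<phi> in \<open>auto simp: J_def \<psi>_def\<close>)
  have t: "(1/2, y) \<in> I \<times> U" using y by (simp add: I_def)
  have hs: "smooth_on (I \<times> V) (\<lambda>z. h (snd z))"
    by (rule smooth_on_compose[OF h smooth_on_linear[OF udom_slabs(2) bounded_linear_snd] udom_slabs(2)
        udom_open[OF V]]) auto
  note p = open_slabs hs _ _ smooth_\<psi> \<psi>_image smooth_J dird_\<psi> J_symmetric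
  have J1: "J (1/2, y) ** curvature_matrix (I \<times> U) sp (christoffel_matrix (I \<times> U) sp (\<lambda>z. h' (snd z))) i j (1/2, y)
    = (\<Sum>a\<in>UNIV. \<Sum>b\<in>UNIV. (J (1/2, y) $ a $ i * J (1/2, y) $ b $ j) *\<^sub>R
        curvature_matrix (I \<times> V) sp (christoffel_matrix (I \<times> V) sp (\<lambda>z. h (snd z))) a b (\<psi> (1/2, y))) ** J (1/2, y)" for i j
    by (rule curvature_matrix_pull[OF p]) (use s inv Jinv h' t in \<open>auto simp: J_matrix \<psi>_def\<close>)
  have h's: "smooth_on (I \<times> U) (\<lambda>z. h' (snd z))"
    by (rule smooth_h'[OF p])
      (use s inv Jinv h' in \<open>auto simp: J_matrix \<psi>_def\<close>)
  have h'sym: "transpose (h' (snd z)) = h' (snd z)" if "z \<in> I \<times> U" for z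
    by (rule h'_sym[OF p _ _ that])
      (use s inv Jinv h' in \<open>auto simp: J_matrix \<psi>_def\<close>)
  have h'inv: "invertible (h' (snd z))" if "z \<in> I \<times> U" for z
    by (rule h'_inv[OF p _ _ that])
      (use s inv Jinv h' in \<open>auto simp: J_matrix \<psi>_def\<close>)
  have r': "riemann h' y $ i $ j = h' y ** curvature_matrix (I \<times> U) sp
      (christoffel_matrix (I \<times> U) sp (\<lambda>z. h' (snd z))) i j (1/2, y)" for i j
    using riemann_slab[OF oI(2) U h's h'sym h'inv t] by simp
  have pt: "\<psi> (1/2, y) = (1/2, \<phi> y)" "(1/2, \<phi> y) \<in> I \<times> V" using t y \<phi>(2) by (auto simp: \<psi>_def)
  have r: "riemann h (\<phi> y) $ i $ j = h (\<phi> y) ** curvature_matrix (I \<times> V) sp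
      (christoffel_matrix (I \<times> V) sp (\<lambda>z. h (snd z))) i j (\<psi> (1/2, y))" for i j
  proof -
    have "transpose (h (snd z)) = h (snd z)" "invertible (h (snd z))" if "z \<in> I \<times> V" for z
      using that s inv by auto
    from riemann_slab[OF oI(2) V hs this pt(2)] show ?thesis unfolding pt(1) by simp
  qed
  define Jy where "Jy = J (1/2, y)"
  have Jy: "Jy = matrix (frechet_derivative \<phi> (at y))" unfolding Jy_def by (simp add: J_matrix[OF t])
  show ?thesis unfolding Jy[symmetric]
  proof (simp only: vec_eq_iff[of _ "frame_components _ _"] , intro allI)
    fix i
    show "riemann h' y $ i = frame_components Jy (riemann h (\<phi> y)) $ i"
    proof (subst vec_eq_iff, intro allI)
      fix j
      show "riemann h' y $ i $ j = frame_components Jy (riemann h (\<phi> y)) $ i $ j"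
        unfolding frame_components_nth r r' h'[OF y, folded Jy] matrix_mul_assoc[symmetric] J1[folded Jy_def]
        by (simp add: mat_sum mat_ring)
    qed
  qed
qed

section \<open>Tensors in moving frames\<close>

text \<open>Pair symmetry follows from the other identities: adding the four Bianchi identities
  obtained by cycling i, j, k, l, all terms but those of the two pairings cancel by
  antisymmetry.\<close>

lemma curvature_tensorsI:
  fixes R :: "'n::finite tensor4"
  assumes a1: "\<And>i j k l. R $ i $ j $ k $ l = - R $ j $ i $ k $ l"
    and a2: "\<And>i j k l. R $ i $ j $ k $ l = - R $ i $ j $ l $ k"
    and b: "\<And>i j k l. R $ i $ j $ k $ l + R $ j $ k $ i $ l + R $ k $ i $ j $ l = 0"
  shows "R \<in> curvature_tensors"
proof -
  have p: "R $ i $ j $ k $ l = R $ k $ l $ i $ j" for i j k l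
    using b[of i j k l] b[of j k l i] b[of k l i j] b[of l i j k]
      a1[of i j k l] a2[of i j k l] a1[of k l i j] a2[of k l i j] a1[of j k i l] a2[of j k i l]
      a1[of k i j l] a2[of k i j l] a1[of l j k i] a2[of l j k i] a1[of k l j i] a2[of k l j i]
      a1[of j k l i] a2[of j k l i] a1[of l i k j] a2[of l i k j] a1[of i k l j] a2[of i k l j]
      a1[of i l k j] a2[of i l k j] a1[of j l i k] a2[of j l i k] a1[of i j l k] a2[of i j l k]
      a1[of l i j k] a2[of l i j k] a1[of i k j l] a2[of i k j l] a1[of l j i k] a2[of l j i k] by linarith
  show ?thesis unfolding curvature_tensors_def using a1 a2 p b by blast
qed

context
  fixes R :: "'n::finite tensor4" assumes R: "R \<in> curvature_tensors"
begin
lemma ct_swap1: "R $ i $ j $ k $ l = - R $ j $ i $ k $ l"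
  and ct_swap2: "R $ i $ j $ k $ l = - R $ i $ j $ l $ k"
  and ct_pair: "R $ i $ j $ k $ l = R $ k $ l $ i $ j"
  and ct_bianchi: "R $ i $ j $ k $ l + R $ j $ k $ i $ l + R $ k $ i $ j $ l = 0"
  using R unfolding curvature_tensors_def by blast+
lemma ct_flip: "R $ i $ j $ k $ l = R $ j $ i $ l $ k"
  using ct_swap1[of i j k l] ct_swap2[of j i k l] by simp
end

lemma ct_add:
  assumes R: "R \<in> curvature_tensors" "R' \<in> curvature_tensors"
  shows "R + R' \<in> curvature_tensors"
proof (rule curvature_tensorsI)
  fix i j k l
  show "(R + R') $ i $ j $ k $ l = - (R + R') $ j $ i $ k $ l"
    using R[THEN ct_swap1, of i j k l] by simp
  show "(R + R') $ i $ j $ k $ l = - (R + R') $ i $ j $ l $ k"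
    using R[THEN ct_swap2, of i j k l] by simp
  show "(R + R') $ i $ j $ k $ l + (R + R') $ j $ k $ i $ l + (R + R') $ k $ i $ j $ l = 0"
    using R[THEN ct_bianchi, of i j k l] by simp
qed

lemma ct_scaleR:
  assumes R: "R \<in> curvature_tensors"
  shows "c *\<^sub>R R \<in> curvature_tensors"
proof (rule curvature_tensorsI)
  fix i j k l
  show "(c *\<^sub>R R) $ i $ j $ k $ l = - (c *\<^sub>R R) $ j $ i $ k $ l"
    using ct_swap1[OF R, of i j k l] by simp
  show "(c *\<^sub>R R) $ i $ j $ k $ l = - (c *\<^sub>R R) $ i $ j $ l $ k"
    using ct_swap2[OF R, of i j k l] by simp
  show "(c *\<^sub>R R) $ i $ j $ k $ l + (c *\<^sub>R R) $ j $ k $ i $ l + (c *\<^sub>R R) $ k $ i $ j $ l = 0"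
    using ct_bianchi[OF R, of i j k l] by (simp add: distrib_left[symmetric])
qed

section \<open>Matrices acting on the four tensor slots\<close>

definition pull :: "real^'n^'n \<Rightarrow> 'b::real_normed_vector^'n \<Rightarrow> 'b^'n" where
  "pull E X = (\<chi> i. \<Sum>p\<in>UNIV. E $ p $ i *\<^sub>R X $ p)"

definition slot1 :: "real^'n^'n \<Rightarrow> 'n::finite tensor4 \<Rightarrow> 'n tensor4" where
  "slot1 E X = pull E X"
definition slot2 :: "real^'n^'n \<Rightarrow> 'n::finite tensor4 \<Rightarrow> 'n tensor4" where
  "slot2 E X = (\<chi> i. pull E (X $ i))"
definition slot3 :: "real^'n^'n \<Rightarrow> 'n::finite tensor4 \<Rightarrow> 'n tensor4" where
  "slot3 E X = (\<chi> i j. pull E (X $ i $ j))"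
definition slot4 :: "real^'n^'n \<Rightarrow> 'n::finite tensor4 \<Rightarrow> 'n tensor4" where
  "slot4 E X = (\<chi> i j k. pull E (X $ i $ j $ k))"

lemmas slot_defs = slot1_def slot2_def slot3_def slot4_def

lemma slot_nth:
  "slot1 E X $ i $ j $ k $ l = (\<Sum>p\<in>UNIV. E $ p $ i * X $ p $ j $ k $ l)"
  "slot2 E X $ i $ j $ k $ l = (\<Sum>p\<in>UNIV. E $ p $ j * X $ i $ p $ k $ l)"
  "slot3 E X $ i $ j $ k $ l = (\<Sum>p\<in>UNIV. E $ p $ k * X $ i $ j $ p $ l)"
  "slot4 E X $ i $ j $ k $ l = (\<Sum>p\<in>UNIV. E $ p $ l * X $ i $ j $ k $ p)"
  by (simp_all add: slot_defs pull_def)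

text \<open>Reduces composition, adjoints and differentiation of the fourfold sum to one slot at a
  time, the slots commuting with each other.\<close>

lemma frame_components_slots: "frame_components E X = slot1 E (slot2 E (slot3 E (slot4 E X)))"
  by (simp add: vec_eq_iff frame_components_def slot_nth sum_distrib_left mult_ac)

lemma pull_pull: "pull A (pull B X) = pull (B ** A) X"
  unfolding pull_def vec_eq_iff
  by (simp add: matrix_matrix_mult_def scaleR_sum_right scaleR_sum_left mult.commute, intro allI, rule sum.swap)

lemma pull_one: "pull (mat 1) X = X"
  by (simp add: pull_def vec_eq_iff mat_def if_distrib[where f="\<lambda>r. r *\<^sub>R _"] cong: if_cong)

lemma slot_slot:
  "slot1 A (slot1 B X) = slot1 (B ** A) X" "slot2 A (slot2 B X) = slot2 (B ** A) X"
  "slot3 A (slot3 B X) = slot3 (B ** A) X" "slot4 A (slot4 B X) = slot4 (B ** A) X"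
  by (simp_all add: slot_defs pull_pull)

lemma slot_one: "slot1 (mat 1) X = X" "slot2 (mat 1) X = X" "slot3 (mat 1) X = X" "slot4 (mat 1) X = X"
  by (simp_all add: slot_defs pull_one)

lemma slot_commute:
  "slot2 A (slot1 B X) = slot1 B (slot2 A X)" "slot3 A (slot1 B X) = slot1 B (slot3 A X)"
  "slot4 A (slot1 B X) = slot1 B (slot4 A X)" "slot3 A (slot2 B X) = slot2 B (slot3 A X)"
  "slot4 A (slot2 B X) = slot2 B (slot4 A X)" "slot4 A (slot3 B X) = slot3 B (slot4 A X)"
  unfolding vec_eq_iff slot_nth
  by (simp_all add: sum_distrib_left mult.left_commute) (intro allI, rule sum.swap)+

lemma frame_components_compose: "frame_components A (frame_components B X) = frame_components (B ** A) X"
  unfolding frame_components_slots by (simp only: slot_commute slot_slot[symmetric])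

lemma frame_components_one: "frame_components (mat 1) X = X"
  by (simp add: frame_components_slots slot_one)

lemma pull_adjoint: "pull E X \<bullet> Y = X \<bullet> pull (transpose E) (Y :: 'b::real_inner^'n)"
  unfolding inner_vec_def pull_def
  by (simp add: inner_sum_left inner_sum_right transpose_nth, rule sum.swap)

lemma slot_adjoint:
  "slot1 E X \<bullet> Y = X \<bullet> slot1 (transpose E) Y" "slot2 E X \<bullet> Y = X \<bullet> slot2 (transpose E) Y"
  "slot3 E X \<bullet> Y = X \<bullet> slot3 (transpose E) Y" "slot4 E X \<bullet> Y = X \<bullet> slot4 (transpose E) Y"
proof -
  show "slot1 E X \<bullet> Y = X \<bullet> slot1 (transpose E) Y" by (simp add: slot1_def pull_adjoint)
  show "slot2 E X \<bullet> Y = X \<bullet> slot2 (transpose E) Y"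
    unfolding inner_vec_def[of "slot2 E X"] inner_vec_def[of X] by (simp add: slot2_def pull_adjoint)
  show "slot3 E X \<bullet> Y = X \<bullet> slot3 (transpose E) Y"
    unfolding inner_vec_def[of "slot3 E X"] inner_vec_def[of X]
    unfolding inner_vec_def[of "slot3 E X $ i" for i] inner_vec_def[of "X $ i" for i] by (simp add: slot3_def pull_adjoint)
  show "slot4 E X \<bullet> Y = X \<bullet> slot4 (transpose E) Y"
    unfolding inner_vec_def[of "slot4 E X"] inner_vec_def[of X]
    unfolding inner_vec_def[of "slot4 E X $ i" for i] inner_vec_def[of "X $ i" for i]
    unfolding inner_vec_def[of "slot4 E X $ i $ j" for i j] inner_vec_def[of "X $ i $ j" for i j]
    by (simp add: slot4_def pull_adjoint)
qed

lemma frame_components_adjoint: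
  "frame_components E X \<bullet> Y = X \<bullet> frame_components (transpose E) Y"
  unfolding frame_components_slots by (simp only: slot_adjoint slot_commute)

lemma frame_components_inner:
  "frame_components E X \<bullet> frame_components E Y = X \<bullet> frame_components (E ** transpose E) Y"
  by (simp add: frame_components_adjoint frame_components_compose)

text \<open>The derivative of \<open>frame_components\<close> at the identity.\<close>

definition gl_action :: "real^'n^'n \<Rightarrow> 'n::finite tensor4 \<Rightarrow> 'n tensor4" where
  "gl_action N X = slot1 N X + slot2 N X + slot3 N X + slot4 N X"

lemma gl_action_adjoint: "gl_action N X \<bullet> Y = X \<bullet> gl_action (transpose N) Y"
  by (simp add: gl_action_def inner_add_left inner_add_right slot_adjoint)

lemma bounded_bilinearI_euclid:
  fixes B :: "'a::euclidean_space \<Rightarrow> 'b::euclidean_space \<Rightarrow> 'c::real_normed_vector"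
  assumes "\<And>x x' y. B (x + x') y = B x y + B x' y" "\<And>x y y'. B x (y + y') = B x y + B x y'"
    "\<And>r x y. B (r *\<^sub>R x) y = r *\<^sub>R B x y" "\<And>r x y. B x (r *\<^sub>R y) = r *\<^sub>R B x y"
  shows "bounded_bilinear B"
  unfolding bilinear_conv_bounded_bilinear[symmetric] bilinear_def
  using assms by (auto intro!: linearI)

lemma bounded_bilinear_slots:
  "bounded_bilinear (slot1 :: real^'n^'n \<Rightarrow> 'n::finite tensor4 \<Rightarrow> 'n tensor4)"
  "bounded_bilinear (slot2 :: real^'n^'n \<Rightarrow> 'n::finite tensor4 \<Rightarrow> 'n tensor4)"
  "bounded_bilinear (slot3 :: real^'n^'n \<Rightarrow> 'n::finite tensor4 \<Rightarrow> 'n tensor4)"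
  "bounded_bilinear (slot4 :: real^'n^'n \<Rightarrow> 'n::finite tensor4 \<Rightarrow> 'n tensor4)"
  by (rule bounded_bilinearI_euclid;
      simp add: vec_eq_iff slot_nth algebra_simps sum.distrib sum_distrib_left)+

text \<open>Contractions with respect to a metric with inverse matrix \<open>k\<close>. They are polynomial in \<open>k\<close> and the tensor,
  hence smooth, and for \<open>k = E E\<^sup>T\<close> agree with the contractions of the components in the frame \<open>E\<close>.\<close>

definition ric_wrt :: "real^'n^'n \<Rightarrow> 'n::finite tensor4 \<Rightarrow> real^'n^'n" where
  "ric_wrt k X = (\<chi> i m. \<Sum>j\<in>UNIV. \<Sum>l\<in>UNIV. k $ j $ l * X $ i $ j $ m $ l)"

lemma bounded_bilinear_ric_wrt: "bounded_bilinear (ric_wrt :: real^'n^'n \<Rightarrow> 'n::finite tensor4 \<Rightarrow> _)"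
  by (rule bounded_bilinearI_euclid)
    (simp_all add: vec_eq_iff ric_wrt_def algebra_simps sum.distrib sum_distrib_left)

lemma ric_eq_ric_wrt: "ric X = ric_wrt (mat 1) X"
  by (simp add: vec_eq_iff ric_def ric_wrt_def mat_def if_distrib[where f="\<lambda>x. x * _"] cong: if_cong)

lemma ric_add: "ric (X + Y) = ric X + ric Y" and ric_scaleR: "ric (c *\<^sub>R X) = c *\<^sub>R ric X"
  and ric_diff: "ric (X - Y) = ric X - ric Y"
  by (simp_all add: vec_eq_iff ric_def sum.distrib sum_distrib_left sum_subtractf)

lemma ric_frame: "ric (frame_components E X) = transpose E ** ric_wrt (E ** transpose E) X ** E"
proof -
  have "(\<Sum>j\<in>UNIV. frame_components E X $ i $ j $ m $ j)
     = (\<Sum>p\<in>UNIV. \<Sum>q\<in>UNIV. \<Sum>r\<in>UNIV. \<Sum>s\<in>UNIV. \<Sum>j\<in>UNIV. E $ p $ i * E $ q $ j * E $ r $ m * E $ s $ j * X $ p $ q $ r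
         $ s)" for i m
    unfolding frame_components_def vec_lambda_beta
    apply (rule trans[OF sum.swap], rule sum.cong[OF refl])
    apply (rule trans[OF sum.swap], rule sum.cong[OF refl])
    apply (rule trans[OF sum.swap], rule sum.cong[OF refl])
    apply (rule sum.swap)
    done
  also have "\<dots> i m = (transpose E ** ric_wrt (E ** transpose E) X ** E) $ i $ m" for i m
  proof -
    have "(transpose E ** ric_wrt (E ** transpose E) X ** E) $ i $ m
      = (\<Sum>r\<in>UNIV. \<Sum>p\<in>UNIV. \<Sum>q\<in>UNIV. \<Sum>s\<in>UNIV. \<Sum>j\<in>UNIV. E $ p $ i * E $ q $ j * E $ r $ m * E $ s $ j * X $ p $ q $ r $ s)"
      by (simp add: matrix_matrix_mult_def transpose_def ric_wrt_def sum_distrib_left sum_distrib_right mult_ac)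
    also have "\<dots> = (\<Sum>p\<in>UNIV. \<Sum>q\<in>UNIV. \<Sum>r\<in>UNIV. \<Sum>s\<in>UNIV. \<Sum>j\<in>UNIV. E $ p $ i * E $ q $ j * E $ r $ m * E $ s $ j * X
        $ p $ q $ r $ s)"
      apply (rule trans[OF sum.swap], rule sum.cong[OF refl])
      apply (rule sum.swap)
      done
    finally show ?thesis ..
  qed
  finally show ?thesis by (simp add: vec_eq_iff ric_def)
qed

lemma mat_inner_mult:
  fixes A B C :: "real^'n^'n"
  shows "(A ** B) \<bullet> C = B \<bullet> (transpose A ** C)" "(A ** B) \<bullet> C = A \<bullet> (C ** transpose B)"
proof -
  show "(A ** B) \<bullet> C = B \<bullet> (transpose A ** C)"
  proof -
    have "(A ** B) \<bullet> C = (\<Sum>i\<in>UNIV. \<Sum>j\<in>UNIV. \<Sum>k\<in>UNIV. A $ i $ k * B $ k $ j * C $ i $ j)"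
      by (simp add: inner_vec_def matrix_matrix_mult_def sum_distrib_left sum_distrib_right mult_ac)
    also have "\<dots> = (\<Sum>i\<in>UNIV. \<Sum>k\<in>UNIV. \<Sum>j\<in>UNIV. A $ i $ k * B $ k $ j * C $ i $ j)"
      by (rule sum.cong[OF refl], rule sum.swap)
    also have "\<dots> = (\<Sum>k\<in>UNIV. \<Sum>i\<in>UNIV. \<Sum>j\<in>UNIV. A $ i $ k * B $ k $ j * C $ i $ j)"
      by (rule sum.swap)
    also have "\<dots> = (\<Sum>k\<in>UNIV. \<Sum>j\<in>UNIV. \<Sum>i\<in>UNIV. A $ i $ k * B $ k $ j * C $ i $ j)"
      by (rule sum.cong[OF refl], rule sum.swap)
    finally show ?thesis
      by (simp add: inner_vec_def matrix_matrix_mult_def transpose_def sum_distrib_left sum_distrib_right mult_ac)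
  qed
  show "(A ** B) \<bullet> C = A \<bullet> (C ** transpose B)"
  proof -
    have "(A ** B) \<bullet> C = (\<Sum>i\<in>UNIV. \<Sum>j\<in>UNIV. \<Sum>k\<in>UNIV. A $ i $ k * B $ k $ j * C $ i $ j)"
      by (simp add: inner_vec_def matrix_matrix_mult_def sum_distrib_left sum_distrib_right mult_ac)
    also have "\<dots> = (\<Sum>i\<in>UNIV. \<Sum>k\<in>UNIV. \<Sum>j\<in>UNIV. A $ i $ k * B $ k $ j * C $ i $ j)"
      by (rule sum.cong[OF refl], rule sum.swap)
    finally show ?thesis
      by (simp add: inner_vec_def matrix_matrix_mult_def transpose_def sum_distrib_left sum_distrib_right mult_ac)
  qed
qed

definition scal_wrt :: "real^'n^'n \<Rightarrow> 'n::finite tensor4 \<Rightarrow> real" where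
  "scal_wrt k X = k \<bullet> ric_wrt k X"

text \<open>Since \<open>X \<bullet> X\<close> is four times \<open>curv_norm_sq X\<close>, the condition defining \<open>Omega a\<close> is
  \<open>pinching_form c R R \<ge> 0\<close> with \<open>c = (n - 2) / 4 + a\<close>.\<close>

definition pinching_form :: "real \<Rightarrow> 'n::finite tensor4 \<Rightarrow> 'n tensor4 \<Rightarrow> real" where
  "pinching_form c X Y = (ric X \<bullet> ric Y - c * (X \<bullet> Y)) / 4"

text \<open>\<open>frame_components k X\<close> raises all four indices of X and
  \<open>k ** ric_wrt k X ** k\<close> both indices of its Ricci tensor, so the two inner products
  are the squared norms in the metric with inverse k.\<close>

definition pinching_wrt :: "real \<Rightarrow> real^'n^'n \<Rightarrow> 'n::finite tensor4 \<Rightarrow> real" where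
  "pinching_wrt c k X = ((k ** ric_wrt k X ** k) \<bullet> ric_wrt k X - c * (X \<bullet> frame_components k X)) / 4"

lemma scal_eq_inner: "scal X = mat 1 \<bullet> ric X"
  by (simp add: scal_def trace_def inner_vec_def mat_def if_distrib[where f="\<lambda>x. x * _"] cong: if_cong)

lemma scal_wrt_frame: "scal_wrt (E ** transpose E) X = scal (frame_components E X)"
proof -
  let ?r = "ric_wrt (E ** transpose E) X"
  have "(E ** transpose E) \<bullet> ?r = E \<bullet> (?r ** E)"
    by (simp add: mat_inner_mult(2)[of E])
  moreover have "mat 1 \<bullet> (transpose E ** (?r ** E)) = (?r ** E) \<bullet> E"
    by (subst inner_commute, subst mat_inner_mult(1)) simp
  ultimately show ?thesis
    by (simp add: scal_wrt_def scal_eq_inner ric_frame matrix_mul_assoc inner_commute)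
qed

lemma pinching_wrt_frame: "pinching_wrt c (E ** transpose E) X = pinching_form c (frame_components E X)
    (frame_components E X)"
proof -
  let ?r = "ric_wrt (E ** transpose E) X"
  have "(E ** transpose E ** ?r ** (E ** transpose E)) \<bullet> ?r = (E ** (transpose E ** ?r ** E) ** transpose E) \<bullet> ?r"
    by (simp add: matrix_mul_assoc)
  also have "\<dots> = (transpose E ** ?r ** E) \<bullet> (transpose E ** ?r ** E)"
    by (subst mat_inner_mult(2), subst mat_inner_mult(1)) (simp add: matrix_mul_assoc)
  finally show ?thesis
    by (simp add: pinching_wrt_def pinching_form_def frame_components_inner ric_frame)
qed

lemma ct_frame:
  assumes R: "R \<in> curvature_tensors" shows "frame_components E R \<in> curvature_tensors"
proof (rule curvature_tensorsI)
  let ?F = "frame_components E R"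
  fix i j k l
  have "?F $ j $ i $ k $ l = (\<Sum>q\<in>UNIV. \<Sum>p\<in>UNIV. \<Sum>r\<in>UNIV. \<Sum>s\<in>UNIV.
      E $ p $ j * E $ q $ i * E $ r $ k * E $ s $ l * R $ p $ q $ r $ s)"
    unfolding frame_components_def vec_lambda_beta by (rule sum.swap)
  also have "\<dots> = - ?F $ i $ j $ k $ l"
    unfolding frame_components_def vec_lambda_beta sum_negf[symmetric]
    by (intro sum.cong refl, subst ct_swap1[OF R]) simp
  finally show "?F $ i $ j $ k $ l = - ?F $ j $ i $ k $ l" by simp
  have "?F $ i $ j $ l $ k = (\<Sum>p\<in>UNIV. \<Sum>q\<in>UNIV. \<Sum>s\<in>UNIV. \<Sum>r\<in>UNIV.
      E $ p $ i * E $ q $ j * E $ r $ l * E $ s $ k * R $ p $ q $ r $ s)"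
    unfolding frame_components_def vec_lambda_beta by (rule sum.cong[OF refl], rule sum.cong[OF refl], rule sum.swap)
  also have "\<dots> = - ?F $ i $ j $ k $ l"
    unfolding frame_components_def vec_lambda_beta sum_negf[symmetric]
    by (intro sum.cong refl, subst ct_swap2[OF R]) simp
  finally show "?F $ i $ j $ k $ l = - ?F $ i $ j $ l $ k" by simp
  have c1: "(\<Sum>p\<in>UNIV. \<Sum>q\<in>UNIV. \<Sum>r\<in>UNIV. f p q r) = (\<Sum>p\<in>UNIV. \<Sum>q\<in>UNIV. \<Sum>r\<in>UNIV. f q r p)" for f :: "'a \<Rightarrow> 'a \<Rightarrow> 'a \<Rightarrow> real"
  proof -
    have "(\<Sum>p\<in>UNIV. \<Sum>q\<in>UNIV. \<Sum>r\<in>UNIV. f q r p) = (\<Sum>q\<in>UNIV. \<Sum>p\<in>UNIV. \<Sum>r\<in>UNIV. f q r p)"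
      by (rule sum.swap)
    moreover have "\<dots> = (\<Sum>q\<in>UNIV. \<Sum>r\<in>UNIV. \<Sum>p\<in>UNIV. f q r p)" by (rule sum.cong[OF refl], rule sum.swap)
    ultimately show ?thesis by simp
  qed
  note c2 = trans[OF c1 c1]
  have "?F $ j $ k $ i $ l = (\<Sum>p\<in>UNIV. \<Sum>q\<in>UNIV. \<Sum>r\<in>UNIV. \<Sum>s\<in>UNIV.
      E $ p $ i * E $ q $ j * E $ r $ k * E $ s $ l * R $ q $ r $ p $ s)"
    unfolding frame_components_def vec_lambda_beta by (subst c1) (simp add: mult_ac)
  moreover have "?F $ k $ i $ j $ l = (\<Sum>p\<in>UNIV. \<Sum>q\<in>UNIV. \<Sum>r\<in>UNIV. \<Sum>s\<in>UNIV.
      E $ p $ i * E $ q $ j * E $ r $ k * E $ s $ l * R $ r $ p $ q $ s)"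
    unfolding frame_components_def vec_lambda_beta by (subst c2) (simp add: mult_ac)
  ultimately have "?F $ i $ j $ k $ l + ?F $ j $ k $ i $ l + ?F $ k $ i $ j $ l
   = (\<Sum>p\<in>UNIV. \<Sum>q\<in>UNIV. \<Sum>r\<in>UNIV. \<Sum>s\<in>UNIV. E $ p $ i * E $ q $ j * E $ r $ k * E $ s $ l *
       (R $ p $ q $ r $ s + R $ q $ r $ p $ s + R $ r $ p $ q $ s))"
    by (simp add: frame_components_def sum.distrib[symmetric] distrib_left)
  then show "?F $ i $ j $ k $ l + ?F $ j $ k $ i $ l + ?F $ k $ i $ j $ l = 0"
    by (simp add: ct_bianchi[OF R])
qed

lemma ric_sym: "R \<in> curvature_tensors \<Longrightarrow> transpose (ric R) = ric R"
  unfolding vec_eq_iff transpose_nth ric_def vec_lambda_beta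
  by (intro allI sum.cong refl) (rule ct_pair)

text \<open>Slots one and three survive the contraction and act on the Ricci tensor; the action on
  slots two and four amounts to changing the inverse metric used in the contraction.\<close>

lemma ric_wrt_gl_action:
  "ric (gl_action N X) = transpose N ** ric X + ric X ** N + ric_wrt (N + transpose N) X"
proof -
  have "ric (slot1 N X) = transpose N ** ric X"
    unfolding vec_eq_iff by (simp add: ric_def slot_nth matrix_matrix_mult_def transpose_nth sum_distrib_left)
      (intro allI, rule sum.swap)
  moreover have "ric (slot3 N X) = ric X ** N"
    unfolding vec_eq_iff by (simp add: ric_def slot_nth matrix_matrix_mult_def transpose_nth sum_distrib_right
        sum_distrib_left mult.commute)
      (intro allI, rule sum.swap)
  moreover have "ric (slot4 N X) = ric_wrt (transpose N) X"
    unfolding vec_eq_iff by (simp add: ric_def slot_nth ric_wrt_def transpose_nth)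
  moreover have "ric (slot2 N X) = ric_wrt N X"
    unfolding vec_eq_iff by (simp add: ric_def slot_nth ric_wrt_def) (intro allI, rule sum.swap)
  ultimately show ?thesis
    by (simp add: gl_action_def ric_add bounded_bilinear.add_left[OF bounded_bilinear_ric_wrt])
qed

section \<open>Cubic forms of Weyl tensors\<close>

definition kulkarni_nomizu :: "real^'n^'n \<Rightarrow> 'n::finite tensor4" where
  "kulkarni_nomizu h = (\<chi> i j k l. h $ i $ k * mat 1 $ j $ l + h $ j $ l * mat 1 $ i $ k
      - h $ i $ l * mat 1 $ j $ k - h $ j $ k * mat 1 $ i $ l)"

text \<open>The endomorphism of two-forms induced by h, which is half the Kulkarni-Nomizu product of
  h with itself.\<close>

definition wedge_square :: "real^'n^'n \<Rightarrow> 'n::finite tensor4" where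
  "wedge_square h = (\<chi> i j k l. h $ i $ k * h $ j $ l - h $ i $ l * h $ j $ k)"

lemma mat1_sym: "mat 1 $ i $ j = (mat 1 :: real^'n^'n) $ j $ i"
  by (simp add: mat_def)

lemma sum_mat1: "(\<Sum>j\<in>UNIV. f j * mat 1 $ i $ j) = (f i :: real)" "(\<Sum>j\<in>UNIV. f j * mat 1 $ j $ i) = f i"
  "(\<Sum>j\<in>UNIV. mat 1 $ i $ j * f j) = f i" "(\<Sum>j\<in>UNIV. mat 1 $ j $ i * f j) = f i"
  by (simp_all add: mat_def if_distrib[where f="\<lambda>x. _ * x"] if_distrib[where f="\<lambda>x. x * _"] cong: if_cong)

lemma ct_kulkarni_nomizu: "transpose h = h \<Longrightarrow> kulkarni_nomizu h \<in> curvature_tensors"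
proof -
  assume "transpose h = h"
  then have s: "h $ i $ j = h $ j $ i" for i j by (metis transpose_nth)
  show ?thesis
  proof (rule curvature_tensorsI)
    fix i j k l
    show "kulkarni_nomizu h $ i $ j $ k $ l + kulkarni_nomizu h $ j $ k $ i $ l + kulkarni_nomizu h $ k $ i $ j $ l = 0"
      using s[of i j] s[of i k] s[of j k] mat1_sym[of i j] mat1_sym[of i k] mat1_sym[of j k]
      by (simp add: kulkarni_nomizu_def)
  qed (simp_all add: kulkarni_nomizu_def)
qed

lemma ct_wedge_square: "transpose h = h \<Longrightarrow> wedge_square h \<in> curvature_tensors"
proof -
  assume "transpose h = h"
  then have s: "h $ i $ j = h $ j $ i" for i j by (metis transpose_nth)
  show ?thesis
  proof (rule curvature_tensorsI)
    fix i j k l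
    show "wedge_square h $ i $ j $ k $ l + wedge_square h $ j $ k $ i $ l + wedge_square h $ k $ i $ j $ l = 0"
      using s[of i j] s[of i k] s[of j k]
      by (simp add: wedge_square_def algebra_simps)
  qed (simp_all add: wedge_square_def)
qed

lemma trace_eq_inner: "trace h = mat 1 \<bullet> h"
  by (simp add: trace_def inner_vec_def sum_mat1)

lemma ric_kulkarni_nomizu: "ric (kulkarni_nomizu h) = (real CARD('n) - 2) *\<^sub>R h + trace h *\<^sub>R mat 1" for h ::
    "real^'n::finite^'n"
proof -
  have "mat 1 $ j $ j = (1::real)" for j :: 'n by (simp add: mat_def)
  then show ?thesis
    by (simp add: vec_eq_iff ric_def kulkarni_nomizu_def sum.distrib sum_subtractf sum_mat1 trace_def
        sum_distrib_right[symmetric] algebra_simps)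
qed

lemma ric_wedge_square: "transpose h = h \<Longrightarrow> ric (wedge_square h) = trace h *\<^sub>R h - h ** h" for h :: "real^'n::finite^'n"
proof -
  assume "transpose h = h"
  then have s: "h $ i $ j = h $ j $ i" for i j by (metis transpose_nth)
  show ?thesis
    by (simp add: vec_eq_iff ric_def wedge_square_def sum_subtractf trace_def sum_distrib_left[symmetric]
        matrix_matrix_mult_def)
qed

lemma inner4: "X \<bullet> Y = (\<Sum>i\<in>UNIV. \<Sum>j\<in>UNIV. \<Sum>k\<in>UNIV. \<Sum>l\<in>UNIV. X $ i $ j $ k $ l * Y $ i $ j $ k $ l)"
  for X Y :: "'n::finite tensor4"
  by (simp add: inner_vec_def)

lemma inner2: "X \<bullet> Y = (\<Sum>i\<in>UNIV. \<Sum>j\<in>UNIV. X $ i $ j * Y $ i $ j)"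
  for X Y :: "real^'n^'m"
  by (simp add: inner_vec_def)

text \<open>All four terms of the product give the same contraction by the curvature symmetries. Up
  to the factor 4 the map \<open>kulkarni_nomizu\<close> is thus adjoint to \<open>ric\<close>,
  whence tensors with vanishing Ricci part are orthogonal to its image.\<close>

lemma kulkarni_nomizu_inner:
  assumes X: "X \<in> curvature_tensors"
  shows "kulkarni_nomizu h \<bullet> X = 4 * (h \<bullet> ric X)"
proof -
  have f: "X $ i $ j $ i $ l = X $ j $ i $ l $ i" for i j l by (rule ct_flip[OF X])
  have f2: "X $ i $ j $ j $ l = - X $ i $ j $ l $ j" for i j l by (rule ct_swap2[OF X])
  have f3: "X $ i $ j $ k $ i = - X $ j $ i $ k $ i" for i j k by (rule ct_swap1[OF X])
  have R: "h \<bullet> ric X = (\<Sum>i\<in>UNIV. \<Sum>k\<in>UNIV. \<Sum>j\<in>UNIV. h $ i $ k * X $ i $ j $ k $ j)"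
    by (simp add: inner2 ric_def sum_distrib_left)
  have 1: "(\<Sum>i\<in>UNIV. \<Sum>j\<in>UNIV. \<Sum>k\<in>UNIV. \<Sum>l\<in>UNIV. h $ i $ k * X $ i $ j $ k $ l * mat 1 $ j $ l) = h \<bullet> ric X"
    unfolding R sum_mat1 by (rule sum.cong[OF refl], rule sum.swap)
  have 2: "(\<Sum>i\<in>UNIV. \<Sum>j\<in>UNIV. \<Sum>k\<in>UNIV. \<Sum>l\<in>UNIV. h $ j $ l * X $ i $ j $ k $ l * mat 1 $ i $ k) = h \<bullet> ric X"
  proof -
    have "(\<Sum>i\<in>UNIV. \<Sum>j\<in>UNIV. \<Sum>k\<in>UNIV. \<Sum>l\<in>UNIV. h $ j $ l * X $ i $ j $ k $ l * mat 1 $ i $ k)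
      = (\<Sum>i\<in>UNIV. \<Sum>j\<in>UNIV. \<Sum>l\<in>UNIV. \<Sum>k\<in>UNIV. h $ j $ l * X $ i $ j $ k $ l * mat 1 $ i $ k)"
      by (rule sum.cong[OF refl], rule sum.cong[OF refl], rule sum.swap)
    also have "\<dots> = (\<Sum>i\<in>UNIV. \<Sum>j\<in>UNIV. \<Sum>l\<in>UNIV. h $ j $ l * X $ j $ i $ l $ i)"
      unfolding sum_mat1 by (intro sum.cong refl arg_cong2[where f="(*)"] f)
    also have "\<dots> = (\<Sum>j\<in>UNIV. \<Sum>i\<in>UNIV. \<Sum>l\<in>UNIV. h $ j $ l * X $ j $ i $ l $ i)" by (rule sum.swap)
    also have "\<dots> = (\<Sum>j\<in>UNIV. \<Sum>l\<in>UNIV. \<Sum>i\<in>UNIV. h $ j $ l * X $ j $ i $ l $ i)"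
      by (rule sum.cong[OF refl], rule sum.swap)
    finally show ?thesis unfolding R .
  qed
  have 3: "(\<Sum>i\<in>UNIV. \<Sum>j\<in>UNIV. \<Sum>k\<in>UNIV. \<Sum>l\<in>UNIV. h $ i $ l * X $ i $ j $ k $ l * mat 1 $ j $ k) = - (h \<bullet> ric X)"
  proof -
    have "(\<Sum>i\<in>UNIV. \<Sum>j\<in>UNIV. \<Sum>k\<in>UNIV. \<Sum>l\<in>UNIV. h $ i $ l * X $ i $ j $ k $ l * mat 1 $ j $ k)
      = (\<Sum>i\<in>UNIV. \<Sum>j\<in>UNIV. \<Sum>l\<in>UNIV. \<Sum>k\<in>UNIV. h $ i $ l * X $ i $ j $ k $ l * mat 1 $ j $ k)"
      by (rule sum.cong[OF refl], rule sum.cong[OF refl], rule sum.swap)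
    also have "\<dots> = (\<Sum>i\<in>UNIV. \<Sum>j\<in>UNIV. \<Sum>l\<in>UNIV. - (h $ i $ l * X $ i $ j $ l $ j))"
      by (simp only: sum_mat1 f2 mult_minus_right)
    also have "\<dots> = (\<Sum>i\<in>UNIV. \<Sum>l\<in>UNIV. \<Sum>j\<in>UNIV. - (h $ i $ l * X $ i $ j $ l $ j))"
      by (rule sum.cong[OF refl], rule sum.swap)
    finally show ?thesis unfolding R by (simp only: sum_negf)
  qed
  have 4: "(\<Sum>i\<in>UNIV. \<Sum>j\<in>UNIV. \<Sum>k\<in>UNIV. \<Sum>l\<in>UNIV. h $ j $ k * X $ i $ j $ k $ l * mat 1 $ i $ l) = - (h \<bullet> ric X)"
  proof -
    have "(\<Sum>i\<in>UNIV. \<Sum>j\<in>UNIV. \<Sum>k\<in>UNIV. \<Sum>l\<in>UNIV. h $ j $ k * X $ i $ j $ k $ l * mat 1 $ i $ l)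
      = (\<Sum>i\<in>UNIV. \<Sum>j\<in>UNIV. \<Sum>k\<in>UNIV. - (h $ j $ k * X $ j $ i $ k $ i))"
      by (simp only: sum_mat1 f3 mult_minus_right)
    also have "\<dots> = (\<Sum>j\<in>UNIV. \<Sum>i\<in>UNIV. \<Sum>k\<in>UNIV. - (h $ j $ k * X $ j $ i $ k $ i))"
      by (rule sum.swap)
    also have "\<dots> = (\<Sum>j\<in>UNIV. \<Sum>k\<in>UNIV. \<Sum>i\<in>UNIV. - (h $ j $ k * X $ j $ i $ k $ i))"
      by (rule sum.cong[OF refl], rule sum.swap)
    finally show ?thesis unfolding R by (simp only: sum_negf)
  qed
  have "kulkarni_nomizu h \<bullet> X = (\<Sum>i\<in>UNIV. \<Sum>j\<in>UNIV. \<Sum>k\<in>UNIV. \<Sum>l\<in>UNIV. h $ i $ k * X $ i $ j $ k $ l * mat 1 $ j $ l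
     + h $ j $ l * X $ i $ j $ k $ l * mat 1 $ i $ k - h $ i $ l * X $ i $ j $ k $ l * mat 1 $ j $ k
     - h $ j $ k * X $ i $ j $ k $ l * mat 1 $ i $ l)"
    unfolding inner4 kulkarni_nomizu_def vec_lambda_beta by (intro sum.cong refl) (simp add: algebra_simps)
  then show ?thesis by (simp add: sum.distrib sum_subtractf 1 2 3 4)
qed

section \<open>The trilinear form that polarises the pairing of R with Q R\<close>

definition Q_form :: "'n::finite tensor4 \<Rightarrow> 'n tensor4 \<Rightarrow> 'n tensor4" where
  "Q_form X Y = (\<chi> i j k l. 1/2 * (\<Sum>p\<in>UNIV. \<Sum>q\<in>UNIV. X $ i $ j $ p $ q * Y $ k $ l $ p $ q)
     + (\<Sum>p\<in>UNIV. \<Sum>q\<in>UNIV. X $ i $ p $ k $ q * Y $ j $ p $ l $ q - X $ i $ p $ l $ q * Y $ j $ p $ k $ q))"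

lemma Q_eq_Q_form: "Q R = Q_form R R"
  by (simp add: vec_eq_iff Q_def curv_square_def curv_sharp_def Q_form_def)

lemma bounded_bilinear_Q_form: "bounded_bilinear (Q_form :: 'n::finite tensor4 \<Rightarrow> _)"
  by (rule bounded_bilinearI_euclid)
   (simp_all add: vec_eq_iff Q_form_def algebra_simps sum.distrib sum_subtractf sum_distrib_left)

text \<open>\<open>Q_form X Y\<close> is not symmetrised, but paired with curvature tensors it
  splits into this contraction and \<open>sharp_form\<close>. Each is invariant under permuting
  three curvature tensors, by renaming indices and the pair or flip symmetry of one factor.\<close>

definition square_form :: "'n::finite tensor4 \<Rightarrow> 'n tensor4 \<Rightarrow> 'n tensor4 \<Rightarrow> real" where
  "square_form Z X Y = (\<Sum>i\<in>UNIV. \<Sum>j\<in>UNIV. \<Sum>k\<in>UNIV. \<Sum>l\<in>UNIV. \<Sum>p\<in>UNIV. \<Sum>q\<in>UNIV.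
     Z $ i $ j $ k $ l * X $ i $ j $ p $ q * Y $ k $ l $ p $ q)"

definition sharp_form :: "'n::finite tensor4 \<Rightarrow> 'n tensor4 \<Rightarrow> 'n tensor4 \<Rightarrow> real" where
  "sharp_form Z X Y = (\<Sum>i\<in>UNIV. \<Sum>j\<in>UNIV. \<Sum>k\<in>UNIV. \<Sum>l\<in>UNIV. \<Sum>p\<in>UNIV. \<Sum>q\<in>UNIV.
     Z $ i $ j $ k $ l * X $ i $ p $ k $ q * Y $ j $ p $ l $ q)"

lemma sum_nest6: "(\<Sum>i\<in>UNIV. \<Sum>j\<in>UNIV. \<Sum>k\<in>UNIV. \<Sum>l\<in>UNIV. \<Sum>p\<in>UNIV. \<Sum>q\<in>UNIV. f i j k l p q)
   = (\<Sum>(i,j,k,l,p,q)\<in>UNIV. f i j k l p q :: real)"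
  by (simp add: sum.cartesian_product)

lemma square_form_swap12: "Y \<in> curvature_tensors \<Longrightarrow> square_form Z X Y = square_form X Z Y"
  unfolding square_form_def sum_nest6
  by (rule sum.reindex_bij_witness[of _ "\<lambda>(i,j,k,l,p,q). (i,j,p,q,k,l)" "\<lambda>(i,j,k,l,p,q). (i,j,p,q,k,l)"])
    (auto simp: ct_pair[of Y])

lemma square_form_swap23: "Z \<in> curvature_tensors \<Longrightarrow> square_form Z X Y = square_form Z Y X"
  unfolding square_form_def sum_nest6
  by (rule sum.reindex_bij_witness[of _ "\<lambda>(i,j,k,l,p,q). (k,l,i,j,p,q)" "\<lambda>(i,j,k,l,p,q). (k,l,i,j,p,q)"])
    (auto simp: ct_pair[of Z])

lemma sharp_form_swap12: "Y \<in> curvature_tensors \<Longrightarrow> sharp_form Z X Y = sharp_form X Z Y"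
  unfolding sharp_form_def sum_nest6
  by (rule sum.reindex_bij_witness[of _ "\<lambda>(i,j,k,l,p,q). (i,p,k,q,j,l)" "\<lambda>(i,j,k,l,p,q). (i,p,k,q,j,l)"])
    (auto simp: ct_flip[of Y])

lemma sharp_form_swap23: "Z \<in> curvature_tensors \<Longrightarrow> sharp_form Z X Y = sharp_form Z Y X"
  unfolding sharp_form_def sum_nest6
  by (rule sum.reindex_bij_witness[of _ "\<lambda>(i,j,k,l,p,q). (j,i,l,k,p,q)" "\<lambda>(i,j,k,l,p,q). (j,i,l,k,p,q)"])
    (auto simp: ct_flip[of Z])

lemma inner_Q_form:
  assumes Z: "Z \<in> curvature_tensors"
  shows "Z \<bullet> Q_form X Y = square_form Z X Y / 2 + 2 * sharp_form Z X Y"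
proof -
  have "(\<Sum>i\<in>UNIV. \<Sum>j\<in>UNIV. \<Sum>k\<in>UNIV. \<Sum>l\<in>UNIV. \<Sum>p\<in>UNIV. \<Sum>q\<in>UNIV.
     Z $ i $ j $ k $ l * X $ i $ p $ l $ q * Y $ j $ p $ k $ q) = - sharp_form Z X Y"
  proof -
    have "- sharp_form Z X Y = (\<Sum>i\<in>UNIV. \<Sum>j\<in>UNIV. \<Sum>k\<in>UNIV. \<Sum>l\<in>UNIV. \<Sum>p\<in>UNIV. \<Sum>q\<in>UNIV.
     Z $ i $ j $ l $ k * X $ i $ p $ k $ q * Y $ j $ p $ l $ q)"
      unfolding sharp_form_def sum_negf[symmetric] by (intro sum.cong refl, subst ct_swap2[OF Z]) simp
    also have "\<dots> = (\<Sum>i\<in>UNIV. \<Sum>j\<in>UNIV. \<Sum>l\<in>UNIV. \<Sum>k\<in>UNIV. \<Sum>p\<in>UNIV. \<Sum>q\<in>UNIV.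
     Z $ i $ j $ l $ k * X $ i $ p $ k $ q * Y $ j $ p $ l $ q)"
      by (rule sum.cong[OF refl], rule sum.cong[OF refl], rule sum.swap)
    finally show ?thesis by simp
  qed
  then show ?thesis
    by (simp add: inner4 Q_form_def square_form_def sharp_form_def algebra_simps sum.distrib sum_subtractf
        sum_distrib_left sum_divide_distrib)
qed

lemma inner_Q_form_swap12:
  assumes "X \<in> curvature_tensors" "Y \<in> curvature_tensors" "Z \<in> curvature_tensors"
  shows "Z \<bullet> Q_form X Y = X \<bullet> Q_form Z Y" "Z \<bullet> Q_form X Y = Z \<bullet> Q_form Y X"
proof -
  show "Z \<bullet> Q_form X Y = X \<bullet> Q_form Z Y"
    by (simp only: inner_Q_form assms square_form_swap12[OF assms(2), of Z X] sharp_form_swap12[OF assms(2), of Z X])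
  show "Z \<bullet> Q_form X Y = Z \<bullet> Q_form Y X"
    using square_form_swap23[OF assms(3), of X Y] sharp_form_swap23[OF assms(3), of X Y] by (simp only: inner_Q_form assms)
qed

text \<open>The curvature acting on bilinear forms is self-adjoint, since exchanging the index pairs
  (i, m) and (j, l) leaves R unchanged.\<close>

lemma ric_wrt_sym:
  assumes R: "R \<in> curvature_tensors"
  shows "A \<bullet> ric_wrt B R = B \<bullet> ric_wrt A R"
proof -
  have n4: "(\<Sum>a\<in>UNIV. \<Sum>b\<in>UNIV. \<Sum>c\<in>UNIV. \<Sum>d\<in>UNIV. f a b c d) = (\<Sum>(a,b,c,d)\<in>UNIV. f a b c d :: real)"
    for f :: "'n \<Rightarrow> 'n \<Rightarrow> 'n \<Rightarrow> 'n \<Rightarrow> real"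
    by (simp add: sum.cartesian_product)
  have e: "A \<bullet> ric_wrt B R = (\<Sum>(i,m,j,l)\<in>UNIV. A $ i $ m * B $ j $ l * R $ i $ j $ m $ l)" for A B
    unfolding n4[symmetric] by (simp add: inner2 ric_wrt_def sum_distrib_left mult.assoc)
  show ?thesis unfolding e
    by (rule sum.reindex_bij_witness[of _ "\<lambda>(i,m,j,l). (j,l,i,m)" "\<lambda>(i,m,j,l). (j,l,i,m)"])
      (auto simp: ct_flip[OF R])
qed

text \<open>The square part contributes S1 / 2 and the sharp part - S2 besides the stated
  contraction. Applying the Bianchi identity to both factors of a difference gives 2 S1 - 2 S2 = S1,
  so these contributions cancel.\<close>

lemma ric_Q:
  assumes R: "R \<in> curvature_tensors"
  shows "ric (Q R) = ric_wrt (ric R) R"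
proof -
  have "ric (Q R) $ i $ k = ric_wrt (ric R) R $ i $ k" for i k
  proof -
    define S1 where "S1 = (\<Sum>a\<in>UNIV. \<Sum>b\<in>UNIV. \<Sum>c\<in>UNIV. R $ i $ a $ b $ c * R $ k $ a $ b $ c)"
    define S2 where "S2 = (\<Sum>a\<in>UNIV. \<Sum>b\<in>UNIV. \<Sum>c\<in>UNIV. R $ i $ a $ b $ c * R $ k $ c $ b $ a)"
    have n3: "(\<Sum>a\<in>UNIV. \<Sum>b\<in>UNIV. \<Sum>c\<in>UNIV. f a b c) = (\<Sum>(a,b,c)\<in>UNIV. f a b c :: real)" for f :: "'n \<Rightarrow> 'n \<Rightarrow> 'n \<Rightarrow> real"
      by (simp add: sum.cartesian_product)
    have b: "R $ x $ a $ b $ c - R $ x $ c $ b $ a = R $ x $ b $ a $ c" for x a b c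
      using ct_bianchi[OF R, of x a b c] ct_pair[OF R, of x c b a] ct_swap1[OF R, of x b a c]
       ct_swap1[OF R, of a b x c] ct_swap2[OF R, of b a x c] ct_pair[OF R, of b a x c] ct_pair[OF R, of x c a b]
       ct_swap2[OF R, of x c a b] by linarith
    have sw1: "(\<Sum>(a,b,c)\<in>UNIV. R $ i $ c $ b $ a * R $ k $ a $ b $ c) = S2"
      unfolding S2_def n3
      by (rule sum.reindex_bij_witness[of _ "\<lambda>(a,b,c). (c,b,a)" "\<lambda>(a,b,c). (c,b,a)"]) auto
    have sw2: "(\<Sum>(a,b,c)\<in>UNIV. R $ i $ c $ b $ a * R $ k $ c $ b $ a) = S1"
      unfolding S1_def n3
      by (rule sum.reindex_bij_witness[of _ "\<lambda>(a,b,c). (c,b,a)" "\<lambda>(a,b,c). (c,b,a)"]) auto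
    have sw3: "(\<Sum>(a,b,c)\<in>UNIV. R $ i $ b $ a $ c * R $ k $ b $ a $ c) = S1"
      unfolding S1_def n3
      by (rule sum.reindex_bij_witness[of _ "\<lambda>(a,b,c). (b,a,c)" "\<lambda>(a,b,c). (b,a,c)"]) auto
    note sw = sw1 sw2 sw3
    have "S1 - S2 - S2 + S1 = (\<Sum>(a,b,c)\<in>UNIV. (R $ i $ a $ b $ c - R $ i $ c $ b $ a) *
        (R $ k $ a $ b $ c - R $ k $ c $ b $ a))"
    proof -
      have "(\<Sum>(a,b,c)\<in>UNIV. (R $ i $ a $ b $ c - R $ i $ c $ b $ a) * (R $ k $ a $ b $ c - R $ k $ c $ b $ a))
        = (\<Sum>(a,b,c)\<in>UNIV. R $ i $ a $ b $ c * R $ k $ a $ b $ c) - (\<Sum>(a,b,c)\<in>UNIV. R $ i $ a $ b $ c * R $ k $ c $ b $ a)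
         - (\<Sum>(a,b,c)\<in>UNIV. R $ i $ c $ b $ a * R $ k $ a $ b $ c) + (\<Sum>(a,b,c)\<in>UNIV. R $ i $ c $ b $ a * R $ k $ c $ b $ a)"
        by (simp add: case_prod_unfold algebra_simps sum.distrib sum_subtractf)
      then show ?thesis unfolding sw by (simp add: S1_def S2_def n3)
    qed
    also have "\<dots> = S1" unfolding b sw ..
    finally have S: "S1 = 2 * S2" by simp
    have 1: "(\<Sum>j\<in>UNIV. \<Sum>p\<in>UNIV. \<Sum>q\<in>UNIV. R $ i $ j $ p $ q * R $ k $ j $ p $ q) = S1"
      by (simp add: S1_def)
    have 2: "(\<Sum>j\<in>UNIV. \<Sum>p\<in>UNIV. \<Sum>q\<in>UNIV. R $ i $ p $ j $ q * R $ j $ p $ k $ q) = S2"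
    proof -
      have "R $ j $ p $ k $ q = R $ k $ q $ j $ p" for j p q by (rule ct_pair[OF R])
      then show ?thesis unfolding S2_def by (simp only:) (rule sum.swap)
    qed
    have 3: "(\<Sum>j\<in>UNIV. \<Sum>p\<in>UNIV. \<Sum>q\<in>UNIV. R $ i $ p $ k $ q * R $ j $ p $ j $ q) = ric_wrt (ric R) R $ i $ k"
    proof -
      have "(\<Sum>j\<in>UNIV. \<Sum>p\<in>UNIV. \<Sum>q\<in>UNIV. R $ i $ p $ k $ q * R $ j $ p $ j $ q)
        = (\<Sum>p\<in>UNIV. \<Sum>j\<in>UNIV. \<Sum>q\<in>UNIV. R $ i $ p $ k $ q * R $ p $ j $ q $ j)"
        by (rule trans[OF sum.swap]) (intro sum.cong refl arg_cong2[where f="(*)"] ct_flip[OF R])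
      also have "\<dots> = (\<Sum>p\<in>UNIV. \<Sum>q\<in>UNIV. \<Sum>j\<in>UNIV. R $ i $ p $ k $ q * R $ p $ j $ q $ j)"
        by (rule sum.cong[OF refl], rule sum.swap)
      finally show ?thesis by (simp add: ric_wrt_def ric_def sum_distrib_left sum_distrib_right mult.commute)
    qed
    have "ric (Q R) $ i $ k = (\<Sum>j\<in>UNIV. \<Sum>p\<in>UNIV. \<Sum>q\<in>UNIV. R $ i $ j $ p $ q * R $ k $ j $ p $ q) / 2
       + (\<Sum>j\<in>UNIV. \<Sum>p\<in>UNIV. \<Sum>q\<in>UNIV. R $ i $ p $ k $ q * R $ j $ p $ j $ q)
       - (\<Sum>j\<in>UNIV. \<Sum>p\<in>UNIV. \<Sum>q\<in>UNIV. R $ i $ p $ j $ q * R $ j $ p $ k $ q)"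
      by (simp add: ric_def Q_eq_Q_form Q_form_def sum.distrib sum_subtractf sum_divide_distrib)
    then show ?thesis unfolding 1 2 3 S by simp
  qed
  then show ?thesis by (simp add: vec_eq_iff)
qed

lemma ric_Q_form:
  assumes "X \<in> curvature_tensors" "Y \<in> curvature_tensors"
  shows "ric (Q_form X Y + Q_form Y X) = ric_wrt (ric Y) X + ric_wrt (ric X) Y"
proof -
  interpret q: bounded_bilinear Q_form by (rule bounded_bilinear_Q_form)
  interpret r: bounded_bilinear ric_wrt by (rule bounded_bilinear_ric_wrt)
  have "ric (Q (X + Y)) = ric_wrt (ric (X + Y)) (X + Y)" by (intro ric_Q ct_add assms)
  then show ?thesis using ric_Q[OF assms(1)] ric_Q[OF assms(2)]
    by (simp add: Q_eq_Q_form q.add_left q.add_right ric_add r.add_left r.add_right algebra_simps)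
qed

lemma wedge_square_inner:
  assumes X: "X \<in> curvature_tensors"
  shows "X \<bullet> wedge_square h = 2 * (h \<bullet> ric_wrt h X)"
proof -
  have n4: "(\<Sum>a\<in>UNIV. \<Sum>b\<in>UNIV. \<Sum>c\<in>UNIV. \<Sum>d\<in>UNIV. f a b c d) = (\<Sum>(a,b,c,d)\<in>UNIV. f a b c d :: real)"
    for f :: "'a \<Rightarrow> 'a \<Rightarrow> 'a \<Rightarrow> 'a \<Rightarrow> real"
    by (simp add: sum.cartesian_product)
  have 1: "(\<Sum>(i,j,k,l)\<in>UNIV. X $ i $ j $ k $ l * (h $ i $ k * h $ j $ l)) = h \<bullet> ric_wrt h X"
  proof -
    have "h \<bullet> ric_wrt h X = (\<Sum>(i,k,j,l)\<in>UNIV. h $ i $ k * h $ j $ l * X $ i $ j $ k $ l)"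
      unfolding n4[symmetric] by (simp add: inner2 ric_wrt_def sum_distrib_left mult.assoc)
    also have "\<dots> = (\<Sum>(i,j,k,l)\<in>UNIV. X $ i $ j $ k $ l * (h $ i $ k * h $ j $ l))"
      by (rule sum.reindex_bij_witness[of _ "\<lambda>(i,j,k,l). (i,k,j,l)" "\<lambda>(i,k,j,l). (i,j,k,l)"]) auto
    finally show ?thesis ..
  qed
  have 2: "(\<Sum>(i,j,k,l)\<in>UNIV. X $ i $ j $ k $ l * (h $ i $ l * h $ j $ k)) = - (h \<bullet> ric_wrt h X)"
    unfolding 1[symmetric] sum_negf[symmetric]
  proof (rule sum.reindex_bij_witness[of _ "\<lambda>(i,j,k,l). (i,j,l,k)" "\<lambda>(i,j,k,l). (i,j,l,k)"], goal_cases)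
    case (5 z) obtain i j k l where z: "z = (i,j,k,l)" by (cases z)
    show ?case using ct_swap2[OF X, of i j k l] by (simp add: z)
  qed auto
  have "X \<bullet> wedge_square h = (\<Sum>(i,j,k,l)\<in>UNIV. X $ i $ j $ k $ l * (h $ i $ k * h $ j $ l))
    - (\<Sum>(i,j,k,l)\<in>UNIV. X $ i $ j $ k $ l * (h $ i $ l * h $ j $ k))"
    unfolding n4[symmetric] by (simp add: inner4 wedge_square_def algebra_simps sum_subtractf)
  then show ?thesis unfolding 1 2 by simp
qed

section \<open>Estimates for the cubic terms\<close>

lemma mat_norm_mult: "norm (A ** B) \<le> norm A * norm B" for A B :: "real^'n^'n"
proof -
  have "(norm (A ** B))\<^sup>2 \<le> (norm A * norm B)\<^sup>2"
  proof -
    have e: "(norm M)\<^sup>2 = (\<Sum>i\<in>UNIV. (norm (M $ i))\<^sup>2)" for M :: "real^'n^'n"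
      by (simp add: norm_vec_def L2_set_def sum_nonneg)
    have "((A ** B) $ i $ j)\<^sup>2 \<le> (norm (A $ i))\<^sup>2 * (norm (transpose B $ j))\<^sup>2" for i j
    proof -
      have "(A ** B) $ i $ j = A $ i \<bullet> transpose B $ j"
        by (simp add: matrix_matrix_mult_def inner_vec_def transpose_nth)
      then show ?thesis
        using Cauchy_Schwarz_ineq[of "A $ i" "transpose B $ j"] by (simp add: power2_norm_eq_inner)
    qed
    then have "(\<Sum>i\<in>UNIV. \<Sum>j\<in>UNIV. ((A ** B) $ i $ j)\<^sup>2)
       \<le> (\<Sum>i\<in>UNIV. \<Sum>j\<in>UNIV. (norm (A $ i))\<^sup>2 * (norm (transpose B $ j))\<^sup>2)"
      by (intro sum_mono)
    also have "\<dots> = (norm A)\<^sup>2 * (norm (transpose B))\<^sup>2"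
      unfolding e[of A] e[of "transpose B"] by (simp add: sum_product)
    also have "(norm (transpose B))\<^sup>2 = (norm B)\<^sup>2"
      unfolding power2_norm_eq_inner inner2 transpose_nth by (rule sum.swap)
    also have "(\<Sum>i\<in>UNIV. \<Sum>j\<in>UNIV. ((A ** B) $ i $ j)\<^sup>2) = (norm (A ** B))\<^sup>2"
      unfolding power2_norm_eq_inner inner2 by (simp add: power2_eq_square)
    finally show ?thesis by (simp add: power_mult_distrib)
  qed
  then show ?thesis by (rule power2_le_imp_le) simp
qed

lemma mat1_inner_mat1: "mat 1 \<bullet> (mat 1 :: real^'n::finite^'n) = real CARD('n)"
  by (simp add: inner2 sum_mat1) (simp add: mat_def)

text \<open>Cauchy-Schwarz for \<open>W\<close> and \<open>h \<and> h\<close>, from which its component along the curvature of the sphere,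
  orthogonal to \<open>W\<close>, is subtracted.\<close>

lemma weyl_ricci_bound:
  fixes h :: "real^'n::finite^'n"
  assumes n: "CARD('n) \<ge> 2" and W: "W \<in> curvature_tensors" "ric W = 0"
    and h: "transpose h = h" "trace h = 0"
  shows "2 * (real CARD('n) - 1) * (h \<bullet> ric_wrt h W)\<^sup>2 \<le> (real CARD('n) - 2) * (W \<bullet> W) * (h \<bullet> h)\<^sup>2"
proof -
  define N where "N = real CARD('n)"
  have N: "N \<ge> 2" using n by (simp add: N_def)
  define x where "x = h \<bullet> h"
  define \<tau> where "\<tau> = (h ** h) \<bullet> (h ** h)"
  \<comment> \<open>The coefficient of the orthogonal projection of \<open>wedge_square h\<close> to
    K, namely - 4 x divided by \<open>K \<bullet> K\<close> = 8 N (N - 1).\<close>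
  define b where "b = - x / (2 * N * (N - 1))"
  define K :: "'n tensor4" where "K = kulkarni_nomizu (mat 1)"
  define Z where "Z = wedge_square h - b *\<^sub>R K"
  have tr: "mat 1 \<bullet> h = 0" using h(2) by (simp add: trace_eq_inner)
  have trhh: "mat 1 \<bullet> (h ** h) = x"
    using mat_inner_mult(1)[of h h "mat 1"] h by (simp add: x_def inner_commute)
  have K: "K \<in> curvature_tensors" unfolding K_def by (rule ct_kulkarni_nomizu) simp
  have KX: "K \<bullet> X = 4 * (mat 1 \<bullet> ric X)" if "X \<in> curvature_tensors" for X
    unfolding K_def by (rule kulkarni_nomizu_inner[OF that])
  have KK: "K \<bullet> K = 8 * N * (N - 1)"
  proof -
    have rK: "ric K = (2 * N - 2) *\<^sub>R mat 1"
      by (simp add: K_def ric_kulkarni_nomizu trace_eq_inner mat1_inner_mat1 N_def scaleR_add_left[symmetric])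
    show ?thesis unfolding KX[OF K] rK by (simp add: mat1_inner_mat1 N_def)
  qed
  have Kh: "K \<bullet> wedge_square h = - 4 * x"
    using KX[OF ct_wedge_square[OF h(1)]] by (simp add: ric_wedge_square[OF h(1)] h(2) inner_diff_right trhh)
  have HH: "wedge_square h \<bullet> wedge_square h = 2 * x\<^sup>2 - 2 * \<tau>"
  proof -
    have "wedge_square h \<bullet> wedge_square h = 2 * (h \<bullet> ric_wrt h (wedge_square h))" by
        (rule wedge_square_inner[OF ct_wedge_square[OF h(1)]])
    also have "ric_wrt h (wedge_square h) = x *\<^sub>R h - h ** h ** h"
    proof -
      have s: "h $ i $ j = h $ j $ i" for i j using h(1) by (metis transpose_nth)
      have "ric_wrt h (wedge_square h) $ i $ m = x * h $ i $ m - (h ** h ** h) $ i $ m" for i m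
      proof -
        have "ric_wrt h (wedge_square h) $ i $ m = (\<Sum>j\<in>UNIV. \<Sum>l\<in>UNIV. h $ j $ l * h $ j $ l * h $ i $ m) -
            (\<Sum>j\<in>UNIV. \<Sum>l\<in>UNIV. h $ i $ l * h $ l $ j * h $ j $ m)"
          unfolding ric_wrt_def wedge_square_def vec_lambda_beta sum_subtractf[symmetric]
          by (intro sum.cong refl, subst (9) s) (simp add: algebra_simps)
        then show ?thesis
          by (simp add: x_def inner2 matrix_matrix_mult_def sum_distrib_right)
      qed
      then show ?thesis by (simp add: vec_eq_iff)
    qed
    also have "h \<bullet> (x *\<^sub>R h - h ** h ** h) = x\<^sup>2 - \<tau>"
    proof -
      have "(h ** h) \<bullet> (h ** h) = h \<bullet> (h ** (h ** h))"
        using mat_inner_mult(1)[of h h "h ** h"] h(1) by simp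
      then show ?thesis
        by (simp add: inner_diff_right x_def \<tau>_def power2_eq_square matrix_mul_assoc)
    qed
    finally show ?thesis by simp
  qed
  \<comment> \<open>Here |h^2|^2 is bounded below by its trace part. Together with the subtracted
    projection this produces the factor (N - 2) / (N - 1).\<close>
  have \<tau>: "x\<^sup>2 \<le> N * \<tau>"
    using Cauchy_Schwarz_ineq[of "mat 1" "h ** h"] unfolding trhh mat1_inner_mat1 \<tau>_def N_def .
  have ZZ: "(N - 1) * (Z \<bullet> Z) \<le> 2 * (N - 2) * x\<^sup>2"
  proof -
    have "Z \<bullet> Z = wedge_square h \<bullet> wedge_square h - 2 * b * (K \<bullet> wedge_square h) + b\<^sup>2 * (K \<bullet> K)"
      by (simp add: Z_def inner_diff_left inner_diff_right inner_commute power2_eq_square)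
    also have "\<dots> = 2 * x\<^sup>2 - 2 * \<tau> + 8 * b * x + 8 * N * (N - 1) * b\<^sup>2"
      unfolding HH Kh KK by simp
    finally have e: "Z \<bullet> Z = 2 * x\<^sup>2 - 2 * \<tau> + 8 * b * x + 8 * N * (N - 1) * b\<^sup>2" .
    have mb: "N * (N - 1) * b = - x / 2" using N by (simp add: b_def field_simps)
    have "N * (N - 1) * (Z \<bullet> Z) = 2 * (N * (N - 1)) * x\<^sup>2 - 2 * (N * (N - 1)) * \<tau>
        + 8 * (N * (N - 1) * b) * x + 8 * (N * (N - 1) * b) * (N * (N - 1) * b)"
      unfolding e by (simp add: algebra_simps power2_eq_square)
    then have "N * (N - 1) * (Z \<bullet> Z) = 2 * (N * (N - 1)) * x\<^sup>2 - 2 * (N * (N - 1)) * \<tau> - 2 * x\<^sup>2"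
      unfolding mb by (simp add: power2_eq_square)
    moreover have "(N - 1) * x\<^sup>2 \<le> (N - 1) * (N * \<tau>)" using \<tau> N by (intro mult_left_mono) auto
    ultimately have "N * ((N - 1) * (Z \<bullet> Z)) \<le> N * (2 * (N - 2) * x\<^sup>2)"
      by (simp add: algebra_simps)
    then show ?thesis using N by simp
  qed
  have WZ: "W \<bullet> Z = 2 * (h \<bullet> ric_wrt h W)"
    using KX[OF W(1)] W(2) by (simp add: Z_def inner_diff_right wedge_square_inner[OF W(1)] inner_commute[of W K])
  have "4 * (h \<bullet> ric_wrt h W)\<^sup>2 \<le> (W \<bullet> W) * (Z \<bullet> Z)"
    using Cauchy_Schwarz_ineq[of W Z] unfolding WZ by (simp add: power_mult_distrib)
  then have "(N - 1) * (4 * (h \<bullet> ric_wrt h W)\<^sup>2) \<le> (N - 1) * ((W \<bullet> W) * (Z \<bullet> Z))"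
    using N by (intro mult_left_mono) auto
  also have "\<dots> = (W \<bullet> W) * ((N - 1) * (Z \<bullet> Z))" by simp
  also have "\<dots> \<le> (W \<bullet> W) * (2 * (N - 2) * x\<^sup>2)" using ZZ by (intro mult_left_mono) auto
  finally show ?thesis by (simp add: N_def x_def algebra_simps)
qed

lemma inner_sym_antisym:
  fixes S A :: "real^'n^'n"
  assumes "transpose S = S" "transpose A = - A" shows "S \<bullet> A = 0"
proof -
  have "transpose S \<bullet> transpose A = S \<bullet> A" unfolding inner2 transpose_nth by (rule sum.swap)
  then show ?thesis using assms by simp
qed

text \<open>Extends the estimate for W(h, h) to matrices without symmetry, as the slices of W are in
  the cubic estimate. The curvature action respects the splitting into symmetric and antisymmetric
  parts, so the two parts are estimated separately.\<close>

lemma weyl_form_bound: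
  fixes X :: "real^'n::finite^'n" and W :: "'n tensor4"
  assumes n: "CARD('n) \<ge> 4" and W: "W \<in> curvature_tensors" "ric W = 0" and X: "trace X = 0"
    and c: "c \<ge> 0" "2 * (real CARD('n) - 2) \<le> (real CARD('n) - 1) * c\<^sup>2"
  shows "X \<bullet> ric_wrt X W \<le> c * (norm W / 2) * (X \<bullet> X)"
proof -
  interpret r: bounded_bilinear ric_wrt by (rule bounded_bilinear_ric_wrt)
  define N where "N = real CARD('n)"
  have N: "N \<ge> 4" using n by (simp add: N_def)
  define S where "S = (1/2) *\<^sub>R (X + transpose X)"
  define A where "A = (1/2) *\<^sub>R (X - transpose X)"
  have XSA: "X = S + A" by (simp add: S_def A_def vec_eq_iff field_simps)
  have S: "transpose S = S" by (simp add: S_def vec_eq_iff transpose_nth add.commute)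
  have A: "transpose A = - A"
    by (simp add: A_def transpose_scalar transpose_diff scaleR_minus_right[symmetric] del: scaleR_minus_right)
  have trS: "trace S = 0" using X by (simp add: S_def trace_def transpose_nth)
  have rs: "transpose (ric_wrt S W) = ric_wrt S W"
  proof -
    have "ric_wrt S W $ j $ i = (\<Sum>a\<in>UNIV. \<Sum>b\<in>UNIV. S $ b $ a * W $ i $ b $ j $ a)" for i j
      unfolding ric_wrt_def vec_lambda_beta
      by (intro sum.cong refl arg_cong2[where f="(*)"]) (metis S transpose_nth, rule ct_pair[OF W(1)])
    also have "\<dots> i j = ric_wrt S W $ i $ j" for i j unfolding ric_wrt_def vec_lambda_beta by (rule sum.swap)
    finally show ?thesis by (simp add: vec_eq_iff transpose_nth)
  qed
  have cross: "A \<bullet> ric_wrt S W = 0" using inner_sym_antisym[OF rs A] by (simp add: inner_commute)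
  have cross': "S \<bullet> ric_wrt A W = 0" using ric_wrt_sym[OF W(1), of S A] cross by simp
  have XX: "X \<bullet> X = S \<bullet> S + A \<bullet> A"
    using inner_sym_antisym[OF S A] by (simp add: XSA inner_add_left inner_add_right inner_commute)
  have XrX: "X \<bullet> ric_wrt X W = S \<bullet> ric_wrt S W + A \<bullet> ric_wrt A W"
    by (simp add: XSA inner_add_left inner_add_right r.add_left cross cross')
  have W0: "norm W \<ge> 0" by simp
  have "S \<bullet> ric_wrt S W \<le> c * (norm W / 2) * (S \<bullet> S)"
  proof -
    have "2 * (N - 1) * (S \<bullet> ric_wrt S W)\<^sup>2 \<le> (N - 2) * (W \<bullet> W) * (S \<bullet> S)\<^sup>2"
      using weyl_ricci_bound[OF _ W S trS] n by (simp add: N_def)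
    also have "\<dots> = (2 * (N - 2)) * (W \<bullet> W / 2 * (S \<bullet> S)\<^sup>2)" by simp
    also have "\<dots> \<le> ((N - 1) * c\<^sup>2) * (W \<bullet> W / 2 * (S \<bullet> S)\<^sup>2)"
      using c(2) by (intro mult_right_mono) (auto simp: N_def)
    also have "\<dots> = (2 * (N - 1)) * (c * (norm W / 2) * (S \<bullet> S))\<^sup>2"
      by (simp add: power_mult_distrib power_divide power2_norm_eq_inner)
    finally have "(2 * (N - 1)) * (S \<bullet> ric_wrt S W)\<^sup>2 \<le> (2 * (N - 1)) * (c * (norm W / 2) * (S \<bullet> S))\<^sup>2" .
    then have "(S \<bullet> ric_wrt S W)\<^sup>2 \<le> (c * (norm W / 2) * (S \<bullet> S))\<^sup>2" using N by simp
    then show ?thesis by (rule power2_le_imp_le) (use c in simp)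
  qed
  \<comment> \<open>For antisymmetric A the Bianchi identity rewrites twice the form as a pairing of
    W with the tensor product of A with itself, so plain Cauchy-Schwarz gives the constant
    1.\<close>
  moreover have "A \<bullet> ric_wrt A W \<le> c * (norm W / 2) * (A \<bullet> A)"
  proof -
    have a: "A $ i $ j = - A $ j $ i" for i j
      using A by (metis transpose_nth vector_uminus_component)
    have n4: "(\<Sum>a\<in>UNIV. \<Sum>b\<in>UNIV. \<Sum>c\<in>UNIV. \<Sum>d\<in>UNIV. f a b c d) = (\<Sum>(a,b,c,d)\<in>UNIV. f a b c d :: real)"
      for f :: "'n \<Rightarrow> 'n \<Rightarrow> 'n \<Rightarrow> 'n \<Rightarrow> real"
      by (simp add: sum.cartesian_product)
    have e: "A \<bullet> ric_wrt A W = (\<Sum>(i,m,j,l)\<in>UNIV. A $ i $ m * A $ j $ l * W $ i $ j $ m $ l)"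
      unfolding n4[symmetric] by (simp add: inner2 ric_wrt_def sum_distrib_left mult.assoc)
    have e2: "A \<bullet> ric_wrt A W = - (\<Sum>(i,m,j,l)\<in>UNIV. A $ i $ m * A $ j $ l * W $ m $ j $ i $ l)"
      unfolding e sum_negf[symmetric]
    proof (rule sum.reindex_bij_witness[of _ "\<lambda>(i,m,j,l). (m,i,j,l)" "\<lambda>(i,m,j,l). (m,i,j,l)"], goal_cases)
      case (5 z) obtain i m j l where z: "z = (i,m,j,l)" by (cases z)
      show ?case using a[of i m] by (simp add: z)
    qed auto
    have b: "W $ i $ j $ m $ l - W $ m $ j $ i $ l = W $ i $ m $ j $ l" for i j m l
      using ct_bianchi[OF W(1), of i j m l] ct_swap1[OF W(1), of j m i l] ct_swap1[OF W(1), of m i j l] by linarith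
    have "2 * (A \<bullet> ric_wrt A W) = (\<Sum>(i,m,j,l)\<in>UNIV. A $ i $ m * A $ j $ l * W $ i $ j $ m $ l)
       - (\<Sum>(i,m,j,l)\<in>UNIV. A $ i $ m * A $ j $ l * W $ m $ j $ i $ l)"
      using e e2 by simp
    also have "\<dots> = (\<Sum>(i,m,j,l)\<in>UNIV. A $ i $ m * A $ j $ l * W $ i $ m $ j $ l)"
      unfolding sum_subtractf[symmetric]
      by (intro sum.cong refl) (auto simp: right_diff_distrib[symmetric] b)
    also have "\<dots> = (\<chi> i m j l. A $ i $ m * A $ j $ l) \<bullet> W"
      unfolding n4[symmetric] by (simp add: inner4)
    also have "\<dots> \<le> norm (\<chi> i m j l. A $ i $ m * A $ j $ l) * norm W" by (rule norm_cauchy_schwarz)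
    also have "norm (\<chi> i m j l. A $ i $ m * A $ j $ l) = A \<bullet> A"
    proof -
      have "(\<chi> i m j l. A $ i $ m * A $ j $ l) \<bullet> (\<chi> i m j l. A $ i $ m * A $ j $ l) = (A \<bullet> A) * (A \<bullet> A)"
        unfolding inner4 vec_lambda_beta inner2[of A] sum_distrib_right
        unfolding sum_distrib_left by (intro sum.cong refl) (simp add: mult_ac)
      then have "(norm (\<chi> i m j l. A $ i $ m * A $ j $ l))\<^sup>2 = (A \<bullet> A)\<^sup>2"
        by (simp only: power2_norm_eq_inner power2_eq_square[of "A \<bullet> A"])
      then show ?thesis using power2_eq_iff_nonneg by auto
    qed
    finally have A2: "A \<bullet> ric_wrt A W \<le> norm W / 2 * (A \<bullet> A)" by (simp add: mult.commute)
    \<comment> \<open>Since 2 (N - 2) \<ge> N - 1, the constant for the symmetric part also covers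
      the antisymmetric one.\<close>
    have "c \<ge> 1"
    proof (rule ccontr)
      assume "\<not> c \<ge> 1"
      then have "c\<^sup>2 < 1" using c(1) by (simp add: abs_square_less_1)
      then have "(N - 1) * c\<^sup>2 < N - 1" using N by simp
      then show False using c(2) N by (simp add: N_def)
    qed
    then have "1 * (norm W / 2 * (A \<bullet> A)) \<le> c * (norm W / 2 * (A \<bullet> A))"
      by (intro mult_right_mono) auto
    then show ?thesis using A2 by (simp add: mult.assoc)
  qed
  ultimately show ?thesis unfolding XrX XX by (simp add: distrib_left)
qed

text \<open>The form pairs W with the Gram matrix of its slices \<open>W $ i $ j\<close>.
  Cauchy-Schwarz for each entry bounds the norm of that Gram matrix by |W|^2.\<close>

lemma square_form_bound: "square_form W W W \<le> norm W ^ 3" for W :: "'n::finite tensor4"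
proof -
  define V where "V = (\<chi> i j k l. \<Sum>p\<in>UNIV. \<Sum>q\<in>UNIV. W $ i $ j $ p $ q * W $ k $ l $ p $ q)"
  have "square_form W W W = W \<bullet> V"
    by (simp add: square_form_def inner4 V_def sum_distrib_left mult.assoc)
  also have "\<dots> \<le> norm W * norm V" by (rule norm_cauchy_schwarz)
  also have "norm V \<le> (norm W)\<^sup>2"
  proof -
    have "V $ i $ j $ k $ l = W $ i $ j \<bullet> W $ k $ l" for i j k l
      by (simp add: V_def inner2)
    then have "(V $ i $ j $ k $ l)\<^sup>2 \<le> (W $ i $ j \<bullet> W $ i $ j) * (W $ k $ l \<bullet> W $ k $ l)" for i j k l
      using Cauchy_Schwarz_ineq[of "W $ i $ j" "W $ k $ l"] by simp
    then have "(norm V)\<^sup>2 \<le> (\<Sum>i\<in>UNIV. \<Sum>j\<in>UNIV. \<Sum>k\<in>UNIV. \<Sum>l\<in>UNIV. (W $ i $ j \<bullet> W $ i $ j) * (W $ k $ l \<bullet> W $ k $ l))"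
      unfolding power2_norm_eq_inner inner4 by (intro sum_mono) (simp add: power2_eq_square)
    also have "\<dots> = ((norm W)\<^sup>2)\<^sup>2"
    proof -
      have "(norm W)\<^sup>2 = (\<Sum>i\<in>UNIV. \<Sum>j\<in>UNIV. W $ i $ j \<bullet> W $ i $ j)"
        unfolding power2_norm_eq_inner by (simp add: inner_vec_def)
      then show ?thesis
        unfolding power2_eq_square[of "(norm W)\<^sup>2"] by (simp only: sum_distrib_right) (simp only: sum_distrib_left)
    qed
    finally show ?thesis by (rule power2_le_imp_le) simp
  qed
  finally show ?thesis by (simp add: power3_eq_cube power2_eq_square mult_left_mono)
qed

text \<open>The sharp part is \<open>\<Sum>p q. X \<bullet> W(X)\<close> for the matrices \<open>X = (W\<^sub>i\<^sub>p\<^sub>k\<^sub>q)\<^sub>i\<^sub>k\<close>, which have trace \<open>0\<close>.\<close>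

lemma weyl_cubic_bound:
  fixes W :: "'n::finite tensor4"
  assumes n: "CARD('n) \<ge> 4" and W: "W \<in> curvature_tensors" "ric W = 0"
    and c: "c \<ge> 0" "2 * (real CARD('n) - 2) \<le> (real CARD('n) - 1) * c\<^sup>2"
  shows "W \<bullet> Q W \<le> 4 * (1 + 2 * c) * (norm W / 2) ^ 3"
proof -
  define X where "X p q = (\<chi> i k. W $ i $ p $ k $ q)" for p q
  have "sharp_form W W W = (\<Sum>(i,j,k,l,p,q)\<in>UNIV. W $ i $ j $ k $ l * W $ i $ p $ k $ q * W $ j $ p $ l $ q)"
    unfolding sharp_form_def sum_nest6 ..
  also have "\<dots> = (\<Sum>(p,q,i,k,j,l)\<in>UNIV. X p q $ i $ k * (X p q $ j $ l * W $ i $ j $ k $ l))"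
    by (rule sum.reindex_bij_witness[of _ "\<lambda>(p,q,i,k,j,l). (i,j,k,l,p,q)" "\<lambda>(i,j,k,l,p,q). (p,q,i,k,j,l)"])
      (auto simp: X_def)
  also have "\<dots> = (\<Sum>p\<in>UNIV. \<Sum>q\<in>UNIV. X p q \<bullet> ric_wrt (X p q) W)"
    unfolding sum_nest6[symmetric] by (simp add: inner2 ric_wrt_def sum_distrib_left)
  also have "\<dots> \<le> (\<Sum>p\<in>UNIV. \<Sum>q\<in>UNIV. c * (norm W / 2) * (X p q \<bullet> X p q))"
  proof (intro sum_mono weyl_form_bound[OF n W _ c])
    fix p q
    have "trace (X p q) = ric W $ p $ q"
      by (simp add: trace_def X_def ric_def) (intro sum.cong refl ct_flip[OF W(1)])
    then show "trace (X p q) = 0" by (simp add: W(2))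
  qed
  also have "\<dots> = c * (norm W / 2) * (norm W)\<^sup>2"
  proof -
    have "(\<Sum>p\<in>UNIV. \<Sum>q\<in>UNIV. X p q \<bullet> X p q) = W \<bullet> W"
    proof -
      have n4: "(\<Sum>a\<in>UNIV. \<Sum>b\<in>UNIV. \<Sum>c\<in>UNIV. \<Sum>d\<in>UNIV. f a b c d) = (\<Sum>(a,b,c,d)\<in>UNIV. f a b c d :: real)"
        for f :: "'n \<Rightarrow> 'n \<Rightarrow> 'n \<Rightarrow> 'n \<Rightarrow> real"
        by (simp add: sum.cartesian_product)
      show ?thesis unfolding inner2 inner4 n4
        by (rule sum.reindex_bij_witness[of _ "\<lambda>(i,p,k,q). (p,q,i,k)" "\<lambda>(p,q,i,k). (i,p,k,q)"]) (auto simp: X_def)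
    qed
    moreover have "(\<Sum>p\<in>UNIV. \<Sum>q\<in>UNIV. c * (norm W / 2) * (X p q \<bullet> X p q))
      = c * (norm W / 2) * (\<Sum>p\<in>UNIV. \<Sum>q\<in>UNIV. X p q \<bullet> X p q)" by (simp only: sum_distrib_left)
    ultimately show ?thesis by (simp only: power2_norm_eq_inner)
  qed
  finally have "sharp_form W W W \<le> c * (norm W / 2) * (norm W)\<^sup>2" .
  then show ?thesis using square_form_bound[of W] unfolding Q_eq_Q_form inner_Q_form[OF W(1)]
    by (simp add: power3_eq_cube power2_eq_square algebra_simps)
qed

text \<open>With \<open>B = \<nu> - h\<close> the claim is a bound for \<open>- h \<bullet> B\<^sup>2\<close>, which follows from Cauchy-Schwarz
  after removing the trace of \<open>B\<^sup>2\<close>; no eigenvalues are needed.\<close>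

lemma traceless_cubic_bound:
  fixes h :: "real^'n::finite^'n"
  assumes n: "CARD('n) \<ge> 2" and h: "transpose h = h" "trace h = 0"
    and nu: "\<nu> \<ge> 0" "real CARD('n) * (real CARD('n) - 1) * \<nu>\<^sup>2 = h \<bullet> h"
  shows "- ((h ** h) \<bullet> h) \<le> (real CARD('n) - 2) * \<nu> * (h \<bullet> h)"
proof -
  define N where "N = real CARD('n)"
  have N: "N \<ge> 2" using n by (simp add: N_def)
  define g where "g = - h"
  \<comment> \<open>In the extremal case - h has the eigenvalue (N - 1) \<nu> once and - \<nu>
    otherwise. Then B has rank one and M is a multiple of g, so that both estimates below are
    equalities.\<close>
  define B where "B = g + \<nu> *\<^sub>R mat 1"
  define x where "x = h \<bullet> h"
  have x: "x = N * (N - 1) * \<nu>\<^sup>2" using nu(2) by (simp add: x_def N_def)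
  have gg: "g \<bullet> g = x" by (simp add: g_def x_def)
  have g1: "mat 1 \<bullet> g = 0" "g \<bullet> mat 1 = 0" using h(2) by (simp_all add: g_def trace_eq_inner inner_commute)
  have gs: "transpose g = g" using h by (simp add: g_def transpose_uminus)
  have Bs: "transpose B = B" by (simp add: B_def transpose_add transpose_scalar gs)
  define \<beta> where "\<beta> = B \<bullet> B"
  have \<beta>: "\<beta> = N\<^sup>2 * \<nu>\<^sup>2"
    by (simp add: \<beta>_def B_def inner_add_left inner_add_right gg g1 mat1_inner_mat1 N_def[symmetric] x
        algebra_simps power2_eq_square)
  define M where "M = B ** B - (\<beta> / N) *\<^sub>R mat 1"
  have gM: "g \<bullet> M = g \<bullet> (B ** B)" by (simp add: M_def inner_diff_right g1)
  have MM: "M \<bullet> M \<le> \<beta>\<^sup>2 * (1 - 1 / N)"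
  proof -
    have 1: "mat 1 \<bullet> (B ** B) = \<beta>"
      using mat_inner_mult(1)[of B B "mat 1"] Bs by (simp add: \<beta>_def inner_commute)
    have "M \<bullet> M = (B ** B) \<bullet> (B ** B) - \<beta>\<^sup>2 / N"
      using N by (simp add: M_def inner_diff_left inner_diff_right 1 inner_commute[of "B ** B" "mat 1"]
          mat1_inner_mat1 N_def[symmetric] power2_eq_square)
    also have "(B ** B) \<bullet> (B ** B) \<le> \<beta>\<^sup>2"
    proof -
      have "(norm (B ** B))\<^sup>2 \<le> ((norm B)\<^sup>2)\<^sup>2"
        unfolding power2_eq_square[of "norm B"] by (intro power_mono mat_norm_mult) simp
      then show ?thesis unfolding power2_norm_eq_inner \<beta>_def .
    qed
    finally show ?thesis by (simp add: algebra_simps)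
  qed
  have "(g \<bullet> (B ** B))\<^sup>2 \<le> x * (M \<bullet> M)"
    using Cauchy_Schwarz_ineq[of g M] unfolding gM gg .
  also have "\<dots> \<le> x * (\<beta>\<^sup>2 * (1 - 1 / N))" using MM by (intro mult_left_mono) (auto simp: x_def)
  also have "\<dots> = ((N - 1) * \<nu> * \<beta>)\<^sup>2"
    using N by (simp add: x field_simps power2_eq_square)
  finally have "g \<bullet> (B ** B) \<le> (N - 1) * \<nu> * \<beta>"
    by (rule power2_le_imp_le) (use N nu(1) in \<open>simp add: \<beta>\<close>)
  moreover have "g \<bullet> (B ** B) = g \<bullet> (g ** g) + 2 * \<nu> * x"
    by (simp add: B_def mat_ring inner_add_right g1 gg)
  moreover have "g \<bullet> (g ** g) = - ((h ** h) \<bullet> h)" by (simp add: g_def mat_ring inner_commute)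
  ultimately have "- ((h ** h) \<bullet> h) \<le> (N - 1) * \<nu> * \<beta> - 2 * \<nu> * x" by linarith
  also have "\<dots> = (N - 2) * \<nu> * x" unfolding \<beta> x by (simp add: algebra_simps power2_eq_square)
  finally show ?thesis by (simp add: N_def x_def)
qed

section \<open>The inequality between the norms\<close>

lemma cauchy_schwarz2:
  fixes a b x y z :: real
  assumes "z\<^sup>2 = x\<^sup>2 + y\<^sup>2" "z \<ge> 0" "a\<^sup>2 + b\<^sup>2 \<le> c\<^sup>2" "c \<ge> 0"
  shows "a * x + b * y \<le> c * z"
proof -
  have "(a * x + b * y)\<^sup>2 \<le> (a\<^sup>2 + b\<^sup>2) * (x\<^sup>2 + y\<^sup>2)"
    using zero_le_power2[of "a * y - b * x"] by (simp add: power2_eq_square algebra_simps)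
  also have "\<dots> \<le> c\<^sup>2 * z\<^sup>2" unfolding assms(1) using assms(3) by (intro mult_right_mono) auto
  finally have "(a * x + b * y)\<^sup>2 \<le> (c * z)\<^sup>2" by (simp add: power_mult_distrib)
  then show ?thesis by (rule power2_le_imp_le) (use assms in simp)
qed

text \<open>Here \<open>Z\<close> is bounded below by the linear form with the unit vector \<open>(g, s)\<close> in the term \<open>p X\<^sup>2 Z\<close>, and by
  the one proportional to \<open>(q, cW)\<close> in the term \<open>e Y\<^sup>2 Z\<close>. What remains is \<open>X\<close> times a quadratic form.\<close>

lemma scaled_inequality:
  fixes X Y Z p e q c3 c2 cW g s :: real
  assumes XY: "X \<ge> 0" "Y \<ge> 0" "Z \<ge> 0" "Z\<^sup>2 = X\<^sup>2 + Y\<^sup>2" and pe: "p \<ge> 0" "e \<ge> 0"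
    and g: "g\<^sup>2 + s\<^sup>2 = 1" and q: "q\<^sup>2 + cW\<^sup>2 \<le> e\<^sup>2" "q \<ge> 0"
    and c: "c3 \<le> p * g" "p * s \<le> c2" "(c2 - p * s)\<^sup>2 \<le> 4 * (p * g - c3) * q"
  shows "c3 * X ^ 3 + c2 * X\<^sup>2 * Y + cW * Y ^ 3 \<le> Z * (p * X\<^sup>2 + e * Y\<^sup>2)"
proof -
  have 1: "g * X + s * Y \<le> Z" using cauchy_schwarz2[OF XY(4,3), of g s 1] g by simp
  have 2: "q * X + cW * Y \<le> e * Z" using cauchy_schwarz2[OF XY(4,3) q(1) pe(2)] .
  have "p * X\<^sup>2 * (g * X + s * Y) \<le> p * X\<^sup>2 * Z" using 1 pe by (intro mult_left_mono) auto
  moreover have "Y\<^sup>2 * (q * X + cW * Y) \<le> Y\<^sup>2 * (e * Z)" using 2 by (intro mult_left_mono) auto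
  moreover have "0 \<le> X * ((p * g - c3) * X\<^sup>2 - (c2 - p * s) * X * Y + q * Y\<^sup>2)"
  proof (intro mult_nonneg_nonneg XY)
    let ?A = "p * g - c3" and ?B = "c2 - p * s"
    have "?A \<ge> 0" using c by simp
    have "(?B * X * Y)\<^sup>2 \<le> (?A * X\<^sup>2 + q * Y\<^sup>2)\<^sup>2"
    proof -
      have "(?B * X * Y)\<^sup>2 = ?B\<^sup>2 * (X * Y)\<^sup>2" by (simp add: power_mult_distrib)
      also have "\<dots> \<le> (4 * ?A * q) * (X * Y)\<^sup>2" using c(3) by (intro mult_right_mono) auto
      also have "\<dots> \<le> (?A * X\<^sup>2 + q * Y\<^sup>2)\<^sup>2"
      proof -
        have "(?A * X\<^sup>2 + q * Y\<^sup>2)\<^sup>2 - (4 * ?A * q) * (X * Y)\<^sup>2 = (?A * X\<^sup>2 - q * Y\<^sup>2)\<^sup>2"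
          by (simp add: power2_eq_square algebra_simps)
        then show ?thesis using zero_le_power2[of "?A * X\<^sup>2 - q * Y\<^sup>2"] by linarith
      qed
      finally show ?thesis .
    qed
    then have "?B * X * Y \<le> ?A * X\<^sup>2 + q * Y\<^sup>2"
      by (rule power2_le_imp_le) (use \<open>?A \<ge> 0\<close> q in simp)
    then show "0 \<le> ?A * X\<^sup>2 - ?B * X * Y + q * Y\<^sup>2" by linarith
  qed
  ultimately show ?thesis by (simp add: power3_eq_cube power2_eq_square algebra_simps)
qed

text \<open>Rational bounds for the irrational coefficients of the inequality: \<open>2 N (N - 1) / r\<^sup>2\<close> dominates the permitted
  distance of \<open>a\<close> from \<open>N/4\<close>, \<open>c1\<close> is the constant of the bound for \<open>W(h, h)\<close>, \<open>l\<close> bounds \<open>2 / sqrt \<kappa>\<close>,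
  \<open>m\<close> bounds \<open>sqrt \<kappa> / a\<close>, and \<open>c3\<close>, \<open>g\<close>, \<open>s\<close>, \<open>q\<close> are used as in \<open>scaled_inequality\<close>.\<close>

locale pinching_constants =
  fixes N r c1 l m c3 q g s :: real
  assumes N: "N \<ge> 4" and r: "r > 0" and c1: "c1 \<ge> 0" "2 * (N - 2) \<le> (N - 1) * c1\<^sup>2"
    and l: "l > 0" "4 \<le> l\<^sup>2 * ((N - 1) / 2 - 2 * N * (N - 1) / r\<^sup>2)"
    and a: "0 < N / 4 - 2 * N * (N - 1) / r\<^sup>2"
    and m: "m > 0" "(N - 2) / 4 + (N / 4 - 2 * N * (N - 1) / r\<^sup>2) \<le> m\<^sup>2 * (N / 4 - 2 * N * (N - 1) / r\<^sup>2)\<^sup>2"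
    and c3: "c3 > 0" "4 * (N - 2) \<le> c3\<^sup>2 * (N / 4 - 2 * N * (N - 1) / r\<^sup>2) * (N * (N - 1))"
    and mono: "N * (N - 1) * (N - 2) * (N / 4 + 2 * N * (N - 1) / r\<^sup>2) \<le> ((N / 4 - 2 * N * (N - 1) / r\<^sup>2) * r)\<^sup>2"
    and g: "g\<^sup>2 + s\<^sup>2 = 1" "g \<ge> 0" "s \<ge> 0"
    and q: "q \<ge> 0" "q\<^sup>2 + ((1 + 2 * c1) * l / 2)\<^sup>2 \<le> (r / N)\<^sup>2"
    and c: "c3 \<le> (r / (N * (N - 1)) + (N - 2) / ((N / 4 - 2 * N * (N - 1) / r\<^sup>2) * r)) * g"
      "(r / (N * (N - 1)) + (N - 2) / ((N / 4 - 2 * N * (N - 1) / r\<^sup>2) * r)) * s \<le> (l + m) * c1 / 2"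
      "((l + m) * c1 / 2 - (r / (N * (N - 1)) + (N - 2) / ((N / 4 - 2 * N * (N - 1) / r\<^sup>2) * r)) * s)\<^sup>2
        \<le> 4 * ((r / (N * (N - 1)) + (N - 2) / ((N / 4 - 2 * N * (N - 1) / r\<^sup>2) * r)) * g - c3) * q"
begin

text \<open>The boundary equation turns \<open>\<sigma>\<close> into a multiple of \<open>sqrt (X\<^sup>2 + Y\<^sup>2)\<close> for \<open>X = sqrt (a / (N - 2)) x\<close> and
  \<open>Y = sqrt \<kappa> y\<close>. The coefficients are monotone in \<open>a\<close>, so the smallest admissible \<open>a\<close> decides.\<close>

lemma cubic_inequality:
  fixes a \<alpha> \<kappa> \<sigma> x y \<tau> w TW \<nu> :: real
  assumes e: "0 < N / 4 - a" "N / 4 - a \<le> 2 * N * (N - 1) / r\<^sup>2"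
    and \<alpha>: "\<alpha> = (N - 4 * a) / (8 * N * (N - 1))" and \<kappa>: "\<kappa> = (N - 2) / 4 + a"
    and xy: "\<sigma> > 0" "x \<ge> 0" "y \<ge> 0" and eq: "\<alpha> * \<sigma>\<^sup>2 = a * x\<^sup>2 / (N - 2) + \<kappa> * y\<^sup>2"
    and w: "(N - 1) * w\<^sup>2 \<le> 2 * (N - 2) * y\<^sup>2 * (x\<^sup>2)\<^sup>2"
    and \<tau>: "\<nu> \<ge> 0" "N * (N - 1) * \<nu>\<^sup>2 = x\<^sup>2" "- \<tau> \<le> (N - 2) * \<nu> * x\<^sup>2"
    and TW: "TW \<le> (1 + 2 * c1) * y ^ 3"
  shows "0 \<le> \<sigma> * ((a / (N * (N - 1) * (N - 2)) + \<alpha>) * x\<^sup>2 + \<kappa> * y\<^sup>2 / N)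
     + 2 * a / (N - 2)\<^sup>2 * \<tau> - (2 * a + \<kappa>) / (2 * (N - 2)) * w - \<kappa> * TW"
proof -
  define \<epsilon>0 where "\<epsilon>0 = 2 * N * (N - 1) / r\<^sup>2"
  define a0 where "a0 = N / 4 - \<epsilon>0"
  define k0 where "k0 = (N - 1) / 2 - \<epsilon>0"
  define p0 where "p0 = r / (N * (N - 1)) + (N - 2) / (a0 * r)"
  define c2 where "c2 = (l + m) * c1 / 2"
  define cW where "cW = (1 + 2 * c1) * l / 2"
  note defs = \<epsilon>0_def[symmetric] a0_def[symmetric] k0_def[symmetric] p0_def[symmetric] c2_def[symmetric] cW_def[symmetric]
  note l = l[unfolded defs] and a' = a[unfolded defs] and m = m[unfolded defs] and c3 = c3[unfolded defs]
    and mono = mono[unfolded defs] and q = q[unfolded defs] and c = c[unfolded defs]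
  have a0: "a0 \<le> a" "a0 > 0" using e a' by (simp_all add: a0_def \<epsilon>0_def)
  have a: "a > 0" using a0 by linarith
  have \<kappa>0: "k0 \<le> \<kappa>" "\<kappa> > 0" using a0 a N by (simp_all add: k0_def a0_def \<kappa> field_simps)
  have \<alpha>p: "\<alpha> > 0" unfolding \<alpha> using e N by (intro divide_pos_pos mult_pos_pos) auto
  \<comment> \<open>The boundary equation becomes \<sigma> = R Z. As a approaches N/4 the factor R
    grows, and r is its value at the largest permitted distance.\<close>
  define R where "R = 1 / sqrt \<alpha>"
  have R: "R > 0" "R\<^sup>2 = 1 / \<alpha>" using \<alpha>p by (simp_all add: R_def power_divide)
  have \<alpha>2: "\<alpha> = (N / 4 - a) / (2 * N * (N - 1))" unfolding \<alpha> by (simp add: field_simps)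
  have aR: "N / 4 - a = 2 * N * (N - 1) / R\<^sup>2" unfolding R(2) \<alpha>2 using N by simp
  have rR: "r \<le> R"
  proof -
    have "2 * N * (N - 1) / R\<^sup>2 \<le> 2 * N * (N - 1) / r\<^sup>2" using e(2) aR by simp
    then have "2 * N * (N - 1) * r\<^sup>2 \<le> 2 * N * (N - 1) * R\<^sup>2"
      using R(1) r by (simp add: divide_le_eq le_divide_eq field_simps)
    then have "r\<^sup>2 \<le> R\<^sup>2" using N by simp
    then show ?thesis by (rule power2_le_imp_le) (use R in simp)
  qed
  define A where "A = sqrt (a / (N - 2))"
  define K where "K = sqrt \<kappa>"
  have A: "A > 0" "A\<^sup>2 = a / (N - 2)" using a N by (simp_all add: A_def)
  have K: "K > 0" "K\<^sup>2 = \<kappa>" using \<kappa>0 by (simp_all add: K_def)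
  define X where "X = A * x"
  define Y where "Y = K * y"
  define Z where "Z = sqrt \<alpha> * \<sigma>"
  define p where "p = R / (N * (N - 1)) + (N - 2) / (a * R)"
  have Z: "\<sigma> = R * Z" "Z \<ge> 0" "Z\<^sup>2 = X\<^sup>2 + Y\<^sup>2"
    using \<alpha>p xy eq by (simp_all add: Z_def R_def X_def Y_def power_mult_distrib A K)
  have X2: "X\<^sup>2 = a / (N - 2) * x\<^sup>2" and Y2: "Y\<^sup>2 = \<kappa> * y\<^sup>2"
    by (simp_all add: X_def Y_def power_mult_distrib A K)
  \<comment> \<open>The first summand of p grows with R while the second decreases. The hypothesis
    \<open>mono\<close> says that the growth dominates: the quotient of the difference of the second
    summands by R - r is at most 1 / (N (N - 1)).\<close>
  have p: "p0 \<le> p"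
  proof -
    have d: "a * R - a0 * r = (R - r) * (N / 4 + 2 * N * (N - 1) / (R * r))"
    proof -
      have cancel: "(u - v / t\<^sup>2) * t = u * t - v * (1 / t)" if "t > 0" for u v t :: real
        using that by (simp add: field_simps power2_eq_square)
      have "a = N / 4 - 2 * N * (N - 1) / R\<^sup>2" using aR by simp
      then have "a * R = N / 4 * R - 2 * N * (N - 1) * (1 / R)" using cancel[OF R(1)] by simp
      moreover have "a0 * r = N / 4 * r - 2 * N * (N - 1) * (1 / r)"
        unfolding a0_def \<epsilon>0_def by (rule cancel[OF r])
      ultimately have "a * R - a0 * r = N / 4 * (R - r) + 2 * N * (N - 1) * (1 / r - 1 / R)"
        by (simp add: right_diff_distrib)
      also have "1 / r - 1 / R = (R - r) / (R * r)" using R r by (simp add: field_simps)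
      also have "N / 4 * (R - r) + M * ((R - r) / (R * r)) = (R - r) * (N / 4 + M / (R * r))" for M
        by (simp add: distrib_left mult.commute)
      finally show ?thesis .
    qed
    have arR: "a0 * r \<le> a * R" using a0 rR a r by (intro mult_mono) auto
    have le: "N * (N - 1) * (N - 2) * (N / 4 + 2 * N * (N - 1) / (R * r)) \<le> (a * R) * (a0 * r)"
    proof -
      have "2 * N * (N - 1) / (R * r) \<le> \<epsilon>0"
        unfolding \<epsilon>0_def power2_eq_square using rR r N by (intro divide_left_mono mult_right_mono) auto
      then have "N * (N - 1) * (N - 2) * (N / 4 + 2 * N * (N - 1) / (R * r)) \<le> N * (N - 1) * (N - 2) * (N / 4 + \<epsilon>0)"
        using N by (intro mult_left_mono) auto
      also have "\<dots> \<le> (a0 * r) * (a0 * r)" using mono by (simp add: power2_eq_square)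
      also have "\<dots> \<le> (a * R) * (a0 * r)" using arR a0 r by (intro mult_right_mono) auto
      finally show ?thesis .
    qed
    have pos: "a * R > 0" "a0 * r > 0" "N * (N - 1) > 0" using a a0 R r N by auto
    have "(N - 2) / (a0 * r) - (N - 2) / (a * R) = (N - 2) * (a * R - a0 * r) / ((a * R) * (a0 * r))"
      using a a0 R r by (simp add: field_simps)
    also have "\<dots> = (R - r) * ((N - 2) * (N / 4 + 2 * N * (N - 1) / (R * r)) / ((a * R) * (a0 * r)))"
      unfolding d by simp
    also have "\<dots> \<le> (R - r) * (1 / (N * (N - 1)))"
    proof (intro mult_left_mono)
      show "(N - 2) * (N / 4 + 2 * N * (N - 1) / (R * r)) / ((a * R) * (a0 * r)) \<le> 1 / (N * (N - 1))"
      proof -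
        have "k / P \<le> 1 / M" if "M * k \<le> P" "P > 0" "M > 0" for k P M :: real
          using that by (simp add: field_simps)
        from this[OF _ mult_pos_pos[OF pos(1,2)] pos(3)] show ?thesis using le by (simp only: mult.assoc)
      qed
    qed (use rR in simp)
    finally show ?thesis unfolding p0_def p_def by (simp add: diff_divide_distrib)
  qed
  have p0: "p0 > 0" unfolding p0_def using r a0 N by (intro add_pos_nonneg divide_pos_pos divide_nonneg_nonneg) auto
  have c2: "c2 \<ge> 0" using c1 l m by (simp add: c2_def)
  have main: "c3 * X ^ 3 + c2 * X\<^sup>2 * Y + cW * Y ^ 3 \<le> Z * (p * X\<^sup>2 + R / N * Y\<^sup>2)"
  proof -
    have "c3 * X ^ 3 + c2 * X\<^sup>2 * Y + cW * Y ^ 3 \<le> Z * (p0 * X\<^sup>2 + r / N * Y\<^sup>2)"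
      by (rule scaled_inequality[OF _ _ Z(2,3) _ _ g(1) q(2,1) c]) (use p0 r N A K xy in \<open>auto simp: X_def Y_def\<close>)
    also have "\<dots> \<le> Z * (p * X\<^sup>2 + R / N * Y\<^sup>2)"
      using p rR N Z by (intro mult_left_mono add_mono mult_right_mono divide_right_mono) auto
    finally show ?thesis .
  qed
  have lhs: "\<sigma> * ((a / (N * (N - 1) * (N - 2)) + \<alpha>) * x\<^sup>2 + \<kappa> * y\<^sup>2 / N) = Z * (p * X\<^sup>2 + R / N * Y\<^sup>2)"
  proof -
    have "R * R * \<alpha> = 1" using R(2) \<alpha>p by (simp add: power2_eq_square)
    then have "1 / R = R * \<alpha>" using R(1) by (simp add: divide_eq_eq mult_ac)
    then have e2: "(N - 2) / (a * R) * (a / (N - 2)) = R * \<alpha>" using a N by simp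
    have "p * X\<^sup>2 = (R / (N * (N - 1)) * (a / (N - 2)) + (N - 2) / (a * R) * (a / (N - 2))) * x\<^sup>2"
      unfolding X2 p_def by (simp only: distrib_right mult.assoc)
    also have "\<dots> = R * ((a / (N * (N - 1) * (N - 2)) + \<alpha>) * x\<^sup>2)"
      unfolding e2 by (simp add: distrib_right distrib_left mult.assoc)
    finally have "p * X\<^sup>2 = R * ((a / (N * (N - 1) * (N - 2)) + \<alpha>) * x\<^sup>2)" .
    then show ?thesis unfolding Z(1) Y2 by (simp add: algebra_simps)
  qed
  \<comment> \<open>The trace-free cubic bound leaves 2 \<nu> X^2; the definition of
    \<open>c3\<close> turns \<nu>, a fixed multiple of x, into a multiple of X.\<close>
  have t1: "- (2 * a / (N - 2)\<^sup>2 * \<tau>) \<le> c3 * X ^ 3"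
  proof -
    have "2 * a / (N - 2)\<^sup>2 * (- \<tau>) \<le> 2 * a / (N - 2)\<^sup>2 * ((N - 2) * \<nu> * x\<^sup>2)"
      using \<tau>(3) a by (intro mult_left_mono) auto
    also have "\<dots> = 2 * \<nu> * X\<^sup>2"
    proof -
      have "2 * a / D\<^sup>2 * (D * \<nu> * x\<^sup>2) = 2 * \<nu> * (a / D * x\<^sup>2)" if "D > 0" for D
        using that by (simp add: power2_eq_square field_simps)
      from this[of "N - 2"] show ?thesis unfolding X2 using N by simp
    qed
    also have "\<dots> \<le> (c3 * X) * X\<^sup>2"
    proof (intro mult_right_mono)
      have "(2 * \<nu>)\<^sup>2 \<le> (c3 * X)\<^sup>2"
      proof -
        have "4 * (N - 2) * \<nu>\<^sup>2 \<le> c3\<^sup>2 * a0 * (N * (N - 1)) * \<nu>\<^sup>2"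
          using c3(2) by (intro mult_right_mono) auto
        also have "\<dots> = c3\<^sup>2 * a0 * x\<^sup>2" unfolding \<tau>(2)[symmetric] by simp
        also have "\<dots> \<le> c3\<^sup>2 * a * x\<^sup>2" using a0 by (intro mult_right_mono mult_left_mono) auto
        finally have "4 * (N - 2) * \<nu>\<^sup>2 \<le> c3\<^sup>2 * a * x\<^sup>2" .
        moreover have "2\<^sup>2 * \<nu>\<^sup>2 \<le> c3\<^sup>2 * (a / D * x\<^sup>2)" if "D > 0" "4 * D * \<nu>\<^sup>2 \<le> c3\<^sup>2 * a * x\<^sup>2" for D
          using that by (simp add: field_simps)
        ultimately show ?thesis unfolding power_mult_distrib X2 using N by simp
      qed
      then show "2 * \<nu> \<le> c3 * X" by (rule power2_le_imp_le) (use c3 A xy in \<open>simp add: X_def\<close>)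
    qed auto
    finally show ?thesis by (simp add: power3_eq_cube power2_eq_square)
  qed
  have lK: "2 \<le> l * K"
  proof -
    have "4 \<le> l\<^sup>2 * \<kappa>" using l(2) \<kappa>0 by (smt (verit) mult_left_mono zero_le_power2)
    then have "2\<^sup>2 \<le> (l * K)\<^sup>2" by (simp add: power_mult_distrib K)
    then show ?thesis by (rule power2_le_imp_le) (use l K in simp)
  qed
  \<comment> \<open>After division by a^2 the quantity \<kappa> = (N - 2)/4 + a decreases in a, so
    the hypothesis at \<open>a0\<close> implies the one at a.\<close>
  have mK: "K \<le> m * a"
  proof -
    have "\<kappa> \<le> m\<^sup>2 * a\<^sup>2"
    proof -
      have "1 \<le> a / a0" using a0 by simp
      then have u: "1 \<le> (a / a0)\<^sup>2" "a / a0 \<le> (a / a0)\<^sup>2"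
        by (rule one_le_power) (rule self_le_power[OF \<open>1 \<le> a / a0\<close>], simp)
      have "\<kappa> = (N - 2) / 4 * 1 + a0 * (a / a0)" using a0 by (simp add: \<kappa>)
      also have "\<dots> \<le> (N - 2) / 4 * (a / a0)\<^sup>2 + a0 * (a / a0)\<^sup>2"
        using u N a0 by (intro add_mono mult_left_mono) auto
      also have "\<dots> = ((N - 2) / 4 + a0) * (a / a0)\<^sup>2" by (simp add: algebra_simps)
      also have "\<dots> \<le> m\<^sup>2 * a0\<^sup>2 * (a / a0)\<^sup>2" using m(2) by (intro mult_right_mono) auto
      also have "\<dots> = m\<^sup>2 * a\<^sup>2" using a0 by (simp add: power_divide)
      finally show ?thesis .
    qed
    then have "K\<^sup>2 \<le> (m * a)\<^sup>2" by (simp add: K power_mult_distrib)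
    then show ?thesis by (rule power2_le_imp_le) (use m a in simp)
  qed
  \<comment> \<open>Using 2 \<le> l K and K \<le> m a, the irrational sum 2 a + K^2 is bounded by (l
    + m) K a, and the factor K is what converts y into Y.\<close>
  have t2: "(2 * a + \<kappa>) / (2 * (N - 2)) * w \<le> c2 * X\<^sup>2 * Y"
  proof -
    have w': "w \<le> c1 * (y * x\<^sup>2)"
    proof -
      have "(N - 1) * w\<^sup>2 \<le> (2 * (N - 2)) * (y * x\<^sup>2)\<^sup>2" using w by (simp add: power_mult_distrib mult.assoc)
      also have "\<dots> \<le> ((N - 1) * c1\<^sup>2) * (y * x\<^sup>2)\<^sup>2" using c1(2) by (intro mult_right_mono) auto
      finally have "(N - 1) * w\<^sup>2 \<le> (N - 1) * (c1 * (y * x\<^sup>2))\<^sup>2" by (simp add: power_mult_distrib)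
      then have "w\<^sup>2 \<le> (c1 * (y * x\<^sup>2))\<^sup>2" using N by simp
      then show ?thesis by (rule power2_le_imp_le) (use c1 xy in simp)
    qed
    have "2 * a + \<kappa> \<le> (l + m) * K * a"
    proof -
      have "2 * a \<le> l * K * a" using lK a by (intro mult_right_mono) auto
      moreover have "\<kappa> \<le> (m * a) * K"
        unfolding K(2)[symmetric] power2_eq_square using mK K(1) by (intro mult_right_mono) auto
      moreover have "(l + m) * K * a = l * K * a + (m * a) * K" by (simp add: algebra_simps)
      ultimately show ?thesis by linarith
    qed
    have "(2 * a + \<kappa>) / (2 * (N - 2)) * w \<le> (2 * a + \<kappa>) / (2 * (N - 2)) * (c1 * (y * x\<^sup>2))"
      using w' a \<kappa>0 N by (intro mult_left_mono) auto
    also have "\<dots> \<le> (l + m) * K * a / (2 * (N - 2)) * (c1 * (y * x\<^sup>2))"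
      using \<open>2 * a + \<kappa> \<le> (l + m) * K * a\<close> N c1 xy by (intro mult_right_mono divide_right_mono) auto
    also have "\<dots> = c2 * X\<^sup>2 * Y"
    proof -
      have "(l + m) * K * a / (2 * D) * (c1 * (y * x\<^sup>2)) = (l + m) * c1 / 2 * (a / D * x\<^sup>2) * (K * y)" if "D > 0" for D
        using that by (simp add: field_simps)
      from this[of "N - 2"] show ?thesis unfolding X2 Y_def c2_def using N by simp
    qed
    finally show ?thesis .
  qed
  \<comment> \<open>Since \<kappa> y^3 = Y^3 / K, the bound 1 / K \<le> l / 2 gives the coefficient
    \<open>cW\<close>.\<close>
  have t3: "\<kappa> * TW \<le> cW * Y ^ 3"
  proof -
    have "\<kappa> * TW \<le> \<kappa> * ((1 + 2 * c1) * y ^ 3)" using TW \<kappa>0 by (intro mult_left_mono) auto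
    also have "\<dots> = ((1 + 2 * c1) * y ^ 3 * \<kappa>) * 1" by simp
    also have "\<dots> \<le> ((1 + 2 * c1) * y ^ 3 * \<kappa>) * (l * K / 2)"
      using lK c1 xy \<kappa>0 by (intro mult_left_mono) auto
    also have "\<dots> = cW * Y ^ 3"
      unfolding cW_def Y_def power_mult_distrib K(2)[symmetric] by (simp add: power3_eq_cube power2_eq_square)
    finally show ?thesis .
  qed
  show ?thesis using main t1 t2 t3 unfolding lhs by linarith
qed

end

section \<open>Admissible constants in each dimension\<close>

text \<open>The choice of r makes 2 N (N - 1) / r^2 equal to 1 / N. The constant \<open>c1\<close>
  lies just above sqrt 2, while \<open>l\<close>, \<open>m\<close>, \<open>c3\<close> and
  \<open>q\<close> are rounded from their requirements at N = 11, the worst case. With g = 1 and s =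
  0 the crude bound X \<le> Z suffices in this range.\<close>

lemma pinching_constants_ge_11:
  assumes N: "N \<ge> (11::real)"
  shows "pinching_constants N (N * sqrt (2 * (N - 1))) (14143/10000) (903/1000) (834/1000) (157/100 / sqrt (2 * (N - 1)))
     (92/100 * sqrt (2 * (N - 1))) 1 0"
proof -
  define t where "t = sqrt (2 * (N - 1))"
  have t: "t > 0" "t\<^sup>2 = 2 * (N - 1)" using N by (simp_all add: t_def)
  have e: "2 * N * (N - 1) / (N * t)\<^sup>2 = 1 / N"
    unfolding power_mult_distrib t(2) using N by (simp add: field_simps power2_eq_square)
  have N2: "N\<^sup>2 \<ge> 11 * N" using N by (simp add: power2_eq_square)
  have iN: "1 / N \<le> 1 / 11" using N by (simp add: field_simps)
  define a where "a = N / 4 - 1 / N"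
  have a: "a \<ge> 11/4 - 1/11" unfolding a_def using N iN by linarith
  have aN: "a * N = N\<^sup>2 / 4 - 1" unfolding a_def using N by (simp add: field_simps power2_eq_square)
  have p1: "N * t / (N * (N - 1)) = 2 / t"
  proof -
    have "N * t / (N * (N - 1)) = t / (N - 1)" using N by simp
    also have "\<dots> = 2 / t" using N t(1) t(2)[unfolded power2_eq_square] by (simp add: frac_eq_eq)
    finally show ?thesis .
  qed
  have p2: "(N - 2) / (a * (N * t)) \<ge> 0" using N a t by simp
  have "pinching_constants N (N * t) (14143/10000) (903/1000) (834/1000) (157/100 / t) (92/100 * t) 1 0"
  proof (unfold_locales, unfold e a_def[symmetric] p1)
    show "4 \<le> (903 / 1000)\<^sup>2 * ((N - 1) / 2 - 1 / N)"
    proof -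
      have "(N - 1) / 2 - 1 / N \<ge> 5 - 1 / 11" using N iN by (intro diff_mono) auto
      then have "(903 / 1000)\<^sup>2 * (5 - 1 / 11) \<le> (903 / 1000)\<^sup>2 * ((N - 1) / 2 - 1 / N)"
        by (intro mult_left_mono) auto
      then show ?thesis by (rule order_trans[rotated]) (simp add: power2_eq_square)
    qed
    show "(N - 2) / 4 + a \<le> (834 / 1000)\<^sup>2 * a\<^sup>2"
    proof -
      have "(N - 2) / 4 = a + 1 / N - 1 / 2" by (simp add: a_def field_simps)
      \<comment> \<open>The tangent to a^2 at 117/44 = 11/4 - 1/11, the value of a for N = 11, makes
        the inequality linear in a.\<close>
      moreover have "2 * (117/44) * a - (117/44) * (117/44) \<le> a * a"
        using zero_le_square[of "a - 117/44"] by (simp add: algebra_simps)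
      ultimately show ?thesis using a iN unfolding power2_eq_square by linarith
    qed
    show "4 * (N - 2) \<le> (157 / 100 / t)\<^sup>2 * a * (N * (N - 1))"
    proof -
      have "(157 / 100 / t)\<^sup>2 * a * (N * (N - 1)) = (157/100)\<^sup>2 / 2 * (a * N)"
        unfolding power_divide t(2) using N by (simp add: field_simps)
      also have "\<dots> = (157/100)\<^sup>2 / 8 * ((N - 2) * (N + 2))" proof -
        have "k / 2 * (N * N / 4 - 1) = k / 8 * ((N - 2) * (N + 2))" for k by (simp add: algebra_simps)
        then show ?thesis unfolding aN power2_eq_square[of N] by blast
      qed
      also have "\<dots> \<ge> (157/100)\<^sup>2 / 8 * ((N - 2) * 13)" using N by (intro mult_left_mono) auto
      moreover have "(157/100)\<^sup>2 / 8 * ((N - 2) * 13) \<ge> 4 * (N - 2)" using N by (simp add: power2_eq_square)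
      ultimately show ?thesis by linarith
    qed
    show "N * (N - 1) * (N - 2) * (N / 4 + 1 / N) \<le> (a * (N * t))\<^sup>2"
    proof -
      have "(a * (N * t))\<^sup>2 = 2 * (N - 1) * (a * N)\<^sup>2" by (simp add: power_mult_distrib t)
      also have "\<dots> = (N - 1) * ((N\<^sup>2 - 4) * (N\<^sup>2 - 4) / 8)" unfolding aN by (simp add: power2_eq_square field_simps)
      finally have r: "(a * (N * t))\<^sup>2 = (N - 1) * ((N\<^sup>2 - 4) * (N\<^sup>2 - 4) / 8)" .
      have l: "N * (N - 1) * (N - 2) * (N / 4 + 1 / N) = (N - 1) * ((N - 2) * (N\<^sup>2 + 4) / 4)"
        using N by (simp add: field_simps power2_eq_square)
      have "2 * ((N - 2) * (N\<^sup>2 + 4)) \<le> (N\<^sup>2 - 4) * (N\<^sup>2 - 4)"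
      proof -
        have "2 * (N\<^sup>2 + 4) \<le> (N + 2) * (N\<^sup>2 - 4)"
        proof -
          have "13 * (N\<^sup>2 - 4) \<le> (N + 2) * (N\<^sup>2 - 4)" using N N2 by (intro mult_right_mono) auto
          moreover have "2 * (N\<^sup>2 + 4) \<le> 13 * (N\<^sup>2 - 4)" using power_mono[OF N, of 2] by simp
          ultimately show ?thesis by (rule order_trans[rotated])
        qed
        then have "(N - 2) * (2 * (N\<^sup>2 + 4)) \<le> (N - 2) * ((N + 2) * (N\<^sup>2 - 4))" using N by (intro mult_left_mono) auto
        then show ?thesis by (simp add: power2_eq_square algebra_simps)
      qed
      then show ?thesis unfolding l r using N by (intro mult_left_mono) auto
    qed
    show "(92/100 * t)\<^sup>2 + ((1 + 2 * (14143/10000)) * (903/1000) / 2)\<^sup>2 \<le> (N * t / N)\<^sup>2"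
    proof -
      have "N * t / N = t" using N by simp
      moreover have "(92/100)\<^sup>2 * (2 * (N - 1)) + ((1 + 2 * (14143/10000)) * (903/1000) / 2)\<^sup>2 \<le> 2 * (N - 1)"
        using N by (simp add: power2_eq_square field_simps)
      ultimately show ?thesis by (simp only: power_mult_distrib[of _ t] t(2))
    qed
    show "157/100 / t \<le> (2 / t + (N - 2) / (a * (N * t))) * 1"
    proof -
      have "157/100 / t \<le> 2 / t" using t by (intro divide_right_mono) auto
      from add_mono[OF this p2] show ?thesis by simp
    qed
    show "((903/1000 + 834/1000) * (14143/10000) / 2 - (2 / t + (N - 2) / (a * (N * t))) * 0)\<^sup>2
       \<le> 4 * ((2 / t + (N - 2) / (a * (N * t))) * 1 - 157/100 / t) * (92/100 * t)"
    proof -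
      have "4 * (2 / t - 157/100 / t) * (92/100 * t) \<le> 4 * ((2 / t + (N - 2) / (a * (N * t))) * 1 - 157/100 / t) *
          (92/100 * t)"
        using p2 t by (intro mult_right_mono mult_left_mono) auto
      moreover have "4 * (2 / t - 157/100 / t) * (92/100 * t) = 4 * (43/100) * (92/100)"
        using t by (simp add: field_simps)
      ultimately show ?thesis by (simp add: power2_eq_square)
    qed
  qed (use N t a in \<open>auto simp: power2_eq_square\<close>)
  then show ?thesis by (simp add: t_def)
qed

text \<open>In each case r is rounded so that 2 N (N - 1) / r^2 lies slightly above
  \<open>epsilon N\<close>. The pairs (g, s) come from Pythagorean triples, so g^2 + s^2 = 1 holds
  exactly and all conditions are comparisons of rationals.\<close>

lemma pinching_constants_small:
  "pinching_constants 4 (1303/100) (29/25) (43/25) (34/25) (89/100) (39/25) (12/13) (5/13)"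
  "pinching_constants 5 (359/20) (5/4) (3/2) (5/4) (3/4) (12/5) (24/25) (7/25)"
  "pinching_constants 6 (457/20) (13/10) (13/10) (23/20) (13/20) 3 (24/25) (7/25)"
  "pinching_constants 7 (277/10) (13/10) (6/5) (11/10) (3/5) (33/10) (40/41) (9/41)"
  "pinching_constants 8 (163/5) (7/5) (11/10) 1 (1/2) (17/5) (40/41) (9/41)"
  "pinching_constants 9 (751/20) (27/20) (21/20) (19/20) (9/20) (73/20) (40/41) (9/41)"
  "pinching_constants 10 (212/5) (7/5) 1 (9/10) (2/5) (37/10) (40/41) (9/41)"
  by (unfold_locales; simp add: power2_eq_square)+

lemma pinching_constants_exist:
  fixes n :: nat
  assumes n: "n \<ge> 4"
  obtains r c1 l m c3 q g s where "pinching_constants (real n) r c1 l m c3 q g s"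
    "epsilon n \<le> 2 * real n * (real n - 1) / r\<^sup>2"
proof (cases "n \<ge> 11")
  case True
  then have "real n \<ge> 11" by simp
  note p = pinching_constants_ge_11[OF this]
  have "2 * real n * (real n - 1) / (real n * sqrt (2 * (real n - 1)))\<^sup>2 = 1 / real n"
    using \<open>real n \<ge> 11\<close> by (simp add: power_mult_distrib field_simps power2_eq_square)
  then show ?thesis using that[OF p] True by (simp add: epsilon_def)
next
  case False
  then consider "n = 4" | "n = 5" | "n = 6" | "n = 7" | "n = 8" | "n = 9" | "n = 10" using n by linarith
  then show ?thesis
  proof cases
    case 1 then show ?thesis using that[of "1303/100"] pinching_constants_small(1) by
        (simp add: epsilon_def power2_eq_square)
  next
    case 2 then show ?thesis using that[of "359/20"] pinching_constants_small(2) by (simp add: epsilon_def power2_eq_square)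
  next
    case 3 then show ?thesis using that[of "457/20"] pinching_constants_small(3) by (simp add: epsilon_def power2_eq_square)
  next
    case 4 then show ?thesis using that[of "277/10"] pinching_constants_small(4) by (simp add: epsilon_def power2_eq_square)
  next
    case 5 then show ?thesis using that[of "163/5"] pinching_constants_small(5) by (simp add: epsilon_def power2_eq_square)
  next
    case 6 then show ?thesis using that[of "751/20"] pinching_constants_small(6) by (simp add: epsilon_def power2_eq_square)
  next
    case 7 then show ?thesis using that[of "212/5"] pinching_constants_small(7) by (simp add: epsilon_def power2_eq_square)
  qed
qed

section \<open>The pinching form on the boundary of the cone\<close>

text \<open>Both parts of Q are expressed by the quadratic tensor C, known as B in Hamilton's
  evolution equation; for the square part this uses the Bianchi identity. The curvature symmetries
  of Q then reduce to the two symmetries C1 and C2.\<close>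

lemma ct_Q:
  assumes R: "R \<in> curvature_tensors"
  shows "Q R \<in> curvature_tensors"
proof -
  define C where "C i j k l = (\<Sum>p\<in>UNIV. \<Sum>q\<in>UNIV. R $ i $ p $ j $ q * R $ k $ p $ l $ q)" for i j k l
  have C1: "C i j k l = C k l i j" for i j k l by (simp add: C_def mult.commute)
  have C2: "C i j k l = C j i l k" for i j k l
  proof -
    have "C j i l k = (\<Sum>q\<in>UNIV. \<Sum>p\<in>UNIV. R $ j $ p $ i $ q * R $ l $ p $ k $ q)"
      unfolding C_def by (rule sum.swap)
    also have "\<dots> = C i j k l" unfolding C_def
      by (intro sum.cong refl arg_cong2[where f="(*)"] ct_pair[OF R])
    finally show ?thesis ..
  qed
  have b: "R $ i $ j $ p $ q = R $ i $ p $ j $ q - R $ i $ q $ j $ p" for i j p q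
    using ct_bianchi[OF R, of i j p q] ct_pair[OF R, of i q j p] ct_swap1[OF R, of j p i q]
      ct_swap1[OF R, of p i j q] ct_pair[OF R, of j p i q] ct_swap2[OF R, of i q p j] ct_pair[OF R, of p j i q]
          ct_swap1[OF R, of p j i q]
    by linarith
  have s: "1/2 * (\<Sum>p\<in>UNIV. \<Sum>q\<in>UNIV. R $ i $ j $ p $ q * R $ k $ l $ p $ q) = C i j k l - C i j l k" for i j k l
  proof -
    have e1: "(\<Sum>p\<in>UNIV. \<Sum>q\<in>UNIV. R $ i $ q $ j $ p * R $ k $ q $ l $ p) = C i j k l"
      unfolding C_def by (rule sum.swap)
    have e2: "(\<Sum>p\<in>UNIV. \<Sum>q\<in>UNIV. R $ i $ p $ j $ q * R $ k $ q $ l $ p) = C i j l k"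
      unfolding C_def by (intro sum.cong refl arg_cong2[where f="(*)"] ct_pair[OF R])
    have e3: "(\<Sum>p\<in>UNIV. \<Sum>q\<in>UNIV. R $ i $ q $ j $ p * R $ k $ p $ l $ q) = C i j l k"
      unfolding e2[symmetric] by (rule sum.swap)
    have "(\<Sum>p\<in>UNIV. \<Sum>q\<in>UNIV. R $ i $ j $ p $ q * R $ k $ l $ p $ q)
      = (\<Sum>p\<in>UNIV. \<Sum>q\<in>UNIV. (R $ i $ p $ j $ q - R $ i $ q $ j $ p) * (R $ k $ p $ l $ q - R $ k $ q $ l $ p))"
      by (intro sum.cong refl arg_cong2[where f="(*)"] b)
    also have "\<dots> = C i j k l - C i j l k - C i j l k + C i j k l"
      by (simp add: algebra_simps sum.distrib sum_subtractf e1 e2 e3) (simp add: C_def)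
    finally show ?thesis by simp
  qed
  have q: "Q R $ i $ j $ k $ l = C i j k l - C i j l k + C i k j l - C i l j k" for i j k l
    unfolding Q_eq_Q_form Q_form_def vec_lambda_beta s by (simp add: C_def sum_subtractf)
  show ?thesis
  proof (rule curvature_tensorsI)
    fix i j k l
    show "Q R $ i $ j $ k $ l = - Q R $ j $ i $ k $ l"
      unfolding q using C2[of i j k l] C2[of i j l k] C1[of i k j l] C1[of i l j k] by linarith
    show "Q R $ i $ j $ k $ l = - Q R $ i $ j $ l $ k" unfolding q by simp
    show "Q R $ i $ j $ k $ l + Q R $ j $ k $ i $ l + Q R $ k $ i $ j $ l = 0"
      unfolding q using C1[of i j k l] C2[of i j l k] C1[of k i j l] C2[of i k j l] C1[of i l j k] C2[of j k l i]
          C2[of k i j l]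
        C1[of j l k i] C1[of j k i l]
      by linarith
  qed
qed

lemma ct_diff: "R \<in> curvature_tensors \<Longrightarrow> R' \<in> curvature_tensors \<Longrightarrow> R - R' \<in> curvature_tensors"
  using ct_add[OF _ ct_scaleR[of R' "-1"], of R] by simp

text \<open>The factor 1/2 gives sectional curvature 1, since the product of the identity with
  itself counts each term twice.\<close>

definition round_tensor :: "'n::finite tensor4" where "round_tensor = (1/2) *\<^sub>R kulkarni_nomizu (mat 1)"

lemma ct_round_tensor: "round_tensor \<in> curvature_tensors"
  unfolding round_tensor_def by (intro ct_scaleR ct_kulkarni_nomizu) simp

lemma ric_round_tensor: "ric (round_tensor :: 'n::finite tensor4) = (real CARD('n) - 1) *\<^sub>R mat 1"
proof -
  have "(real CARD('n) - 2) *\<^sub>R mat 1 + real CARD('n) *\<^sub>R mat 1 = (2 * (real CARD('n) - 1)) *\<^sub>R (mat 1 :: real^'n^'n)"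
    unfolding scaleR_add_left[symmetric] by (rule arg_cong2[where f=scaleR]) auto
  then show ?thesis by (simp add: round_tensor_def ric_scaleR ric_kulkarni_nomizu trace_eq_inner mat1_inner_mat1)
qed

lemma round_tensor_inner: "X \<in> curvature_tensors \<Longrightarrow> round_tensor \<bullet> X = 2 * scal X"
  by (simp add: round_tensor_def kulkarni_nomizu_inner scal_eq_inner)

lemma ric_wrt_round_tensor: "ric_wrt B round_tensor = trace B *\<^sub>R mat 1 - transpose B"
proof -
  have s: "round_tensor $ i $ j $ m $ l = mat 1 $ i $ m * mat 1 $ j $ l - mat 1 $ i $ l * mat 1 $ j $ m" for i j m l
    by (simp add: round_tensor_def kulkarni_nomizu_def algebra_simps)
  show ?thesis
    by (simp add: vec_eq_iff ric_wrt_def s transpose_nth trace_def right_diff_distrib sum_subtractf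
       mult.assoc[symmetric] sum_mat1 sum_distrib_right[symmetric])
qed

lemma pinching_form_sym: "pinching_form c X Y = pinching_form c Y X" by (simp add: pinching_form_def inner_commute)

lemma pinching_form_add: "pinching_form c X (Y + Z) = pinching_form c X Y + pinching_form c X Z" and
    pinching_form_diff: "pinching_form c X (Y - Z) = pinching_form c X Y - pinching_form c X Z"
  and pinching_form_scaleR: "pinching_form c X (r *\<^sub>R Y) = r * pinching_form c X Y"
  by (simp_all add: pinching_form_def ric_add ric_diff ric_scaleR inner_add_right inner_diff_right algebra_simps
      add_divide_distrib diff_divide_distrib)

section \<open>Scalar, traceless Ricci and Weyl parts\<close>

locale curvature_decomposition =
  fixes R :: "'n::finite tensor4" and N :: real
  assumes R: "R \<in> curvature_tensors" and n: "CARD('n) \<ge> 4" and N_def: "N = real CARD('n)"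
begin

definition "Ric0 = ric R - (scal R / N) *\<^sub>R mat 1"
text \<open>The Schouten tensor, written in terms of the two parts of Ric: its product with the
  identity metric has the Ricci tensor of R, so \<open>Weyl\<close> has none.\<close>

definition "Sch = (1 / (N - 2)) *\<^sub>R Ric0 + (scal R / (2 * N * (N - 1))) *\<^sub>R mat 1"
definition "Weyl = R - kulkarni_nomizu Sch"

lemma N: "N \<ge> 4" using n by (simp add: N_def)

lemma Ric0_sym: "transpose Ric0 = Ric0"
  by (simp add: Ric0_def transpose_diff transpose_scalar ric_sym[OF R])

lemma mat1_mat1: "mat 1 \<bullet> (mat 1 :: real^'n^'n) = N" by (simp add: mat1_inner_mat1 N_def)

lemma Ric0_trace: "mat 1 \<bullet> Ric0 = 0" "Ric0 \<bullet> mat 1 = 0"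
  using N by (simp_all add: Ric0_def inner_diff_right inner_diff_left mat1_mat1 scal_eq_inner inner_commute)

lemma Sch_sym: "transpose Sch = Sch"
  by (simp add: Sch_def transpose_add transpose_scalar Ric0_sym)

lemma Weyl: "Weyl \<in> curvature_tensors"
  unfolding Weyl_def by (intro ct_diff R ct_kulkarni_nomizu Sch_sym)

lemma ric_kulkarni_nomizu_Sch: "ric (kulkarni_nomizu Sch) = ric R"
proof -
  have t: "trace Sch = scal R / (2 * (N - 1))"
    using N by (simp add: trace_eq_inner Sch_def inner_add_right Ric0_trace mat1_mat1 field_simps)
  have "ric (kulkarni_nomizu Sch) = (N - 2) *\<^sub>R Sch + (scal R / (2 * (N - 1))) *\<^sub>R mat 1"
    using ric_kulkarni_nomizu[of Sch] unfolding t N_def[symmetric] .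
  also have "(N - 2) *\<^sub>R Sch = Ric0 + ((N - 2) * (scal R / (2 * N * (N - 1)))) *\<^sub>R mat 1"
    using N by (simp add: Sch_def scaleR_add_right)
  also have "Ric0 + ((N - 2) * (scal R / (2 * N * (N - 1)))) *\<^sub>R mat 1 + (scal R / (2 * (N - 1))) *\<^sub>R mat 1
    = Ric0 + (scal R / N) *\<^sub>R mat 1"
  proof -
    have "(N - 2) * (scal R / (2 * N * (N - 1))) + scal R / (2 * (N - 1)) = scal R / N"
    proof -
      have "(D - 1) * (u / (2 * (D + 1) * D)) + u / (2 * D) = u / (D + 1)" if "D > 0" for D u :: real
        using that by (simp add: divide_simps) (simp add: algebra_simps)
      from this[of "N - 1"] show ?thesis using N by simp
    qed
    then show ?thesis by (simp add: add.assoc scaleR_add_left[symmetric])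
  qed
  finally show ?thesis by (simp add: Ric0_def)
qed

lemma ric_Weyl: "ric Weyl = 0"
  by (simp add: Weyl_def ric_diff ric_kulkarni_nomizu_Sch)

lemma ric_decomp: "ric R = Ric0 + (scal R / N) *\<^sub>R mat 1"
  by (simp add: Ric0_def)

lemma ric_norm: "ric R \<bullet> ric R = Ric0 \<bullet> Ric0 + (scal R)\<^sup>2 / N"
  using N unfolding ric_decomp by (simp add: inner_add_left inner_add_right Ric0_trace mat1_mat1 power2_eq_square)

lemma Sch_inner: "Sch \<bullet> ric R = Ric0 \<bullet> Ric0 / (N - 2) + (scal R)\<^sup>2 / (2 * N * (N - 1))"
proof -
  have "Sch \<bullet> ric R = Sch \<bullet> Ric0 + (scal R / N) * (mat 1 \<bullet> Sch)"
    unfolding ric_decomp by (simp add: inner_add_right inner_commute)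
  then show ?thesis
    using N by (simp add: Sch_def inner_add_left inner_add_right Ric0_trace mat1_mat1 power2_eq_square)
qed

lemma R_norm: "R \<bullet> R = Weyl \<bullet> Weyl + 4 * (Ric0 \<bullet> Ric0 / (N - 2) + (scal R)\<^sup>2 / (2 * N * (N - 1)))"
proof -
  have RW: "Weyl + kulkarni_nomizu Sch = R" by (simp add: Weyl_def)
  have "(Weyl + kulkarni_nomizu Sch) \<bullet> (Weyl + kulkarni_nomizu Sch) = Weyl \<bullet> Weyl + 2 *
      (kulkarni_nomizu Sch \<bullet> Weyl) + kulkarni_nomizu Sch \<bullet> kulkarni_nomizu Sch"
    by (simp add: inner_add_left inner_add_right inner_commute[of Weyl "kulkarni_nomizu Sch"])
  then have "R \<bullet> R = Weyl \<bullet> Weyl + 2 * (kulkarni_nomizu Sch \<bullet> Weyl) + kulkarni_nomizu Sch \<bullet> kulkarni_nomizu Sch"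
    unfolding RW .
  moreover have "kulkarni_nomizu Sch \<bullet> Weyl = 0" by (simp add: kulkarni_nomizu_inner[OF Weyl] ric_Weyl)
  moreover have "kulkarni_nomizu Sch \<bullet> kulkarni_nomizu Sch = 4 * (Sch \<bullet> ric R)" by
      (simp add: kulkarni_nomizu_inner[OF ct_kulkarni_nomizu[OF Sch_sym]] ric_kulkarni_nomizu_Sch)
  ultimately show ?thesis by (simp add: Sch_inner)
qed

context
  fixes a \<kappa> \<alpha> :: real
  assumes \<kappa>: "\<kappa> = (N - 2) / 4 + a" and \<alpha>: "\<alpha> = (N - 4 * a) / (8 * N * (N - 1))"
begin

lemma pinching_form_decomp: "pinching_form \<kappa> R R = \<alpha> * (scal R)\<^sup>2 - a * (Ric0 \<bullet> Ric0) / (N - 2) - \<kappa> * (Weyl \<bullet> Weyl / 4)"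
proof -
  \<comment> \<open>Stated for independent D and M so that N - 1 and N - 2 remain atomic when
    denominators are cleared.\<close>
  have "(h + s / N - (D / 4 + a) * (w + 4 * (h / D + s / (2 * N * M)))) / 4
    = (N - 4 * a) / (8 * N * M) * s - a * h / D - (D / 4 + a) * (w / 4)"
    if "D > 0" "M > 0" "D = N - 2" "M = N - 1" for h s w D M
  proof -
    have "(1 / (M + 1) - ((M - 1) / 4 + a) * (4 / (2 * (M + 1) * M))) / 4 = (M + 1 - 4 * a) / (8 * (M + 1) * M)"
      using that(2) by (simp add: divide_simps) (simp add: algebra_simps)
    moreover have "M + 1 = N" "M - 1 = D" using that(3,4) by simp_all
    ultimately have "(1 / N - (D / 4 + a) * (4 / (2 * N * M))) / 4 = (N - 4 * a) / (8 * N * M)"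
      by (simp only:)
    then have E: "(N - 4 * a) / (8 * N * M) * s = (1 / N - (D / 4 + a) * (4 / (2 * N * M))) / 4 * s"
      by (simp only:)
    have "(D * k + s * i - (D / 4 + a) * (w + 4 * (k + s * q))) / 4
       = (i - (D / 4 + a) * (4 * q)) / 4 * s - a * k - (D / 4 + a) * (w / 4)" for i k q
      by (simp add: algebra_simps add_divide_distrib diff_divide_distrib)
    from this[of "h / D" "1 / N" "1 / (2 * N * M)"] show ?thesis
      unfolding E using that by simp
  qed
  from this[of "N - 2" "N - 1"] show ?thesis unfolding pinching_form_def ric_norm R_norm \<kappa> \<alpha> using N by simp
qed

text \<open>In the expansion of R into Weyl part and product part, the term with two Weyl factors
  and one product factor vanishes: it is a contraction with the Ricci tensor of Q Weyl, which is 0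
  by \<open>ric_Q\<close>. The term with one Weyl factor gives W(h, h), and the pairing of the
  product part with Q R is evaluated from the Ricci tensor of Q R.\<close>

lemma R_cubic: "R \<bullet> Q R = Weyl \<bullet> Q Weyl + 2 / (N - 2) * (Ric0 \<bullet> ric_wrt Ric0 Weyl) + 4 * (Sch \<bullet> ric_wrt (ric R) R)"
proof -
  interpret q: bounded_bilinear Q_form by (rule bounded_bilinear_Q_form)
  interpret r: bounded_bilinear ric_wrt by (rule bounded_bilinear_ric_wrt)
  define K where "K = kulkarni_nomizu Sch"
  have K: "K \<in> curvature_tensors" unfolding K_def by (rule ct_kulkarni_nomizu[OF Sch_sym])
  have RWK: "Weyl + K = R" by (simp add: Weyl_def K_def)
  have e: "K \<bullet> X = 4 * (Sch \<bullet> ric X)" if "X \<in> curvature_tensors" for X unfolding K_def by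
      (rule kulkarni_nomizu_inner[OF that])
  have "R \<bullet> Q R = Weyl \<bullet> Q R + K \<bullet> Q R" by (metis RWK inner_add_left)
  also have "K \<bullet> Q R = 4 * (Sch \<bullet> ric_wrt (ric R) R)" by (simp add: e[OF ct_Q[OF R]] ric_Q[OF R])
  also have "Weyl \<bullet> Q R = Weyl \<bullet> Q Weyl + 2 * (Weyl \<bullet> Q_form K Weyl) + Weyl \<bullet> Q_form K K"
  proof -
    have "Weyl \<bullet> Q_form (Weyl + K) (Weyl + K) = Weyl \<bullet> Q_form Weyl Weyl + 2 * (Weyl \<bullet> Q_form K Weyl) + Weyl \<bullet> Q_form K K"
      using inner_Q_form_swap12(2)[OF Weyl K Weyl] by (simp add: q.add_left q.add_right inner_add_right)
    then show ?thesis unfolding RWK Q_eq_Q_form .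
  qed
  also have "Weyl \<bullet> Q_form K Weyl = 0"
    unfolding inner_Q_form_swap12(1)[OF K Weyl Weyl] Q_eq_Q_form[symmetric]
    by (simp add: e[OF ct_Q[OF Weyl]] ric_Q[OF Weyl] ric_Weyl r.zero_left)
  also have "Weyl \<bullet> Q_form K K = 2 / (N - 2) * (Ric0 \<bullet> ric_wrt Ric0 Weyl)"
  proof -
    have ct2: "Q_form K Weyl + Q_form Weyl K \<in> curvature_tensors"
    proof -
      have "Q_form K Weyl + Q_form Weyl K = Q (K + Weyl) - Q K - Q Weyl"
        by (simp add: Q_eq_Q_form q.add_left q.add_right)
      then show ?thesis by (simp add: ct_diff ct_Q ct_add K Weyl)
    qed
    have "2 * (Weyl \<bullet> Q_form K K) = K \<bullet> (Q_form Weyl K + Q_form K Weyl)"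
      using inner_Q_form_swap12(1)[OF K K Weyl] inner_Q_form_swap12(2)[OF K Weyl K] by (simp add: inner_add_right)
    also have "\<dots> = 4 * (Sch \<bullet> (ric_wrt (ric R) Weyl))"
      using e[OF ct2] ric_Q_form[OF K Weyl] by
          (simp add: add.commute ric_Weyl r.zero_left, simp add: K_def ric_kulkarni_nomizu_Sch)
    also have "ric_wrt (ric R) Weyl = ric_wrt Ric0 Weyl"
      unfolding ric_decomp by (simp add: r.add_left r.scaleR_left ric_eq_ric_wrt[symmetric] ric_Weyl)
    also have "Sch \<bullet> ric_wrt Ric0 Weyl = (Ric0 \<bullet> ric_wrt Ric0 Weyl) / (N - 2)"
    proof -
      have "mat 1 \<bullet> ric_wrt Ric0 Weyl = 0"
        unfolding ric_wrt_sym[OF Weyl, of "mat 1"] by (simp add: ric_eq_ric_wrt[symmetric] ric_Weyl)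
      then show ?thesis by (simp add: Sch_def inner_add_left)
    qed
    finally show ?thesis by simp
  qed
  finally show ?thesis by simp
qed

text \<open>The product part is evaluated through its pairing with \<open>wedge_square Ric0\<close>,
  for which only the Ricci contraction - h^2 of the wedge square is required.\<close>

lemma ric_wrt_kulkarni_nomizu_Sch: "Ric0 \<bullet> ric_wrt Ric0 R = Ric0 \<bullet> ric_wrt Ric0 Weyl - 2 / (N - 2) * ((Ric0 ** Ric0) \<bullet> Ric0)
    - scal R / (N * (N - 1)) * (Ric0 \<bullet> Ric0)"
proof -
  interpret r: bounded_bilinear ric_wrt by (rule bounded_bilinear_ric_wrt)
  have K: "kulkarni_nomizu Sch \<in> curvature_tensors" by (rule ct_kulkarni_nomizu[OF Sch_sym])
  have "kulkarni_nomizu Sch \<bullet> wedge_square Ric0 = - 4 * (Sch \<bullet> (Ric0 ** Ric0))"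
    by (simp add: kulkarni_nomizu_inner[OF ct_wedge_square[OF Ric0_sym]] ric_wedge_square[OF Ric0_sym]
        trace_eq_inner Ric0_trace)
  then have "Ric0 \<bullet> ric_wrt Ric0 (kulkarni_nomizu Sch) = - 2 * (Sch \<bullet> (Ric0 ** Ric0))"
    using wedge_square_inner[OF K, of Ric0] by simp
  also have "Sch \<bullet> (Ric0 ** Ric0) = ((Ric0 ** Ric0) \<bullet> Ric0) / (N - 2) + scal R / (2 * N * (N - 1)) * (Ric0 \<bullet> Ric0)"
  proof -
    have "mat 1 \<bullet> (Ric0 ** Ric0) = Ric0 \<bullet> Ric0"
      using mat_inner_mult(1)[of Ric0 Ric0 "mat 1"] Ric0_sym by (simp add: inner_commute)
    then show ?thesis by (simp add: Sch_def inner_add_left inner_commute[of Ric0 "Ric0 ** Ric0"])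
  qed
  finally have 1: "Ric0 \<bullet> ric_wrt Ric0 (kulkarni_nomizu Sch) = - 2 *
      (((Ric0 ** Ric0) \<bullet> Ric0) / (N - 2) + scal R / (2 * N * (N - 1)) * (Ric0 \<bullet> Ric0))" .
  have "R = Weyl + kulkarni_nomizu Sch" by (simp add: Weyl_def)
  then have "Ric0 \<bullet> ric_wrt Ric0 R = Ric0 \<bullet> ric_wrt Ric0 Weyl + Ric0 \<bullet> ric_wrt Ric0 (kulkarni_nomizu Sch)"
    by (metis r.add_right inner_add_right)
  moreover have "- 2 * (t / (N - 2) + u / (2 * N * (N - 1)) * x) = - (2 / (N - 2) * t) - u / (N * (N - 1)) * x" for t u x
    by (simp add: distrib_left mult.assoc)
  ultimately show ?thesis unfolding 1 by simp
qed

text \<open>The multiple (scal / N) P(R, R) is split off because it absorbs the pure scal^3 term and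
  vanishes on the boundary. What remains has a sign except for the three cubic terms.\<close>

lemma pinching_form_Q:
  "pinching_form \<kappa> R (Q R) = scal R * (a * (Ric0 \<bullet> Ric0) / (N * (N - 1) * (N - 2)) + \<alpha> * (Ric0 \<bullet> Ric0) + \<kappa> *
      (Weyl \<bullet> Weyl / 4) / N)
     + 2 * a / (N - 2)\<^sup>2 * ((Ric0 ** Ric0) \<bullet> Ric0) - (2 * a + \<kappa>) / (2 * (N - 2)) * (Ric0 \<bullet> ric_wrt Ric0 Weyl)
     - \<kappa> * (Weyl \<bullet> Q Weyl / 4) + scal R / N * pinching_form \<kappa> R R"
proof -
  interpret r: bounded_bilinear ric_wrt by (rule bounded_bilinear_ric_wrt)
  define x where "x = Ric0 \<bullet> Ric0"
  define s where "s = scal R"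
  define w where "w = Ric0 \<bullet> ric_wrt Ric0 Weyl"
  define t where "t = (Ric0 ** Ric0) \<bullet> Ric0"
  define u where "u = Ric0 \<bullet> ric_wrt Ric0 R"
  define y where "y = Weyl \<bullet> Weyl"
  define T where "T = Weyl \<bullet> Q Weyl"
  have u: "u = w - 2 / (N - 2) * t - s / (N * (N - 1)) * x"
    unfolding u_def w_def t_def s_def x_def by (rule ric_wrt_kulkarni_nomizu_Sch)
  have one: "mat 1 \<bullet> ric_wrt B R = ric R \<bullet> B" for B
    unfolding ric_wrt_sym[OF R, of "mat 1"] by (simp add: ric_eq_ric_wrt[symmetric] inner_commute)
  have h_ric: "Ric0 \<bullet> ric_wrt (ric R) R = u + s / N * x"
  proof -
    have "Ric0 \<bullet> ric_wrt (ric R) R = u + (s / N) * (Ric0 \<bullet> ric R)"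
      by (subst ric_decomp) (simp add: r.add_left r.scaleR_left inner_add_right u_def s_def ric_eq_ric_wrt[symmetric])
    also have "Ric0 \<bullet> ric R = x" unfolding ric_decomp by (simp add: inner_add_right Ric0_trace x_def)
    finally show ?thesis .
  qed
  have rn: "ric R \<bullet> ric R = x + s\<^sup>2 / N" unfolding x_def s_def by (rule ric_norm)
  have "ric R \<bullet> ric_wrt (ric R) R = Ric0 \<bullet> ric_wrt (ric R) R + (s / N) * (mat 1 \<bullet> ric_wrt (ric R) R)"
    by (subst (1) ric_decomp) (simp add: inner_add_left s_def)
  then have rr: "ric R \<bullet> ric_wrt (ric R) R = u + s / N * x + s / N * (x + s\<^sup>2 / N)"
    unfolding h_ric one rn .
  have sr: "Sch \<bullet> ric_wrt (ric R) R = (u + s / N * x) / (N - 2) + s / (2 * N * (N - 1)) * (x + s\<^sup>2 / N)"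
    by (simp add: Sch_def inner_add_left h_ric one rn s_def)
  have "pinching_form \<kappa> R (Q R) = (u + s / N * x + s / N * (x + s\<^sup>2 / N)
     - \<kappa> * (T + 2 / (N - 2) * w + 4 * ((u + s / N * x) / (N - 2) + s / (2 * N * (N - 1)) * (x + s\<^sup>2 / N)))) / 4"
    unfolding pinching_form_def ric_Q[OF R] R_cubic rr sr T_def w_def ..
  also have "\<dots> = s * (a * x / (N * (N - 1) * (N - 2)) + \<alpha> * x + \<kappa> * (y / 4) / N)
     + 2 * a / (N - 2)\<^sup>2 * t - (2 * a + \<kappa>) / (2 * (N - 2)) * w
     - \<kappa> * (T / 4) + s / N * (\<alpha> * s\<^sup>2 - a * x / (N - 2) - \<kappa> * (y / 4))"
  proof -
    \<comment> \<open>With the reciprocals as variables and partial fractions for their products,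
      the comparison of coefficients c1 to c4 becomes linear rewriting.\<close>
    define i where "i = 1 / N"
    define j where "j = 1 / (N - 1)"
    define k where "k = 1 / (N - 2)"
    have ijk: "i * N = 1" "j * (N - 1) = 1" "k * (N - 2) = 1" using N by (simp_all add: i_def j_def k_def)
    have "2 * a / (N - 2)\<^sup>2 = 2 * a * (k * k)" "(2 * a + \<kappa>) / (2 * (N - 2)) = (2 * a + \<kappa>) * k / 2"
       "2 / (N - 2) = 2 * k" "\<And>z. z / (N - 2) = z * k" "\<And>z. z / N = z * i" "\<And>z. z / (2 * N * (N - 1)) = z * (i * j) / 2"
       "\<And>z. z / (N * (N - 1) * (N - 2)) = z * (i * j * k)" "\<And>z. z / (N * (N - 1)) = z * (i * j)"
       and al: "\<alpha> = (N - 4 * a) * (i * j) / 8"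
      by (simp_all add: i_def j_def k_def \<alpha> power2_eq_square)
    note d = this
    have i: "N * i = 1" "N * j = 1 + j" "N * k = 1 + 2 * k" using ijk by (simp_all add: algebra_simps)
    have pf: "i * j = j - i" "i * k = (k - i) / 2" "j * k = k - j" using N by (simp_all add: i_def j_def k_def field_simps)
    have il: "N * (i * u) = u" "N * (j * u) = u + j * u" "N * (k * u) = u + 2 * (k * u)"
      "i * (j * u) = j * u - i * u" "i * (k * u) = (k * u - i * u) / 2" "j * (k * u) = k * u - j * u" for u
      unfolding mult.assoc[symmetric] i pf by (simp_all add: algebra_simps)
    define z where "z = a"
    have \<kappa>z: "\<kappa> = (N - 2) / 4 + z" and alz: "\<alpha> = (N - 4 * z) * (i * j) / 8" by (simp_all add: \<kappa> al z_def)
    have c1: "(1 - \<kappa> * (6 * k)) / 4 = - ((2 * z + \<kappa>) * k / 2)"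
      unfolding \<kappa>z by (simp add: algebra_simps i il pf diff_divide_distrib add_divide_distrib)
    have c2: "(\<kappa> * (8 * k * k) - 2 * k) / 4 = 2 * z * (k * k)"
      unfolding \<kappa>z by (simp add: algebra_simps i il pf diff_divide_distrib add_divide_distrib)
    have c3: "(2 * i - i * j - \<kappa> * (4 * (i - i * j) * k + 2 * i * j)) / 4 = z * (i * j * k) + \<alpha> - z * i * k"
      unfolding \<kappa>z alz by (simp add: algebra_simps i il pf diff_divide_distrib add_divide_distrib)
    have c4: "(i * i - \<kappa> * (2 * i * j * i)) / 4 = i * \<alpha>"
      unfolding \<kappa>z alz by (simp add: algebra_simps i il pf diff_divide_distrib add_divide_distrib)
    note c = c1[unfolded z_def] c2[unfolded z_def] c3[unfolded z_def] c4
    have "(w - 2 * k * t - s * (i * j) * x + s * i * x + s * i * (x + s\<^sup>2 * i)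
       - \<kappa> * (T + 2 * k * w + 4 * ((w - 2 * k * t - s * (i * j) * x + s * i * x) * k + s * (i * j) / 2 * (x + s\<^sup>2 * i)))) / 4
      = w * ((1 - \<kappa> * (6 * k)) / 4) + t * ((\<kappa> * (8 * k * k) - 2 * k) / 4)
       + s * x * ((2 * i - i * j - \<kappa> * (4 * (i - i * j) * k + 2 * i * j)) / 4)
       + s * s * s * ((i * i - \<kappa> * (2 * i * j * i)) / 4) - \<kappa> * (T / 4)"
      unfolding power2_eq_square by (simp add: algebra_simps add_divide_distrib diff_divide_distrib)
    also have "\<dots> = s * (a * x * (i * j * k) + \<alpha> * x + \<kappa> * (y / 4) * i) + 2 * a * (k * k) * t
       - (2 * a + \<kappa>) * k / 2 * w - \<kappa> * (T / 4) + s * i * (\<alpha> * s\<^sup>2 - a * x * k - \<kappa> * (y / 4))"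
      unfolding c power2_eq_square by (simp add: algebra_simps)
    finally show ?thesis unfolding d u .
  qed
  finally show ?thesis unfolding pinching_form_decomp x_def s_def w_def t_def y_def T_def .
qed

end

end

section \<open>Consequences for the boundary of the cone and the signature of the form\<close>

lemma pinching_form_boundary:
  fixes R :: "'n::finite tensor4"
  assumes R: "R \<in> curvature_tensors" and n: "CARD('n) \<ge> 4"
    and a: "real CARD('n) / 4 - epsilon CARD('n) \<le> a" "a < real CARD('n) / 4"
    and P: "pinching_form ((real CARD('n) - 2) / 4 + a) R R = 0" and s: "scal R > 0"
  shows "pinching_form ((real CARD('n) - 2) / 4 + a) R (Q R) \<ge> 0"
proof -
  define N where "N = real CARD('n)"
  have ab: "0 < N / 4 - a" "N / 4 - a \<le> epsilon CARD('n)" using a by (simp_all add: N_def)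
  interpret curvature_decomposition R N by standard (use R n N_def in auto)
  obtain r c1 l m c3 q g s' where pc: "pinching_constants N r c1 l m c3 q g s'"
    and e: "epsilon CARD('n) \<le> 2 * N * (N - 1) / r\<^sup>2"
    using pinching_constants_exist[OF n] unfolding N_def by metis
  interpret pinching_constants N r c1 l m c3 q g s' by (rule pc)
  define \<kappa> where "\<kappa> = (N - 2) / 4 + a"
  define \<alpha> where "\<alpha> = (N - 4 * a) / (8 * N * (N - 1))"
  define x where "x = norm Ric0"
  define y where "y = norm Weyl / 2"
  define \<nu> where "\<nu> = sqrt (x\<^sup>2 / (N * (N - 1)))"
  have x2: "Ric0 \<bullet> Ric0 = x\<^sup>2" by (simp add: x_def power2_norm_eq_inner)
  have y2: "Weyl \<bullet> Weyl = 4 * y\<^sup>2" by (simp add: y_def power_divide power2_norm_eq_inner)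
  have \<nu>: "\<nu> \<ge> 0" "N * (N - 1) * \<nu>\<^sup>2 = x\<^sup>2" using N by (simp_all add: \<nu>_def)
  have tr: "trace Ric0 = 0" by (simp add: trace_eq_inner Ric0_trace)
  have P0: "pinching_form \<kappa> R R = 0" using P by (simp add: \<kappa>_def N_def)
  have eq: "\<alpha> * (scal R)\<^sup>2 = a * x\<^sup>2 / (N - 2) + \<kappa> * y\<^sup>2"
    using P0 unfolding pinching_form_decomp[OF \<kappa>_def \<alpha>_def] x2 y2 by simp
  have w: "(N - 1) * (Ric0 \<bullet> ric_wrt Ric0 Weyl)\<^sup>2 \<le> 2 * (N - 2) * y\<^sup>2 * (x\<^sup>2)\<^sup>2"
  proof -
    have "2 * ((N - 1) * (Ric0 \<bullet> ric_wrt Ric0 Weyl)\<^sup>2) \<le> 2 * (2 * (N - 2) * y\<^sup>2 * (x\<^sup>2)\<^sup>2)"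
      using weyl_ricci_bound[OF _ Weyl ric_Weyl Ric0_sym tr] n unfolding x2 y2 N_def[symmetric]
      by (simp only: mult_ac) simp
    then show ?thesis by simp
  qed
  have t: "- ((Ric0 ** Ric0) \<bullet> Ric0) \<le> (N - 2) * \<nu> * x\<^sup>2"
    using traceless_cubic_bound[OF _ Ric0_sym tr \<nu>(1)] n \<nu>(2) unfolding x2 N_def[symmetric] by simp
  have T: "Weyl \<bullet> Q Weyl / 4 \<le> (1 + 2 * c1) * y ^ 3"
    using weyl_cubic_bound[OF n Weyl ric_Weyl c1(1) c1(2)[unfolded N_def]] unfolding y_def by (simp add: algebra_simps)
  have "0 \<le> scal R * ((a / (N * (N - 1) * (N - 2)) + \<alpha>) * x\<^sup>2 + \<kappa> * y\<^sup>2 / N)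
     + 2 * a / (N - 2)\<^sup>2 * ((Ric0 ** Ric0) \<bullet> Ric0) - (2 * a + \<kappa>) / (2 * (N - 2)) * (Ric0 \<bullet> ric_wrt Ric0 Weyl)
     - \<kappa> * (Weyl \<bullet> Q Weyl / 4)"
    by (rule cubic_inequality[OF _ _ \<alpha>_def \<kappa>_def s _ _ eq w \<nu> t T])
      (use ab e in \<open>auto simp: x_def y_def\<close>)
  also have "\<dots> = pinching_form \<kappa> R (Q R)"
    unfolding pinching_form_Q[OF \<kappa>_def \<alpha>_def] P0 x2 y2 by (simp add: distrib_right)
  finally show ?thesis by (simp add: \<kappa>_def N_def)
qed

text \<open>On the hyperplane scal = 0 only the two negative squares of
  \<open>pinching_form_decomp\<close> remain. For a > 0 both coefficients are nonzero, so the cone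
  meets this hyperplane in its apex only.\<close>

lemma pinching_form_traceless_nonpos:
  fixes R :: "'n::finite tensor4"
  assumes R: "R \<in> curvature_tensors" and n: "CARD('n) \<ge> 4" and a: "a \<ge> 0" and s: "scal R = 0"
  shows "pinching_form ((real CARD('n) - 2) / 4 + a) R R \<le> 0"
    and "a > 0 \<Longrightarrow> pinching_form ((real CARD('n) - 2) / 4 + a) R R \<ge> 0 \<Longrightarrow> R = 0"
proof -
  define N where "N = real CARD('n)"
  interpret curvature_decomposition R N by standard (use R n N_def in auto)
  define \<kappa> where "\<kappa> = (N - 2) / 4 + a"
  have k: "\<kappa> > 0" unfolding \<kappa>_def by (rule add_pos_nonneg) (use N a in auto)
  have P: "pinching_form \<kappa> R R = - (a * (Ric0 \<bullet> Ric0) / (N - 2)) - \<kappa> * (Weyl \<bullet> Weyl / 4)"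
    unfolding pinching_form_decomp[OF \<kappa>_def refl] s by simp
  have 1: "a * (Ric0 \<bullet> Ric0) / (N - 2) \<ge> 0" "\<kappa> * (Weyl \<bullet> Weyl / 4) \<ge> 0" using a k N by auto
  then show "pinching_form ((real CARD('n) - 2) / 4 + a) R R \<le> 0" using P unfolding \<kappa>_def N_def by linarith
  assume "a > 0" "pinching_form ((real CARD('n) - 2) / 4 + a) R R \<ge> 0"
  then have "a * (Ric0 \<bullet> Ric0) / (N - 2) = 0" "\<kappa> * (Weyl \<bullet> Weyl / 4) = 0"
    using P 1 unfolding \<kappa>_def N_def by linarith+
  then have "Ric0 = 0" "Weyl = 0" using \<open>a > 0\<close> k N by auto
  then have "Weyl = 0" "kulkarni_nomizu Sch = 0" using s by (simp_all add: Sch_def kulkarni_nomizu_def vec_eq_iff)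
  then show "R = 0" by (simp add: Weyl_def)
qed

lemma scal_add: "scal (X + Y) = scal X + scal Y" and scal_scaleR: "scal (c *\<^sub>R X) = c * scal X"
  and scal_diff: "scal (X - Y) = scal X - scal Y"
  by (simp_all add: scal_eq_inner ric_add ric_scaleR ric_diff inner_add_right inner_diff_right)

text \<open>Subtracting the multiple of \<open>X\<close> with the same scalar curvature makes \<open>Y\<close> traceless without changing its square.\<close>

lemma pinching_form_orthogonal_nonpos:
  fixes X Y :: "'n::finite tensor4"
  assumes n: "CARD('n) \<ge> 4" and a: "a \<ge> 0" and XY: "X \<in> curvature_tensors" "Y \<in> curvature_tensors"
    and X: "pinching_form ((real CARD('n) - 2) / 4 + a) X X = 0" "scal X \<noteq> 0"
    and o: "pinching_form ((real CARD('n) - 2) / 4 + a) X Y = 0"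
  shows "pinching_form ((real CARD('n) - 2) / 4 + a) Y Y \<le> 0"
proof -
  let ?P = "pinching_form ((real CARD('n) - 2) / 4 + a)"
  define t where "t = scal Y / scal X"
  define Z where "Z = Y - t *\<^sub>R X"
  have "Z \<in> curvature_tensors" unfolding Z_def by (intro ct_diff ct_scaleR XY)
  moreover have "scal Z = 0" using X(2) by (simp add: Z_def scal_diff scal_scaleR t_def)
  ultimately have "?P Z Z \<le> 0" by (rule pinching_form_traceless_nonpos(1)[OF _ n a])
  moreover have "?P Z Z = ?P Y Y"
    using o X(1) pinching_form_sym[of _ X Y] by
        (simp add: Z_def pinching_form_diff pinching_form_scaleR pinching_form_sym[of _ "Y - t *\<^sub>R X"])
  ultimately show ?thesis by simp
qed

lemma pinching_form_round_tensor:
  fixes X :: "'n::finite tensor4"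
  assumes X: "X \<in> curvature_tensors"
  shows "pinching_form c X round_tensor = scal X * (real CARD('n) - 1 - 2 * c) / 4"
  using round_tensor_inner[OF X] by (simp add: pinching_form_def ric_round_tensor inner_commute[of "ric X"]
      scal_eq_inner[symmetric] inner_commute[of X] algebra_simps)

text \<open>Used with \<open>k = 1\<close> for the ODE and \<open>k = 2\<close> for the Ricci flow. The difference of \<open>Q R\<close> and \<open>Q (R + \<eta> I)\<close>
  is absorbed by the growth rate \<open>L\<close> of \<open>\<eta>\<close>.\<close>

lemma pinching_form_contact:
  fixes R :: "'n::finite tensor4"
  assumes n: "CARD('n) \<ge> 4" and R: "R \<in> curvature_tensors"
    and a: "real CARD('n) / 4 - epsilon CARD('n) \<le> a" "0 \<le> a" "a < real CARD('n) / 4"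
    and \<eta>: "\<eta> > 0" and k: "k \<ge> 0"
    and P: "pinching_form ((real CARD('n) - 2) / 4 + a) (R + \<eta> *\<^sub>R round_tensor) (R + \<eta> *\<^sub>R round_tensor) = 0"
    and s: "scal (R + \<eta> *\<^sub>R round_tensor) > 0" and L: "2 * k * scal (R + \<eta> *\<^sub>R round_tensor) < real CARD('n) * L"
  shows "pinching_form ((real CARD('n) - 2) / 4 + a) (R + \<eta> *\<^sub>R round_tensor) (k *\<^sub>R Q R + (\<eta> * L) *\<^sub>R round_tensor) > 0"
proof -
  interpret q: bounded_bilinear Q_form by (rule bounded_bilinear_Q_form)
  define N where "N = real CARD('n)"
  define \<kappa> where "\<kappa> = (N - 2) / 4 + a"
  let ?P = "pinching_form \<kappa>"
  define X where "X = R + \<eta> *\<^sub>R round_tensor"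
  define I :: "'n tensor4" where "I = round_tensor"
  have I: "I \<in> curvature_tensors" unfolding I_def by (rule ct_round_tensor)
  have N: "N \<ge> 4" using n by (simp add: N_def)
  have X: "X \<in> curvature_tensors" unfolding X_def by (intro ct_add R ct_scaleR ct_round_tensor)
  define s where "s = scal X"
  have s: "s > 0" "2 * k * s < N * L" using assms by (simp_all add: s_def X_def N_def)
  \<comment> \<open>The linear term in the expansion of Q (X - \<eta> I). The Ricci tensor of S and
    its pairing with X involve Ric and scal of X only.\<close>
  define S where "S = Q_form X I + Q_form I X"
  have ct2: "Q_form Y Z + Q_form Z Y \<in> curvature_tensors" if "Y \<in> curvature_tensors" "Z \<in> curvature_tensors" for Y
      Z :: "'n tensor4"
  proof -
    have "Q_form Y Z + Q_form Z Y = Q (Y + Z) - Q Y - Q Z" by (simp add: Q_eq_Q_form q.add_left q.add_right)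
    then show ?thesis by (simp add: ct_diff ct_Q ct_add that)
  qed
  have rS: "ric S = (N - 2) *\<^sub>R ric X + s *\<^sub>R mat 1"
  proof -
    have "ric S = ric_wrt (ric I) X + ric_wrt (ric X) I" unfolding S_def by (rule ric_Q_form[OF X I])
    also have "ric_wrt (ric I) X = (N - 1) *\<^sub>R ric X"
      by (simp add: I_def ric_round_tensor N_def bounded_bilinear.scaleR_left[OF bounded_bilinear_ric_wrt]
          ric_eq_ric_wrt[symmetric])
    finally have "ric S = (N - 1) *\<^sub>R ric X + ric_wrt (ric X) I" .
    moreover have "ric_wrt (ric X) I = s *\<^sub>R mat 1 - ric X"
      by (simp add: I_def ric_wrt_round_tensor ric_sym[OF X] s_def scal_def)
    moreover have "(N - 2) *\<^sub>R ric X = (N - 1) *\<^sub>R ric X - ric X" using scaleR_diff_left[of "N - 1" 1 "ric X"] by simp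
    ultimately show ?thesis by simp
  qed
  have RR: "ric X \<bullet> mat 1 = s" by (simp add: s_def scal_eq_inner inner_commute)
  have XS: "X \<bullet> S = 4 * (ric X \<bullet> ric X)"
  proof -
    have "X \<bullet> S = 2 * (I \<bullet> Q X)"
      using inner_Q_form_swap12[OF X I X] inner_Q_form_swap12(1)[OF I X X] inner_Q_form_swap12(2)[OF I X X]
      by (simp add: S_def inner_add_right Q_eq_Q_form)
    also have "I \<bullet> Q X = 2 * (ric X \<bullet> ric X)"
      unfolding I_def round_tensor_inner[OF ct_Q[OF X]] scal_eq_inner ric_Q[OF X] ric_wrt_sym[OF X, of "mat 1"] by
          (simp add: ric_eq_ric_wrt)
    finally show ?thesis by simp
  qed
  \<comment> \<open>The pairing equals (s^2 - 4 a |Ric|^2) / 4, and s^2 \<le> N |Ric|^2 leaves a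
    multiple of s^2 with the same factor N - 4 a that appears in \<open>?P X I\<close>.\<close>
  have "?P X S \<le> (N - 4 * a) / (4 * N) * s\<^sup>2"
  proof -
    have e1: "?P X S = (s\<^sup>2 - 4 * a * (ric X \<bullet> ric X)) / 4"
    proof -
      have "((N - 2) * v + s * s - ((N - 2) / 4 + a) * (4 * v)) / 4 = (s\<^sup>2 - 4 * a * v) / 4" for v
        by (simp add: power2_eq_square distrib_right)
      then show ?thesis unfolding pinching_form_def rS XS \<kappa>_def by (simp add: inner_add_right RR)
    qed
    have "s\<^sup>2 \<le> N * (ric X \<bullet> ric X)"
      using Cauchy_Schwarz_ineq[of "mat 1" "ric X"] by (simp add: mat1_inner_mat1 s_def scal_eq_inner N_def)
    then have le: "4 * a * (s\<^sup>2 / N) \<le> 4 * a * (ric X \<bullet> ric X)"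
      using N a by (intro mult_left_mono) (auto simp: field_simps)
    have e2: "(N - 4 * a) / (4 * N) * s\<^sup>2 = (s\<^sup>2 - 4 * a * (s\<^sup>2 / N)) / 4" using N by (simp add: field_simps)
    show ?thesis unfolding e1 e2 by (intro divide_right_mono diff_left_mono le) simp
  qed
  moreover have PI: "?P X I = (N - 4 * a) / 8 * s"
    unfolding I_def pinching_form_round_tensor[OF X] s_def[symmetric] N_def[symmetric] \<kappa>_def by (simp add: field_simps)
  moreover have PQI: "?P X (Q I) \<ge> 0"
  proof -
    have "ric (Q I) = ((N - 1) * (N - 1)) *\<^sub>R mat 1"
    proof -
      have "ric (Q I) = ric_wrt ((N - 1) *\<^sub>R mat 1) I" unfolding ric_Q[OF I] by (simp add: I_def ric_round_tensor N_def)
      also have "\<dots> = (N - 1) *\<^sub>R ric I" by (simp add: bounded_bilinear.scaleR_left[OF bounded_bilinear_ric_wrt]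
          ric_eq_ric_wrt[symmetric])
      finally show ?thesis by (simp add: I_def ric_round_tensor N_def)
    qed
    moreover have "X \<bullet> Q I = (2 * (N - 1)) * s"
    proof -
      have "2 * (X \<bullet> Q I) = I \<bullet> S"
        unfolding Q_eq_Q_form S_def using inner_Q_form_swap12(1)[OF I I X] inner_Q_form_swap12(2)[OF X I I]
        by (simp add: inner_add_right)
      also have "\<dots> = 2 * ((N - 2) * s + N * s)"
        unfolding I_def round_tensor_inner[OF ct2[OF X I, folded S_def]] scal_eq_inner rS
        by (simp add: inner_add_right mat1_inner_mat1 N_def s_def scal_eq_inner)
      finally show ?thesis by (simp add: algebra_simps)
    qed
    ultimately have "?P X (Q I) = ((N - 1) * (N - 1) * s - \<kappa> * ((2 * (N - 1)) * s)) / 4"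
      by (simp add: pinching_form_def RR)
    also have "\<dots> = (N - 1) * s * ((N - 1) - 2 * \<kappa>) / 4" by (simp add: algebra_simps)
    finally have e: "?P X (Q I) = (N - 1) * s * ((N - 1) - 2 * \<kappa>) / 4" .
    have "(N - 1) - 2 * \<kappa> \<ge> 0" using a(3) unfolding \<kappa>_def N_def by (simp add: field_simps)
    then show ?thesis unfolding e using N s by (intro divide_nonneg_nonneg mult_nonneg_nonneg) auto
  qed
  moreover have PQX: "?P X (Q X) \<ge> 0"
    using pinching_form_boundary[OF X n a(1,3)] P assms(9) by (simp add: X_def \<kappa>_def N_def)
  moreover have "?P X (k *\<^sub>R Q R + (\<eta> * L) *\<^sub>R I)
     = k * ?P X (Q X) - k * \<eta> * ?P X S + k * \<eta>\<^sup>2 * ?P X (Q I) + \<eta> * L * ?P X I"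
  proof -
    have "R = X - \<eta> *\<^sub>R I" by (simp add: X_def I_def)
    then have e: "Q R = Q X - \<eta> *\<^sub>R S + \<eta>\<^sup>2 *\<^sub>R Q I"
      unfolding S_def Q_eq_Q_form
      by (simp add: q.diff_left q.diff_right q.scaleR_left q.scaleR_right scaleR_add_right scaleR_diff_right
          power2_eq_square)
    show ?thesis unfolding e by (simp add: pinching_form_add pinching_form_diff pinching_form_scaleR distrib_left
        right_diff_distrib)
  qed
  moreover have "k * \<eta> * ?P X S \<le> k * \<eta> * ((N - 4 * a) / (4 * N) * s\<^sup>2)"
    using calculation(1) k \<eta> by (intro mult_left_mono) auto
  \<comment> \<open>The error is quadratic in s and the gain linear, which is why L must exceed a
    multiple of the scalar curvature.\<close>
  moreover have "k * \<eta> * ((N - 4 * a) / (4 * N) * s\<^sup>2) < \<eta> * L * ((N - 4 * a) / 8 * s)"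
  proof -
    have "(\<eta> * (N - 4 * a) * s / (8 * N)) * (2 * k * s) < (\<eta> * (N - 4 * a) * s / (8 * N)) * (N * L)"
      using s \<eta> N a(3) unfolding N_def[symmetric] by (intro mult_strict_left_mono) auto
    moreover have "(\<eta> * M * s / (8 * N)) * (2 * k * s) = k * \<eta> * (M / (4 * N) * s\<^sup>2)"
      "(\<eta> * M * s / (8 * N)) * (N * L) = \<eta> * L * (M / 8 * s)" for M
      using N by (simp_all add: power2_eq_square)
    ultimately show ?thesis by (simp only:)
  qed
  moreover have "k * ?P X (Q X) \<ge> 0" "k * \<eta>\<^sup>2 * ?P X (Q I) \<ge> 0" using PQX PQI k by auto
  ultimately have "?P X (k *\<^sub>R Q R + (\<eta> * L) *\<^sub>R I) > 0" unfolding PI by linarith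
  then show ?thesis by (simp add: X_def I_def \<kappa>_def N_def)
qed

section \<open>The cones described by scal and the pinching form\<close>

text \<open>For a > 0 the conditions scal = 0 and P \<ge> 0 force R = 0, so relaxing scal > 0 to
  scal \<ge> 0 adds exactly the apex.\<close>

lemma Omega_bar_iff:
  fixes R :: "'n::finite tensor4"
  assumes n: "CARD('n) \<ge> 4" and a: "a > 0"
  shows "R \<in> Omega_bar a \<longleftrightarrow> R \<in> curvature_tensors \<and> pinching_form ((real CARD('n) - 2) / 4 + a) R R \<ge> 0 \<and> scal R \<ge> 0"
    and "R \<in> Omega a \<longleftrightarrow> R \<in> curvature_tensors \<and> pinching_form ((real CARD('n) - 2) / 4 + a) R R \<ge> 0 \<and> scal R > 0"
proof -
  have c: "curv_norm_sq R = (R \<bullet> R) / 4" by (simp add: curv_norm_sq_def inner4 power2_eq_square)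
  have r: "ric_norm_sq R = ric R \<bullet> ric R" by (simp add: ric_norm_sq_def inner2 power2_eq_square)
  have e: "((real CARD('n) - 2) / 4 + a) * curv_norm_sq R \<le> 1/4 * ric_norm_sq R
     \<longleftrightarrow> pinching_form ((real CARD('n) - 2) / 4 + a) R R \<ge> 0"
    unfolding pinching_form_def c r by simp
  show 1: "R \<in> Omega a \<longleftrightarrow> R \<in> curvature_tensors \<and> pinching_form ((real CARD('n) - 2) / 4 + a) R R \<ge> 0 \<and> scal R > 0"
    unfolding Omega_def e[symmetric] by simp
  show "R \<in> Omega_bar a \<longleftrightarrow> R \<in> curvature_tensors \<and> pinching_form ((real CARD('n) - 2) / 4 + a) R R \<ge> 0 \<and> scal R \<ge> 0"
  proof (cases "R = 0")
    case True
    then show ?thesis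
      by (simp add: Omega_bar_def curvature_tensors_def pinching_form_def ric_def scal_eq_inner inner2)
  next
    case False
    then show ?thesis
      using pinching_form_traceless_nonpos(2)[OF _ n less_imp_le[OF a] _ a] 1
      by (auto simp: Omega_bar_def le_less)
  qed
qed

text \<open>The two scalars of the transformed components are the contractions with
  \<open>E ** transpose E\<close>, which is the identity for orthogonal E.\<close>

lemma O_invariant_Omega:
  fixes a :: real
  assumes n: "CARD('n::finite) \<ge> 4" and a: "a > 0"
  shows "O_invariant (Omega a :: 'n tensor4 set)" "O_invariant (Omega_bar a :: 'n tensor4 set)"
proof -
  have P: "pinching_form c (frame_components E R) (frame_components E R) = pinching_form c R R" and s: "scal
      (frame_components E R) = scal R"
    if "orthogonal_matrix E" for c and E :: "real^'n^'n" and R :: "'n tensor4"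
  proof -
    have E: "E ** transpose E = mat 1" using that by (simp add: orthogonal_matrix_def)
    show "pinching_form c (frame_components E R) (frame_components E R) = pinching_form c R R"
      using pinching_wrt_frame[of c E R] pinching_wrt_frame[of c "mat 1" R] unfolding E by (simp add: frame_components_one)
    show "scal (frame_components E R) = scal R"
      using scal_wrt_frame[of E R] scal_wrt_frame[of "mat 1" R] unfolding E by (simp add: frame_components_one)
  qed
  show "O_invariant (Omega a :: 'n tensor4 set)" "O_invariant (Omega_bar a :: 'n tensor4 set)"
    unfolding O_invariant_def using P s ct_frame by (auto simp: Omega_bar_iff[OF n a])
qed

section \<open>Evolution of the curvature at the centre of normal coordinates\<close>

lemma ct_gl_action:
  assumes R: "R \<in> curvature_tensors" shows "gl_action N R \<in> curvature_tensors"
proof (rule curvature_tensorsI)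
  fix i j k l
  have s: "(\<Sum>p\<in>UNIV. N $ p $ x * R $ p $ j $ k $ l) = - (\<Sum>p\<in>UNIV. N $ p $ x * R $ j $ p $ k $ l)" for x j k l
    unfolding sum_negf[symmetric] by (intro sum.cong refl, subst ct_swap1[OF R]) simp
  have s2: "(\<Sum>p\<in>UNIV. N $ p $ x * R $ i $ j $ p $ l) = - (\<Sum>p\<in>UNIV. N $ p $ x * R $ i $ j $ l $ p)" for x i j l
    unfolding sum_negf[symmetric] by (intro sum.cong refl, subst ct_swap2[OF R]) simp
  have s3: "(\<Sum>p\<in>UNIV. N $ p $ x * R $ i $ j $ k $ p) = - (\<Sum>p\<in>UNIV. N $ p $ x * R $ j $ i $ k $ p)" for x i j k
    unfolding sum_negf[symmetric] by (intro sum.cong refl, subst ct_swap1[OF R]) simp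
  have s4: "(\<Sum>p\<in>UNIV. N $ p $ x * R $ p $ j $ k $ l) = - (\<Sum>p\<in>UNIV. N $ p $ x * R $ p $ j $ l $ k)" for x j k l
    unfolding sum_negf[symmetric] by (intro sum.cong refl, subst ct_swap2[OF R]) simp
  have b: "(\<Sum>p\<in>UNIV. N $ p $ x * f p) + (\<Sum>p\<in>UNIV. N $ p $ x * g p) + (\<Sum>p\<in>UNIV. N $ p $ x * h p) = 0"
    if "\<And>p. f p + g p + h p = 0" for f g h and x
    using that by (simp add: sum.distrib[symmetric] distrib_left[symmetric])
  show "gl_action N R $ i $ j $ k $ l = - gl_action N R $ j $ i $ k $ l"
    using s[of i j k l] s[of j i k l] s3[of k i j l] s3[of l i j k] s2[of k i j l] s2[of k j i l] by
        (simp add: gl_action_def slot_nth)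
  show "gl_action N R $ i $ j $ k $ l = - gl_action N R $ i $ j $ l $ k"
    using s4[of i j k l] s4[of j i k l] s2[of k i j l] s2[of l i j k] s[of j i k l] s[of j i l k] by
        (simp add: gl_action_def slot_nth)
  show "gl_action N R $ i $ j $ k $ l + gl_action N R $ j $ k $ i $ l + gl_action N R $ k $ i $ j $ l = 0"
    using b[of "\<lambda>p. R $ p $ j $ k $ l" "\<lambda>p. R $ j $ k $ p $ l" "\<lambda>p. R $ k $ p $ j $ l" i]
      b[of "\<lambda>p. R $ i $ p $ k $ l" "\<lambda>p. R $ p $ k $ i $ l" "\<lambda>p. R $ k $ i $ p $ l" j]
      b[of "\<lambda>p. R $ i $ j $ p $ l" "\<lambda>p. R $ j $ p $ i $ l" "\<lambda>p. R $ p $ i $ j $ l" k]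
      b[of "\<lambda>p. R $ i $ j $ k $ p" "\<lambda>p. R $ j $ k $ i $ p" "\<lambda>p. R $ k $ i $ j $ p" l]
      ct_bianchi[OF R]
    by (simp add: gl_action_def slot_nth)
qed

lemma gl_action_diff_left: "gl_action (M - N) X = gl_action M X - gl_action N X"
  by (simp add: gl_action_def bounded_bilinear.diff_left[OF bounded_bilinear_slots(1)]
      bounded_bilinear.diff_left[OF bounded_bilinear_slots(2)]
     bounded_bilinear.diff_left[OF bounded_bilinear_slots(3)] bounded_bilinear.diff_left[OF bounded_bilinear_slots(4)])

text \<open>The algebraic content of \<open>\<partial>\<^sub>t Rm = \<Delta> Rm + 2 Q(Rm)\<close>. The variables stand for values at one point where \<open>h = 1\<close>
  and \<open>\<partial>h = 0\<close>: \<open>\<Gamma> i j = \<partial>\<^sub>i G\<^sub>j\<close>, \<open>dd p m = \<partial>\<^sub>p \<partial>\<^sub>m Rm\<close>, \<open>H p m\<close> is the covariant Hessian of \<open>Rm\<close>,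
  \<open>Y = \<partial>\<^sub>t Rm\<close>, and \<open>Yg i j = \<partial>\<^sub>i \<partial>\<^sub>t G\<^sub>j\<close> is determined by its symmetries and the flow equation.
  \<open>B\<close> is the differentiated second Bianchi identity.\<close>

lemma evolution_identity:
  fixes R :: "'n::finite tensor4" and \<Gamma> :: "'n \<Rightarrow> 'n \<Rightarrow> real^'n^'n" and dd H :: "'n \<Rightarrow> 'n \<Rightarrow> 'n tensor4"
  assumes R: "R \<in> curvature_tensors" and dd: "\<And>p m. dd p m \<in> curvature_tensors" "\<And>p m. dd p m = dd m p"
    and RN: "\<And>i j. R $ i $ j = \<Gamma> i j - \<Gamma> j i"
    and H: "\<And>p m. H p m = dd p m - gl_action (\<Gamma> p m) R"
    and B: "\<And>p m i j. H p m $ i $ j + H p i $ j $ m + H p j $ m $ i = 0"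
    and Y: "\<And>i j. Y $ i $ j = - 2 *\<^sub>R (ric R ** R $ i $ j) + (Yg i j - Yg j i)"
    and Yg: "\<And>i j a b. Yg i j $ a $ b = Yg i b $ a $ j" "\<And>i j. Yg i j + transpose (Yg i j) = - 2 *\<^sub>R ric (H i j)"
  shows "Y + gl_action (ric R) R = (\<Sum>p\<in>UNIV. H p p) + 2 *\<^sub>R Q R"
proof -
  define r where "r = ric R"
  define G where "G i j = ric (H i j)" for i j
  have Hct: "H p m \<in> curvature_tensors" for p m unfolding H by (intro ct_diff dd ct_gl_action R)
  have Gs: "G i j $ a $ b = G i j $ b $ a" for i j a b
    using ric_sym[OF Hct, of i j] unfolding G_def by (metis transpose_nth)
  have rs: "r $ a $ b = r $ b $ a" for a b using ric_sym[OF R] unfolding r_def by (metis transpose_nth)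
  have B': "H p m $ i $ j $ k $ l + H p i $ j $ m $ k $ l + H p j $ m $ i $ k $ l = 0" for p m i j k l
    using arg_cong[OF B[of p m i j], of "\<lambda>M. M $ k $ l"] by simp
  \<comment> \<open>The Ricci identity: covariant second derivatives commute up to the action of the
    curvature.\<close>
  have comm: "H p m = H m p - gl_action (R $ p $ m) R" for p m
    unfolding H RN[of p m] gl_action_diff_left using dd(2)[of p m] by simp
  \<comment> \<open>The elimination of the Koszul formula, applied to the time derivative of the
    connection; \<open>G\<close> holds the Hessian of Ric.\<close>
  have Yg': "Yg i j $ a $ b = - (G i j $ a $ b + G i b $ a $ j - G i a $ j $ b)" for i j a b
  proof -
    have e: "Yg i j $ a $ b + Yg i j $ b $ a = - 2 * G i j $ a $ b" for j a b
      using arg_cong[OF Yg(2)[of i j], of "\<lambda>M. M $ a $ b"] by (simp add: transpose_nth G_def)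
    show ?thesis using e[of j a b] e[of b a j] e[of a j b] Yg(1)[of i j a b] Yg(1)[of i j b a] Yg(1)[of i b j a]
      by linarith
  qed
  show ?thesis
  proof (simp only: vec_eq_iff, intro allI)
    fix i j k l
    define D where "D i j = (\<Sum>p\<in>UNIV. gl_action (R $ p $ i) R $ j $ p $ k $ l)" for i j
    \<comment> \<open>The contracted second Bianchi identity: a divergence of the curvature becomes
      an exterior derivative of Ric.\<close>
    have contr: "(\<Sum>p\<in>UNIV. H i p $ j $ p $ k $ l) = G i l $ k $ j - G i k $ l $ j" for i j
    proof -
      have "H i p $ j $ p $ k $ l = H i l $ k $ p $ j $ p - H i k $ l $ p $ j $ p" for p
        using ct_pair[OF Hct, of i p j p k l] B'[of i p k l j p] ct_swap1[OF Hct, of i l p k j p] by linarith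
      then show ?thesis by (simp add: sum_subtractf G_def ric_def)
    qed
    \<comment> \<open>The second Bianchi identity moves a derivative index into the curvature, the
      two derivatives are exchanged at the cost of D, and the resulting divergences are replaced by
      derivatives of Ric.\<close>
    have lap: "(\<Sum>p\<in>UNIV. H p p $ i $ j $ k $ l) = G i k $ l $ j - G i l $ k $ j + G j l $ k $ i - G j k $ l $ i +
        D i j - D j i"
    proof -
      have "H p p $ i $ j $ k $ l = - H i p $ j $ p $ k $ l + gl_action (R $ p $ i) R $ j $ p $ k $ l
          + H j p $ i $ p $ k $ l - gl_action (R $ p $ j) R $ i $ p $ k $ l" for p
      proof -
        have "H p p $ i $ j $ k $ l = - H p i $ j $ p $ k $ l - H p j $ p $ i $ k $ l" using B'[of p p i j k l] by linarith
        also have "H p j $ p $ i $ k $ l = - H p j $ i $ p $ k $ l" by (rule ct_swap1[OF Hct])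
        also have "H p i $ j $ p $ k $ l = H i p $ j $ p $ k $ l - gl_action (R $ p $ i) R $ j $ p $ k $ l"
          by (subst comm) simp
        also have "H p j $ i $ p $ k $ l = H j p $ i $ p $ k $ l - gl_action (R $ p $ j) R $ i $ p $ k $ l"
          by (subst comm) simp
        finally show ?thesis by simp
      qed
      then show ?thesis
        by (simp only: sum.distrib sum_subtractf sum_negf contr D_def)
    qed
    \<comment> \<open>The trace of the Ricci identity. It accounts for the products of Ric and R
      left over when the Hessians of Ric are compared.\<close>
    have Gc: "G i j $ k $ l - G j i $ k $ l = (R $ i $ j ** r) $ k $ l - (r ** R $ i $ j) $ k $ l"
    proof -
      have t: "transpose (R $ i $ j) = - R $ i $ j"
        by (simp add: vec_eq_iff transpose_nth) (intro allI ct_swap2[OF R])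
      have "G i j = G j i - ric (gl_action (R $ i $ j) R)"
        unfolding G_def by (subst comm) (simp add: ric_diff)
      then show ?thesis
        by (simp add: ric_wrt_gl_action t mat_minus r_def[symmetric] bounded_bilinear.zero_left[OF bounded_bilinear_ric_wrt])
    qed
    have Ye: "Y $ i $ j $ k $ l = - 2 * (r ** R $ i $ j) $ k $ l - (G i j $ k $ l + G i l $ k $ j - G i k $ j $ l)
       + (G j i $ k $ l + G j l $ k $ i - G j k $ i $ l)"
      by (simp add: Y Yg' r_def)
    have ae: "gl_action r R $ i $ j $ k $ l = (\<Sum>a\<in>UNIV. r $ a $ i * R $ a $ j $ k $ l) +
        (\<Sum>a\<in>UNIV. r $ a $ j * R $ i $ a $ k $ l)
       + (r ** R $ i $ j) $ k $ l + (R $ i $ j ** r) $ k $ l"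
      by (simp add: gl_action_def slot_nth matrix_matrix_mult_def rs[of k] mult.commute)
    define S1 where "S1 i j = (\<Sum>p\<in>UNIV. \<Sum>q\<in>UNIV. R $ i $ p $ k $ q * R $ j $ p $ l $ q)" for i j
    \<comment> \<open>The commutator terms are quadratic in R: the four slots give a Ricci term, the
      source of the square part and two copies of the sharp part.\<close>
    have De: "D i j = (\<Sum>a\<in>UNIV. r $ a $ i * R $ a $ j $ k $ l) - (\<Sum>p\<in>UNIV. \<Sum>a\<in>UNIV. R $ p $ i $ a $ j * R $ p $ a $ k $ l)
       - S1 i j + S1 j i" for i j
    proof -
      have 1: "(\<Sum>p\<in>UNIV. \<Sum>a\<in>UNIV. R $ p $ i $ a $ j * R $ a $ p $ k $ l) = -
          (\<Sum>p\<in>UNIV. \<Sum>a\<in>UNIV. R $ p $ i $ a $ j * R $ p $ a $ k $ l)"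
        unfolding sum_negf[symmetric] by (intro sum.cong refl, subst (2) ct_swap1[OF R]) simp
      have 2: "(\<Sum>p\<in>UNIV. \<Sum>a\<in>UNIV. R $ p $ i $ a $ p * R $ j $ a $ k $ l) = (\<Sum>a\<in>UNIV. r $ a $ i * R $ a $ j $ k $ l)"
      proof -
        have "R $ p $ i $ a $ p * R $ j $ a $ k $ l = R $ a $ p $ i $ p * R $ a $ j $ k $ l" for p a
          using ct_swap1[OF R, of j a k l] ct_pair[OF R, of p i a p] ct_swap2[OF R, of a p p i] by simp
        then have "(\<Sum>p\<in>UNIV. \<Sum>a\<in>UNIV. R $ p $ i $ a $ p * R $ j $ a $ k $ l) =
            (\<Sum>p\<in>UNIV. \<Sum>a\<in>UNIV. R $ a $ p $ i $ p * R $ a $ j $ k $ l)"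
          by simp
        also have "\<dots> = (\<Sum>a\<in>UNIV. \<Sum>p\<in>UNIV. R $ a $ p $ i $ p * R $ a $ j $ k $ l)" by (rule sum.swap)
        finally show ?thesis by (simp add: r_def ric_def sum_distrib_right)
      qed
      have 3: "(\<Sum>p\<in>UNIV. \<Sum>a\<in>UNIV. R $ p $ i $ a $ k * R $ j $ p $ a $ l) = - S1 i j"
      proof -
        have "R $ p $ i $ a $ k * R $ j $ p $ a $ l = - (R $ i $ p $ k $ a * R $ j $ p $ l $ a)" for p a
          using ct_flip[OF R, of p i a k] ct_swap2[OF R, of j p a l] by simp
        then show ?thesis by (simp add: S1_def sum_negf)
      qed
      have 4: "(\<Sum>p\<in>UNIV. \<Sum>a\<in>UNIV. R $ p $ i $ a $ l * R $ j $ p $ k $ a) = S1 j i"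
      proof -
        have "R $ p $ i $ a $ l * R $ j $ p $ k $ a = R $ j $ p $ k $ a * R $ i $ p $ l $ a" for p a
          using ct_flip[OF R, of p i a l] by simp
        then show ?thesis by (simp only: S1_def)
      qed
      have "D i j = (\<Sum>p\<in>UNIV. \<Sum>a\<in>UNIV. R $ p $ i $ a $ j * R $ a $ p $ k $ l) +
          (\<Sum>p\<in>UNIV. \<Sum>a\<in>UNIV. R $ p $ i $ a $ p * R $ j $ a $ k $ l)
         + (\<Sum>p\<in>UNIV. \<Sum>a\<in>UNIV. R $ p $ i $ a $ k * R $ j $ p $ a $ l) +
             (\<Sum>p\<in>UNIV. \<Sum>a\<in>UNIV. R $ p $ i $ a $ l * R $ j $ p $ k $ a)"
        by (simp add: D_def gl_action_def slot_nth sum.distrib)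
      then show ?thesis unfolding 1 2 3 4 by simp
    qed
    have rr: "(\<Sum>a\<in>UNIV. r $ a $ j * R $ i $ a $ k $ l) = - (\<Sum>a\<in>UNIV. r $ a $ j * R $ a $ i $ k $ l)"
      unfolding sum_negf[symmetric] by (intro sum.cong refl, subst ct_swap1[OF R]) simp
    \<comment> \<open>Antisymmetrising in i and j, the first Bianchi identity produces the square
      part of Q.\<close>
    have sq: "(\<Sum>p\<in>UNIV. \<Sum>a\<in>UNIV. R $ p $ i $ a $ j * R $ p $ a $ k $ l) -
        (\<Sum>p\<in>UNIV. \<Sum>a\<in>UNIV. R $ p $ j $ a $ i * R $ p $ a $ k $ l)
      = (\<Sum>p\<in>UNIV. \<Sum>q\<in>UNIV. R $ i $ j $ p $ q * R $ k $ l $ p $ q)"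
    proof -
      have "R $ p $ i $ a $ j * R $ p $ a $ k $ l - R $ p $ j $ a $ i * R $ p $ a $ k $ l = R $ i $ j $ p $ a * R
          $ k $ l $ p $ a" for p a
      proof -
        have "R $ p $ i $ a $ j - R $ p $ j $ a $ i = R $ i $ j $ p $ a"
          using ct_bianchi[OF R, of i j p a] ct_pair[OF R, of p j a i] ct_flip[OF R, of a i p j] ct_flip[OF R, of p i a j]
            ct_swap1[OF R, of p i j a] ct_swap2[OF R, of i p j a] ct_swap2[OF R, of j p i a] ct_flip[OF R, of p j a i]
            ct_swap2[OF R, of p i a j] ct_swap1[OF R, of j p i a] ct_swap1[OF R, of j p a i]
                ct_swap2[OF R, of p j a i] by linarith
        then show ?thesis using ct_pair[OF R, of k l p a] by (simp add: left_diff_distrib[symmetric])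
      qed
      then show ?thesis by (simp only: sum_subtractf[symmetric])
    qed
    have q: "Q R $ i $ j $ k $ l = 1/2 * (\<Sum>p\<in>UNIV. \<Sum>q\<in>UNIV. R $ i $ j $ p $ q * R $ k $ l $ p $ q) + S1 i j - S1 j i"
      by (simp add: Q_eq_Q_form Q_form_def S1_def sum_subtractf mult.commute)
    show "(Y + gl_action (ric R) R) $ i $ j $ k $ l = ((\<Sum>p\<in>UNIV. H p p) + 2 *\<^sub>R Q R) $ i $ j $ k $ l"
      using Gc Ye ae lap De[of i j] De[of j i] rr sq q Gs[of i k j l] Gs[of j k i l] unfolding r_def[symmetric] by simp
  qed
qed

section \<open>Derivatives of tensor fields along a Ricci flow\<close>

lemma dird2_bilinear:
  assumes S: "udom S" and B: "bounded_bilinear B" and fg: "smooth_on S f" "smooth_on S g" and x: "x \<in> S"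
  shows "dird S u (dird S v (\<lambda>x. B (f x) (g x))) x
    = B (f x) (dird S u (dird S v g) x) + B (dird S u f x) (dird S v g x)
    + (B (dird S v f x) (dird S u g x) + B (dird S u (dird S v f) x) (g x))"
proof -
  note d = smooth_on_imp_differentiable_on
  have "dird S u (dird S v (\<lambda>x. B (f x) (g x))) x = dird S u (\<lambda>x. B (f x) (dird S v g x) + B (dird S v f x) (g x)) x"
    by (rule dird_cong[OF dird_bilinear[OF S B d[OF fg(1)] d[OF fg(2)]] x])
  also have "\<dots> = dird S u (\<lambda>x. B (f x) (dird S v g x)) x + dird S u (\<lambda>x. B (dird S v f x) (g x)) x"
    by (rule dird_add[OF S _ _ x]) (intro d smooth_on_bilinear[OF S B] fg smooth_on_dird)+
  also have "dird S u (\<lambda>x. B (f x) (dird S v g x)) x = B (f x) (dird S u (dird S v g) x) + B (dird S u f x) (dird S v g x)"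
    by (rule dird_bilinear[OF S B d d x]) (intro fg smooth_on_dird)+
  also have "dird S u (\<lambda>x. B (dird S v f x) (g x)) x = B (dird S v f x) (dird S u g x) + B (dird S u (dird S v f) x) (g x)"
    by (rule dird_bilinear[OF S B d d x]) (intro fg smooth_on_dird)+
  finally show ?thesis .
qed

lemma dird_entry:
  fixes f :: "'a::euclidean_space \<Rightarrow> real^'n^'m"
  assumes "udom S" "smooth_on S f" "x \<in> S"
  shows "dird S v (\<lambda>x. f x $ a $ b) x = dird S v f x $ a $ b"
proof -
  have "(\<lambda>x. f x $ a) differentiable_on S"
    by (intro smooth_on_imp_differentiable_on smooth_on_vec_nth assms)
  then show ?thesis
    by (simp add: dird_vec_nth[OF assms(1) _ assms(3)] smooth_on_imp_differentiable_on[OF assms(2)])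
qed

lemma dird_entry4:
  fixes X :: "'a::euclidean_space \<Rightarrow> 'n::finite tensor4"
  assumes S: "udom S" "smooth_on S X" "x \<in> S"
  shows "dird S v (\<lambda>x. X x $ i $ j $ k $ l) x = dird S v X x $ i $ j $ k $ l"
    and "dird S v (\<lambda>x. X x $ i $ j) x = dird S v X x $ i $ j"
proof -
  have d: "X differentiable_on S" "(\<lambda>x. X x $ i) differentiable_on S" "(\<lambda>x. X x $ i $ j) differentiable_on S"
     "(\<lambda>x. X x $ i $ j $ k) differentiable_on S"
    by (intro smooth_on_imp_differentiable_on smooth_on_vec_nth S)+
  show "dird S v (\<lambda>x. X x $ i $ j) x = dird S v X x $ i $ j"
    by (simp add: dird_vec_nth[OF S(1) _ S(3)] d)
  then show "dird S v (\<lambda>x. X x $ i $ j $ k $ l) x = dird S v X x $ i $ j $ k $ l"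
    by (simp add: dird_vec_nth[OF S(1) _ S(3)] d)
qed

lemma ct_dird:
  fixes X :: "'a::euclidean_space \<Rightarrow> 'n::finite tensor4"
  assumes S: "udom S" "smooth_on S X" "x \<in> S" and ct: "\<And>x. x \<in> S \<Longrightarrow> X x \<in> curvature_tensors"
  shows "dird S v X x \<in> curvature_tensors"
proof (rule curvature_tensorsI)
  fix i j k l
  note e = dird_entry4(1)[OF S]
  have d: "(\<lambda>x. X x $ i $ j $ k $ l) differentiable_on S" for i j k l
    by (intro smooth_on_imp_differentiable_on smooth_on_vec_nth S)
  have m: "dird S v (\<lambda>x. - X x $ i $ j $ k $ l) x = - dird S v (\<lambda>x. X x $ i $ j $ k $ l) x" for i j k l
    by (rule dird_linear_compose[OF S(1) bounded_linear_minus[OF bounded_linear_ident] d S(3)])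
  have "dird S v (\<lambda>x. X x $ i $ j $ k $ l) x = dird S v (\<lambda>x. - X x $ j $ i $ k $ l) x"
    by (rule dird_cong[OF ct_swap1[OF ct] S(3)])
  then show "dird S v X x $ i $ j $ k $ l = - dird S v X x $ j $ i $ k $ l" unfolding m e .
  have "dird S v (\<lambda>x. X x $ i $ j $ k $ l) x = dird S v (\<lambda>x. - X x $ i $ j $ l $ k) x"
    by (rule dird_cong[OF ct_swap2[OF ct] S(3)])
  then show "dird S v X x $ i $ j $ k $ l = - dird S v X x $ i $ j $ l $ k" unfolding m e .
  have "dird S v (\<lambda>x. X x $ i $ j $ k $ l + X x $ j $ k $ i $ l + X x $ k $ i $ j $ l) x = dird S v (\<lambda>x. 0) x"
    by (rule dird_cong[OF ct_bianchi[OF ct] S(3)])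
  then show "dird S v X x $ i $ j $ k $ l + dird S v X x $ j $ k $ i $ l + dird S v X x $ k $ i $ j $ l = 0"
    unfolding dird_add[OF S(1) differentiable_on_add[OF d d] d S(3)] dird_add[OF S(1) d d S(3)] dird_const[OF S(1,3)] e .
qed

text \<open>A Ricci flow in one chart at interior times. Time is an ordinary direction (1, 0) of the
  slab, which is open so that time and space derivatives commute.\<close>

locale local_flow =
  fixes I :: "real set" and U :: "(real^'n::finite) set" and h :: "real \<times> (real^'n) \<Rightarrow> real^'n^'n"
    and W G k Rm
  assumes I: "open I" and U: "open U" and W_def: "W = I \<times> U"
    and h: "smooth_on W h" and h_sym: "\<And>z. z \<in> W \<Longrightarrow> transpose (h z) = h z" and h_invertible: "\<And>z. z \<in> W \<Longrightarrow> invertible (h z)"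
    and G_def: "G = christoffel_matrix W sp h" and k_def: "k = (\<lambda>z. matrix_inv (h z))"
    and Rm_def: "Rm = (\<lambda>z. \<chi> i j. h z ** curvature_matrix W sp G i j z)"
    and flow: "\<And>z. z \<in> W \<Longrightarrow> dird W (1, 0) h z = - 2 *\<^sub>R ric_wrt (k z) (Rm z)"
begin

lemma open_W: "open W" unfolding W_def by (intro open_Times I U)
lemma udom_W: "udom W" by (rule udom_open[OF open_W])
lemma smooth_G: "smooth_on W (G i)" unfolding G_def by (rule smooth_on_christoffel_matrix[OF udom_W h h_invertible])
lemma smooth_curvature_matrix: "smooth_on W (curvature_matrix W sp G i j)" by
    (rule smooth_on_curvature_matrix[OF udom_W smooth_G])
lemma smooth_k: "smooth_on W k" unfolding k_def by (rule smooth_on_matrix_inv[OF udom_W h h_invertible])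
lemma smooth_Rm: "smooth_on W Rm"
  unfolding Rm_def by (intro smooth_on_vec udom_W, unfold vec_lambda_beta, intro smooth_on_vec_nth udom_W
      smooth_on_matmul h smooth_curvature_matrix)

lemma Rm_riemann: "(t, x) \<in> W \<Longrightarrow> Rm (t, x) = riemann (\<lambda>y. h (t, y)) x"
  using riemann_slab[OF udom_open[OF I] U h[unfolded W_def] h_sym[unfolded W_def] h_invertible[unfolded W_def]]
  unfolding Rm_def G_def W_def by (simp add: vec_eq_iff)

lemma Rm_ct: "z \<in> W \<Longrightarrow> Rm z \<in> curvature_tensors"
  using riemann_symmetries[OF udom_open[OF I] U h[unfolded W_def] h_sym[unfolded W_def] h_invertible[unfolded W_def] _ I]
    Rm_riemann[of "fst z" "snd z"] unfolding W_def by (cases z) auto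

lemma metric_compatible: "z \<in> W \<Longrightarrow> dird W (sp i) h z = transpose (G i z) ** h z + h z ** G i z"
  unfolding G_def by (rule christoffel_matrix_compatible[OF udom_W h h_sym h_invertible])

lemma G_symmetric: "z \<in> W \<Longrightarrow> G i z $ a $ b = G b z $ a $ i"
  unfolding G_def by (rule christoffel_matrix_symmetric[OF udom_W h h_sym])

lemma k_inverse: "z \<in> W \<Longrightarrow> k z ** h z = mat 1"
  unfolding k_def by (rule matrix_inv_works[OF h_invertible])

context
  fixes z0 assumes z0: "z0 \<in> W" and h0: "h z0 = mat 1" and dh0: "\<And>i. dird W (sp i) h z0 = 0"
begin

abbreviation "\<Gamma>' i j \<equiv> dird W (sp i) (G j) z0"

lemma G_zero: "G i z0 = 0"
proof (rule levi_civita_unique[of "mat 1"])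
  show "transpose (G i z0) ** mat 1 + mat 1 ** G i z0 = transpose 0 ** mat 1 + mat 1 ** (0 :: real^'n^'n)" for i
    using metric_compatible[OF z0, of i] by (simp add: dh0 h0 transpose_zero)
qed (use G_symmetric[OF z0] in \<open>auto simp: invertible_def intro: exI[of _ "mat 1"]\<close>)

lemma k_one: "k z0 = mat 1" using k_inverse[OF z0] by (simp add: h0)

lemma dird_k: "dird W v k z0 = - dird W v h z0"
proof -
  have "dird W v (\<lambda>z. k z ** h z) z0 = dird W v (\<lambda>z. mat 1) z0"
    by (rule dird_cong[OF k_inverse z0])
  then have "dird W v h z0 + dird W v k z0 = 0"
    by (simp add: dird_matmul[OF udom_W smooth_k h z0] dird_const[OF udom_W z0] h0 k_one)
  then show ?thesis by (simp add: eq_neg_iff_add_eq_0 add.commute)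
qed

lemma dird2_h: "dird W (sp i) (dird W (sp j) h) z0 = transpose (\<Gamma>' i j) + \<Gamma>' i j"
proof -
  have t: "smooth_on W (\<lambda>z. transpose (G j z))" by (rule smooth_on_transpose[OF udom_W smooth_G])
  have "dird W (sp i) (dird W (sp j) h) z0 = dird W (sp i) (\<lambda>z. transpose (G j z) ** h z + h z ** G j z) z0"
    by (rule dird_cong[OF metric_compatible z0])
  also have "\<dots> = dird W (sp i) (\<lambda>z. transpose (G j z) ** h z) z0 + dird W (sp i) (\<lambda>z. h z ** G j z) z0"
    by (rule dird_add[OF udom_W _ _ z0]) (intro smooth_on_imp_differentiable_on smooth_on_matmul udom_W t h smooth_G)+
  also have "\<dots> = transpose (\<Gamma>' i j) + \<Gamma>' i j"
    by (simp add: dird_matmul[OF udom_W t h z0] dird_matmul[OF udom_W h smooth_G z0]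
        dird_transpose[OF udom_W smooth_G z0] h0 dh0 G_zero transpose_zero mat_zero)
  finally show ?thesis .
qed

lemma dird2_k: "dird W (sp i) (dird W (sp j) k) z0 = - (transpose (\<Gamma>' i j) + \<Gamma>' i j)"
proof -
  have "dird W (sp i) (dird W (sp j) (\<lambda>z. k z ** h z)) z0 = dird W (sp i) (dird W (sp j) (\<lambda>z. mat 1)) z0"
    by (rule dird_cong[OF dird_cong[OF k_inverse] z0])
  also have "\<dots> = dird W (sp i) (\<lambda>z. 0) z0" by (rule dird_cong[OF dird_const[OF udom_W] z0])
  finally have "dird W (sp i) (dird W (sp j) h) z0 + dird W (sp i) (dird W (sp j) k) z0 = 0"
    by (simp add: dird2_bilinear[OF udom_W bounded_bilinear_matrix_mult smooth_k h z0] dird_const[OF udom_W z0] h0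
        k_one dh0 dird_k mat_zero)
  then have "dird W (sp i) (dird W (sp j) k) z0 = - dird W (sp i) (dird W (sp j) h) z0"
    by (simp add: eq_neg_iff_add_eq_0 add.commute)
  then show ?thesis unfolding dird2_h .
qed

text \<open>At the centre G = 0, so the covariant Hessian is the ordinary second derivative
  corrected by the action of the first derivatives of G. The hypotheses of
  \<open>evolution_identity\<close> are obtained by differentiating the formulas for curvature,
  metric compatibility and flow.\<close>

lemma normal_evolution:
  "dird W (1, 0) Rm z0 + gl_action (ric (Rm z0)) (Rm z0)
   = (\<Sum>p\<in>UNIV. dird W (sp p) (dird W (sp p) Rm) z0 - gl_action (\<Gamma>' p p) (Rm z0)) + 2 *\<^sub>R Q (Rm z0)"
proof (rule evolution_identity[where R="Rm z0" and \<Gamma>=\<Gamma>' and dd="\<lambda>p m. dird W (sp p) (dird W (sp m) Rm) z0"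
      and H="\<lambda>p m. dird W (sp p) (dird W (sp m) Rm) z0 - gl_action (\<Gamma>' p m) (Rm z0)"
      and Yg="\<lambda>i j. dird W (sp i) (dird W (1, 0) (G j)) z0"])
  let ?F = "curvature_matrix W sp G"
  note d = smooth_on_imp_differentiable_on
  show "Rm z0 \<in> curvature_tensors" by (rule Rm_ct[OF z0])
  show "dird W (sp p) (dird W (sp m) Rm) z0 \<in> curvature_tensors" for p m
    by (intro ct_dird udom_W smooth_on_dird smooth_Rm z0 Rm_ct)
  show "dird W (sp p) (dird W (sp m) Rm) z0 = dird W (sp m) (dird W (sp p) Rm) z0" for p m
    by (rule dird_commute[OF open_W smooth_Rm z0])
  have F0: "?F i j z0 = \<Gamma>' i j - \<Gamma>' j i" for i j by (simp add: curvature_matrix_def G_zero mat_zero)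
  show R0: "Rm z0 $ i $ j = \<Gamma>' i j - \<Gamma>' j i" for i j by (simp add: Rm_def h0 F0)
  have Rij: "(\<lambda>z. Rm z $ i $ j) = (\<lambda>z. h z ** ?F i j z)" for i j by (simp add: Rm_def)
  have \<Gamma>sym: "\<Gamma>' p m $ a $ i = \<Gamma>' p i $ a $ m" for p m a i
  proof -
    have "dird W (sp p) (\<lambda>z. G m z $ a $ i) z0 = dird W (sp p) (\<lambda>z. G i z $ a $ m) z0"
      by (rule dird_cong[OF G_symmetric z0])
    then show ?thesis unfolding dird_entry[OF udom_W smooth_G z0] .
  qed
  \<comment> \<open>Of the twice differentiated products of Christoffel matrices only those with
    each factor differentiated once survive, since G vanishes at the centre.\<close>
  have ddF: "dird W (sp p) (dird W (sp m) (?F i j)) z0 = dird W (sp p) (dird W (sp m) (dird W (sp i) (G j))) z0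
     - dird W (sp p) (dird W (sp m) (dird W (sp j) (G i))) z0
     + (\<Gamma>' p i ** \<Gamma>' m j + \<Gamma>' m i ** \<Gamma>' p j) - (\<Gamma>' p j ** \<Gamma>' m i + \<Gamma>' m j ** \<Gamma>' p i)" for p m i j
  proof -
    have s1: "smooth_on W (dird W (sp i) (G j))" for i j by (intro smooth_on_dird smooth_G)
    have s2: "smooth_on W (\<lambda>z. G i z ** G j z)" for i j by (intro smooth_on_matmul udom_W smooth_G)
    have pull: "dird W v (\<lambda>z. f1 z - f2 z + f3 z - f4 z) z = dird W v f1 z - dird W v f2 z + dird W v f3 z - dird W v f4 z"
      if "smooth_on W f1" "smooth_on W f2" "smooth_on W f3" "smooth_on W f4" "z \<in> W" for f1 f2 f3 f4 :: "_ \<Rightarrow>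
          real^'n^'n" and v z
    proof -
      have "smooth_on W (\<lambda>z. f1 z - f2 z)" "smooth_on W (\<lambda>z. f1 z - f2 z + f3 z)"
        by (intro smooth_on_diff smooth_on_add udom_W that)+
      then show ?thesis using that
        by (simp add: dird_diff[OF udom_W d d] dird_add[OF udom_W d d])
    qed
    have "dird W (sp p) (dird W (sp m) (?F i j)) z0 = dird W (sp p) (\<lambda>z. dird W (sp m) (dird W (sp i) (G j)) z
      - dird W (sp m) (dird W (sp j) (G i)) z + dird W (sp m) (\<lambda>z. G i z ** G j z) z - dird W (sp m)
          (\<lambda>z. G j z ** G i z) z) z0"
      unfolding curvature_matrix_def by (rule dird_cong[OF pull[OF s1 s1 s2 s2] z0])
    also have "\<dots> = dird W (sp p) (dird W (sp m) (dird W (sp i) (G j))) z0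
      - dird W (sp p) (dird W (sp m) (dird W (sp j) (G i))) z0 + dird W (sp p) (dird W (sp m) (\<lambda>z. G i z ** G j z)) z0
      - dird W (sp p) (dird W (sp m) (\<lambda>z. G j z ** G i z)) z0"
      by (rule pull) (intro smooth_on_dird s1 s2 z0)+
    finally show ?thesis
      by (simp add: dird2_bilinear[OF udom_W bounded_bilinear_matrix_mult smooth_G smooth_G z0] G_zero mat_zero)
  qed
  have Hm: "(dird W (sp p) (dird W (sp m) Rm) z0 - gl_action (\<Gamma>' p m) (Rm z0)) $ i $ j
     = dird W (sp p) (dird W (sp m) (?F i j)) z0 + \<Gamma>' p m ** ?F i j z0 - ?F i j z0 ** \<Gamma>' p m
       - (\<Sum>a\<in>UNIV. \<Gamma>' p m $ a $ i *\<^sub>R ?F a j z0) - (\<Sum>a\<in>UNIV. \<Gamma>' p m $ a $ j *\<^sub>R ?F i a z0)" for p m i j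
  proof -
    have e: "dird W v Rm z $ i $ j = dird W v (\<lambda>z. h z ** ?F i j z) z" if "z \<in> W" for v z
      unfolding Rij[symmetric] by (rule dird_entry4(2)[OF udom_W smooth_Rm that, symmetric])
    have "dird W (sp p) (dird W (sp m) Rm) z0 $ i $ j = dird W (sp p) (\<lambda>z. dird W (sp m) Rm z $ i $ j) z0"
      by (rule dird_entry4(2)[OF udom_W smooth_on_dird[OF smooth_Rm] z0, symmetric])
    also have "\<dots> = dird W (sp p) (dird W (sp m) (\<lambda>z. h z ** ?F i j z)) z0"
      by (rule dird_cong[OF e z0])
    also have "\<dots> = dird W (sp p) (dird W (sp m) (?F i j)) z0 + (transpose (\<Gamma>' p m) + \<Gamma>' p m) ** ?F i j z0"
      by (simp add: dird2_bilinear[OF udom_W bounded_bilinear_matrix_mult h smooth_curvature_matrix z0] h0 dh0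
          mat_zero dird2_h)
    finally have 1: "dird W (sp p) (dird W (sp m) Rm) z0 $ i $ j = dird W (sp p) (dird W (sp m) (?F i j)) z0 +
        (transpose (\<Gamma>' p m) + \<Gamma>' p m) ** ?F i j z0" .
    have RF0: "Rm z0 $ i $ j = ?F i j z0" for i j by (simp add: R0 F0)
    have "gl_action (\<Gamma>' p m) (Rm z0) $ i $ j = (\<Sum>a\<in>UNIV. \<Gamma>' p m $ a $ i *\<^sub>R ?F a j z0) +
        (\<Sum>a\<in>UNIV. \<Gamma>' p m $ a $ j *\<^sub>R ?F i a z0)
       + transpose (\<Gamma>' p m) ** ?F i j z0 + ?F i j z0 ** \<Gamma>' p m"
      by (simp add: vec_eq_iff gl_action_def slot_nth RF0[symmetric] matrix_matrix_mult_def transpose_nth mult.commute)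
    then show ?thesis using 1 by (simp add: mat_ring)
  qed
  \<comment> \<open>In the cyclic sum the third-order terms in G cancel because derivatives commute,
    the action on the first index pair cancels by \<open>s\<close>, and the products of first
    derivatives cancel algebraically.\<close>
  show "(dird W (sp p) (dird W (sp m) Rm) z0 - gl_action (\<Gamma>' p m) (Rm z0)) $ i $ j
     + (dird W (sp p) (dird W (sp i) Rm) z0 - gl_action (\<Gamma>' p i) (Rm z0)) $ j $ m
     + (dird W (sp p) (dird W (sp j) Rm) z0 - gl_action (\<Gamma>' p j) (Rm z0)) $ m $ i = 0" for p m i j
  proof -
    have c3: "dird W (sp p) (dird W (sp m) (dird W (sp i) (G j))) z0 = dird W (sp p)
        (dird W (sp i) (dird W (sp m) (G j))) z0" for m i j
      by (rule dird_cong[OF dird_commute[OF open_W smooth_G] z0])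
    have s: "(\<Sum>a\<in>UNIV. \<Gamma>' p m $ a $ i *\<^sub>R ?F a j z0) = - (\<Sum>a\<in>UNIV. \<Gamma>' p i $ a $ m *\<^sub>R ?F j a z0)" for m i j
      unfolding sum_negf[symmetric] by (intro sum.cong refl)
          (simp add: \<Gamma>sym[of p m] F0 scaleR_minus_right[symmetric] del: scaleR_minus_right)
    show ?thesis
      unfolding Hm ddF
      unfolding s[of m i j] s[of i j m] s[of j m i]
      unfolding F0 mat_ring
      using c3[of m i j] c3[of i j m] c3[of j m i] by (simp add: algebra_simps)
  qed
  show "dird W (1, 0) Rm z0 $ i $ j = - 2 *\<^sub>R (ric (Rm z0) ** Rm z0 $ i $ j)
     + (dird W (sp i) (dird W (1, 0) (G j)) z0 - dird W (sp j) (dird W (1, 0) (G i)) z0)" for i j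
  proof -
    have "dird W (1, 0) Rm z0 $ i $ j = dird W (1, 0) (\<lambda>z. h z ** ?F i j z) z0"
      unfolding Rij[symmetric] by (rule dird_entry4(2)[OF udom_W smooth_Rm z0, symmetric])
    also have "\<dots> = dird W (1, 0) (?F i j) z0 - 2 *\<^sub>R (ric (Rm z0) ** ?F i j z0)"
      by (simp add: dird_matmul[OF udom_W h smooth_curvature_matrix z0] h0 flow[OF z0] k_one
          ric_eq_ric_wrt[symmetric] mat_ring)
    also have "dird W (1, 0) (?F i j) z0 = dird W (1, 0) (dird W (sp i) (G j)) z0 - dird W (1, 0) (dird W (sp j) (G i)) z0"
    proof -
      have s: "smooth_on W (dird W (sp i) (G j))" "smooth_on W (\<lambda>z. G i z ** G j z)" for i j
        by (intro smooth_on_dird smooth_on_matmul udom_W smooth_G)+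
      have s2: "smooth_on W (\<lambda>z. dird W (sp i) (G j) z - dird W (sp j) (G i) z)"
        "smooth_on W (\<lambda>z. dird W (sp i) (G j) z - dird W (sp j) (G i) z + G i z ** G j z)"
        by (intro smooth_on_diff smooth_on_add udom_W s)+
      show ?thesis unfolding curvature_matrix_def
        by (simp add: dird_diff[OF udom_W d[OF s2(2)] d[OF s(2)] z0] dird_add[OF udom_W d[OF s2(1)] d[OF s(2)] z0]
            dird_diff[OF udom_W d[OF s(1)] d[OF s(1)] z0]
            dird_matmul[OF udom_W smooth_G smooth_G z0] G_zero mat_zero)
    qed
    also have "\<dots> = dird W (sp i) (dird W (1, 0) (G j)) z0 - dird W (sp j) (dird W (1, 0) (G i)) z0"
      using dird_commute[OF open_W smooth_G z0] by simp
    finally show ?thesis by (simp add: R0 F0)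
  qed
  show "dird W (sp i) (dird W (1, 0) (G j)) z0 $ a $ b = dird W (sp i) (dird W (1, 0) (G b)) z0 $ a $ j" for i j a b
  proof -
    have "dird W (1, 0) (G j) z $ a $ b = dird W (1, 0) (G b) z $ a $ j" if z: "z \<in> W" for z
    proof -
      have "dird W (1, 0) (\<lambda>z. G j z $ a $ b) z = dird W (1, 0) (\<lambda>z. G b z $ a $ j) z"
        by (rule dird_cong[OF G_symmetric z])
      then show ?thesis unfolding dird_entry[OF udom_W smooth_G z] .
    qed
    then have "dird W (sp i) (\<lambda>z. dird W (1, 0) (G j) z $ a $ b) z0 = dird W (sp i) (\<lambda>z. dird W (1, 0) (G b) z $ a $ j) z0"
      by (rule dird_cong[OF _ z0])
    then show ?thesis unfolding dird_entry[OF udom_W smooth_on_dird[OF smooth_G] z0] .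
  qed
  \<comment> \<open>The derivative of h once in time and twice in space is computed in two ways:
    through the flow equation, giving the Hessian of Ric, and through metric compatibility, giving
    the time derivative of G.\<close>
  show "dird W (sp i) (dird W (1, 0) (G j)) z0 + transpose (dird W (sp i) (dird W (1, 0) (G j)) z0)
      = - 2 *\<^sub>R ric (dird W (sp i) (dird W (sp j) Rm) z0 - gl_action (\<Gamma>' i j) (Rm z0))" for i j
  proof -
    let ?r = "\<lambda>z. ric_wrt (k z) (Rm z)"
    have sr: "smooth_on W ?r" by (rule smooth_on_bilinear[OF udom_W bounded_bilinear_ric_wrt smooth_k smooth_Rm])
    have "dird W (sp i) (dird W (1, 0) (dird W (sp j) h)) z0 = dird W (sp i) (dird W (sp j) (dird W (1, 0) h)) z0"
      by (rule dird_cong[OF dird_commute[OF open_W h] z0])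
    also have "\<dots> = dird W (sp i) (dird W (sp j) (\<lambda>z. - 2 *\<^sub>R ?r z)) z0"
      by (rule dird_cong[OF dird_cong[OF flow] z0])
    also have "\<dots> = dird W (sp i) (\<lambda>z. - 2 *\<^sub>R dird W (sp j) ?r z) z0"
      by (rule dird_cong[OF dird_linear_compose[OF udom_W bounded_linear_scaleR_right d[OF sr]] z0])
    also have "\<dots> = - 2 *\<^sub>R dird W (sp i) (dird W (sp j) ?r) z0"
      by (rule dird_linear_compose[OF udom_W bounded_linear_scaleR_right d[OF smooth_on_dird[OF sr]] z0])
    also have "dird W (sp i) (dird W (sp j) ?r) z0 = ric (dird W (sp i) (dird W (sp j) Rm) z0) - ric_wrt
        (transpose (\<Gamma>' i j) + \<Gamma>' i j) (Rm z0)"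
      by (simp add: dird2_bilinear[OF udom_W bounded_bilinear_ric_wrt smooth_k smooth_Rm z0] k_one dird_k dh0
          dird2_k ric_eq_ric_wrt
        bounded_bilinear.zero_left[OF bounded_bilinear_ric_wrt] bounded_bilinear.minus_left[OF bounded_bilinear_ric_wrt]
        bounded_bilinear.diff_left[OF bounded_bilinear_ric_wrt] bounded_bilinear.add_left[OF bounded_bilinear_ric_wrt])
    finally have 1: "dird W (sp i) (dird W (1, 0) (dird W (sp j) h)) z0
      = - 2 *\<^sub>R (ric (dird W (sp i) (dird W (sp j) Rm) z0) - ric_wrt (transpose (\<Gamma>' i j) + \<Gamma>' i j) (Rm z0))" .
    have t: "smooth_on W (\<lambda>z. transpose (G j z))" by (rule smooth_on_transpose[OF udom_W smooth_G])
    have th: "smooth_on W (\<lambda>z. transpose (G j z) ** h z)" "smooth_on W (\<lambda>z. h z ** G j z)"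
      by (intro smooth_on_matmul udom_W t h smooth_G)+
    have dt: "dird W v (\<lambda>z. transpose (G j z)) z = transpose (dird W v (G j) z)" if "z \<in> W" for v z
      by (rule dird_transpose[OF udom_W smooth_G that])
    have ddt: "dird W u (dird W v (\<lambda>z. transpose (G j z))) z0 = transpose (dird W u (dird W v (G j)) z0)" for u v
      by (subst dird_cong[OF dt z0], assumption) (rule dird_transpose[OF udom_W smooth_on_dird[OF smooth_G] z0])
    have "dird W (sp i) (dird W (1, 0) (dird W (sp j) h)) z0
       = dird W (sp i) (dird W (1, 0) (\<lambda>z. transpose (G j z) ** h z + h z ** G j z)) z0"
      by (rule dird_cong[OF dird_cong[OF metric_compatible] z0])
    also have "\<dots> = dird W (sp i) (\<lambda>z. dird W (1, 0) (\<lambda>z. transpose (G j z) ** h z) z + dird W (1, 0)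
        (\<lambda>z. h z ** G j z) z) z0"
      by (rule dird_cong[OF dird_add[OF udom_W d[OF th(1)] d[OF th(2)]] z0])
    also have "\<dots> = dird W (sp i) (dird W (1, 0) (\<lambda>z. transpose (G j z) ** h z)) z0 + dird W (sp i)
        (dird W (1, 0) (\<lambda>z. h z ** G j z)) z0"
      by (rule dird_add[OF udom_W d[OF smooth_on_dird[OF th(1)]] d[OF smooth_on_dird[OF th(2)]] z0])
    also have "\<dots> = transpose (dird W (sp i) (dird W (1, 0) (G j)) z0) + dird W (sp i) (dird W (1, 0) (G j)) z0
       - 2 *\<^sub>R (transpose (\<Gamma>' i j) ** ric (Rm z0)) - 2 *\<^sub>R (ric (Rm z0) ** \<Gamma>' i j)"
      by (simp add: dird2_bilinear[OF udom_W bounded_bilinear_matrix_mult t h z0]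
          dird2_bilinear[OF udom_W bounded_bilinear_matrix_mult h smooth_G z0]
        dt[OF z0] ddt h0 dh0 G_zero mat_ring flow[OF z0] k_one ric_eq_ric_wrt[symmetric])
    finally show ?thesis
      using 1 by (simp add: ric_diff ric_wrt_gl_action scaleR_diff_right scaleR_add_right algebra_simps)
  qed
qed simp_all

end

end

section \<open>Derivatives of the curvature scalars\<close>

lemmas slot_zero = bounded_bilinear.zero_left[OF bounded_bilinear_slots(1)]
    bounded_bilinear.zero_left[OF bounded_bilinear_slots(2)]
    bounded_bilinear.zero_left[OF bounded_bilinear_slots(3)] bounded_bilinear.zero_left[OF bounded_bilinear_slots(4)]

text \<open>Varying the inverse metric in |Ric|^2 has the same effect as letting M act on R.
  Adjointness combines the terms with M and with its transpose.\<close>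

lemma ric_inner_gl_action:
  fixes R :: "'n::finite tensor4" and M :: "real^'n^'n"
  assumes "transpose (ric R) = ric R"
  shows "((M + transpose M) ** ric R + ric R ** (M + transpose M)) \<bullet> ric R + 2 * (ric R \<bullet> ric_wrt (M + transpose M) R)
     = 2 * (ric R \<bullet> ric (gl_action M R))"
proof -
  have 1: "(M ** ric R) \<bullet> ric R = ric R \<bullet> (transpose M ** ric R)" by (rule mat_inner_mult(1))
  have 2: "(ric R ** transpose M) \<bullet> ric R = ric R \<bullet> (ric R ** M)" using
      mat_inner_mult(2)[of "ric R" "transpose M" "ric R"] by simp
  show ?thesis unfolding ric_wrt_gl_action mat_ring inner_add_left inner_add_right 1 2
    by (simp add: inner_commute[of "transpose M ** ric R"] inner_commute[of "ric R ** M"])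
qed

lemma inner_gl_action_symmetrized: "R \<bullet> gl_action (M + transpose M) R = 2 * (R \<bullet> gl_action M R)" for R ::
    "'n::finite tensor4" and M
proof -
  have "gl_action (M + transpose M) R = gl_action M R + gl_action (transpose M) R"
    by (simp add: gl_action_def bounded_bilinear.add_left[OF bounded_bilinear_slots(1)]
        bounded_bilinear.add_left[OF bounded_bilinear_slots(2)]
     bounded_bilinear.add_left[OF bounded_bilinear_slots(3)] bounded_bilinear.add_left[OF bounded_bilinear_slots(4)])
  moreover have "R \<bullet> gl_action (transpose M) R = R \<bullet> gl_action M R" using gl_action_adjoint[of M R R] by
      (simp add: inner_commute)
  ultimately show ?thesis by (simp add: inner_add_right)
qed

lemma scal_gl_action:
  assumes R: "R \<in> curvature_tensors"
  shows "(M + transpose M) \<bullet> ric R + scal Y + mat 1 \<bullet> ric_wrt (M + transpose M) R = scal (Y + gl_action M R)"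
proof -
  have 1: "mat 1 \<bullet> (transpose M ** ric R) = M \<bullet> ric R"
    using mat_inner_mult(1)[of "transpose M" "ric R" "mat 1"] by (simp add: inner_commute)
  have 2: "mat 1 \<bullet> (ric R ** M) = transpose M \<bullet> ric R"
    using mat_inner_mult(2)[of "ric R" M "mat 1"] by (simp add: inner_commute)
  show ?thesis by (simp add: scal_eq_inner ric_add ric_wrt_gl_action inner_add_left inner_add_right 1 2)
qed

section \<open>Differentiating the scalars where the inverse metric is the identity\<close>

context
  fixes S :: "'a::euclidean_space set" and k :: "'a \<Rightarrow> real^'n::finite^'n" and X :: "'a \<Rightarrow> 'n tensor4"
  assumes S: "udom S" and k: "smooth_on S k" and X: "smooth_on S X"
begin

lemma smooth_slots:
  "smooth_on S (\<lambda>z. slot4 (k z) (X z))" "smooth_on S (\<lambda>z. slot3 (k z) (slot4 (k z) (X z)))"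
  "smooth_on S (\<lambda>z. slot2 (k z) (slot3 (k z) (slot4 (k z) (X z))))"
  "smooth_on S (\<lambda>z. frame_components (k z) (X z))"
  unfolding frame_components_slots
  by (intro smooth_on_bilinear[OF S bounded_bilinear_slots(1)] smooth_on_bilinear[OF S bounded_bilinear_slots(2)]
      smooth_on_bilinear[OF S bounded_bilinear_slots(3)] smooth_on_bilinear[OF S bounded_bilinear_slots(4)] k X)+

lemma smooth_ric_wrt: "smooth_on S (\<lambda>z. ric_wrt (k z) (X z))"
  by (rule smooth_on_bilinear[OF S bounded_bilinear_ric_wrt k X])

lemma smooth_krk: "smooth_on S (\<lambda>z. k z ** ric_wrt (k z) (X z))" "smooth_on S (\<lambda>z. k z ** ric_wrt (k z) (X z) ** k z)"
  by (intro smooth_on_matmul S k smooth_ric_wrt)+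

lemma smooth_pinching_wrt: "smooth_on S (\<lambda>z. pinching_wrt c (k z) (X z))"
proof -
  have "smooth_on S (\<lambda>z. ((k z ** ric_wrt (k z) (X z) ** k z) \<bullet> ric_wrt (k z) (X z) - c *
      (X z \<bullet> frame_components (k z) (X z))) * (1/4))"
    by (intro smooth_on_mult smooth_on_diff smooth_on_inner smooth_on_const S smooth_krk smooth_ric_wrt X smooth_slots)
  then show ?thesis unfolding pinching_wrt_def by simp
qed

lemma smooth_scal_wrt: "smooth_on S (\<lambda>z. scal_wrt (k z) (X z))"
  unfolding scal_wrt_def by (intro smooth_on_inner S k smooth_ric_wrt)

lemma dird_scaled_diff:
  assumes "smooth_on S f" "smooth_on S g" "z \<in> S"
  shows "dird S u (\<lambda>z. (f z - c * g z) / 4) z = (dird S u f z - c * dird S u g z) / (4::real)"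
proof -
  note d = smooth_on_imp_differentiable_on
  have "dird S u (\<lambda>z. (f z - c * g z) / 4) z = dird S u (\<lambda>z. f z - c * g z) z / 4"
    by (rule dird_linear_compose[OF S bounded_linear_divide _ assms(3)])
      (intro d smooth_on_diff smooth_on_mult smooth_on_const S assms)
  also have "dird S u (\<lambda>z. f z - c * g z) z = dird S u f z - dird S u (\<lambda>z. c * g z) z"
    by (rule dird_diff[OF S d[OF assms(1)] _ assms(3)]) (intro d smooth_on_mult smooth_on_const S assms)
  also have "dird S u (\<lambda>z. c * g z) z = c * dird S u g z"
    by (rule dird_linear_compose[OF S bounded_linear_mult_right d[OF assms(2)] assms(3)])
  finally show ?thesis .
qed

context
  fixes z0 assumes z0: "z0 \<in> S" and k_one: "k z0 = mat 1"
begin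

lemma dird_frame: "dird S u (\<lambda>z. frame_components (k z) (X z)) z0 = dird S u X z0 + gl_action (dird S u k z0) (X z0)"
proof -
  note d = smooth_on_imp_differentiable_on
  show ?thesis unfolding frame_components_slots
    by (simp add: dird_bilinear[OF S bounded_bilinear_slots(1) d[OF k] d[OF smooth_slots(3)] z0]
      dird_bilinear[OF S bounded_bilinear_slots(2) d[OF k] d[OF smooth_slots(2)] z0]
      dird_bilinear[OF S bounded_bilinear_slots(3) d[OF k] d[OF smooth_slots(1)] z0]
      dird_bilinear[OF S bounded_bilinear_slots(4) d[OF k] d[OF X] z0] k_one slot_one gl_action_def)
qed

lemma dird2_frame:
  assumes "dird S u k z0 = 0"
  shows "dird S u (dird S u (\<lambda>z. frame_components (k z) (X z))) z0
    = dird S u (dird S u X) z0 + gl_action (dird S u (dird S u k) z0) (X z0)"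
  unfolding frame_components_slots
  by (simp add: dird2_bilinear[OF S bounded_bilinear_slots(1) k smooth_slots(3) z0]
      dird2_bilinear[OF S bounded_bilinear_slots(2) k smooth_slots(2) z0]
      dird2_bilinear[OF S bounded_bilinear_slots(3) k smooth_slots(1) z0]
      dird2_bilinear[OF S bounded_bilinear_slots(4) k X z0] k_one slot_one gl_action_def assms slot_zero)

text \<open>A first-order change \<open>M + transpose M\<close> of the inverse metric is traded for
  the action of M on the tensor. In time M is Ric; for second derivatives in space it is minus the
  derivative of the Christoffel matrix, which produces the covariant Hessian.\<close>

lemma dird_pinching_wrt:
  assumes R: "X z0 \<in> curvature_tensors" and M: "dird S u k z0 = M + transpose M"
  shows "dird S u (\<lambda>z. pinching_wrt c (k z) (X z)) z0 = 2 * pinching_form c (X z0) (dird S u X z0 + gl_action M (X z0))"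
proof -
  note d = smooth_on_imp_differentiable_on
  let ?r = "\<lambda>z. ric_wrt (k z) (X z)"
  have r0: "?r z0 = ric (X z0)" by (simp add: k_one ric_eq_ric_wrt)
  have dr: "dird S u ?r z0 = ric (dird S u X z0) + ric_wrt (M + transpose M) (X z0)"
    by (simp add: dird_bilinear[OF S bounded_bilinear_ric_wrt d[OF k] d[OF X] z0] k_one ric_eq_ric_wrt M)
  have "dird S u (\<lambda>z. (k z ** ?r z ** k z) \<bullet> ?r z) z0
     = ric (X z0) \<bullet> dird S u ?r z0 + (ric (X z0) ** (M + transpose M) +
         (dird S u ?r z0 + (M + transpose M) ** ric (X z0))) \<bullet> ric (X z0)"
    by (simp add: dird_bilinear[OF S bounded_bilinear_inner d[OF smooth_krk(2)] d[OF smooth_ric_wrt] z0]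
      dird_matmul[OF S smooth_krk(1) k z0] dird_matmul[OF S k smooth_ric_wrt z0] k_one M r0[unfolded k_one])
  also have "\<dots> = 2 * (ric (X z0) \<bullet> ric (dird S u X z0 + gl_action M (X z0)))"
    using ric_inner_gl_action[OF ric_sym[OF R], of M] unfolding dr ric_add
    by (simp add: inner_add_left inner_add_right inner_commute[of "ric (dird S u X z0)"] inner_commute[of "ric_wrt _ _"])
  finally have 1: "dird S u (\<lambda>z. (k z ** ?r z ** k z) \<bullet> ?r z) z0 = 2 *
      (ric (X z0) \<bullet> ric (dird S u X z0 + gl_action M (X z0)))" .
  have 2: "dird S u (\<lambda>z. X z \<bullet> frame_components (k z) (X z)) z0 = 2 * (X z0 \<bullet> (dird S u X z0 + gl_action M (X z0)))"
    by (simp add: dird_bilinear[OF S bounded_bilinear_inner d[OF X] d[OF smooth_slots(4)] z0] dird_frame k_one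
        frame_components_one M
       inner_add_right inner_gl_action_symmetrized inner_commute[of "dird S u X z0"])
  have "dird S u (\<lambda>z. pinching_wrt c (k z) (X z)) z0 = (dird S u (\<lambda>z. (k z ** ?r z ** k z) \<bullet> ?r z) z0
      - c * dird S u (\<lambda>z. X z \<bullet> frame_components (k z) (X z)) z0) / 4"
    unfolding pinching_wrt_def by (rule dird_scaled_diff[OF _ _ z0])
        (intro smooth_on_inner S smooth_krk smooth_ric_wrt X smooth_slots)+
  then show ?thesis unfolding 1 2 pinching_form_def by (simp add: algebra_simps)
qed

lemma dird2_pinching_wrt:
  assumes R: "X z0 \<in> curvature_tensors" and dird_k: "dird S u k z0 = 0" and M: "dird S u (dird S u k) z0 = M + transpose M"
  shows "dird S u (dird S u (\<lambda>z. pinching_wrt c (k z) (X z))) z0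
    = 2 * pinching_form c (dird S u X z0) (dird S u X z0) + 2 * pinching_form c (X z0)
        (dird S u (dird S u X) z0 + gl_action M (X z0))"
proof -
  note d = smooth_on_imp_differentiable_on
  let ?r = "\<lambda>z. ric_wrt (k z) (X z)"
  have r0: "?r z0 = ric (X z0)" by (simp add: k_one ric_eq_ric_wrt)
  have r1: "dird S u ?r z0 = ric (dird S u X z0)"
    by (simp add: dird_bilinear[OF S bounded_bilinear_ric_wrt d[OF k] d[OF X] z0] k_one ric_eq_ric_wrt dird_k
        bounded_bilinear.zero_left[OF bounded_bilinear_ric_wrt])
  have r2: "dird S u (dird S u ?r) z0 = ric (dird S u (dird S u X) z0) + ric_wrt (M + transpose M) (X z0)"
    by (simp add: dird2_bilinear[OF S bounded_bilinear_ric_wrt k X z0] k_one ric_eq_ric_wrt dird_k M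
        bounded_bilinear.zero_left[OF bounded_bilinear_ric_wrt])
  have "dird S u (dird S u (\<lambda>z. (k z ** ?r z ** k z) \<bullet> ?r z)) z0
     = ric (X z0) \<bullet> dird S u (dird S u ?r) z0 + 2 * (dird S u ?r z0 \<bullet> dird S u ?r z0)
       + (ric (X z0) ** (M + transpose M) + (dird S u (dird S u ?r) z0 + (M + transpose M) ** ric (X z0))) \<bullet> ric (X z0)"
    by (simp add: dird2_bilinear[OF S bounded_bilinear_inner smooth_krk(2) smooth_ric_wrt z0]
      dird2_bilinear[OF S bounded_bilinear_matrix_mult smooth_krk(1) k z0]
          dird2_bilinear[OF S bounded_bilinear_matrix_mult k smooth_ric_wrt z0]
      dird_matmul[OF S smooth_krk(1) k z0] dird_matmul[OF S k smooth_ric_wrt z0] k_one M r0[unfolded k_one] dird_k mat_zero)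
  also have "\<dots> = 2 * (ric (X z0) \<bullet> ric (dird S u (dird S u X) z0 + gl_action M (X z0))) + 2 *
      (ric (dird S u X z0) \<bullet> ric (dird S u X z0))"
    using ric_inner_gl_action[OF ric_sym[OF R], of M] unfolding r2 r1 ric_add
    by (simp add: inner_add_left inner_add_right inner_commute[of "ric (dird S u (dird S u X) z0)"]
        inner_commute[of "ric_wrt _ _"])
  finally have 1: "dird S u (dird S u (\<lambda>z. (k z ** ?r z ** k z) \<bullet> ?r z)) z0
    = 2 * (ric (X z0) \<bullet> ric (dird S u (dird S u X) z0 + gl_action M (X z0))) + 2 *
        (ric (dird S u X z0) \<bullet> ric (dird S u X z0))" .
  have 2: "dird S u (dird S u (\<lambda>z. X z \<bullet> frame_components (k z) (X z))) z0
     = 2 * (X z0 \<bullet> (dird S u (dird S u X) z0 + gl_action M (X z0))) + 2 * (dird S u X z0 \<bullet> dird S u X z0)"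
    by (simp add: dird2_bilinear[OF S bounded_bilinear_inner X smooth_slots(4) z0] dird2_frame[OF dird_k]
        dird_frame dird_k k_one frame_components_one M
       inner_add_right inner_gl_action_symmetrized inner_commute[of "dird S u (dird S u X) z0"])
      (simp add: gl_action_def slot_zero)
  have s: "smooth_on S (\<lambda>z. (k z ** ?r z ** k z) \<bullet> ?r z)" "smooth_on S (\<lambda>z. X z \<bullet> frame_components (k z) (X z))"
    by (intro smooth_on_inner S smooth_krk smooth_ric_wrt X smooth_slots)+
  have "dird S u (dird S u (\<lambda>z. pinching_wrt c (k z) (X z))) z0 = (dird S u (dird S u (\<lambda>z. (k z ** ?r z ** k z) \<bullet> ?r z)) z0
      - c * dird S u (dird S u (\<lambda>z. X z \<bullet> frame_components (k z) (X z))) z0) / 4"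
    unfolding pinching_wrt_def
    by (subst dird_cong[OF dird_scaled_diff[OF s] z0], assumption, rule
        dird_scaled_diff[OF smooth_on_dird[OF s(1)] smooth_on_dird[OF s(2)] z0])
  then show ?thesis unfolding 1 2 pinching_form_def by
      (simp add: distrib_left right_diff_distrib add_divide_distrib diff_divide_distrib)
qed

lemma dird_scal_wrt:
  assumes R: "X z0 \<in> curvature_tensors" and M: "dird S u k z0 = M + transpose M"
  shows "dird S u (\<lambda>z. scal_wrt (k z) (X z)) z0 = scal (dird S u X z0 + gl_action M (X z0))"
proof -
  note d = smooth_on_imp_differentiable_on
  have dr: "dird S u (\<lambda>z. ric_wrt (k z) (X z)) z0 = ric (dird S u X z0) + ric_wrt (M + transpose M) (X z0)"
    by (simp add: dird_bilinear[OF S bounded_bilinear_ric_wrt d[OF k] d[OF X] z0] k_one ric_eq_ric_wrt M)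
  show ?thesis unfolding scal_wrt_def scal_gl_action[OF R, symmetric]
    by (simp add: dird_bilinear[OF S bounded_bilinear_inner d[OF k] d[OF smooth_ric_wrt] z0] dr k_one M
        ric_eq_ric_wrt[symmetric] inner_add_right scal_eq_inner)
qed

lemma dird2_scal_wrt:
  assumes R: "X z0 \<in> curvature_tensors" and dird_k: "dird S u k z0 = 0" and M: "dird S u (dird S u k) z0 = M + transpose M"
  shows "dird S u (dird S u (\<lambda>z. scal_wrt (k z) (X z))) z0 = scal (dird S u (dird S u X) z0 + gl_action M (X z0))"
proof -
  have r2: "dird S u (dird S u (\<lambda>z. ric_wrt (k z) (X z))) z0 = ric (dird S u (dird S u X) z0) + ric_wrt
      (M + transpose M) (X z0)"
    by (simp add: dird2_bilinear[OF S bounded_bilinear_ric_wrt k X z0] k_one ric_eq_ric_wrt dird_k M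
        bounded_bilinear.zero_left[OF bounded_bilinear_ric_wrt])
  show ?thesis unfolding scal_wrt_def scal_gl_action[OF R, symmetric]
    by (simp add: dird2_bilinear[OF S bounded_bilinear_inner k smooth_ric_wrt z0] r2 k_one M dird_k
        ric_eq_ric_wrt[symmetric] inner_add_right scal_eq_inner)
qed

end

end

section \<open>Second derivative test and monotonicity at spatial minima\<close>

lemma second_derivative_test:
  fixes f :: "'a::euclidean_space \<Rightarrow> real"
  assumes W: "open W" and f: "smooth_on W f" and x: "x \<in> W" and e: "e > 0"
    and m: "\<And>s. \<bar>s\<bar> < e \<Longrightarrow> f x \<le> f (x + s *\<^sub>R u)"
  shows "dird W u f x = 0" "dird W u (dird W u f) x \<ge> 0"
proof -
  have "open ((\<lambda>s. x + s *\<^sub>R u) -` W)"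
    by (intro open_vimage W continuous_intros)
  moreover have "0 \<in> (\<lambda>s. x + s *\<^sub>R u) -` W" using x by simp
  ultimately obtain d' where d': "d' > 0" and b: "ball 0 d' \<subseteq> (\<lambda>s. x + s *\<^sub>R u) -` W"
    by (rule openE)
  have d'2: "x + s *\<^sub>R u \<in> W" if "\<bar>s\<bar> < d'" for s using b that by (auto simp: dist_norm)
  define d where "d = min d' e"
  have d: "d > 0" "\<And>s. \<bar>s\<bar> < d \<Longrightarrow> x + s *\<^sub>R u \<in> W" using d' d'2 e by (auto simp: d_def)
  have g: "DERIV (\<lambda>s. f (x + s *\<^sub>R u)) s :> dird W u f (x + s *\<^sub>R u)" if "\<bar>s\<bar> < d" for s
    using dird_line[OF smooth_on_imp_differentiable_on[OF f] W d(2)[OF that]]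
    by (simp add: has_real_derivative_iff_has_vector_derivative)
  have g': "DERIV (\<lambda>s. dird W u f (x + s *\<^sub>R u)) 0 :> dird W u (dird W u f) x"
    using dird_line[OF smooth_on_imp_differentiable_on[OF smooth_on_dird[OF f]] W, of x 0 u u] x
    by (simp add: has_real_derivative_iff_has_vector_derivative)
  show z: "dird W u f x = 0"
    using DERIV_local_min[OF g[of 0] d(1)] m d(1) by (auto simp: d_def)
  show "dird W u (dird W u f) x \<ge> 0"
  proof (rule ccontr)
    assume "\<not> ?thesis"
    from DERIV_neg_dec_right[OF g'] this obtain b where b: "b > 0" "\<And>s. 0 < s \<Longrightarrow> s < b \<Longrightarrow> dird W u f (x + s *\<^sub>R u) < 0"
      using z by auto
    define c where "c = min b d / 2"
    have c: "0 < c" "c < b" "c < d" using b(1) d(1) by (auto simp: c_def)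
    obtain y where y: "0 < y" "y < c" "f (x + c *\<^sub>R u) - f (x + 0 *\<^sub>R u) = (c - 0) * dird W u f (x + y *\<^sub>R u)"
      using MVT2[OF c(1), of "\<lambda>s. f (x + s *\<^sub>R u)" "\<lambda>s. dird W u f (x + s *\<^sub>R u)"] g c by force
    have "dird W u f (x + y *\<^sub>R u) < 0" by (rule b(2)) (use y c in auto)
    then have "f (x + c *\<^sub>R u) < f x" using y(3) c(1) mult_pos_neg[OF c(1)] by fastforce
    with m[of c] c show False by (auto simp: d_def)
  qed
qed

lemma gl_action_minus: "gl_action (- M) X = - gl_action M X"
  using gl_action_diff_left[of 0 M X] gl_action_diff_left[of 0 0 X] by simp

lemma pinching_form_add_left: "pinching_form c (X + Y) Z = pinching_form c X Z + pinching_form c Y Z" and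
    pinching_form_scaleR_left: "pinching_form c (r *\<^sub>R X) Z = r * pinching_form c X Z"
  by (simp_all add: pinching_form_sym[of c _ Z] pinching_form_add pinching_form_scaleR)

lemma pinching_form_sum: "pinching_form c X (\<Sum>i\<in>A. f i) = (\<Sum>i\<in>A. pinching_form c X (f i))"
  by (induction A rule: infinite_finite_induct)
      (simp_all add: pinching_form_add, simp_all add: pinching_form_def ric_eq_ric_wrt
      bounded_bilinear.zero_right[OF bounded_bilinear_ric_wrt])

lemma scal_sum: "scal (\<Sum>i\<in>A. f i) = (\<Sum>i\<in>A. scal (f i))"
  by (induction A rule: infinite_finite_induct)
      (simp_all add: scal_add, simp_all add: scal_eq_inner ric_eq_ric_wrt
      bounded_bilinear.zero_right[OF bounded_bilinear_ric_wrt])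

lemma scal_Q: "R \<in> curvature_tensors \<Longrightarrow> scal (Q R) = ric R \<bullet> ric R"
  using ric_wrt_sym[of R "mat 1" "ric R"] by (simp add: scal_eq_inner ric_Q ric_eq_ric_wrt[symmetric])

lemma scal_wrt_one: "scal_wrt (mat 1) X = scal X" by (simp add: scal_wrt_def scal_eq_inner ric_eq_ric_wrt)

lemma pinching_wrt_one: "pinching_wrt c (mat 1) X = pinching_form c X X"
  by (simp add: pinching_wrt_def pinching_form_def ric_eq_ric_wrt frame_components_one)

lemma scal_round_tensor: "scal (round_tensor :: 'n::finite tensor4) = real CARD('n) * (real CARD('n) - 1)"
  by (simp add: scal_def ric_round_tensor trace_def mat_def)

context local_flow
begin

lemma smooth_pinching: "smooth_on W (\<lambda>z. pinching_wrt c (k z) (Rm z))"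
  and smooth_scal: "smooth_on W (\<lambda>z. scal_wrt (k z) (Rm z))"
  by (rule smooth_pinching_wrt[OF udom_W smooth_k smooth_Rm], rule smooth_scal_wrt[OF udom_W smooth_k smooth_Rm])

lemma linear_combination:
  "smooth_on W (\<lambda>z. \<alpha> * pinching_wrt c (k z) (Rm z) + \<beta> * scal_wrt (k z) (Rm z))"
  "z \<in> W \<Longrightarrow> dird W u (\<lambda>z. \<alpha> * pinching_wrt c (k z) (Rm z) + \<beta> * scal_wrt (k z) (Rm z)) z
    = \<alpha> * dird W u (\<lambda>z. pinching_wrt c (k z) (Rm z)) z + \<beta> * dird W u (\<lambda>z. scal_wrt (k z) (Rm z)) z"
proof -
  note d = smooth_on_imp_differentiable_on
  have m: "smooth_on W (\<lambda>z. \<alpha> * pinching_wrt c (k z) (Rm z))" "smooth_on W (\<lambda>z. \<beta> * scal_wrt (k z) (Rm z))"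
    by (intro smooth_on_mult smooth_on_const udom_W smooth_pinching smooth_scal)+
  then show "smooth_on W (\<lambda>z. \<alpha> * pinching_wrt c (k z) (Rm z) + \<beta> * scal_wrt (k z) (Rm z))" by (intro smooth_on_add udom_W)
  assume z: "z \<in> W"
  show "dird W u (\<lambda>z. \<alpha> * pinching_wrt c (k z) (Rm z) + \<beta> * scal_wrt (k z) (Rm z)) z
    = \<alpha> * dird W u (\<lambda>z. pinching_wrt c (k z) (Rm z)) z + \<beta> * dird W u (\<lambda>z. scal_wrt (k z) (Rm z)) z"
    using dird_add[OF udom_W d[OF m(1)] d[OF m(2)] z]
    by (simp add: dird_linear_compose[OF udom_W bounded_linear_mult_right d[OF smooth_pinching] z]
        dird_linear_compose[OF udom_W bounded_linear_mult_right d[OF smooth_scal] z])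
qed

context
  fixes z0 assumes z0: "z0 \<in> W" and h0: "h z0 = mat 1" and dh0: "\<And>i. dird W (sp i) h z0 = 0"
begin

text \<open>Diagonal entries of the covariant Hessian. The companion \<open>Rm_velocity\<close> is
  the time derivative in Uhlenbeck's moving frame, which stays orthonormal along the flow; the
  action of Ric accounts for the motion of the frame.\<close>

abbreviation "Hess p \<equiv> dird W (sp p) (dird W (sp p) Rm) z0 - gl_action (dird W (sp p) (G p) z0) (Rm z0)"
abbreviation "Rm_velocity \<equiv> dird W (1, 0) Rm z0 + gl_action (ric (Rm z0)) (Rm z0)"

lemma time_derivatives:
  "dird W (1, 0) (\<lambda>z. pinching_wrt c (k z) (Rm z)) z0 = 2 * pinching_form c (Rm z0) Rm_velocity"
  "dird W (1, 0) (\<lambda>z. scal_wrt (k z) (Rm z)) z0 = scal Rm_velocity"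
proof -
  have "ric (Rm z0) = transpose (ric (Rm z0))" by (rule ric_sym[OF Rm_ct[OF z0], symmetric])
  \<comment> \<open>The inverse metric grows by 2 Ric, written as a matrix plus its transpose so
    that M = Ric.\<close>
  then have "dird W (1, 0) k z0 = ric (Rm z0) + transpose (ric (Rm z0))"
    using dird_k[OF z0 h0 dh0, of "(1,0)"] dh0 by
        (simp add: flow[OF z0] k_one[OF z0 h0 dh0] ric_eq_ric_wrt[symmetric] scaleR_2[symmetric])
  then show "dird W (1, 0) (\<lambda>z. pinching_wrt c (k z) (Rm z)) z0 = 2 * pinching_form c (Rm z0) Rm_velocity"
    "dird W (1, 0) (\<lambda>z. scal_wrt (k z) (Rm z)) z0 = scal Rm_velocity"
    by (fact dird_pinching_wrt[OF udom_W smooth_k smooth_Rm z0 k_one[OF z0 h0 dh0] Rm_ct[OF z0]], fact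
        dird_scal_wrt[OF udom_W smooth_k smooth_Rm z0 k_one[OF z0 h0 dh0] Rm_ct[OF z0]])
qed

lemma space_derivatives:
  "dird W (sp p) (\<lambda>z. pinching_wrt c (k z) (Rm z)) z0 = 2 * pinching_form c (Rm z0) (dird W (sp p) Rm z0)"
  "dird W (sp p) (\<lambda>z. scal_wrt (k z) (Rm z)) z0 = scal (dird W (sp p) Rm z0)"
  "dird W (sp p) (dird W (sp p) (\<lambda>z. pinching_wrt c (k z) (Rm z))) z0
    = 2 * pinching_form c (dird W (sp p) Rm z0) (dird W (sp p) Rm z0) + 2 * pinching_form c (Rm z0) (Hess p)"
  "dird W (sp p) (dird W (sp p) (\<lambda>z. scal_wrt (k z) (Rm z))) z0 = scal (Hess p)"
proof -
  let ?M = "- dird W (sp p) (G p) z0"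
  note k = udom_W smooth_k smooth_Rm z0 k_one[OF z0 h0 dh0] Rm_ct[OF z0]
  have t: "transpose ?M = - transpose (dird W (sp p) (G p) z0)" by (simp add: vec_eq_iff transpose_def)
  have k1: "dird W (sp p) k z0 = 0" using dird_k[OF z0 h0 dh0] dh0 by simp
  have k2: "dird W (sp p) (dird W (sp p) k) z0 = ?M + transpose ?M"
    using dird2_k[OF z0 h0 dh0] unfolding t by simp
  have H: "Hess p = dird W (sp p) (dird W (sp p) Rm) z0 + gl_action ?M (Rm z0)" by (simp add: gl_action_minus)
  show "dird W (sp p) (\<lambda>z. pinching_wrt c (k z) (Rm z)) z0 = 2 * pinching_form c (Rm z0) (dird W (sp p) Rm z0)"
    using dird_pinching_wrt[OF k, of "sp p" 0 c] k1 gl_action_diff_left[of 0 0 "Rm z0"] by (simp add: transpose_zero)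
  show "dird W (sp p) (\<lambda>z. scal_wrt (k z) (Rm z)) z0 = scal (dird W (sp p) Rm z0)"
    using dird_scal_wrt[OF k, of "sp p" 0] k1 gl_action_diff_left[of 0 0 "Rm z0"] by (simp add: transpose_zero)
  show "dird W (sp p) (dird W (sp p) (\<lambda>z. pinching_wrt c (k z) (Rm z))) z0
    = 2 * pinching_form c (dird W (sp p) Rm z0) (dird W (sp p) Rm z0) + 2 * pinching_form c (Rm z0) (Hess p)"
    unfolding H by (rule dird2_pinching_wrt[OF k k1 k2])
  show "dird W (sp p) (dird W (sp p) (\<lambda>z. scal_wrt (k z) (Rm z))) z0 = scal (Hess p)"
    unfolding H by (rule dird2_scal_wrt[OF k k1 k2])
qed

lemma scal_nondecreasing_at_min:
  assumes "e > 0" "\<And>p s. \<bar>s\<bar> < e \<Longrightarrow> scal (Rm z0) \<le> scal_wrt (k (z0 + s *\<^sub>R sp p)) (Rm (z0 + s *\<^sub>R sp p))"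
  shows "dird W (1, 0) (\<lambda>z. scal_wrt (k z) (Rm z)) z0 \<ge> 0"
proof -
  have "scal (Hess p) \<ge> 0" for p
  proof -
    have "scal_wrt (k z0) (Rm z0) \<le> scal_wrt (k (z0 + s *\<^sub>R sp p)) (Rm (z0 + s *\<^sub>R sp p))" if "\<bar>s\<bar> < e" for s
      using assms(2)[OF that] by (simp add: scal_wrt_one k_one[OF z0 h0 dh0])
    from second_derivative_test(2)[OF open_W smooth_scal z0 assms(1) this] show ?thesis by (simp add: space_derivatives)
  qed
  then have "scal Rm_velocity \<ge> 0"
    unfolding normal_evolution[OF z0 h0 dh0] by (simp add: scal_add scal_sum scal_scaleR scal_Q Rm_ct[OF z0] sum_nonneg)
  then show ?thesis by (simp add: time_derivatives)
qed

text \<open>The conclusion is the time derivative of P(Rm + \<eta> I) for a function \<eta> with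
  derivative L \<eta>, multiplied out. Keeping P and scal apart lets later arguments work with these
  two scalars alone.\<close>

lemma pinching_form_increasing_at_contact:
  fixes a \<kappa> \<beta>
  defines "\<kappa> \<equiv> (real CARD('n) - 2) / 4 + a" and "\<beta> \<equiv> (real CARD('n) - 1 - 2 * ((real CARD('n) - 2) / 4 + a)) / 4"
  assumes n: "CARD('n) \<ge> 4"
    and a: "real CARD('n) / 4 - epsilon CARD('n) \<le> a" "0 \<le> a" "a < real CARD('n) / 4"
    and \<eta>: "\<eta> > 0"
    and P: "pinching_form \<kappa> (Rm z0 + \<eta> *\<^sub>R round_tensor) (Rm z0 + \<eta> *\<^sub>R round_tensor) = 0"
    and s: "scal (Rm z0 + \<eta> *\<^sub>R round_tensor) > 0" and L: "4 * scal (Rm z0 + \<eta> *\<^sub>R round_tensor) < real CARD('n) * L"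
    and e: "e > 0" and m: "\<And>p s. \<bar>s\<bar> < e \<Longrightarrow> pinching_form \<kappa> (Rm z0) (Rm z0) + 2 * \<eta> * \<beta> * scal (Rm z0)
      \<le> pinching_wrt \<kappa> (k (z0 + s *\<^sub>R sp p)) (Rm (z0 + s *\<^sub>R sp p)) + 2 * \<eta> * \<beta> * scal_wrt (k (z0 + s *\<^sub>R sp p))
          (Rm (z0 + s *\<^sub>R sp p))"
  shows "dird W (1, 0) (\<lambda>z. pinching_wrt \<kappa> (k z) (Rm z)) z0 + 2 * \<eta> * \<beta> * dird W (1, 0) (\<lambda>z. scal_wrt (k z) (Rm z)) z0
    + 2 * \<eta> * L * \<beta> * scal (Rm z0) + 2 * \<eta>\<^sup>2 * L * \<beta> * real CARD('n) * (real CARD('n) - 1) > 0"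
proof -
  define X where "X = Rm z0 + \<eta> *\<^sub>R round_tensor"
  have R: "Rm z0 \<in> curvature_tensors" by (rule Rm_ct[OF z0])
  have X: "X \<in> curvature_tensors" unfolding X_def by (intro ct_add ct_scaleR ct_round_tensor R)
  have Pl: "2 * pinching_form \<kappa> X Z = 2 * pinching_form \<kappa> (Rm z0) Z + 2 * \<eta> * \<beta> * scal Z" if "Z \<in> curvature_tensors" for Z
  proof -
    have "pinching_form \<kappa> round_tensor Z = scal Z * \<beta>" unfolding pinching_form_sym[of _ round_tensor]
        pinching_form_round_tensor[OF that] \<beta>_def \<kappa>_def by simp
    then show ?thesis by (simp add: X_def pinching_form_add_left pinching_form_scaleR_left algebra_simps)
  qed
  have V: "dird W v Rm z0 \<in> curvature_tensors" "dird W v (dird W v Rm) z0 \<in> curvature_tensors" for v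
    by (intro ct_dird udom_W smooth_on_dird smooth_Rm z0 Rm_ct, assumption)+
  have H: "Hess p \<in> curvature_tensors" for p by (intro ct_diff V ct_gl_action R)
  have Rm_velocity: "Rm_velocity \<in> curvature_tensors" by (intro ct_add V ct_gl_action R)
  let ?\<Phi> = "\<lambda>z. 1 * pinching_wrt \<kappa> (k z) (Rm z) + (2 * \<eta> * \<beta>) * scal_wrt (k z) (Rm z)"
  have m': "?\<Phi> z0 \<le> ?\<Phi> (z0 + s *\<^sub>R sp p)" if "\<bar>s\<bar> < e" for s p
    using m[OF that] by (simp add: k_one[OF z0 h0 dh0] scal_wrt_one pinching_wrt_one)
  \<comment> \<open>The second derivative at the minimum is 2 P(dRm, dRm) + 2 P(X, Hess). As dRm is
    orthogonal to the null vector X, its square is nonpositive, so the Hessian term must be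
    nonnegative.\<close>
  have "pinching_form \<kappa> X (Hess p) \<ge> 0" for p
  proof -
    note t = second_derivative_test[OF open_W linear_combination(1) z0 e m', of p]
    have c1: "dird W (sp p) ?\<Phi> z = 1 * dird W (sp p) (\<lambda>z. pinching_wrt \<kappa> (k z) (Rm z)) z + (2 * \<eta> * \<beta>) * dird W
        (sp p) (\<lambda>z. scal_wrt (k z) (Rm z)) z"
      if "z \<in> W" for z by (rule linear_combination(2)[OF that])
    have "2 * pinching_form \<kappa> X (dird W (sp p) Rm z0) = 0"
      using t(1) unfolding c1[OF z0] Pl[OF V(1)] by (simp add: space_derivatives)
    then have "pinching_form \<kappa> (dird W (sp p) Rm z0) (dird W (sp p) Rm z0) \<le> 0"
      using pinching_form_orthogonal_nonpos[OF n a(2) X V(1)] P s by (simp add: X_def \<kappa>_def)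
    moreover have "dird W (sp p) (dird W (sp p) ?\<Phi>) z0
       = dird W (sp p) (dird W (sp p) (\<lambda>z. pinching_wrt \<kappa> (k z) (Rm z))) z0 + (2 * \<eta> * \<beta>) * dird W (sp p)
           (dird W (sp p) (\<lambda>z. scal_wrt (k z) (Rm z))) z0"
    proof -
      note d = smooth_on_imp_differentiable_on
      have "dird W (sp p) (dird W (sp p) ?\<Phi>) z0 = dird W (sp p) (\<lambda>z. dird W (sp p) (\<lambda>z. pinching_wrt \<kappa> (k z) (Rm z)) z
         + (2 * \<eta> * \<beta>) * dird W (sp p) (\<lambda>z. scal_wrt (k z) (Rm z)) z) z0"
        by (rule dird_cong[OF _ z0]) (use c1 in simp)
      also have "\<dots> = dird W (sp p) (dird W (sp p) (\<lambda>z. pinching_wrt \<kappa> (k z) (Rm z))) z0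
         + dird W (sp p) (\<lambda>z. (2 * \<eta> * \<beta>) * dird W (sp p) (\<lambda>z. scal_wrt (k z) (Rm z)) z) z0"
        by (rule dird_add[OF udom_W d d z0]) (intro smooth_on_mult smooth_on_const udom_W smooth_on_dird
            smooth_pinching smooth_scal)+
      finally show ?thesis
        by (simp add: dird_linear_compose[OF udom_W bounded_linear_mult_right d[OF smooth_on_dird[OF smooth_scal]] z0])
    qed
    ultimately show ?thesis
      using t(2) Pl[OF H, of p] by (simp add: space_derivatives)
  qed
  then have "pinching_form \<kappa> X Rm_velocity \<ge> pinching_form \<kappa> X (2 *\<^sub>R Q (Rm z0))"
    unfolding normal_evolution[OF z0 h0 dh0] by (simp add: pinching_form_add pinching_form_sum sum_nonneg)
  moreover have "pinching_form \<kappa> X (2 *\<^sub>R Q (Rm z0) + (\<eta> * L) *\<^sub>R round_tensor) > 0"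
    unfolding X_def \<kappa>_def by (rule pinching_form_contact[OF n R a \<eta>]) (use P s L in \<open>simp_all add: \<kappa>_def\<close>)
  ultimately have "2 * pinching_form \<kappa> X Rm_velocity + (\<eta> * L) * (2 * pinching_form \<kappa> X round_tensor) > 0"
    by (simp add: pinching_form_add pinching_form_scaleR)
  then show ?thesis
    unfolding Pl[OF Rm_velocity] Pl[OF ct_round_tensor] scal_round_tensor pinching_form_round_tensor[OF R]
    by (simp add: time_derivatives \<beta>_def \<kappa>_def pinching_form_round_tensor[OF R] algebra_simps power2_eq_square)
qed

end

end

section \<open>Normal coordinates\<close>

lemma ric_wrt_slot:
  "ric_wrt K (slot1 A X) = transpose A ** ric_wrt K X" "ric_wrt K (slot2 A X) = ric_wrt (A ** K) X"
  "ric_wrt K (slot3 A X) = ric_wrt K X ** A" "ric_wrt K (slot4 A X) = ric_wrt (K ** transpose A) X"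
proof -
  show "ric_wrt K (slot1 A X) = transpose A ** ric_wrt K X"
  proof (simp add: vec_eq_iff ric_wrt_def slot_nth matrix_matrix_mult_def transpose_nth sum_distrib_left, intro allI)
    fix i m
    have "(\<Sum>j\<in>UNIV. \<Sum>l\<in>UNIV. \<Sum>p\<in>UNIV. K $ j $ l * (A $ p $ i * X $ p $ j $ m $ l))
      = (\<Sum>j\<in>UNIV. \<Sum>p\<in>UNIV. \<Sum>l\<in>UNIV. K $ j $ l * (A $ p $ i * X $ p $ j $ m $ l))"
      by (intro sum.cong refl sum.swap)
    also have "\<dots> = (\<Sum>p\<in>UNIV. \<Sum>j\<in>UNIV. \<Sum>l\<in>UNIV. K $ j $ l * (A $ p $ i * X $ p $ j $ m $ l))"
      by (rule sum.swap)
    finally show "(\<Sum>j\<in>UNIV. \<Sum>l\<in>UNIV. \<Sum>p\<in>UNIV. K $ j $ l * (A $ p $ i * X $ p $ j $ m $ l))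
      = (\<Sum>p\<in>UNIV. \<Sum>j\<in>UNIV. \<Sum>l\<in>UNIV. A $ p $ i * (K $ j $ l * X $ p $ j $ m $ l))"
      by (simp add: mult_ac)
  qed
  show "ric_wrt K (slot3 A X) = ric_wrt K X ** A"
  proof (simp add: vec_eq_iff ric_wrt_def slot_nth matrix_matrix_mult_def sum_distrib_left sum_distrib_right, intro allI)
    fix i m
    have "(\<Sum>j\<in>UNIV. \<Sum>l\<in>UNIV. \<Sum>p\<in>UNIV. K $ j $ l * (A $ p $ m * X $ i $ j $ p $ l))
      = (\<Sum>j\<in>UNIV. \<Sum>p\<in>UNIV. \<Sum>l\<in>UNIV. K $ j $ l * (A $ p $ m * X $ i $ j $ p $ l))"
      by (intro sum.cong refl sum.swap)
    also have "\<dots> = (\<Sum>p\<in>UNIV. \<Sum>j\<in>UNIV. \<Sum>l\<in>UNIV. K $ j $ l * (A $ p $ m * X $ i $ j $ p $ l))"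
      by (rule sum.swap)
    finally show "(\<Sum>j\<in>UNIV. \<Sum>l\<in>UNIV. \<Sum>p\<in>UNIV. K $ j $ l * (A $ p $ m * X $ i $ j $ p $ l))
      = (\<Sum>p\<in>UNIV. \<Sum>j\<in>UNIV. \<Sum>l\<in>UNIV. K $ j $ l * X $ i $ j $ p $ l * A $ p $ m)"
      by (simp add: mult_ac)
  qed
  show "ric_wrt K (slot2 A X) = ric_wrt (A ** K) X"
  proof (simp add: vec_eq_iff ric_wrt_def slot_nth matrix_matrix_mult_def sum_distrib_left sum_distrib_right, intro allI)
    fix i m
    have "(\<Sum>j\<in>UNIV. \<Sum>l\<in>UNIV. \<Sum>p\<in>UNIV. K $ j $ l * (A $ p $ j * X $ i $ p $ m $ l))
      = (\<Sum>l\<in>UNIV. \<Sum>j\<in>UNIV. \<Sum>p\<in>UNIV. K $ j $ l * (A $ p $ j * X $ i $ p $ m $ l))"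
      by (rule sum.swap)
    also have "\<dots> = (\<Sum>l\<in>UNIV. \<Sum>p\<in>UNIV. \<Sum>j\<in>UNIV. K $ j $ l * (A $ p $ j * X $ i $ p $ m $ l))"
      by (intro sum.cong refl sum.swap)
    also have "\<dots> = (\<Sum>p\<in>UNIV. \<Sum>l\<in>UNIV. \<Sum>j\<in>UNIV. K $ j $ l * (A $ p $ j * X $ i $ p $ m $ l))"
      by (rule sum.swap)
    finally show "(\<Sum>j\<in>UNIV. \<Sum>l\<in>UNIV. \<Sum>p\<in>UNIV. K $ j $ l * (A $ p $ j * X $ i $ p $ m $ l))
      = (\<Sum>p\<in>UNIV. \<Sum>l\<in>UNIV. \<Sum>j\<in>UNIV. A $ p $ j * K $ j $ l * X $ i $ p $ m $ l)"
      by (simp add: mult_ac)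
  qed
  show "ric_wrt K (slot4 A X) = ric_wrt (K ** transpose A) X"
  proof (simp add: vec_eq_iff ric_wrt_def slot_nth matrix_matrix_mult_def transpose_nth sum_distrib_left
      sum_distrib_right, intro allI)
    fix i m
    have "(\<Sum>j\<in>UNIV. \<Sum>l\<in>UNIV. \<Sum>p\<in>UNIV. K $ j $ l * (A $ p $ l * X $ i $ j $ m $ p))
      = (\<Sum>j\<in>UNIV. \<Sum>p\<in>UNIV. \<Sum>l\<in>UNIV. K $ j $ l * (A $ p $ l * X $ i $ j $ m $ p))"
      by (intro sum.cong refl sum.swap)
    then show "(\<Sum>j\<in>UNIV. \<Sum>l\<in>UNIV. \<Sum>p\<in>UNIV. K $ j $ l * (A $ p $ l * X $ i $ j $ m $ p))
      = (\<Sum>j\<in>UNIV. \<Sum>p\<in>UNIV. \<Sum>l\<in>UNIV. K $ j $ l * A $ p $ l * X $ i $ j $ m $ p)"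
      by (simp add: mult_ac)
  qed
qed

lemma ric_wrt_frame: "ric_wrt K (frame_components E X) = transpose E ** ric_wrt (E ** K ** transpose E) X ** E"
  by (simp add: frame_components_slots ric_wrt_slot matrix_mul_assoc)

lemma scal_wrt_frame_components: "scal_wrt K (frame_components E X) = scal_wrt (E ** K ** transpose E) X"
proof -
  let ?r = "ric_wrt (E ** K ** transpose E) X"
  have "K \<bullet> (transpose E ** ?r ** E) = (K ** transpose E) \<bullet> (transpose E ** ?r)"
    using mat_inner_mult(2)[of K "transpose E" "transpose E ** ?r"] by simp
  also have "\<dots> = (E ** (K ** transpose E)) \<bullet> ?r"
    using mat_inner_mult(1)[of E "K ** transpose E" ?r] by simp
  finally show ?thesis by (simp add: scal_wrt_def ric_wrt_frame matrix_mul_assoc)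
qed

lemma pinching_wrt_frame_components: "pinching_wrt c K (frame_components E X) = pinching_wrt c (E ** K ** transpose E) X"
proof -
  let ?k = "E ** K ** transpose E"
  let ?r = "ric_wrt ?k X"
  have "(K ** (transpose E ** ?r ** E) ** K) \<bullet> (transpose E ** ?r ** E)
    = (K ** (transpose E ** ?r ** E) ** K ** transpose E) \<bullet> (transpose E ** ?r)"
    using mat_inner_mult(2)[of _ "transpose E" "transpose E ** ?r"] by simp
  also have "\<dots> = (E ** (K ** (transpose E ** ?r ** E) ** K ** transpose E)) \<bullet> ?r"
    using mat_inner_mult(1)[of E _ ?r] by simp
  also have "\<dots> = (?k ** ?r ** ?k) \<bullet> ?r" by (simp add: matrix_mul_assoc)
  finally show ?thesis
    by (simp add: pinching_wrt_def ric_wrt_frame frame_components_adjoint frame_components_compose)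
qed

text \<open>Gram-Schmidt for G: a vector orthogonal in the Euclidean sense to all
  \<open>G *v f i\<close> is G-orthogonal to all \<open>f i\<close>. While k < n the span of these
  vectors is proper, so a nonzero one exists and can be normalised.\<close>

lemma exists_orthonormal_frame:
  fixes G :: "real^'n^'n::finite"
  assumes s: "transpose G = G" and p: "\<And>v. v \<noteq> 0 \<Longrightarrow> v \<bullet> (G *v v) > 0"
  obtains E where "orthonormal_frame G E"
proof -
  have "\<exists>f. \<forall>i<k. \<forall>j<k. f i \<bullet> (G *v f j) = (if i = j then 1 else 0)" if "k \<le> CARD('n)" for k
    using that
  proof (induction k)
    case (Suc k)
    then obtain f where f: "\<And>i j. i < k \<Longrightarrow> j < k \<Longrightarrow> f i \<bullet> (G *v f j) = (if i = j then 1 else 0)" by auto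
    let ?S = "(\<lambda>i. G *v f i) ` {..<k}"
    have "dim ?S \<le> card ?S" by (rule dim_le_card) (auto intro: span_base)
    also have "\<dots> \<le> k" using card_image_le[of "{..<k}"] by simp
    finally have "dim (span ?S) < DIM(real^'n)" using Suc.prems by simp
    then obtain x where x: "x \<noteq> 0" "\<And>y. y \<in> span ?S \<Longrightarrow> orthogonal x y"
      using orthogonal_to_subspace_exists[of ?S] by (metis dim_span)
    define u where "u = (1 / sqrt (x \<bullet> (G *v x))) *\<^sub>R x"
    have 1: "u \<bullet> (G *v f i) = 0" if "i < k" for i
      using x(2)[OF span_base] that by (auto simp: u_def orthogonal_def)
    then have 2: "f i \<bullet> (G *v u) = 0" if "i < k" for i
      using that dot_lmul_matrix[of "f i" G u] s by (metis inner_commute vector_transpose_matrix)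
    have 3: "u \<bullet> (G *v u) = 1"
      using p[OF x(1)] by (simp add: u_def matrix_vector_mult_scaleR)
    show ?case
      by (rule exI[of _ "f(k := u)"]) (auto simp: less_Suc_eq f 1 2 3)
  qed auto
  then obtain f where f: "\<And>i j. i < CARD('n) \<Longrightarrow> j < CARD('n) \<Longrightarrow> f i \<bullet> (G *v f j) = (if i = j then 1 else 0)"
    by blast
  obtain b where b: "bij_betw b (UNIV :: 'n set) {0..<CARD('n)}"
    using ex_bij_betw_finite_nat[OF finite[of UNIV]] by blast
  have bl: "b i < CARD('n)" and bi: "b i = b j \<longleftrightarrow> i = j" for i j
    using bij_betwE[OF b] bij_betw_imp_inj_on[OF b] by (auto simp: inj_on_def)
  define E :: "real^'n^'n" where "E = (\<chi> a i. f (b i) $ a)"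
  have "(transpose E ** (G ** E)) $ i $ j = f (b i) \<bullet> (G *v f (b j))" for i j
    by (simp add: E_def matrix_matrix_mult_def transpose_def inner_vec_def matrix_vector_mult_def)
  then have "orthonormal_frame G E"
    by (simp add: orthonormal_frame_def vec_eq_iff mat_def f bl bi matrix_mul_assoc)
  then show thesis by (rule that)
qed

lemma orthonormal_frame_inverse:
  assumes "orthonormal_frame G E"
  shows "invertible E" "invertible G" "matrix_inv G = E ** transpose E"
proof -
  have 1: "(transpose E ** G) ** E = mat 1" using assms by (simp add: orthonormal_frame_def)
  then have 2: "E ** (transpose E ** G) = mat 1" by (rule matrix_left_right_inverse[THEN iffD1])
  show "invertible E" unfolding invertible_def using 1 2 by blast
  have 3: "(E ** transpose E) ** G = mat 1" using 2 by (simp add: matrix_mul_assoc)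
  then have 4: "G ** (E ** transpose E) = mat 1" by (rule matrix_left_right_inverse[THEN iffD1])
  show "invertible G" unfolding invertible_def using 3 4 by blast
  show "matrix_inv G = E ** transpose E" by (rule matrix_inv_eqI[OF 4])
qed

lemma matrix_inv_congruence:
  fixes J H :: "real^'n^'n"
  assumes J: "invertible J" and H: "invertible H"
  shows "J ** matrix_inv (transpose J ** H ** J) ** transpose J = matrix_inv H"
proof -
  let ?i = "matrix_inv J"
  note Ji = matrix_inv_works[OF J]
  have ti: "transpose J ** transpose ?i = mat 1" "transpose ?i ** transpose J = mat 1"
    unfolding matrix_transpose_mul[symmetric] Ji by simp_all
  have "(transpose J ** H ** J) ** (?i ** matrix_inv H ** transpose ?i)
      = transpose J ** H ** (J ** ?i) ** matrix_inv H ** transpose ?i"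
    by (simp add: matrix_mul_assoc)
  also have "\<dots> = transpose J ** (H ** matrix_inv H) ** transpose ?i" by (simp add: Ji matrix_mul_assoc)
  also have "\<dots> = mat 1" by (simp add: matrix_inv_works[OF H] ti)
  finally have "matrix_inv (transpose J ** H ** J) = ?i ** matrix_inv H ** transpose ?i" by (rule matrix_inv_eqI)
  then have "J ** matrix_inv (transpose J ** H ** J) ** transpose J = (J ** ?i) ** matrix_inv H **
      (transpose ?i ** transpose J)"
    by (simp add: matrix_mul_assoc)
  then show ?thesis by (simp add: Ji ti)
qed

context local_flow
begin

lemma smooth_slice: "t \<in> I \<Longrightarrow> smooth_on U (\<lambda>x. h (t, x))"
proof -
  assume t: "t \<in> I"
  have "smooth_on U (\<lambda>x::real^'n. (t, 0) + (0::real, x))"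
    by (intro smooth_on_add smooth_on_const smooth_on_linear udom_open U bounded_linear_Pair bounded_linear_zero
        bounded_linear_ident)
  then have "smooth_on U (\<lambda>x::real^'n. (t, x))" by simp
  from smooth_on_compose[OF h this udom_open[OF U] udom_W] t show ?thesis by (auto simp: W_def)
qed

text \<open>The coordinates are \<open>x\<^sub>0 + E y - \<Gamma>(E y, E y) / 2\<close> with the Christoffel symbols at \<open>(t\<^sub>0, x\<^sub>0)\<close>.\<close>

lemma normal_coordinates:
  assumes z0: "(t0, x0) \<in> W" and E: "orthonormal_frame (h (t0, x0)) E"
  obtains N :: "(real^'n) set" and \<phi> h' W' G' k' Rm' where "local_flow I N h' W' G' k' Rm'" "0 \<in> N" "\<phi> 0 = x0" "\<phi> ` N \<subseteq> U"
    "h' (t0, 0) = mat 1" "\<And>i. dird W' (sp i) h' (t0, 0) = 0"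
    "\<And>t y. t \<in> I \<Longrightarrow> y \<in> N \<Longrightarrow> scal_wrt (k' (t, y)) (Rm' (t, y)) = scal_wrt (k (t, \<phi> y)) (Rm (t, \<phi> y))"
    "\<And>c t y. t \<in> I \<Longrightarrow> y \<in> N \<Longrightarrow> pinching_wrt c (k' (t, y)) (Rm' (t, y)) = pinching_wrt c (k (t, \<phi> y)) (Rm (t, \<phi> y))"
proof -
  have t0: "t0 \<in> I" and x0: "x0 \<in> U" using z0 by (auto simp: W_def)
  note iE = orthonormal_frame_inverse[OF E]
  define B :: "real^'n \<Rightarrow> real^'n \<Rightarrow> real^'n" where "B a b = (\<Sum>i\<in>UNIV. a $ i *\<^sub>R (G i (t0, x0) *v b))" for a b
  have bB: "bounded_bilinear B"
    by (rule bounded_bilinearI_euclid)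
      (simp_all add: B_def scaleR_add_left sum.distrib matrix_vector_right_distrib scaleR_add_right scaleR_sum_right
        matrix_vector_mult_scaleR mult_ac)
  have Bn: "B a b $ m = (\<Sum>i\<in>UNIV. \<Sum>j\<in>UNIV. G i (t0, x0) $ m $ j * a $ i * b $ j)" for a b m
    by (simp add: B_def matrix_vector_mult_def sum_distrib_left mult_ac)
  have Bs: "B a b = B b a" for a b
  proof -
    have "B a b $ m = (\<Sum>j\<in>UNIV. \<Sum>i\<in>UNIV. G i (t0, x0) $ m $ j * a $ i * b $ j)" for m
      unfolding Bn by (rule sum.swap)
    also have "\<dots> m = B b a $ m" for m
      unfolding Bn by (intro sum.cong refl) (simp add: G_symmetric[OF z0, of _ m])
    finally show ?thesis by (simp add: vec_eq_iff)
  qed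
  have lE: "bounded_linear (\<lambda>y. E *v y)" by (rule matrix_vector_mul_bounded_linear)
  note lB = bounded_linear_compose[OF bounded_bilinear.bounded_linear_right[OF bB] lE]
  define \<phi> where "\<phi> y = x0 + E *v y - (1/2) *\<^sub>R B (E *v y) (E *v y)" for y
  \<comment> \<open>The Jacobian of \<phi> on the whole space, available before its domain N has
    been chosen.\<close>
  define Jf :: "real^'n \<Rightarrow> real^'n^'n" where "Jf y = (\<chi> a i. (E *v axis i 1 - B (E *v axis i 1) (E *v y)) $ a)" for y
  have sq: "smooth_on S (\<lambda>y. B (E *v y) (E *v y))" if "udom S" for S
    by (intro smooth_on_bilinear[OF that bB] smooth_on_linear[OF that lE])
  have s\<phi>: "smooth_on S \<phi>" if "udom S" for S
    unfolding \<phi>_def by (intro smooth_on_add smooth_on_diff smooth_on_const smooth_on_linear lE that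
       smooth_on_linear_compose[OF that bounded_linear_scaleR_right] sq)
  have d1: "dird S v \<phi> y = E *v v - B (E *v v) (E *v y)" if "udom S" "y \<in> S" for S v y
  proof -
    note d = smooth_on_imp_differentiable_on
    have "dird S v \<phi> y = dird S v (\<lambda>y. x0 + E *v y) y - dird S v (\<lambda>y. (1/2) *\<^sub>R B (E *v y) (E *v y)) y"
      unfolding \<phi>_def by (rule dird_diff[OF that(1) d d that(2)])
        (intro smooth_on_add smooth_on_const smooth_on_linear lE that
            smooth_on_linear_compose[OF that(1) bounded_linear_scaleR_right] sq)+
    also have "dird S v (\<lambda>y. x0 + E *v y) y = dird S v (\<lambda>y. x0) y + dird S v (\<lambda>y. E *v y) y"
      by (rule dird_add[OF that(1) d d that(2)]) (intro smooth_on_const smooth_on_linear lE that)+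
    also have "dird S v (\<lambda>y. (1/2) *\<^sub>R B (E *v y) (E *v y)) y = (1/2) *\<^sub>R dird S v (\<lambda>y. B (E *v y) (E *v y)) y"
      by (rule dird_linear_compose[OF that(1) bounded_linear_scaleR_right d[OF sq[OF that(1)]] that(2)])
    also have "dird S v (\<lambda>y. B (E *v y) (E *v y)) y = B (E *v y) (E *v v) + B (E *v v) (E *v y)"
      using dird_bilinear[OF that(1) bB d[OF smooth_on_linear[OF that(1) lE]] d[OF smooth_on_linear[OF that(1) lE]] that(2)]
      by (simp add: dird_linear[OF that(1) lE that(2)])
    finally show ?thesis
      by (simp add: dird_const[OF that] dird_linear[OF that(1) lE that(2)] Bs[of "E *v y"] scaleR_2[symmetric])
  qed
  have d2: "dird S u (dird S v \<phi>) y = - B (E *v v) (E *v u)" if S: "udom S" "y \<in> S" for S u v y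
  proof -
    note d = smooth_on_imp_differentiable_on
    have "dird S u (dird S v \<phi>) y = dird S u (\<lambda>y. E *v v - B (E *v v) (E *v y)) y"
      by (rule dird_cong[OF d1[OF S(1)] S(2)])
    also have "\<dots> = dird S u (\<lambda>y. E *v v) y - dird S u (\<lambda>y. B (E *v v) (E *v y)) y"
      by (rule dird_diff[OF S(1) d d S(2)]) (intro smooth_on_const smooth_on_linear[OF S(1) lB] S)+
    finally show ?thesis by (simp add: dird_const[OF S] dird_linear[OF S(1) lB S(2)])
  qed
  note u1 = udom_open[OF open_UNIV]
  \<comment> \<open>The points that \<phi> sends into U with invertible derivative, which is what
    the pullback formulas require; 0 is one of them because the Jacobian there is E.\<close>
  define N where "N = \<phi> -` U \<inter> {y. det (Jf y) \<noteq> 0}"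
  have c\<phi>: "continuous_on UNIV \<phi>" by (rule smooth_on_imp_continuous_on[OF s\<phi>[OF u1]])
  have "smooth_on UNIV (\<lambda>y. Jf y $ a $ i)" for a i
    unfolding Jf_def vec_lambda_beta
    by (intro smooth_on_vec_nth smooth_on_diff smooth_on_const smooth_on_linear[OF u1 lB] u1)
  then have "smooth_on UNIV (\<lambda>y. det (Jf y))" by (rule smooth_on_det[OF u1])
  from smooth_on_imp_continuous_on[OF this] have oN: "open N"
    unfolding N_def by (intro open_Int open_vimage U c\<phi> open_Collect_neq continuous_on_const)
  have J0: "Jf 0 = E"
    by (simp add: Jf_def vec_eq_iff bounded_bilinear.zero_right[OF bB] matrix_vector_mult_basis column_def)
  have \<phi>0: "\<phi> 0 = x0" by (simp add: \<phi>_def bounded_bilinear.zero_right[OF bB])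
  have N0: "0 \<in> N" using iE(1) x0 by (simp add: N_def J0 \<phi>0 invertible_det_nz[symmetric])
  have \<phi>N: "\<phi> ` N \<subseteq> U" by (auto simp: N_def)
  have uN: "udom N" by (rule udom_open[OF oN])
  define J :: "real \<times> (real^'n) \<Rightarrow> real^'n^'n" where "J = (\<lambda>z. \<chi> a i. dird N (axis i 1) \<phi> (snd z) $ a)"
  define \<psi> :: "real \<times> (real^'n) \<Rightarrow> real \<times> (real^'n)" where "\<psi> = (\<lambda>z. (fst z, \<phi> (snd z)))"
  interpret m: chart_map I N U \<phi> J \<psi>
    by standard (use I oN U s\<phi>[OF uN] \<phi>N in \<open>auto simp: J_def \<psi>_def\<close>)
  let ?S = "I \<times> N"
  have JJ: "J z = Jf (snd z)" if "z \<in> ?S" for z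
    using that by (auto simp: J_def Jf_def d1[OF uN])
  have Jinv: "invertible (J z)" if "z \<in> ?S" for z
    using that by (auto simp: JJ N_def invertible_det_nz)
  define h' where "h' z = transpose (J z) ** h (\<psi> z) ** J z" for z
  note W' = m.open_slabs(2)[folded W_def]
  note p = m.open_slabs(1) W' h h_sym h_invertible m.smooth_\<psi> m.\<psi>_image[folded W_def] m.smooth_J m.dird_\<psi>
      m.J_symmetric Jinv h'_def
  have sh': "smooth_on ?S h'" by (rule smooth_h'[OF p])
  have h's: "transpose (h' z) = h' z" if "z \<in> ?S" for z by (rule h'_sym[OF p that])
  have h'i: "invertible (h' z)" if "z \<in> ?S" for z by (rule h'_inv[OF p that])
  define G' where "G' = christoffel_matrix ?S sp h'"
  define k' where "k' = (\<lambda>z. matrix_inv (h' z))"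
  define Rm' where "Rm' = (\<lambda>z. \<chi> i j. h' z ** curvature_matrix ?S sp G' i j z)"
  have \<psi>W: "\<psi> z \<in> W" if "z \<in> ?S" for z using m.\<psi>_image[folded W_def] that by blast
  have Rm'_pull: "Rm' z = frame_components (J z) (Rm (\<psi> z))" if z: "z \<in> ?S" for z
  proof -
    obtain t y where ty: "z = (t, y)" "t \<in> I" "y \<in> N" using z by auto
    have y: "\<And>y. y \<in> N \<Longrightarrow> (t, y) \<in> ?S" using ty by auto
    have "Rm' z $ i $ j = riemann (\<lambda>y. h' (t, y)) y $ i $ j" for i j
      using riemann_slab[OF udom_open[OF I] oN sh' h's h'i] z unfolding Rm'_def G'_def ty by simp
    then have "Rm' z = riemann (\<lambda>y. h' (t, y)) y" by (simp add: vec_eq_iff)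
    also have "\<dots> = frame_components (matrix (frechet_derivative \<phi> (at y))) (riemann (\<lambda>x. h (t, x)) (\<phi> y))"
    proof (rule riemann_pullback[OF oN U smooth_slice[OF ty(2)] _ _ s\<phi>[OF uN] \<phi>N])
      show "transpose (h (t, x)) = h (t, x)" "invertible (h (t, x))" if "x \<in> U" for x
        using h_sym[of "(t, x)"] h_invertible[of "(t, x)"] that ty by (auto simp: W_def)
      show "invertible (matrix (frechet_derivative \<phi> (at y)))" if "y \<in> N" for y
        using Jinv[OF y[OF that]] m.J_matrix[OF y[OF that]] by simp
      show "h' (t, y) = transpose (matrix (frechet_derivative \<phi> (at y))) ** h (t, \<phi> y) ** matrix
          (frechet_derivative \<phi> (at y))"
        if "y \<in> N" for y
        using m.J_matrix[OF y[OF that]] by (simp add: h'_def \<psi>_def)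
    qed (fact ty(3))
    also have "\<dots> = frame_components (J z) (Rm (\<psi> z))"
      using m.J_matrix[OF z] Rm_riemann[of t "\<phi> y"] \<psi>W[OF z] by (simp add: ty \<psi>_def)
    finally show ?thesis .
  qed
  have k'_pull: "J z ** k' z ** transpose (J z) = k (\<psi> z)" if z: "z \<in> ?S" for z
    unfolding k'_def k_def h'_def by (rule matrix_inv_congruence[OF Jinv[OF z] h_invertible[OF \<psi>W[OF z]]])
  have lf: "local_flow I N h' ?S G' k' Rm'"
  proof
    fix z assume z: "z \<in> ?S"
    note d = smooth_on_imp_differentiable_on
    have sJt: "smooth_on ?S (\<lambda>z. transpose (J z))" by (rule smooth_on_transpose[OF m.udom_slabs(1) m.smooth_J])
    have sh\<psi>: "smooth_on ?S (\<lambda>z. h (\<psi> z))" by (rule smooth_pull[OF p h])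
    \<comment> \<open>The coordinate change is fixed in time, so J has no time derivative and the
      flow equation is carried over as an equation of tensors.\<close>
    have d0: "dird ?S (1, 0) (\<lambda>z. f (snd z)) z = 0" if f: "smooth_on N f" for f :: "real^'n \<Rightarrow> 'c::real_normed_vector"
    proof -
      have "dird ?S (1, 0) (\<lambda>z. f (snd z)) z = dird N (dird ?S (1, 0) snd z) f (snd z)"
        by (rule dird_compose[OF m.udom_slabs(1) d[OF f]
            d[OF smooth_on_linear[OF m.udom_slabs(1) bounded_linear_snd]] _ z]) auto
      then show ?thesis
        using z by (auto simp: dird_linear[OF m.udom_slabs(1) bounded_linear_snd z]
            linear_0[OF dird_linear_dir[OF uN d[OF f]]])
    qed
    have "smooth_on N (\<lambda>y. \<chi> a i. dird N (axis i 1) \<phi> y $ a)"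
      by (intro smooth_on_vec uN, unfold vec_lambda_beta, intro smooth_on_vec_nth uN smooth_on_dird s\<phi>)
    from d0[OF this] have dJ: "dird ?S (1, 0) J z = 0" by (simp add: J_def)
    have "dird ?S (1, 0) \<psi> z = (1, 0)"
      unfolding m.\<psi>_split
      apply (subst dird_add[OF m.udom_slabs(1) d[OF m.smooth_fst_part] d[OF m.smooth_snd_part] z])
      apply (subst dird_linear[OF m.udom_slabs(1) bounded_linear_compose[OF m.inclusions(2) bounded_linear_fst] z])
      apply (subst dird_linear_compose[OF m.udom_slabs(1) m.inclusions(1) d[OF m.smooth_snd[OF s\<phi>[OF uN]]] z])
      by (simp add: d0[OF s\<phi>[OF uN]])
    then have dh: "dird ?S (1, 0) (\<lambda>z. h (\<psi> z)) z = dird W (1, 0) h (\<psi> z)"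
      using dird_compose[OF m.udom_slabs(1) d[OF h] d[OF m.smooth_\<psi>] m.\<psi>_image[folded W_def] z, of "(1, 0)"] by simp
    have "dird ?S (1, 0) h' z = transpose (J z) ** dird W (1, 0) h (\<psi> z) ** J z"
      unfolding h'_def
      by (simp add: dird_matmul[OF m.udom_slabs(1) smooth_on_matmul[OF m.udom_slabs(1) sJt sh\<psi>] m.smooth_J z]
          dird_matmul[OF m.udom_slabs(1) sJt sh\<psi> z]
          dird_transpose[OF m.udom_slabs(1) m.smooth_J z] dJ dh mat_zero transpose_zero)
    also have "\<dots> = - 2 *\<^sub>R ric_wrt (k' z) (Rm' z)"
      unfolding Rm'_pull[OF z] ric_wrt_frame k'_pull[OF z] flow[OF \<psi>W[OF z]] by (simp add: mat_ring)
    finally show "dird ?S (1, 0) h' z = - 2 *\<^sub>R ric_wrt (k' z) (Rm' z)" .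
  qed (use I oN sh' h's h'i in \<open>simp_all add: G'_def k'_def Rm'_def\<close>)
  have z0': "(t0, 0) \<in> ?S" using t0 N0 by simp
  have \<psi>0: "\<psi> (t0, 0) = (t0, x0)" by (simp add: \<psi>_def \<phi>0)
  have J0': "J (t0, 0) = E" using JJ[OF z0'] J0 by simp
  have h'0: "h' (t0, 0) = mat 1" using E by (simp add: h'_def J0' \<psi>0 orthonormal_frame_def)
  \<comment> \<open>In the transformation law the derivative of J is - B on the frame vectors, by
    the quadratic term of \<phi>, and cancels the old Christoffel symbols.\<close>
  have "E ** G' i (t0, 0) = 0" for i
  proof -
    let ?r = "(\<Sum>a\<in>UNIV. E $ a $ i *\<^sub>R G a (t0, x0)) ** E + dird ?S (sp i) J (t0, 0)"
    have "E ** G' i (t0, 0) = ?r"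
      using christoffel_matrix_pull[OF p z0', of i] unfolding J0' \<psi>0 G'_def G_def .
    moreover have "?r $ a $ j = 0" for a j
    proof -
      have "dird ?S (sp i) J (t0, 0) $ a $ j = - B (E *v axis j 1) (E *v axis i 1) $ a"
        using m.dird_J[OF z0', of i a j] d2[OF uN N0] by simp
      moreover have "((\<Sum>a\<in>UNIV. E $ a $ i *\<^sub>R G a (t0, x0)) ** E) $ a $ j = B (E *v axis i 1) (E *v axis j 1) $ a"
        unfolding Bn matrix_vector_mult_basis column_def
        by (simp add: matrix_matrix_mult_def sum_distrib_right sum_distrib_left mult_ac) (subst sum.swap, simp add: mult_ac)
      ultimately show ?thesis by (simp add: Bs[of "E *v axis j 1"])
    qed
    ultimately show ?thesis by (simp add: vec_eq_iff)
  qed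
  then have "matrix_inv E ** (E ** G' i (t0, 0)) = 0" for i by (simp add: mat_zero)
  then have G'0: "G' i (t0, 0) = 0" for i
    by (simp add: matrix_mul_assoc matrix_inv_works[OF iE(1)])
  have dh'0: "dird ?S (sp i) h' (t0, 0) = 0" for i
    using local_flow.metric_compatible[OF lf z0', of i] by (simp add: G'0 mat_zero transpose_zero)
  show thesis
    by (rule that[OF lf N0 \<phi>0 \<phi>N h'0 dh'0])
      (simp_all add: Rm'_pull scal_wrt_frame_components pinching_wrt_frame_components k'_pull, simp_all add: \<psi>_def)
qed

end

section \<open>Transfer from normal coordinates to the given chart\<close>

context local_flow
begin

lemma time_line:
  fixes f :: "_ \<Rightarrow> real"
  assumes "smooth_on W f" "(t0, x0) \<in> W"
  shows "((\<lambda>t. f (t, x0)) has_real_derivative dird W (1, 0) f (t0, x0)) (at t0)"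
  using dird_line[OF smooth_on_imp_differentiable_on[OF assms(1)] open_W, of "(0, x0)" t0 "(1, 0)"] assms(2)
  by (simp add: has_real_derivative_iff_has_vector_derivative)

text \<open>Points on the axes through the centre correspond to points of U, so a minimum over U is
  a minimum along each axis. The centre is fixed in time, so both time derivatives are those at
  x0.\<close>

lemma curvature_minimum:
  fixes F :: "real^'n^'n \<Rightarrow> 'n tensor4 \<Rightarrow> real"
  assumes z0: "(t0, x0) \<in> W" and E: "orthonormal_frame (h (t0, x0)) E"
  obtains N :: "(real^'n) set" and h' W' G' k' Rm' e where "local_flow I N h' W' G' k' Rm'" "(t0, 0) \<in> W'"
    "h' (t0, 0) = mat 1" "\<And>i. dird W' (sp i) h' (t0, 0) = 0"
    "scal (Rm' (t0, 0)) = scal_wrt (k (t0, x0)) (Rm (t0, x0))"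
    "\<And>c. pinching_form c (Rm' (t0, 0)) (Rm' (t0, 0)) = pinching_wrt c (k (t0, x0)) (Rm (t0, x0))"
    "((\<lambda>t. scal_wrt (k (t, x0)) (Rm (t, x0))) has_real_derivative dird W' (1, 0) (\<lambda>z. scal_wrt (k' z) (Rm' z))
        (t0, 0)) (at t0)"
    "\<And>c. ((\<lambda>t. pinching_wrt c (k (t, x0)) (Rm (t, x0))) has_real_derivative dird W' (1, 0)
        (\<lambda>z. pinching_wrt c (k' z) (Rm' z)) (t0, 0)) (at t0)"
    "e > 0" "\<And>p s. \<bar>s\<bar> < e \<Longrightarrow> \<exists>x\<in>U. scal_wrt (k' ((t0, 0) + s *\<^sub>R sp p)) (Rm' ((t0, 0) + s *\<^sub>R sp p)) = scal_wrt
        (k (t0, x)) (Rm (t0, x))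
       \<and> (\<forall>c. pinching_wrt c (k' ((t0, 0) + s *\<^sub>R sp p)) (Rm' ((t0, 0) + s *\<^sub>R sp p)) = pinching_wrt c (k (t0, x))
           (Rm (t0, x)))"
proof -
  obtain N :: "(real^'n) set" and \<phi> h' W' G' k' Rm' where lf: "local_flow I N h' W' G' k' Rm'"
    and N: "0 \<in> N" "\<phi> 0 = x0" "\<phi> ` N \<subseteq> U" and h': "h' (t0, 0) = mat 1" "\<And>i. dird W' (sp i) h' (t0, 0) = 0"
    and s: "\<And>t y. t \<in> I \<Longrightarrow> y \<in> N \<Longrightarrow> scal_wrt (k' (t, y)) (Rm' (t, y)) = scal_wrt (k (t, \<phi> y)) (Rm (t, \<phi> y))"
    and P: "\<And>c t y. t \<in> I \<Longrightarrow> y \<in> N \<Longrightarrow> pinching_wrt c (k' (t, y)) (Rm' (t, y)) = pinching_wrt c (k (t, \<phi> y)) (Rm (t, \<phi> y))"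
    by (rule normal_coordinates[OF z0 E], rule that)
  interpret l: local_flow I N h' W' G' k' Rm' by (rule lf)
  have t0: "t0 \<in> I" using z0 by (simp add: W_def)
  have z0': "(t0, 0) \<in> W'" using t0 N by (simp add: l.W_def)
  have ev: "\<forall>\<^sub>F t in nhds t0. t \<in> I" using I t0 by (rule eventually_nhds_in_open)
  have k1: "k' (t0, 0) = mat 1" by (rule l.k_one[OF z0' h'])
  obtain e where e: "e > 0" "ball 0 e \<subseteq> N" using l.U N(1) by (rule openE)
  show thesis
  proof (rule that[OF lf z0' h' _ _ _ _ e(1)])
    show "scal (Rm' (t0, 0)) = scal_wrt (k (t0, x0)) (Rm (t0, x0))"
      using s[OF t0 N(1)] by (simp add: k1 scal_wrt_one N)
    show "pinching_form c (Rm' (t0, 0)) (Rm' (t0, 0)) = pinching_wrt c (k (t0, x0)) (Rm (t0, x0))" for c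
      using P[OF t0 N(1)] by (simp add: k1 pinching_wrt_one N)
    show "((\<lambda>t. scal_wrt (k (t, x0)) (Rm (t, x0))) has_real_derivative dird W' (1, 0)
        (\<lambda>z. scal_wrt (k' z) (Rm' z)) (t0, 0)) (at t0)"
      by (rule DERIV_cong_ev[THEN iffD1, OF refl _ refl l.time_line[OF l.smooth_scal z0']])
        (use eventually_mono[OF ev s[OF _ N(1)]] N in simp)
    show "((\<lambda>t. pinching_wrt c (k (t, x0)) (Rm (t, x0))) has_real_derivative dird W' (1, 0)
        (\<lambda>z. pinching_wrt c (k' z) (Rm' z)) (t0, 0)) (at t0)" for c
      by (rule DERIV_cong_ev[THEN iffD1, OF refl _ refl l.time_line[OF l.smooth_pinching z0']])
        (use eventually_mono[OF ev P[OF _ N(1)]] N in simp)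
    show "\<exists>x\<in>U. scal_wrt (k' ((t0, 0) + s *\<^sub>R sp p)) (Rm' ((t0, 0) + s *\<^sub>R sp p)) = scal_wrt (k (t0, x)) (Rm (t0, x))
       \<and> (\<forall>c. pinching_wrt c (k' ((t0, 0) + s *\<^sub>R sp p)) (Rm' ((t0, 0) + s *\<^sub>R sp p)) = pinching_wrt c (k (t0, x))
           (Rm (t0, x)))" if "\<bar>s\<bar> < e" for s p
    proof -
      have "s *\<^sub>R axis p 1 \<in> N" using that e(2) by (auto simp: norm_axis_1)
      then show ?thesis using s[OF t0] P[OF t0] N(3) by (intro bexI[of _ "\<phi> (s *\<^sub>R axis p 1)"]) auto
    qed
  qed
qed

lemma scal_minimum_nondecreasing:
  assumes z0: "(t0, x0) \<in> W" and E: "orthonormal_frame (h (t0, x0)) E"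
    and m: "\<And>x. x \<in> U \<Longrightarrow> scal_wrt (k (t0, x0)) (Rm (t0, x0)) \<le> scal_wrt (k (t0, x)) (Rm (t0, x))"
  obtains D where "((\<lambda>t. scal_wrt (k (t, x0)) (Rm (t, x0))) has_real_derivative D) (at t0)" "D \<ge> 0"
proof (rule curvature_minimum[OF z0 E])
  fix N h' W' G' k' Rm' and e :: real
  assume l: "local_flow I N h' W' G' k' Rm'" and z: "(t0, 0::real^'n) \<in> W'"
    "h' (t0, 0) = mat 1" "\<And>i. dird W' (sp i) h' (t0, 0) = 0"
    "scal (Rm' (t0, 0)) = scal_wrt (k (t0, x0)) (Rm (t0, x0))"
    and d: "((\<lambda>t. scal_wrt (k (t, x0)) (Rm (t, x0))) has_real_derivative dird W' (1, 0)
        (\<lambda>z. scal_wrt (k' z) (Rm' z)) (t0, 0)) (at t0)"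
    and e: "e > 0" "\<And>p s. \<bar>s\<bar> < e \<Longrightarrow> \<exists>x\<in>U. scal_wrt (k' ((t0, 0) + s *\<^sub>R sp p)) (Rm' ((t0, 0) + s *\<^sub>R sp p)) =
        scal_wrt (k (t0, x)) (Rm (t0, x))
       \<and> (\<forall>c. pinching_wrt c (k' ((t0, 0) + s *\<^sub>R sp p)) (Rm' ((t0, 0) + s *\<^sub>R sp p)) = pinching_wrt c (k (t0, x))
           (Rm (t0, x)))"
  have "scal (Rm' (t0, 0)) \<le> scal_wrt (k' ((t0, 0) + s *\<^sub>R sp p)) (Rm' ((t0, 0) + s *\<^sub>R sp p))" if "\<bar>s\<bar> < e" for s p
    using e(2)[OF that, of p] m z(4) by force
  from local_flow.scal_nondecreasing_at_min[OF l z(1-3) e(1) this] that d show thesis by blast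
qed

text \<open>The contact hypotheses are phrased in the two scalars of the original chart; expanding
  P(R + \<eta> I) shows that they say the same as for tensors.\<close>

lemma pinching_form_contact_increasing:
  fixes a \<kappa> \<beta>
  defines "\<kappa> \<equiv> (real CARD('n) - 2) / 4 + a" and "\<beta> \<equiv> (real CARD('n) - 1 - 2 * ((real CARD('n) - 2) / 4 + a)) / 4"
  assumes z0: "(t0, x0) \<in> W" and E: "orthonormal_frame (h (t0, x0)) E"
    and n: "CARD('n) \<ge> 4"
    and a: "real CARD('n) / 4 - epsilon CARD('n) \<le> a" "0 \<le> a" "a < real CARD('n) / 4"
    and \<eta>: "\<eta> > 0"
    and P: "pinching_wrt \<kappa> (k (t0, x0)) (Rm (t0, x0)) + 2 * \<eta> * \<beta> * scal_wrt (k (t0, x0)) (Rm (t0, x0))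
       + \<eta>\<^sup>2 * \<beta> * real CARD('n) * (real CARD('n) - 1) = 0"
    and s: "scal_wrt (k (t0, x0)) (Rm (t0, x0)) + \<eta> * real CARD('n) * (real CARD('n) - 1) > 0"
    and L: "4 * (scal_wrt (k (t0, x0)) (Rm (t0, x0)) + \<eta> * real CARD('n) * (real CARD('n) - 1)) < real CARD('n) * L"
    and m: "\<And>x. x \<in> U \<Longrightarrow> pinching_wrt \<kappa> (k (t0, x0)) (Rm (t0, x0)) + 2 * \<eta> * \<beta> * scal_wrt (k (t0, x0)) (Rm (t0, x0))
       \<le> pinching_wrt \<kappa> (k (t0, x)) (Rm (t0, x)) + 2 * \<eta> * \<beta> * scal_wrt (k (t0, x)) (Rm (t0, x))"
  obtains D D' where "((\<lambda>t. scal_wrt (k (t, x0)) (Rm (t, x0))) has_real_derivative D) (at t0)"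
    "((\<lambda>t. pinching_wrt \<kappa> (k (t, x0)) (Rm (t, x0))) has_real_derivative D') (at t0)"
    "D' + 2 * \<eta> * \<beta> * D + 2 * \<eta> * L * \<beta> * scal_wrt (k (t0, x0)) (Rm (t0, x0)) + 2 * \<eta>\<^sup>2 * L * \<beta> * real CARD('n) *
        (real CARD('n) - 1) > 0"
proof (rule curvature_minimum[OF z0 E])
  fix N h' W' G' k' Rm' and e :: real
  assume l: "local_flow I N h' W' G' k' Rm'" and z: "(t0, 0::real^'n) \<in> W'"
    "h' (t0, 0) = mat 1" "\<And>i. dird W' (sp i) h' (t0, 0) = 0"
    and z0s: "scal (Rm' (t0, 0)) = scal_wrt (k (t0, x0)) (Rm (t0, x0))"
    and z0P: "\<And>c. pinching_form c (Rm' (t0, 0)) (Rm' (t0, 0)) = pinching_wrt c (k (t0, x0)) (Rm (t0, x0))"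
    and d: "((\<lambda>t. scal_wrt (k (t, x0)) (Rm (t, x0))) has_real_derivative dird W' (1, 0)
        (\<lambda>z. scal_wrt (k' z) (Rm' z)) (t0, 0)) (at t0)"
       "\<And>c. ((\<lambda>t. pinching_wrt c (k (t, x0)) (Rm (t, x0))) has_real_derivative dird W' (1, 0)
           (\<lambda>z. pinching_wrt c (k' z) (Rm' z)) (t0, 0)) (at t0)"
    and e: "e > 0" "\<And>p s. \<bar>s\<bar> < e \<Longrightarrow> \<exists>x\<in>U. scal_wrt (k' ((t0, 0) + s *\<^sub>R sp p)) (Rm' ((t0, 0) + s *\<^sub>R sp p)) =
        scal_wrt (k (t0, x)) (Rm (t0, x))
       \<and> (\<forall>c. pinching_wrt c (k' ((t0, 0) + s *\<^sub>R sp p)) (Rm' ((t0, 0) + s *\<^sub>R sp p)) = pinching_wrt c (k (t0, x))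
           (Rm (t0, x)))"
  let ?R = "Rm' (t0, 0)"
  have ct: "?R \<in> curvature_tensors" by (rule local_flow.Rm_ct[OF l z(1)])
  have sX: "scal (?R + \<eta> *\<^sub>R round_tensor) = scal ?R + \<eta> * real CARD('n) * (real CARD('n) - 1)"
    by (simp add: scal_add scal_scaleR scal_round_tensor)
  have "pinching_form \<kappa> Z round_tensor = scal Z * \<beta>" if "Z \<in> curvature_tensors" for Z :: "'n tensor4"
    unfolding pinching_form_round_tensor[OF that] \<beta>_def \<kappa>_def by simp
  note 1 = this[OF ct] this[OF ct_round_tensor, unfolded scal_round_tensor]
  have PX: "pinching_form \<kappa> (?R + \<eta> *\<^sub>R round_tensor) (?R + \<eta> *\<^sub>R round_tensor)
    = pinching_form \<kappa> ?R ?R + 2 * \<eta> * \<beta> * scal ?R + \<eta>\<^sup>2 * \<beta> * real CARD('n) * (real CARD('n) - 1)"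
    by (simp add: pinching_form_add pinching_form_add_left pinching_form_scaleR pinching_form_scaleR_left
        pinching_form_sym[of _ round_tensor ?R] 1 power2_eq_square algebra_simps)
  have "pinching_form \<kappa> ?R ?R + 2 * \<eta> * \<beta> * scal ?R \<le> pinching_wrt \<kappa> (k' ((t0, 0) + s *\<^sub>R sp p)) (Rm' ((t0, 0) + s *\<^sub>R sp p))
     + 2 * \<eta> * \<beta> * scal_wrt (k' ((t0, 0) + s *\<^sub>R sp p)) (Rm' ((t0, 0) + s *\<^sub>R sp p))" if "\<bar>s\<bar> < e" for s p
    using e(2)[OF that, of p] m unfolding z0s z0P by force
  note c = local_flow.pinching_form_increasing_at_contact[OF l z n a \<eta>, folded \<beta>_def, folded \<kappa>_def, OF _ _ _ e(1) this]
  show thesis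
    by (rule that[OF d]) (use c[of L] P s L in \<open>simp add: PX sX z0s z0P\<close>)
qed

end

section \<open>First contact\<close>

text \<open>By compactness there is an earliest time at which \<Phi> is nonpositive somewhere. There
  it vanishes at a point and is nonnegative everywhere by left continuity, but a positive derivative
  makes it negative shortly before. Derivatives within the closed interval admit a contact at its
  right end.\<close>

lemma first_contact:
  fixes \<Phi> :: "real \<Rightarrow> 'm \<Rightarrow> real"
  assumes X: "compact_space X"
    and c: "continuous_map (prod_topology (top_of_set {0..t1}) X) euclideanreal (\<lambda>(t, p). \<Phi> t p)"
    and init: "\<And>p. p \<in> topspace X \<Longrightarrow> \<Phi> 0 p > 0"
    and contact: "\<And>t p. 0 < t \<Longrightarrow> t \<le> t1 \<Longrightarrow> p \<in> topspace X \<Longrightarrow> \<Phi> t p = 0 \<Longrightarrow> (\<And>q. q \<in> topspace X \<Longrightarrow> \<Phi> t q \<ge> 0)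
      \<Longrightarrow> \<exists>D>0. ((\<lambda>t. \<Phi> t p) has_real_derivative D) (at t within {0..t1})"
    and tp: "t \<in> {0..t1}" "p \<in> topspace X"
  shows "\<Phi> t p > 0"
proof (rule ccontr)
  assume neg: "\<not> \<Phi> t p > 0"
  let ?XX = "prod_topology (top_of_set {0..t1}) X"
  define Z where "Z = {z \<in> topspace ?XX. (case z of (t, p) \<Rightarrow> \<Phi> t p) \<in> {..0}}"
  have top: "topspace ?XX = {0..t1} \<times> topspace X" by simp
  have "compact_space ?XX" using X by (simp add: compact_space_prod_topology compact_space_subtopology)
  moreover have "closedin ?XX Z" unfolding Z_def by (rule closedin_continuous_map_preimage[OF c]) simp
  ultimately have "compactin ?XX Z" by (rule closedin_compact_space)
  then have "compactin (top_of_set {0..t1}) (fst ` Z)" by (rule image_compactin) (rule continuous_map_fst)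
  then have cZ: "compact (fst ` Z)" by (simp add: compactin_subtopology)
  have "fst ` Z \<noteq> {}" using neg tp by (force simp: Z_def)
  from compact_attains_inf[OF cZ this] obtain t0 p0 where z: "(t0, p0) \<in> Z" and m: "\<And>t p. (t, p) \<in> Z \<Longrightarrow> t0 \<le> t"
    by force
  have t0: "t0 \<in> {0..t1}" and p0: "p0 \<in> topspace X" and le: "\<Phi> t0 p0 \<le> 0" using z by (auto simp: Z_def)
  have pos: "\<Phi> t p > 0" if "0 \<le> t" "t < t0" "p \<in> topspace X" for t p
  proof (rule ccontr)
    assume "\<not> ?thesis"
    then have "(t, p) \<in> Z" using that t0 by (auto simp: Z_def)
    with m that show False by force
  qed
  have "t0 \<noteq> 0" using init[OF p0] le by auto
  with t0 have t0': "0 < t0" "t0 \<le> t1" by auto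
  have nn: "\<Phi> t0 q \<ge> 0" if q: "q \<in> topspace X" for q
  proof -
    have "continuous_map (top_of_set {0..t1}) ?XX (\<lambda>t. (t, q))"
      by (intro continuous_map_pairedI) (use q in \<open>auto simp: continuous_map_const\<close>)
    from continuous_map_compose[OF this c] have "continuous_on {0..t1} (\<lambda>t. \<Phi> t q)"
      by (simp add: o_def continuous_map_iff_continuous)
    then have "((\<lambda>t. \<Phi> t q) \<longlongrightarrow> \<Phi> t0 q) (at t0 within {0..t1})" using t0 by (simp add: continuous_on_def)
    then have "((\<lambda>t. \<Phi> t q) \<longlongrightarrow> \<Phi> t0 q) (at t0 within {0..<t0})" by (rule tendsto_within_subset) (use t0 in auto)
    moreover have "\<forall>\<^sub>F t in at t0 within {0..<t0}. \<Phi> t q \<ge> 0"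
      unfolding eventually_at_filter using pos q by (force intro!: always_eventually)
    moreover have "at t0 within {0..<t0} \<noteq> bot"
      using t0' by (simp add: trivial_limit_within islimpt_Ico)
    ultimately show ?thesis by (rule tendsto_lowerbound)
  qed
  have z0: "\<Phi> t0 p0 = 0" using le nn[OF p0] by simp
  from contact[OF t0' p0 this nn] obtain D where D: "D > 0" "((\<lambda>t. \<Phi> t p0) has_real_derivative D) (at t0 within {0..t1})"
    by blast
  from has_real_derivative_pos_inc_left[OF D(2,1)] obtain d where d: "d > 0"
    "\<And>h. h > 0 \<Longrightarrow> t0 - h \<in> {0..t1} \<Longrightarrow> h < d \<Longrightarrow> \<Phi> (t0 - h) p0 < \<Phi> t0 p0" by blast
  define h where "h = min (d/2) t0"
  have h: "h > 0" "t0 - h \<in> {0..t1}" "h < d" using d(1) t0' by (auto simp: h_def min_def)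
  show False using d(2)[OF h] pos[of "t0 - h" p0] h t0' p0 z0 by auto
qed

text \<open>Scalar curvature comes first, since its lower bound makes the perturbed scalar curvature
  positive at a contact, and its upper bound on the compact product fixes the growth rate L.\<close>

lemma pinching_preserved:
  fixes S P :: "real \<Rightarrow> 'm \<Rightarrow> real"
  assumes X: "compact_space X"
    and cS: "continuous_map (prod_topology (top_of_set {0..t1}) X) euclideanreal (\<lambda>(t, p). S t p)"
    and cP: "continuous_map (prod_topology (top_of_set {0..t1}) X) euclideanreal (\<lambda>(t, p). P t p)"
    and S_min: "\<And>t p. 0 < t \<Longrightarrow> t \<le> t1 \<Longrightarrow> p \<in> topspace X \<Longrightarrow> (\<And>q. q \<in> topspace X \<Longrightarrow> S t p \<le> S t q)
      \<Longrightarrow> \<exists>D\<ge>0. ((\<lambda>t. S t p) has_real_derivative D) (at t within {0..t1})"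
    and contact: "\<And>t p \<eta> L. 0 < t \<Longrightarrow> t \<le> t1 \<Longrightarrow> p \<in> topspace X \<Longrightarrow> \<eta> > 0 \<Longrightarrow>
       P t p + 2 * \<eta> * \<beta> * S t p + \<eta>\<^sup>2 * \<beta> * n * (n - 1) = 0 \<Longrightarrow> S t p + \<eta> * n * (n - 1) > 0 \<Longrightarrow>
       4 * (S t p + \<eta> * n * (n - 1)) < n * L \<Longrightarrow>
       (\<And>q. q \<in> topspace X \<Longrightarrow> P t p + 2 * \<eta> * \<beta> * S t p \<le> P t q + 2 * \<eta> * \<beta> * S t q) \<Longrightarrow>
       \<exists>D D'. ((\<lambda>t. S t p) has_real_derivative D) (at t within {0..t1}) \<and> ((\<lambda>t. P t p) has_real_derivative D')
           (at t within {0..t1})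
         \<and> D' + 2 * \<eta> * \<beta> * D + 2 * \<eta> * L * \<beta> * S t p + 2 * \<eta>\<^sup>2 * L * \<beta> * n * (n - 1) > 0"
    and init: "\<And>p. p \<in> topspace X \<Longrightarrow> P 0 p \<ge> 0" "\<And>p. p \<in> topspace X \<Longrightarrow> S 0 p \<ge> m" and m: "m \<ge> 0"
    and \<beta>: "\<beta> > 0" and n: "n > (1::real)"
    and tp: "t \<in> {0..t1}" "p \<in> topspace X"
  shows "S t p \<ge> m" "P t p \<ge> 0"
proof -
  let ?XX = "prod_topology (top_of_set {0..t1}) X"
  have top: "topspace ?XX = {0..t1} \<times> topspace X" by simp
  have ct: "continuous_map ?XX euclideanreal (\<lambda>(t, p). f t)" if "continuous_on UNIV f" for f :: "real \<Rightarrow> real"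
  proof -
    have "continuous_map (top_of_set {0..t1}) euclideanreal f"
      using continuous_on_subset[OF that subset_UNIV] by (simp add: continuous_map_iff_continuous)
    from continuous_map_compose[OF continuous_map_fst this] show ?thesis by (simp add: o_def case_prod_unfold)
  qed
  have cadd: "continuous_map ?XX euclideanreal (\<lambda>(t, p). f t p + g t p)" and cmult: "continuous_map ?XX
      euclideanreal (\<lambda>(t, p). f t p * g t p)"
    if "continuous_map ?XX euclideanreal (\<lambda>(t, p). f t p)" "continuous_map ?XX euclideanreal (\<lambda>(t, p). g t p)" for f g
    using continuous_map_add[OF that] continuous_map_real_mult[OF that] by (simp_all add: case_prod_unfold)
  have S: "S t p \<ge> m" if tp: "t \<in> {0..t1}" "p \<in> topspace X" for t p
  proof -
    \<comment> \<open>The barrier is strict at time 0 by the summand 1 and has positive slope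
      \<delta> by the summand t; letting \<delta> tend to 0 gives the bound.\<close>
    have "S t p + (\<delta> * (1 + t) - m) > 0" if \<delta>: "\<delta> > 0" for \<delta>
    proof (rule first_contact[OF X _ _ _ tp])
      show "continuous_map ?XX euclideanreal (\<lambda>(t, p). S t p + (\<delta> * (1 + t) - m))"
        by (rule cadd[OF cS ct]) (intro continuous_intros)
      show "S 0 p + (\<delta> * (1 + 0) - m) > 0" if "p \<in> topspace X" for p using init(2)[OF that] \<delta> by simp
      fix t p assume t: "0 < t" "t \<le> t1" "p \<in> topspace X" "S t p + (\<delta> * (1 + t) - m) = 0"
        and "\<And>q. q \<in> topspace X \<Longrightarrow> S t q + (\<delta> * (1 + t) - m) \<ge> 0"
      then have "S t p \<le> S t q" if "q \<in> topspace X" for q using that by fastforce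
      from S_min[OF t(1-3) this] obtain D where "D \<ge> 0" "((\<lambda>t. S t p) has_real_derivative D) (at t within {0..t1})" by blast
      then show "\<exists>D>0. ((\<lambda>t. S t p + (\<delta> * (1 + t) - m)) has_real_derivative D) (at t within {0..t1})"
        using \<delta> by (intro exI[of _ "D + \<delta>"] conjI) (auto intro!: derivative_eq_intros)
    qed
    then have "m \<le> S t p + e" if "e > 0" for e
      using that tp by (fastforce dest: spec[of _ "e / (1 + t)"] intro: less_imp_le)
    then show ?thesis by (rule field_le_epsilon)
  qed
  then show "S t p \<ge> m" using tp .
  have "compact_space ?XX" using X by (simp add: compact_space_prod_topology compact_space_subtopology)
  then have "compactin euclideanreal ((\<lambda>(t, p). S t p) ` topspace ?XX)"
    by (intro image_compactin[OF _ cS]) (simp add: compact_space_def)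
  then have "bounded ((\<lambda>(t, p). S t p) ` topspace ?XX)" by (simp add: compact_imp_bounded)
  then obtain B where "\<forall>x\<in>(\<lambda>(t, p). S t p) ` topspace ?XX. \<bar>x\<bar> \<le> B" unfolding bounded_real by blast
  then have B: "S t p \<le> B" if "t \<in> {0..t1}" "p \<in> topspace X" for t p using that by force
  \<comment> \<open>L is chosen before \<epsilon>: as long as \<eta> \<le> 1, the bound B on S
    implies the hypothesis on L of the contact inequality, whatever \<epsilon> is.\<close>
  define L where "L = (4 * (\<bar>B\<bar> + n * (n - 1)) + 1) / n"
  have nL: "n * L = 4 * (\<bar>B\<bar> + n * (n - 1)) + 1" using n by (simp add: L_def)
  have "n * (n - 1) > 0" using n by simp
  then have L: "L > 0" using nL n by (smt (verit) zero_less_mult_iff)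
  have key: "P t p + 2 * (\<epsilon> * exp (L * t)) * \<beta> * S t p + (\<epsilon> * exp (L * t))\<^sup>2 * \<beta> * n * (n - 1) > 0"
    if \<epsilon>: "\<epsilon> > 0" "\<epsilon> * exp (L * t1) \<le> 1" for \<epsilon>
  proof (rule first_contact[OF X _ _ _ tp])
    define \<eta> where "\<eta> t = \<epsilon> * exp (L * t)" for t
    have \<eta>: "\<eta> t > 0" for t using \<epsilon> by (simp add: \<eta>_def)
    have d\<eta>: "(\<eta> has_real_derivative L * \<eta> t) (at t within A)" for t A
      unfolding \<eta>_def by (auto intro!: derivative_eq_intros)
    have c\<eta>: "continuous_on UNIV \<eta>" unfolding \<eta>_def by (intro continuous_intros)
    have "continuous_map ?XX euclideanreal (\<lambda>(t, p). P t p + 2 * \<eta> t * \<beta> * S t p + (\<eta> t)\<^sup>2 * \<beta> * n * (n - 1))"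
      by (rule cadd[OF cadd[OF cP cmult[OF ct cS]] ct]) (intro continuous_intros c\<eta>)+
    then show "continuous_map ?XX euclideanreal
        (\<lambda>(t, p). P t p + 2 * (\<epsilon> * exp (L * t)) * \<beta> * S t p + (\<epsilon> * exp (L * t))\<^sup>2 * \<beta> * n * (n - 1))"
      by (simp add: \<eta>_def)
    show "P 0 p + 2 * (\<epsilon> * exp (L * 0)) * \<beta> * S 0 p + (\<epsilon> * exp (L * 0))\<^sup>2 * \<beta> * n * (n - 1) > 0" if "p \<in> topspace X" for p
      using init[OF that] \<epsilon> \<beta> n m by (intro add_nonneg_pos add_nonneg_nonneg mult_nonneg_nonneg mult_pos_pos) auto
    fix t p assume t: "0 < t" "t \<le> t1" "p \<in> topspace X"
      and z: "P t p + 2 * (\<epsilon> * exp (L * t)) * \<beta> * S t p + (\<epsilon> * exp (L * t))\<^sup>2 * \<beta> * n * (n - 1) = 0"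
      and nn: "\<And>q. q \<in> topspace X \<Longrightarrow> P t q + 2 * (\<epsilon> * exp (L * t)) * \<beta> * S t q + (\<epsilon> * exp (L * t))\<^sup>2 * \<beta> * n * (n - 1) \<ge> 0"
    have "exp (L * t) \<le> exp (L * t1)" using t L by simp
    then have \<eta>1: "\<eta> t \<le> 1" using \<epsilon> unfolding \<eta>_def by (smt (verit) mult_left_mono)
    have tI: "t \<in> {0..t1}" using t by auto
    have s: "0 \<le> S t p" using S[OF tI t(3)] m by simp
    have "\<eta> t * (n * (n - 1)) \<le> 1 * (n * (n - 1))" using \<eta>1 n by (intro mult_right_mono) auto
    then have "4 * (S t p + \<eta> t * n * (n - 1)) < n * L" using B[OF tI t(3)] nL by (simp add: mult.assoc)
    moreover have "S t p + \<eta> t * n * (n - 1) > 0" using s \<eta>[of t] n by (intro add_nonneg_pos mult_pos_pos) auto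
    moreover have "P t p + 2 * \<eta> t * \<beta> * S t p \<le> P t q + 2 * \<eta> t * \<beta> * S t q" if "q \<in> topspace X" for q
      using z nn[OF that] by (simp add: \<eta>_def)
    ultimately obtain D D' where D: "((\<lambda>t. S t p) has_real_derivative D) (at t within {0..t1})"
        "((\<lambda>t. P t p) has_real_derivative D') (at t within {0..t1})"
        and pos: "D' + 2 * \<eta> t * \<beta> * D + 2 * \<eta> t * L * \<beta> * S t p + 2 * (\<eta> t)\<^sup>2 * L * \<beta> * n * (n - 1) > 0"
      using contact[OF t \<eta>[of t] z[folded \<eta>_def]] by blast
    have "((\<lambda>t. P t p + 2 * \<eta> t * \<beta> * S t p + (\<eta> t)\<^sup>2 * \<beta> * n * (n - 1)) has_real_derivative
        D' + 2 * \<eta> t * \<beta> * D + 2 * \<eta> t * L * \<beta> * S t p + 2 * (\<eta> t)\<^sup>2 * L * \<beta> * n * (n - 1)) (at t within {0..t1})"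
      by (auto intro!: derivative_eq_intros D d\<eta> simp: power2_eq_square algebra_simps)
    with pos show "\<exists>D>0. ((\<lambda>t. P t p + 2 * (\<epsilon> * exp (L * t)) * \<beta> * S t p + (\<epsilon> * exp (L * t))\<^sup>2 * \<beta> * n * (n - 1))
        has_real_derivative D) (at t within {0..t1})"
      unfolding \<eta>_def by blast
  qed
  let ?f = "\<lambda>\<epsilon>. P t p + 2 * (\<epsilon> * exp (L * t)) * \<beta> * S t p + (\<epsilon> * exp (L * t))\<^sup>2 * \<beta> * n * (n - 1)"
  \<comment> \<open>At a fixed time and point \<epsilon> tends to 0; all \<epsilon> below exp(- L
    t1) keep \<eta> \<le> 1 on the interval.\<close>
  have "(?f \<longlongrightarrow> ?f 0) (at_right 0)" by (intro tendsto_intros)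
  moreover have "\<forall>\<^sub>F \<epsilon> in at_right 0. ?f \<epsilon> \<ge> 0"
  proof (rule eventually_at_rightI[of 0 "exp (- L * t1)"])
    fix \<epsilon> assume "\<epsilon> \<in> {0<..<exp (- L * t1)}"
    then have "\<epsilon> > 0" "\<epsilon> * exp (L * t1) \<le> exp (- L * t1) * exp (L * t1)" by auto
    with key[of \<epsilon>] show "?f \<epsilon> \<ge> 0" by (simp add: exp_add[symmetric])
  qed simp
  ultimately have "?f 0 \<ge> 0" by (rule tendsto_lowerbound) simp
  then show "P t p \<ge> 0" by simp
qed

section \<open>The Hamilton ODE\<close>

text \<open>Guarantees a > 0 on the whole range and a nonempty range below n/4, from which the
  endpoint is approached.\<close>

lemma epsilon_bounds:
  assumes "n \<ge> 4" shows "0 < epsilon n" "epsilon n < real n / 4"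
proof -
  have "0 < epsilon n \<and> epsilon n < real n / 4"
  proof (cases "n \<ge> 11")
    case True
    then have "1 / real n < 1" "real n / 4 \<ge> 1" by simp_all
    then have "1 / real n < real n / 4" by linarith
    then show ?thesis using True by (auto simp: epsilon_def)
  next
    case False
    with assms consider "n = 4" | "n = 5" | "n = 6" | "n = 7" | "n = 8" | "n = 9" | "n = 10" by linarith
    then show ?thesis by cases (simp_all add: epsilon_def power2_eq_square)
  qed
  then show "0 < epsilon n" "epsilon n < real n / 4" by auto
qed

lemma pinching_form_mono: "c \<le> d \<Longrightarrow> pinching_form d R R \<le> pinching_form c R R"
  using mult_right_mono[of c d "R \<bullet> R"] by (simp add: pinching_form_def divide_right_mono)

lemma pinching_form_limit:
  assumes "c < d" and P: "\<And>b. c \<le> b \<Longrightarrow> b < d \<Longrightarrow> pinching_form b R R \<ge> 0"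
  shows "pinching_form d R R \<ge> 0"
proof (rule tendsto_lowerbound)
  show "((\<lambda>b. pinching_form b R R) \<longlongrightarrow> pinching_form d R R) (at_left d)" unfolding pinching_form_def by
      (intro tendsto_intros) auto
  show "\<forall>\<^sub>F b in at_left d. pinching_form b R R \<ge> 0" by (rule eventually_at_leftI[OF _ assms(1)]) (auto intro: P)
qed simp

lemma bounded_linear_scal: "bounded_linear (scal :: 'n::finite tensor4 \<Rightarrow> real)"
  by (simp add: linear_conv_bounded_linear[symmetric] linearI scal_add scal_scaleR)

lemma bounded_bilinear_pinching_form: "bounded_bilinear (pinching_form c :: 'n::finite tensor4 \<Rightarrow> _)"
  by (rule bounded_bilinearI_euclid) (simp_all add: pinching_form_add pinching_form_scaleR pinching_form_add_left
      pinching_form_scaleR_left)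

lemma hamilton_ode_pinching:
  fixes R :: "real \<Rightarrow> 'n::finite tensor4" and a :: real
  defines "\<kappa> \<equiv> (real CARD('n) - 2) / 4 + a"
  assumes n: "CARD('n) \<ge> 4" and a: "real CARD('n) / 4 - epsilon CARD('n) \<le> a" "a < real CARD('n) / 4"
    and ct: "\<And>t. t \<in> {0..t1} \<Longrightarrow> R t \<in> curvature_tensors"
    and ode: "\<And>t. t \<in> {0..t1} \<Longrightarrow> (R has_vector_derivative Q (R t)) (at t within {0..t1})"
    and init: "pinching_form \<kappa> (R 0) (R 0) \<ge> 0" "scal (R 0) \<ge> 0" and t: "t \<in> {0..t1}"
  shows "scal (R t) \<ge> scal (R 0)" "pinching_form \<kappa> (R t) (R t) \<ge> 0"
proof -
  let ?N = "real CARD('n)"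
  define \<beta> where "\<beta> = (?N - 1 - 2 * \<kappa>) / 4"
  have \<beta>: "\<beta> > 0" using a(2) by (simp add: \<beta>_def \<kappa>_def field_simps)
  have a0: "0 \<le> a" using epsilon_bounds[OF n] a by linarith
  have N: "?N > 1" using n by simp
  \<comment> \<open>A one-point space stands in for the manifold, where being a spatial minimum is
    no condition.\<close>
  let ?X = "discrete_topology (UNIV :: unit set)"
  have c: "continuous_map (prod_topology (top_of_set {0..t1}) ?X) euclideanreal (\<lambda>(t, p). f t)"
    if "continuous_on {0..t1} f" for f :: "real \<Rightarrow> real"
    using continuous_map_compose[OF continuous_map_fst, of "top_of_set {0..t1}" euclideanreal f ?X] that
    by (simp add: o_def case_prod_unfold)
  have dS: "((\<lambda>t. scal (R t)) has_real_derivative scal (Q (R t))) (at t within {0..t1})" if "t \<in> {0..t1}" for t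
    using bounded_linear.has_vector_derivative[OF bounded_linear_scal ode[OF that]]
    by (simp add: has_real_derivative_iff_has_vector_derivative)
  have dP: "((\<lambda>t. pinching_form \<kappa> (R t) (R t)) has_real_derivative 2 * pinching_form \<kappa> (R t) (Q (R t)))
      (at t within {0..t1})" if "t \<in> {0..t1}" for t
    using bounded_bilinear.has_vector_derivative[OF bounded_bilinear_pinching_form ode[OF that] ode[OF that], of \<kappa>]
    by (simp add: has_real_derivative_iff_has_vector_derivative pinching_form_sym[of _ "Q _"])
  have cS: "continuous_on {0..t1} (\<lambda>t. scal (R t))" by (rule DERIV_continuous_on[OF dS])
  have cP: "continuous_on {0..t1} (\<lambda>t. pinching_form \<kappa> (R t) (R t))" by (rule DERIV_continuous_on[OF dP])
  have Smin: "\<exists>D\<ge>0. ((\<lambda>t. scal (R t)) has_real_derivative D) (at t within {0..t1})" if "0 < t" "t \<le> t1" for t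
    using dS[of t] that by (intro exI[of _ "scal (Q (R t))"]) (simp add: scal_Q ct)
  have contact: "\<exists>D D'. ((\<lambda>t. scal (R t)) has_real_derivative D) (at t within {0..t1}) \<and>
      ((\<lambda>t. pinching_form \<kappa> (R t) (R t)) has_real_derivative D') (at t within {0..t1})
         \<and> D' + 2 * \<eta> * \<beta> * D + 2 * \<eta> * L * \<beta> * scal (R t) + 2 * \<eta>\<^sup>2 * L * \<beta> * ?N * (?N - 1) > 0"
    if t: "0 < t" "t \<le> t1" and \<eta>: "\<eta> > 0" and z: "pinching_form \<kappa> (R t) (R t) + 2 * \<eta> * \<beta> * scal (R t) + \<eta>\<^sup>2 * \<beta> *
        ?N * (?N - 1) = 0"
      and s: "scal (R t) + \<eta> * ?N * (?N - 1) > 0" and L: "4 * (scal (R t) + \<eta> * ?N * (?N - 1)) < ?N * L" for t \<eta> L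
  proof -
    have tI: "t \<in> {0..t1}" using t by auto
    let ?Y = "R t + \<eta> *\<^sub>R round_tensor"
    have sX: "scal ?Y = scal (R t) + \<eta> * ?N * (?N - 1)" by (simp add: scal_add scal_scaleR scal_round_tensor)
    have Ps: "pinching_form \<kappa> Z round_tensor = scal Z * \<beta>" if "Z \<in> curvature_tensors" for Z :: "'n tensor4"
      unfolding pinching_form_round_tensor[OF that] \<beta>_def by simp
    note 1 = Ps[OF ct[OF tI]] Ps[OF ct_Q[OF ct[OF tI]]] Ps[OF ct_round_tensor, unfolded scal_round_tensor]
    have PX: "pinching_form \<kappa> ?Y ?Y = 0" using z
      by (simp add: pinching_form_add pinching_form_add_left pinching_form_scaleR pinching_form_scaleR_left
          pinching_form_sym[of _ round_tensor "R t"] 1 power2_eq_square algebra_simps)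
    have "pinching_form \<kappa> ?Y (1 *\<^sub>R Q (R t) + (\<eta> * L) *\<^sub>R round_tensor) > 0"
      using pinching_form_contact[OF n ct[OF tI] a(1) a0 a(2) \<eta>, of 1 L, folded \<kappa>_def] PX s L by (simp add: sX)
    then have "2 * pinching_form \<kappa> (R t) (Q (R t)) + 2 * \<eta> * \<beta> * scal (Q (R t)) + 2 * \<eta> * L * \<beta> * scal (R t) + 2 *
        \<eta>\<^sup>2 * L * \<beta> * ?N * (?N - 1) > 0"
      by (simp add: pinching_form_add pinching_form_add_left pinching_form_scaleR pinching_form_scaleR_left
          pinching_form_sym[of _ round_tensor "Q _"] 1 power2_eq_square algebra_simps)
    then show ?thesis using dS[OF tI] dP[OF tI] by blast
  qed
  have X: "compact_space ?X" by (simp add: compact_space_discrete_topology)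
  note result = pinching_preserved[OF X c[OF cS] c[OF cP], where \<beta>=\<beta> and n="?N" and m="scal (R 0)" and p="()",
      OF Smin contact init(1) order_refl init(2) \<beta> N t]
  show "scal (R t) \<ge> scal (R 0)" "pinching_form \<kappa> (R t) (R t) \<ge> 0" by (rule result; simp)+
qed

text \<open>The endpoint \<open>a = n/4\<close>, excluded so far because the form then degenerates.\<close>

lemma pinching_closed_range:
  fixes R :: "'n::finite tensor4" and a :: real
  assumes n: "CARD('n) \<ge> 4" and a: "a \<in> {real CARD('n) / 4 - epsilon CARD('n) .. real CARD('n) / 4}"
    and step: "\<And>b. real CARD('n) / 4 - epsilon CARD('n) \<le> b \<Longrightarrow> b < real CARD('n) / 4 \<Longrightarrow> b \<le> a \<Longrightarrow>
      pinching_form ((real CARD('n) - 2) / 4 + b) R R \<ge> 0"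
  shows "pinching_form ((real CARD('n) - 2) / 4 + a) R R \<ge> 0"
proof (cases "a = real CARD('n) / 4")
  case True
  let ?c = "(real CARD('n) - 2) / 4"
  have "pinching_form (?c + real CARD('n) / 4) R R \<ge> 0"
  proof (rule pinching_form_limit)
    show "?c + (real CARD('n) / 4 - epsilon CARD('n)) < ?c + real CARD('n) / 4" using epsilon_bounds[OF n] by simp
    fix b assume b: "?c + (real CARD('n) / 4 - epsilon CARD('n)) \<le> b" "b < ?c + real CARD('n) / 4"
    have "real CARD('n) / 4 - epsilon CARD('n) \<le> b - ?c" "b - ?c < real CARD('n) / 4" using b by linarith+
    from step[OF this] this(2) True show "pinching_form b R R \<ge> 0" by simp
  qed
  then show ?thesis unfolding True .
next
  case False
  then show ?thesis using a by (intro step) auto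
qed

lemma hamilton_ode_invariant_Omega:
  fixes a :: real
  assumes n: "CARD('n::finite) \<ge> 4" and a: "a \<in> {real CARD('n) / 4 - epsilon CARD('n) .. real CARD('n) / 4}"
  shows "hamilton_ode_invariant (Omega_bar a :: 'n tensor4 set)" "hamilton_ode_invariant (Omega a :: 'n tensor4 set)"
proof -
  let ?P = "\<lambda>a. pinching_form ((real CARD('n) - 2) / 4 + a)"
  have a0: "a > 0" using a epsilon_bounds[OF n] by auto
  have main: "scal (R 0) \<le> scal (R t) \<and> ?P a (R t) (R t) \<ge> 0"
    if I: "is_interval I" "0 \<in> I" "I \<subseteq> {0..}" and ct: "\<forall>t\<in>I. R t \<in> curvature_tensors"
      and ode: "\<forall>t\<in>I. (R has_vector_derivative Q (R t)) (at t within I)" and t: "t \<in> I"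
      and init: "?P a (R 0) (R 0) \<ge> 0" "scal (R 0) \<ge> 0" for R :: "real \<Rightarrow> 'n tensor4" and I t
  proof -
    \<comment> \<open>The solution is restricted to the closed interval up to t, whatever the shape
      of I beyond t.\<close>
    have sub: "{0..t} \<subseteq> I" using I(1,2) t unfolding is_interval_1 by (meson atLeastAtMost_iff subsetI)
    have ode': "(R has_vector_derivative Q (R s)) (at s within {0..t})" if "s \<in> {0..t}" for s
      by (rule has_vector_derivative_within_subset[OF bspec[OF ode subsetD[OF sub that]] sub])
    have tt: "t \<in> {0..t}" using t I by auto
    have step: "scal (R 0) \<le> scal (R t)" "?P b (R t) (R t) \<ge> 0"
      if "real CARD('n) / 4 - epsilon CARD('n) \<le> b" "b < real CARD('n) / 4" "?P b (R 0) (R 0) \<ge> 0" for b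
      by (rule hamilton_ode_pinching[OF n that(1,2) bspec[OF ct subsetD[OF sub]] ode' that(3) init(2) tt], assumption+)+
    have e: "epsilon CARD('n) > 0" using epsilon_bounds[OF n] by simp
    have "scal (R 0) \<le> scal (R t)"
    \<comment> \<open>The bound for scal may be taken from any admissible b. The left endpoint works
      for a = n/4 too, because the form decreases in its parameter.\<close>
    proof (rule step(1))
      show "?P (real CARD('n) / 4 - epsilon CARD('n)) (R 0) (R 0) \<ge> 0"
        by (rule order_trans[OF init(1) pinching_form_mono]) (use a in simp)
    qed (use e in simp_all)
    moreover have "?P a (R t) (R t) \<ge> 0"
      by (rule pinching_closed_range[OF n a step(2)[OF _ _ order_trans[OF init(1) pinching_form_mono]]]) simp_all
    ultimately show ?thesis by simp
  qed
  show "hamilton_ode_invariant (Omega_bar a :: 'n tensor4 set)"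
    unfolding hamilton_ode_invariant_def
  proof (intro allI impI ballI, elim conjE)
    fix R :: "real \<Rightarrow> 'n tensor4" and I t
    assume I: "is_interval I" "0 \<in> I" "I \<subseteq> {0..}" and ct: "\<forall>t\<in>I. R t \<in> curvature_tensors"
      and ode: "\<forall>t\<in>I. (R has_vector_derivative Q (R t)) (at t within I)" and R0: "R 0 \<in> Omega_bar a" and t: "t \<in> I"
    have "?P a (R 0) (R 0) \<ge> 0" "scal (R 0) \<ge> 0" using R0 unfolding Omega_bar_iff[OF n a0] by auto
    with main[OF I ct ode t] bspec[OF ct t] show "R t \<in> Omega_bar a" unfolding Omega_bar_iff[OF n a0] by auto
  qed
  show "hamilton_ode_invariant (Omega a :: 'n tensor4 set)"
    unfolding hamilton_ode_invariant_def
  proof (intro allI impI ballI, elim conjE)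
    fix R :: "real \<Rightarrow> 'n tensor4" and I t
    assume I: "is_interval I" "0 \<in> I" "I \<subseteq> {0..}" and ct: "\<forall>t\<in>I. R t \<in> curvature_tensors"
      and ode: "\<forall>t\<in>I. (R has_vector_derivative Q (R t)) (at t within I)" and R0: "R 0 \<in> Omega a" and t: "t \<in> I"
    have "?P a (R 0) (R 0) \<ge> 0" "scal (R 0) > 0" using R0 unfolding Omega_bar_iff[OF n a0] by auto
    with main[OF I ct ode t] bspec[OF ct t] show "R t \<in> Omega a" unfolding Omega_bar_iff[OF n a0] by auto
  qed
qed

section \<open>Ricci flow on a compact manifold\<close>

lemma ricci_eq_ric_wrt: "ricci h x = ric_wrt (matrix_inv (h x)) (riemann h x)"
  by (simp add: ricci_def ric_wrt_def)

lemma riemann_in_curvature_tensors: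
  fixes h :: "real^'n::finite \<Rightarrow> real^'n^'n"
  assumes V: "open V" and h: "smooth_on V h" and s: "\<And>x. x \<in> V \<Longrightarrow> transpose (h x) = h x"
    and inv: "\<And>x. x \<in> V \<Longrightarrow> invertible (h x)" and x: "x \<in> V"
  shows "riemann h x \<in> curvature_tensors"
proof -
  \<comment> \<open>A single metric is treated as a flow that is constant in time.\<close>
  have u: "udom (UNIV \<times> V :: (real \<times> (real^'n)) set)" by (intro udom_open open_Times V open_UNIV)
  have "smooth_on (UNIV \<times> V :: (real \<times> (real^'n)) set) (\<lambda>z. h (snd z))"
    by (rule smooth_on_compose[OF h smooth_on_linear[OF u bounded_linear_snd] u udom_open[OF V]]) auto
  from riemann_symmetries[OF udom_open[OF open_UNIV] V this _ _ _ open_UNIV, of 0 x] s inv x show ?thesis by auto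
qed

section \<open>Scalars in charts and their invariance\<close>

locale compact_ricci_flow =
  fixes M :: "'m topology" and \<A> :: "('m, 'n::finite) chart set" and T :: real and g :: "real \<Rightarrow> ('m, 'n) metric"
  assumes manifold: "smooth_manifold M \<A>" and compact: "compact_space M" and T: "T > 0" and flow: "ricci_flow \<A> T g"
begin

definition "Sc c t x = scal_wrt (matrix_inv (g t c x)) (riemann (g t c) x)"
definition "Pc \<kappa> c t x = pinching_wrt \<kappa> (matrix_inv (g t c x)) (riemann (g t c) x)"

lemma metric_at: "t \<in> {0..<T} \<Longrightarrow> riemannian_metric \<A> (g t)"
  using flow by (auto simp: ricci_flow_def)

lemma chart_open: "c \<in> \<A> \<Longrightarrow> open (chart_image c)" "c \<in> \<A> \<Longrightarrow> openin M (fst c)"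
  and chart_homeo: "c \<in> \<A> \<Longrightarrow> homeomorphic_map (subtopology M (fst c)) (top_of_set (chart_image c)) (snd c)"
  and covered: "topspace M = (\<Union>c\<in>\<A>. fst c)"
  using manifold by (auto simp: smooth_manifold_def)

lemma chart_subset: "c \<in> \<A> \<Longrightarrow> fst c \<subseteq> topspace M"
  using covered by blast

lemma chart_inj: "c \<in> \<A> \<Longrightarrow> inj_on (snd c) (fst c)"
  using homeomorphic_imp_injective_map[OF chart_homeo] chart_subset by (simp add: Int_absorb1)

lemma metric_symmetric: "t \<in> {0..<T} \<Longrightarrow> c \<in> \<A> \<Longrightarrow> x \<in> chart_image c \<Longrightarrow> transpose (g t c x) = g t c x"
  and metric_posdef: "t \<in> {0..<T} \<Longrightarrow> c \<in> \<A> \<Longrightarrow> x \<in> chart_image c \<Longrightarrow> v \<noteq> 0 \<Longrightarrow> v \<bullet> (g t c x *v v) > 0"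
  and smooth_slice: "t \<in> {0..<T} \<Longrightarrow> c \<in> \<A> \<Longrightarrow> smooth_on (chart_image c) (g t c)"
  using metric_at[of t] by (auto simp: riemannian_metric_def)

lemma metric_frame:
  assumes "t \<in> {0..<T}" "c \<in> \<A>" "x \<in> chart_image c"
  obtains E where "orthonormal_frame (g t c x) E"
  using exists_orthonormal_frame[OF metric_symmetric[OF assms] metric_posdef[OF assms]] by blast

lemma metric_invertible: "t \<in> {0..<T} \<Longrightarrow> c \<in> \<A> \<Longrightarrow> x \<in> chart_image c \<Longrightarrow> invertible (g t c x)"
  by (rule metric_frame) (auto dest: orthonormal_frame_inverse)

lemma riemann_ct: "t \<in> {0..<T} \<Longrightarrow> c \<in> \<A> \<Longrightarrow> x \<in> chart_image c \<Longrightarrow> riemann (g t c) x \<in> curvature_tensors"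
  by (rule riemann_in_curvature_tensors[OF chart_open(1) smooth_slice metric_symmetric metric_invertible])

lemma Sc_frame: "orthonormal_frame (g t c x) E \<Longrightarrow> Sc c t x = scal (frame_components E (riemann (g t c) x))"
  and Pc_frame: "orthonormal_frame (g t c x) E \<Longrightarrow>
    Pc \<kappa> c t x = pinching_form \<kappa> (frame_components E (riemann (g t c) x)) (frame_components E (riemann (g t c) x))"
  by (simp_all add: Sc_def Pc_def orthonormal_frame_inverse scal_wrt_frame pinching_wrt_frame)

text \<open>Curvature changes by the Jacobian in every slot and the inverse metric by congruence
  with the same matrix, so full contractions of the two agree.\<close>

lemma chart_change:
  assumes t: "t \<in> {0..<T}" and c: "c \<in> \<A>" and d: "d \<in> \<A>" and p: "p \<in> fst c \<inter> fst d"
  shows "Sc c t (snd c p) = Sc d t (snd d p)" "Pc \<kappa> c t (snd c p) = Pc \<kappa> d t (snd d p)"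
proof -
  let ?O = "fst c \<inter> fst d" and ?\<phi> = "transition c d"
  let ?U = "snd c ` ?O" and ?J = "\<lambda>x. matrix (frechet_derivative (transition c d) (at x))"
  have tr: "?\<phi> (snd c q) = snd d q" if "q \<in> ?O" for q
    using that chart_inj[OF c] by (simp add: transition_def)
  have "openin (subtopology M (fst c)) ?O"
    using chart_open(2)[OF c] chart_open(2)[OF d] by (metis Int_commute openin_subtopology_Int)
  then have "openin (top_of_set (chart_image c)) ?U"
    using homeomorphic_imp_open_map[OF chart_homeo[OF c]] by (simp add: open_map_def)
  then have U: "open ?U" using chart_open(1)[OF c] by (simp add: openin_open_eq)
  have \<phi>: "smooth_on ?U ?\<phi>" using manifold c d by (auto simp: smooth_manifold_def)
  have \<phi>U: "?\<phi> ` ?U \<subseteq> chart_image d" using tr by (auto simp: chart_image_def)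
  have law: "g t c x = transpose (?J x) ** g t d (?\<phi> x) ** ?J x" if x: "x \<in> ?U" for x
  proof -
    obtain q where q: "q \<in> ?O" "x = snd c q" using x by blast
    have "\<forall>c\<in>\<A>. \<forall>d\<in>\<A>. \<forall>p\<in>fst c \<inter> fst d. let J = matrix (frechet_derivative (transition c d) (at (snd c p)))
        in g t c (snd c p) = transpose J ** g t d (snd d p) ** J"
      using metric_at[OF t] unfolding riemannian_metric_def by (elim conjE)
    from bspec[OF bspec[OF bspec[OF this c] d] q(1)] show ?thesis unfolding Let_def q(2) tr[OF q(1)] .
  qed
  have Uc: "x \<in> chart_image c" if "x \<in> ?U" for x using that by (auto simp: chart_image_def)
  \<comment> \<open>The transformation law factors det g through det J, so nondegeneracy of g makes
    J invertible.\<close>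
  have Jinv: "invertible (?J x)" if "x \<in> ?U" for x
  proof -
    have "det (g t c x) \<noteq> 0" using metric_invertible[OF t c Uc[OF that]] by (simp add: invertible_det_nz)
    then show ?thesis unfolding law[OF that] by (simp add: det_mul invertible_det_nz)
  qed
  let ?x = "snd c p"
  have x: "?x \<in> ?U" using p by blast
  have dp: "snd d p \<in> chart_image d" using p by (auto simp: chart_image_def)
  have R: "riemann (g t c) ?x = frame_components (?J ?x) (riemann (g t d) (snd d p))"
    using riemann_pullback[OF U chart_open(1)[OF d] smooth_slice[OF t d] metric_symmetric[OF t d]
        metric_invertible[OF t d] \<phi> \<phi>U Jinv law x] tr[OF p]
    by simp
  have k: "?J ?x ** matrix_inv (g t c ?x) ** transpose (?J ?x) = matrix_inv (g t d (snd d p))"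
    unfolding law[OF x] using matrix_inv_congruence[OF Jinv[OF x] metric_invertible[OF t d dp]] tr[OF p] by simp
  show "Sc c t (snd c p) = Sc d t (snd d p)" "Pc \<kappa> c t (snd c p) = Pc \<kappa> d t (snd d p)"
    unfolding Sc_def Pc_def R scal_wrt_frame_components pinching_wrt_frame_components k by simp_all
qed

lemma metric_slab:
  assumes c: "c \<in> \<A>"
  defines "W \<equiv> {0..<T} \<times> chart_image c"
  shows "udom W" "smooth_on W (\<lambda>(t, x). g t c x)"
    "\<And>z. z \<in> W \<Longrightarrow> transpose (case z of (t, x) \<Rightarrow> g t c x) = (case z of (t, x) \<Rightarrow> g t c x)"
    "\<And>z. z \<in> W \<Longrightarrow> invertible (case z of (t, x) \<Rightarrow> g t c x)"
proof -
  show "udom W" unfolding W_def by (intro udom_Times udom_Ico udom_open chart_open c)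
  show "smooth_on W (\<lambda>(t, x). g t c x)" using flow c by (auto simp: W_def ricci_flow_def)
qed (auto simp: W_def metric_symmetric metric_invertible c)

lemma smooth_scalars:
  assumes c: "c \<in> \<A>"
  shows "smooth_on ({0..<T} \<times> chart_image c) (\<lambda>(t, x). Sc c t x)" "smooth_on ({0..<T} \<times> chart_image c) (\<lambda>(t, x). Pc \<kappa> c t x)"
proof -
  let ?W = "{0..<T} \<times> chart_image c" and ?h = "\<lambda>(t, x). g t c x"
  note s = metric_slab[OF c]
  let ?R = "\<lambda>z. \<chi> i j. ?h z ** curvature_matrix ?W sp (christoffel_matrix ?W sp ?h) i j z"
  have R: "riemann (g t c) x = ?R (t, x)" if "(t, x) \<in> ?W" for t x
    using riemann_slab[OF udom_Ico chart_open(1)[OF c] s(2-4) that] by (simp add: vec_eq_iff)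
  have sR: "smooth_on ?W ?R"
    by (intro smooth_on_vec s(1), unfold vec_lambda_beta, intro smooth_on_vec_nth s(1) smooth_on_matmul s(2)
        smooth_on_curvature_matrix smooth_on_christoffel_matrix s(4))
  have sk: "smooth_on ?W (\<lambda>z. matrix_inv (?h z))" by (rule smooth_on_matrix_inv[OF s(1,2,4)])
  show "smooth_on ?W (\<lambda>(t, x). Sc c t x)"
    by (rule smooth_on_cong[THEN iffD1, OF _ smooth_scal_wrt[OF s(1) sk sR]]) (auto simp: Sc_def R)
  show "smooth_on ?W (\<lambda>(t, x). Pc \<kappa> c t x)"
    by (rule smooth_on_cong[THEN iffD1, OF _ smooth_pinching_wrt[OF s(1) sk sR]]) (auto simp: Pc_def R)
qed

text \<open>Without time 0 the slab is open and the one-sided flow equation becomes two-sided. Time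
  0 is covered by the initial condition and continuity.\<close>

lemma local_flow_in_chart:
  assumes c: "c \<in> \<A>"
  defines "W \<equiv> {0<..<T} \<times> chart_image c" and "h \<equiv> \<lambda>(t, x). g t c x"
  shows "local_flow {0<..<T} (chart_image c) h W (christoffel_matrix W sp h) (\<lambda>z. matrix_inv (h z))
      (\<lambda>z. \<chi> i j. h z ** curvature_matrix W sp (christoffel_matrix W sp h) i j z)"
    "\<And>t x. (t, x) \<in> W \<Longrightarrow> (\<chi> i j. h (t, x) ** curvature_matrix W sp (christoffel_matrix W sp h) i j (t, x)) =
        riemann (g t c) x"
proof -
  note V = chart_open(1)[OF c]
  have oW: "open W" unfolding W_def by (intro open_Times V open_greaterThanLessThan)
  have sub: "W \<subseteq> {0..<T} \<times> chart_image c" by (auto simp: W_def)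
  have sm: "smooth_on W h" unfolding h_def by (rule smooth_on_subset[OF metric_slab(2)[OF c] udom_open[OF oW] sub])
  have sy: "transpose (h z) = h z" "invertible (h z)" if "z \<in> W" for z
    using metric_slab(3,4)[OF c] sub that unfolding h_def by blast+
  show R: "(\<chi> i j. h (t, x) ** curvature_matrix W sp (christoffel_matrix W sp h) i j (t, x)) = riemann (g t c) x"
      if "(t, x) \<in> W" for t x
    using riemann_slab[OF udom_open[OF open_greaterThanLessThan[of 0 T]] V, folded W_def, OF sm sy that]
    by (simp add: vec_eq_iff h_def)
  show "local_flow {0<..<T} (chart_image c) h W (christoffel_matrix W sp h) (\<lambda>z. matrix_inv (h z))
      (\<lambda>z. \<chi> i j. h z ** curvature_matrix W sp (christoffel_matrix W sp h) i j z)"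
  proof
    fix z assume z: "z \<in> W"
    obtain t x where tx: "z = (t, x)" "0 < t" "t < T" "x \<in> chart_image c" using z by (auto simp: W_def)
    have "((\<lambda>s. g s c x) has_vector_derivative (- 2) *\<^sub>R ricci (g t c) x) (at t within {0..<T})"
      using flow c tx by (auto simp: ricci_flow_def)
    then have "((\<lambda>s. g s c x) has_vector_derivative (- 2) *\<^sub>R ricci (g t c) x) (at t within {0<..<T})"
      by (rule has_vector_derivative_within_subset) auto
    then have "((\<lambda>s. g s c x) has_vector_derivative (- 2) *\<^sub>R ricci (g t c) x) (at t)"
      using tx at_within_open[of t "{0<..<T}"] by simp
    moreover have "((\<lambda>s. g s c x) has_vector_derivative dird W (1, 0) h z) (at t)"
      using dird_line[OF smooth_on_imp_differentiable_on[OF sm] oW, of "(0, x)" t "(1, 0)"] z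
      by (simp add: tx h_def)
    ultimately have "dird W (1, 0) h z = (- 2) *\<^sub>R ricci (g t c) x" by (rule vector_derivative_unique_at[rotated])
    then show "dird W (1, 0) h z = - 2 *\<^sub>R ric_wrt (matrix_inv (h z))
        (\<chi> i j. h z ** curvature_matrix W sp (christoffel_matrix W sp h) i j z)"
      using R[of t x] z by (simp add: ricci_eq_ric_wrt tx h_def)
  qed (use V sm sy in \<open>auto simp: W_def\<close>)
qed

section \<open>The two scalars as functions on the manifold\<close>

definition "chart_at p = (SOME c. c \<in> \<A> \<and> p \<in> fst c)"
definition "S t p = Sc (chart_at p) t (snd (chart_at p) p)"
definition "P \<kappa> t p = Pc \<kappa> (chart_at p) t (snd (chart_at p) p)"

lemma chart_at: "p \<in> topspace M \<Longrightarrow> chart_at p \<in> \<A> \<and> p \<in> fst (chart_at p)"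
  unfolding chart_at_def by (rule someI_ex) (use covered in auto)

lemma scalars_in_chart:
  assumes "t \<in> {0..<T}" "c \<in> \<A>" "p \<in> fst c"
  shows "S t p = Sc c t (snd c p)" "P \<kappa> t p = Pc \<kappa> c t (snd c p)"
proof -
  have "p \<in> topspace M" by (rule subsetD[OF chart_subset[OF assms(2)] assms(3)])
  then show "S t p = Sc c t (snd c p)" "P \<kappa> t p = Pc \<kappa> c t (snd c p)"
    unfolding S_def P_def using chart_at assms chart_change[OF assms(1), of "chart_at p" c p] by auto
qed

text \<open>The function is pasted from its chart expressions on the open sets
  \<open>{0..t1} \<times> fst c\<close>, which agree on overlaps because F itself does not mention
  the chart.\<close>

lemma continuous_scalar:
  assumes t1: "t1 < T" and F: "\<And>t c p. t \<in> {0..<T} \<Longrightarrow> c \<in> \<A> \<Longrightarrow> p \<in> fst c \<Longrightarrow> F t p = Fc c t (snd c p)"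
    and sF: "\<And>c. c \<in> \<A> \<Longrightarrow> smooth_on ({0..<T} \<times> chart_image c) (\<lambda>(t, x). Fc c t x)"
  shows "continuous_map (prod_topology (top_of_set {0..t1}) M) euclideanreal (\<lambda>(t, p). F t p)"
proof (rule pasting_lemma[where I=\<A> and T="\<lambda>c. {0..t1} \<times> fst c" and f="\<lambda>c (t, p). Fc c t (snd c p)"])
  fix c assume c: "c \<in> \<A>"
  show "openin (prod_topology (top_of_set {0..t1}) M) ({0..t1} \<times> fst c)"
    using chart_open(2)[OF c] by (simp add: openin_prod_Times_iff)
  have "continuous_map (prod_topology (top_of_set {0..t1}) (subtopology M (fst c)))
      (prod_topology (top_of_set {0..t1}) (top_of_set (chart_image c)))
     (\<lambda>(t, p). (t, snd c p))"
    unfolding continuous_map_prod_top using homeomorphic_imp_continuous_map[OF chart_homeo[OF c]] by simp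
  moreover have "continuous_map (top_of_set ({0..t1} \<times> chart_image c)) euclideanreal (\<lambda>(t, x). Fc c t x)"
  proof -
    have "{0..t1} \<times> chart_image c \<subseteq> {0..<T} \<times> chart_image c" using t1 by auto
    from continuous_on_subset[OF smooth_on_imp_continuous_on[OF sF[OF c]] this] show ?thesis
      by (simp add: continuous_map_iff_continuous)
  qed
  ultimately have "continuous_map (prod_topology (top_of_set {0..t1}) (subtopology M (fst c))) euclideanreal
      ((\<lambda>(t, x). Fc c t x) \<circ> (\<lambda>(t, p). (t, snd c p)))"
    by (intro continuous_map_compose) auto
  then show "continuous_map (subtopology (prod_topology (top_of_set {0..t1}) M) ({0..t1} \<times> fst c)) euclideanreal
      (\<lambda>(t, p). Fc c t (snd c p))"
    by (simp add: subtopology_Times o_def case_prod_unfold subtopology_subtopology)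
next
  fix c d z assume "c \<in> \<A>" "d \<in> \<A>" "z \<in> topspace (prod_topology (top_of_set {0..t1}) M) \<inter> {0..t1} \<times> fst c \<inter> {0..t1} \<times> fst d"
  then show "(case z of (t, p) \<Rightarrow> Fc c t (snd c p)) = (case z of (t, p) \<Rightarrow> Fc d t (snd d p))"
    using t1 F[of "fst z" c "snd z"] F[of "fst z" d "snd z"] by auto
next
  fix z assume "z \<in> topspace (prod_topology (top_of_set {0..t1}) M)"
  then show "\<exists>c. c \<in> \<A> \<and> z \<in> {0..t1} \<times> fst c \<and> (case z of (t, p) \<Rightarrow> F t p) = (case z of (t, p) \<Rightarrow> Fc c t (snd c p))"
    using t1 chart_at[of "snd z"] F[of "fst z" "chart_at (snd z)" "snd z"] by (intro exI[of _ "chart_at (snd z)"]) auto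
qed

lemma continuous_S: "t1 < T \<Longrightarrow> continuous_map (prod_topology (top_of_set {0..t1}) M) euclideanreal (\<lambda>(t, p). S t p)"
  by (rule continuous_scalar[OF _ scalars_in_chart(1) smooth_scalars(1)])

lemma continuous_P: "t1 < T \<Longrightarrow> continuous_map (prod_topology (top_of_set {0..t1}) M) euclideanreal (\<lambda>(t, p). P \<kappa> t p)"
  by (rule continuous_scalar[OF _ scalars_in_chart(2) smooth_scalars(2)])

text \<open>Every point of the chart carries values attained on M, so a minimum over M is one over
  the chart. The chart belongs to p and does not change with time, so time derivatives may be
  computed in it.\<close>

lemma flow_in_chart:
  assumes p: "p \<in> topspace M" and t: "0 < t" "t < T"
  obtains c :: "('m, 'n) chart" and h W G k Rm x E where "local_flow {0<..<T} (chart_image c) h W G k Rm" "(t, x)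
      \<in> W" "orthonormal_frame (h (t, x)) E"
    "S t p = scal_wrt (k (t, x)) (Rm (t, x))" "\<And>\<kappa>. P \<kappa> t p = pinching_wrt \<kappa> (k (t, x)) (Rm (t, x))"
    "\<And>y. y \<in> chart_image c \<Longrightarrow> \<exists>q\<in>topspace M. S t q = scal_wrt (k (t, y)) (Rm (t, y)) \<and>
        (\<forall>\<kappa>. P \<kappa> t q = pinching_wrt \<kappa> (k (t, y)) (Rm (t, y)))"
    "\<And>D A. ((\<lambda>t. scal_wrt (k (t, x)) (Rm (t, x))) has_real_derivative D) (at t) \<Longrightarrow>
        ((\<lambda>t. S t p) has_real_derivative D) (at t within A)"
    "\<And>\<kappa> D A. ((\<lambda>t. pinching_wrt \<kappa> (k (t, x)) (Rm (t, x))) has_real_derivative D) (at t) \<Longrightarrow>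
        ((\<lambda>t. P \<kappa> t p) has_real_derivative D) (at t within A)"
proof -
  define c where "c = chart_at p"
  define x where "x = snd c p"
  have c: "c \<in> \<A>" "p \<in> fst c" using chart_at[OF p] by (auto simp: c_def)
  have x: "x \<in> chart_image c" using c by (auto simp: x_def chart_image_def)
  define W where "W = {0<..<T} \<times> chart_image c"
  define h where "h = (\<lambda>(t, x). g t c x)"
  define k where "k = (\<lambda>z. matrix_inv (h z))"
  define Rm where "Rm = (\<lambda>z. \<chi> i j. h z ** curvature_matrix W sp (christoffel_matrix W sp h) i j z)"
  note l = local_flow_in_chart[OF c(1), folded W_def h_def]
  have Rm: "Rm (t, y) = riemann (g t c) y" if "(t, y) \<in> W" for t y unfolding Rm_def by (rule l(2)[OF that])
  have Sk: "scal_wrt (k (t, y)) (Rm (t, y)) = Sc c t y" and Pk: "pinching_wrt \<kappa> (k (t, y)) (Rm (t, y)) = Pc \<kappa> c t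
      y" if "(t, y) \<in> W" for \<kappa> t y
    by (simp_all add: Rm[OF that] k_def h_def Sc_def Pc_def)
  have tx: "(t, x) \<in> W" using t x by (simp add: W_def)
  obtain E where E: "orthonormal_frame (g t c x) E" using metric_frame[of t c x] t c x by auto
  have ev: "\<forall>\<^sub>F t in nhds t. (t, x) \<in> W"
    using eventually_nhds_in_open[OF open_greaterThanLessThan, of t 0 T] t x by (auto simp: W_def elim: eventually_mono)
  show thesis
  proof (rule that[of c h W "christoffel_matrix W sp h" k Rm x E])
    show "local_flow {0<..<T} (chart_image c) h W (christoffel_matrix W sp h) k Rm" unfolding k_def Rm_def by (rule l(1))
    show "\<exists>q\<in>topspace M. S t q = scal_wrt (k (t, y)) (Rm (t, y)) \<and> (\<forall>\<kappa>. P \<kappa> t q = pinching_wrt \<kappa> (k (t, y)) (Rm (t, y)))"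
      if y: "y \<in> chart_image c" for y
    proof -
      obtain q where q: "q \<in> fst c" "y = snd c q" using y by (auto simp: chart_image_def)
      have "(t, y) \<in> W" using t y by (simp add: W_def)
      then show ?thesis using scalars_in_chart[OF _ c(1) q(1)] t q chart_subset[OF c(1)]
        by (intro bexI[of _ q]) (auto simp: Sk Pk)
    qed
    show "((\<lambda>t. S t p) has_real_derivative D) (at t within A)"
      if "((\<lambda>t. scal_wrt (k (t, x)) (Rm (t, x))) has_real_derivative D) (at t)" for D A
      by (rule has_field_derivative_at_within, rule DERIV_cong_ev[THEN iffD1, OF refl _ refl that])
        (use eventually_mono[OF ev Sk] in \<open>simp add: S_def c_def x_def\<close>)
    show "((\<lambda>t. P \<kappa> t p) has_real_derivative D) (at t within A)"
      if "((\<lambda>t. pinching_wrt \<kappa> (k (t, x)) (Rm (t, x))) has_real_derivative D) (at t)" for \<kappa> D A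
      by (rule has_field_derivative_at_within, rule DERIV_cong_ev[THEN iffD1, OF refl _ refl that])
        (use eventually_mono[OF ev Pk] in \<open>simp add: P_def c_def x_def\<close>)
  qed (use tx E in \<open>simp_all add: h_def Sk Pk S_def P_def c_def[symmetric] x_def[symmetric]\<close>)
qed

lemma pinching:
  fixes a :: real
  defines "\<kappa> \<equiv> (real CARD('n) - 2) / 4 + a"
  assumes n: "CARD('n) \<ge> 4" and a: "real CARD('n) / 4 - epsilon CARD('n) \<le> a" "a < real CARD('n) / 4"
    and init: "\<And>p. p \<in> topspace M \<Longrightarrow> P \<kappa> 0 p \<ge> 0" "\<And>p. p \<in> topspace M \<Longrightarrow> S 0 p \<ge> m" and m: "m \<ge> 0"
    and t: "t \<in> {0..<T}" "p \<in> topspace M"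
  shows "S t p \<ge> m" "P \<kappa> t p \<ge> 0"
proof -
  let ?N = "real CARD('n)"
  define \<beta> where "\<beta> = (?N - 1 - 2 * \<kappa>) / 4"
  have \<beta>: "\<beta> > 0" using a(2) by (simp add: \<beta>_def \<kappa>_def field_simps)
  have a0: "0 \<le> a" using epsilon_bounds[OF n] a by linarith
  have N: "?N > 1" using n by simp
  \<comment> \<open>The given time t is used as the right end of the compact interval, since T
    itself is excluded.\<close>
  have tt: "t \<in> {0..t}" and tT: "t < T" using t by auto
  have Smin: "\<exists>D\<ge>0. ((\<lambda>t. S t p) has_real_derivative D) (at s within {0..t})"
    if s: "0 < s" "s \<le> t" and p: "p \<in> topspace M" and min: "\<And>q. q \<in> topspace M \<Longrightarrow> S s p \<le> S s q" for s p
  proof (rule flow_in_chart[OF p s(1) order.strict_trans1[OF s(2) tT]])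
    fix c :: "('m, 'n) chart" and h W G k Rm x E
    assume l: "local_flow {0<..<T} (chart_image c) h W G k Rm" "(s, x) \<in> W" "orthonormal_frame (h (s, x)) E"
      and Sx: "S s p = scal_wrt (k (s, x)) (Rm (s, x))"
      and y: "\<And>y. y \<in> chart_image c \<Longrightarrow> \<exists>q\<in>topspace M. S s q = scal_wrt (k (s, y)) (Rm (s, y)) \<and>
          (\<forall>\<kappa>. P \<kappa> s q = pinching_wrt \<kappa> (k (s, y)) (Rm (s, y)))"
      and d: "\<And>D A. ((\<lambda>t. scal_wrt (k (t, x)) (Rm (t, x))) has_real_derivative D) (at s) \<Longrightarrow>
          ((\<lambda>t. S t p) has_real_derivative D) (at s within A)"
    have "scal_wrt (k (s, x)) (Rm (s, x)) \<le> scal_wrt (k (s, z)) (Rm (s, z))" if "z \<in> chart_image c" for z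
      using y[OF that] min Sx by metis
    from local_flow.scal_minimum_nondecreasing[OF l this] obtain D where
      "((\<lambda>t. scal_wrt (k (t, x)) (Rm (t, x))) has_real_derivative D) (at s)" "D \<ge> 0" by blast
    then show ?thesis by (intro exI[of _ D] conjI d)
  qed
  have contact: "\<exists>D D'. ((\<lambda>t. S t p) has_real_derivative D) (at s within {0..t}) \<and>
      ((\<lambda>t. P \<kappa> t p) has_real_derivative D') (at s within {0..t})
         \<and> D' + 2 * \<eta> * \<beta> * D + 2 * \<eta> * L * \<beta> * S s p + 2 * \<eta>\<^sup>2 * L * \<beta> * ?N * (?N - 1) > 0"
    if s: "0 < s" "s \<le> t" and p: "p \<in> topspace M" and \<eta>: "\<eta> > 0"
      and z: "P \<kappa> s p + 2 * \<eta> * \<beta> * S s p + \<eta>\<^sup>2 * \<beta> * ?N * (?N - 1) = 0"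
      and sp: "S s p + \<eta> * ?N * (?N - 1) > 0" and L: "4 * (S s p + \<eta> * ?N * (?N - 1)) < ?N * L"
      and min: "\<And>q. q \<in> topspace M \<Longrightarrow> P \<kappa> s p + 2 * \<eta> * \<beta> * S s p \<le> P \<kappa> s q + 2 * \<eta> * \<beta> * S s q" for s p \<eta> L
  proof (rule flow_in_chart[OF p s(1) order.strict_trans1[OF s(2) tT]])
    fix c :: "('m, 'n) chart" and h W G k Rm x E
    assume l: "local_flow {0<..<T} (chart_image c) h W G k Rm" "(s, x) \<in> W" "orthonormal_frame (h (s, x)) E"
      and Sx: "S s p = scal_wrt (k (s, x)) (Rm (s, x))" and Px: "\<And>\<kappa>. P \<kappa> s p = pinching_wrt \<kappa> (k (s, x)) (Rm (s, x))"
      and y: "\<And>y. y \<in> chart_image c \<Longrightarrow> \<exists>q\<in>topspace M. S s q = scal_wrt (k (s, y)) (Rm (s, y)) \<and>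
          (\<forall>\<kappa>. P \<kappa> s q = pinching_wrt \<kappa> (k (s, y)) (Rm (s, y)))"
      and d: "\<And>D A. ((\<lambda>t. scal_wrt (k (t, x)) (Rm (t, x))) has_real_derivative D) (at s) \<Longrightarrow>
          ((\<lambda>t. S t p) has_real_derivative D) (at s within A)"
        "\<And>\<kappa> D A. ((\<lambda>t. pinching_wrt \<kappa> (k (t, x)) (Rm (t, x))) has_real_derivative D) (at s) \<Longrightarrow>
            ((\<lambda>t. P \<kappa> t p) has_real_derivative D) (at s within A)"
    have le: "pinching_wrt \<kappa> (k (s, x)) (Rm (s, x)) + 2 * \<eta> * \<beta> * scal_wrt (k (s, x)) (Rm (s, x))
        \<le> pinching_wrt \<kappa> (k (s, z)) (Rm (s, z)) + 2 * \<eta> * \<beta> * scal_wrt (k (s, z)) (Rm (s, z))" if "z \<in> chart_image c" for z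
      using y[OF that] min Sx Px by metis
    show ?thesis
    proof (rule local_flow.pinching_form_contact_increasing[OF l n a(1) a0 a(2) \<eta>, folded \<kappa>_def, folded \<beta>_def, of L])
      fix D D'
      assume "((\<lambda>t. scal_wrt (k (t, x)) (Rm (t, x))) has_real_derivative D) (at s)"
        "((\<lambda>t. pinching_wrt \<kappa> (k (t, x)) (Rm (t, x))) has_real_derivative D') (at s)"
        "0 < D' + 2 * \<eta> * \<beta> * D + 2 * \<eta> * L * \<beta> * scal_wrt (k (s, x)) (Rm (s, x)) + 2 * \<eta>\<^sup>2 * L * \<beta> * ?N * (?N - 1)"
      then show ?thesis using d unfolding Sx by blast
    qed (use z sp L le in \<open>simp_all only: Sx Px\<close>)
  qed
  note result = pinching_preserved[OF compact continuous_S[OF tT] continuous_P[OF tT], where \<beta>=\<beta> and n="?N" and m=m and p=p,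
      OF Smin contact init m \<beta> N tt t(2)]
  show "S t p \<ge> m" "P \<kappa> t p \<ge> 0" by (rule result; assumption)+
qed

end

section \<open>From the scalars back to the cones\<close>

context compact_ricci_flow
begin

lemma scalars_in_frame:
  assumes t: "t \<in> {0..<T}" and c: "c \<in> \<A>" and p: "p \<in> fst c" and E: "orthonormal_frame (g t c (snd c p)) E"
  shows "S t p = scal (frame_components E (riemann (g t c) (snd c p)))"
    and "P \<kappa> t p = pinching_form \<kappa> (frame_components E (riemann (g t c) (snd c p)))
        (frame_components E (riemann (g t c) (snd c p)))"
  using Sc_frame[OF E] Pc_frame[OF E] scalars_in_chart[OF t c p] by simp_all

lemma point_frame:
  assumes t: "t \<in> {0..<T}" and p: "p \<in> topspace M"
  obtains c E where "c \<in> \<A>" "p \<in> fst c" "snd c p \<in> chart_image c" "orthonormal_frame (g t c (snd c p)) E"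
proof -
  have x: "snd (chart_at p) p \<in> chart_image (chart_at p)" using chart_at[OF p] by (auto simp: chart_image_def)
  obtain E where "orthonormal_frame (g t (chart_at p) (snd (chart_at p) p)) E"
    by (rule metric_frame[OF t conjunct1[OF chart_at[OF p]] x])
  then show thesis using that chart_at[OF p] x by blast
qed

text \<open>\<open>curvature_in\<close> speaks of all orthonormal frames, but scal and the form of
  the components are the frame-independent \<open>S\<close> and \<open>P\<close>. The forward
  direction needs one frame at each point, the converse an arbitrary one.\<close>

lemma curvature_in_Omega_iff:
  fixes a :: real
  assumes n: "CARD('n) \<ge> 4" and a: "a > 0" and t: "t \<in> {0..<T}"
  defines "\<kappa> \<equiv> (real CARD('n) - 2) / 4 + a"
  shows "curvature_in \<A> (g t) (Omega_bar a) \<longleftrightarrow> (\<forall>p\<in>topspace M. P \<kappa> t p \<ge> 0 \<and> S t p \<ge> 0)"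
    and "curvature_in \<A> (g t) (Omega a) \<longleftrightarrow> (\<forall>p\<in>topspace M. P \<kappa> t p \<ge> 0 \<and> S t p > 0)"
proof -
  have iff: "curvature_in \<A> (g t) C \<longleftrightarrow> (\<forall>p\<in>topspace M. P \<kappa> t p \<ge> 0 \<and> F (S t p))"
    if C: "\<And>R. R \<in> C \<longleftrightarrow> R \<in> curvature_tensors \<and> pinching_form \<kappa> R R \<ge> 0 \<and> F (scal R)" for C :: "'n tensor4 set" and F
  proof
    assume L: "curvature_in \<A> (g t) C"
    show "\<forall>p\<in>topspace M. P \<kappa> t p \<ge> 0 \<and> F (S t p)"
    proof
      fix p assume "p \<in> topspace M"
      then obtain c E where c: "c \<in> \<A>" "p \<in> fst c" "snd c p \<in> chart_image c" "orthonormal_frame (g t c (snd c p)) E"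
        by (rule point_frame[OF t])
      then have "frame_components E (riemann (g t c) (snd c p)) \<in> C" using L by (auto simp: curvature_in_def)
      then show "P \<kappa> t p \<ge> 0 \<and> F (S t p)" unfolding C scalars_in_frame[OF t c(1,2,4)] by simp
    qed
  next
    assume R: "\<forall>p\<in>topspace M. P \<kappa> t p \<ge> 0 \<and> F (S t p)"
    show "curvature_in \<A> (g t) C"
      unfolding curvature_in_def
    proof (intro ballI allI impI)
      fix c x E assume c: "c \<in> \<A>" and x: "x \<in> chart_image c" and E: "orthonormal_frame (g t c x) E"
      obtain p where p: "p \<in> fst c" "x = snd c p" using x by (auto simp: chart_image_def)
      have "P \<kappa> t p \<ge> 0 \<and> F (S t p)" using R subsetD[OF chart_subset[OF c] p(1)] by blast
      then show "frame_components E (riemann (g t c) x) \<in> C"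
        unfolding C scalars_in_frame[OF t c p(1) E[unfolded p(2)]] p(2)[symmetric]
        using ct_frame[OF riemann_ct[OF t c x]] by blast
    qed
  qed
  show "curvature_in \<A> (g t) (Omega_bar a) \<longleftrightarrow> (\<forall>p\<in>topspace M. P \<kappa> t p \<ge> 0 \<and> S t p \<ge> 0)"
    unfolding \<kappa>_def by (rule iff[unfolded \<kappa>_def]) (rule Omega_bar_iff(1)[OF n a])
  show "curvature_in \<A> (g t) (Omega a) \<longleftrightarrow> (\<forall>p\<in>topspace M. P \<kappa> t p \<ge> 0 \<and> S t p > 0)"
    unfolding \<kappa>_def by (rule iff[unfolded \<kappa>_def]) (rule Omega_bar_iff(2)[OF n a])
qed

lemma pinching_closed:
  fixes a :: real
  defines "\<kappa> \<equiv> (real CARD('n) - 2) / 4 + a"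
  assumes n: "CARD('n) \<ge> 4" and a: "a \<in> {real CARD('n) / 4 - epsilon CARD('n) .. real CARD('n) / 4}"
    and init: "\<And>p. p \<in> topspace M \<Longrightarrow> P \<kappa> 0 p \<ge> 0" "\<And>p. p \<in> topspace M \<Longrightarrow> S 0 p \<ge> m" and m: "m \<ge> 0"
    and t: "t \<in> {0..<T}" and p: "p \<in> topspace M"
  shows "S t p \<ge> m" "P \<kappa> t p \<ge> 0"
proof -
  have t0: "0 \<in> {0..<T}" using T by simp
  \<comment> \<open>The form decreases in its parameter, so the initial condition at a passes to
    every smaller b.\<close>
  have init': "P ((real CARD('n) - 2) / 4 + b) 0 q \<ge> 0" if b: "b \<le> a" and q: "q \<in> topspace M" for b q
  proof (rule point_frame[OF t0 q])
    fix c E assume c: "c \<in> \<A>" "q \<in> fst c" "orthonormal_frame (g 0 c (snd c q)) E"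
    show ?thesis using init(1)[OF q] b unfolding scalars_in_frame[OF t0 c] \<kappa>_def by (elim order_trans)
        (rule pinching_form_mono, simp)
  qed
  have e: "epsilon CARD('n) > 0" using epsilon_bounds[OF n] by simp
  have step: "S t p \<ge> m" "P ((real CARD('n) - 2) / 4 + b) t p \<ge> 0"
    if "real CARD('n) / 4 - epsilon CARD('n) \<le> b" "b < real CARD('n) / 4" "b \<le> a" for b
    using pinching[OF n that(1,2) init'[OF that(3)] init(2) m t p] by auto
  show "S t p \<ge> m" by (rule step(1)[OF order_refl]) (use e a in auto)
  show "P \<kappa> t p \<ge> 0"
  proof (rule point_frame[OF t p])
    fix c E assume c: "c \<in> \<A>" "p \<in> fst c" "orthonormal_frame (g t c (snd c p)) E"
    show ?thesis unfolding scalars_in_frame[OF t c] \<kappa>_def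
      by (rule pinching_closed_range[OF n a]) (use step(2) in \<open>simp add: scalars_in_frame[OF t c]\<close>)
  qed
qed

text \<open>Compactness turns pointwise positivity at time 0 into a uniform bound m, which the flow
  keeps, so strict positivity is not lost in the limit of the barriers. On the empty manifold any
  positive m serves.\<close>

lemma scal_lower_bound:
  assumes pos: "\<And>p. p \<in> topspace M \<Longrightarrow> S 0 p > 0"
  obtains m where "m > 0" "\<And>p. p \<in> topspace M \<Longrightarrow> S 0 p \<ge> m"
proof (cases "topspace M = {}")
  case True
  then show thesis using that[of 1] by auto
next
  case False
  have "continuous_map M (prod_topology (top_of_set {0..0::real}) M) (\<lambda>p. (0, p))"
    by (intro continuous_map_pairedI) (auto simp: continuous_map_const)
  from continuous_map_compose[OF this continuous_S[OF T]] have "continuous_map M euclideanreal (S 0)" by (simp add: o_def)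
  then have "compactin euclideanreal (S 0 ` topspace M)"
    using compact by (intro image_compactin) (auto simp: compact_space_def)
  then have "compact (S 0 ` topspace M)" by simp
  from compact_attains_inf[OF this] False obtain p where "p \<in> topspace M" "\<And>q. q \<in> topspace M \<Longrightarrow> S 0 p \<le> S 0 q" by auto
  then show thesis using that[of "S 0 p"] pos by auto
qed

lemma Omega_preserved:
  fixes a :: real
  assumes n: "CARD('n) \<ge> 4" and a: "a \<in> {real CARD('n) / 4 - epsilon CARD('n) .. real CARD('n) / 4}" and t: "t \<in> {0..<T}"
  shows "curvature_in \<A> (g 0) (Omega_bar a) \<Longrightarrow> curvature_in \<A> (g t) (Omega_bar a)"
    and "curvature_in \<A> (g 0) (Omega a) \<Longrightarrow> curvature_in \<A> (g t) (Omega a)"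
proof -
  have a0: "a > 0" using a epsilon_bounds[OF n] by auto
  have t0: "0 \<in> {0..<T}" using T by simp
  note iff = curvature_in_Omega_iff[OF n a0]
  show "curvature_in \<A> (g 0) (Omega_bar a) \<Longrightarrow> curvature_in \<A> (g t) (Omega_bar a)"
    unfolding iff[OF t0] iff[OF t] using pinching_closed[OF n a _ _ order_refl t] by auto
  assume 0: "curvature_in \<A> (g 0) (Omega a)"
  obtain m where m: "m > 0" "\<And>p. p \<in> topspace M \<Longrightarrow> S 0 p \<ge> m"
    by (rule scal_lower_bound) (use 0 iff(2)[OF t0] in auto)
  have "S t p \<ge> m \<and> P ((real CARD('n) - 2) / 4 + a) t p \<ge> 0" if p: "p \<in> topspace M" for p
    using pinching_closed[OF n a _ m(2) less_imp_le[OF m(1)] t p] 0 unfolding iff[OF t0] by auto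
  then show "curvature_in \<A> (g t) (Omega a)" unfolding iff[OF t] using m(1) by fastforce
qed

end

lemma ricci_flow_invariant_Omega:
  fixes a :: real
  assumes n: "CARD('n::finite) \<ge> 4" and a: "a \<in> {real CARD('n) / 4 - epsilon CARD('n) .. real CARD('n) / 4}"
  shows "ricci_flow_invariant TYPE('m) (Omega_bar a :: 'n tensor4 set)" "ricci_flow_invariant TYPE('m)
      (Omega a :: 'n tensor4 set)"
proof -
  have a0: "a > 0" using a epsilon_bounds[OF n] by auto
  have ct: "Omega_bar a \<subseteq> (curvature_tensors :: 'n tensor4 set)" "Omega a \<subseteq> (curvature_tensors :: 'n tensor4 set)"
    using Omega_bar_iff[OF n a0] by blast+
  show "ricci_flow_invariant TYPE('m) (Omega_bar a :: 'n tensor4 set)"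
    unfolding ricci_flow_invariant_def
    by (intro conjI allI impI ballI ct O_invariant_Omega n a0)
      (blast intro: compact_ricci_flow.Omega_preserved(1) compact_ricci_flow.intro n a)
  show "ricci_flow_invariant TYPE('m) (Omega a :: 'n tensor4 set)"
    unfolding ricci_flow_invariant_def
    by (intro conjI allI impI ballI ct O_invariant_Omega n a0)
      (blast intro: compact_ricci_flow.Omega_preserved(2) compact_ricci_flow.intro n a)
qed

theorem theorem1p1:
  fixes a :: real
  assumes "CARD('n::finite) \<ge> 4"
    and "a \<in> {real CARD('n) / 4 - epsilon CARD('n) .. real CARD('n) / 4}"
  shows "hamilton_ode_invariant (Omega_bar a :: 'n tensor4 set)
       \<and> hamilton_ode_invariant (Omega a :: 'n tensor4 set)
       \<and> ricci_flow_invariant TYPE('m) (Omega_bar a :: 'n tensor4 set)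
       \<and> ricci_flow_invariant TYPE('m) (Omega a :: 'n tensor4 set)"
  using hamilton_ode_invariant_Omega[OF assms] ricci_flow_invariant_Omega[OF assms] by blast

end
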